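(* Let $G$ be a locally compact abelian group, let $K$ be a compact group acting on $G$, and let $K$ act on the Pontryagin dual $\widehat{G}$ by the dual action. Let $H$ be the orbit hypergroup of $K$ acting on $G$ and let $H'$ be the orbit hypergroup of $K$ acting on $\widehat G$. Then the dual of the commutative hypergroup $H$ is (isomorphic, as a hypergroup, to) $H'$.
   Context: A compact group acting on a locally compact group acts continuously by topological automorphisms; $k\cdot x$ denotes the action; Haar measure $dk$ on $K$ is normalized to be a probability measure. The dual action is $\langle k\cdot\chi, x\rangle=\langle \chi, k^{-1}\cdot x\rangle$ for $k\in K$, $\chi\in\widehat G$, $x\in G$. Orbit hypergroup: for $K$ acting on a locally compact group $G$, define $\pi(f)(x)=\int_K f(k\cdot x)\,dk$ on functions and let $\pi$ also denote the adjoint map on the space $\operatorname{M}(G)$ of complex Radon measures, $\int f\,d\pi(\mu)=\int \pi(f)\,d\mu$. A measure $\mu$ is $K$-radial if $\pi(\mu)=\mu$. The orbit hypergroup $H$ is the space of $K$-orbits with the quotient topology, where the point mass at the orbit $K\cdot x$ is identified with $\pi(\delta_x)$, so that $\operatorname{M}(H)$ is identified with the algebra $\pi(\operatorname{M}(G))$ of $K$-radial measures; convolution is inherited from $\operatorname{M}(G)$ (the hyperproduct of $K\cdot x$ and $K\cdot y$ is the probability measure $\pi(\delta_x)*\pi(\delta_y)$), the involution is $(K\cdot x)^*=K\cdot x^{-1}$ and the identity is $\{e\}$. Dual of a commutative hypergroup $H$: the set of all nonzero bounded continuous functions $\chi:H\to\mathbb C$ with $\chi(x*y)=\chi(x)\chi(y)$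 (where $\chi(x*y)=\int_H\chi\,d(\delta_x*\delta_y)$) and $\chi(x^* )=\overline{\chi(x)}$, with the topology of uniform convergence on compact sets. Its hyperproduct is given by pointwise multiplication: for characters $\chi,\psi$ the hyperproduct $\chi*\psi$ is the probability measure $\mu$ on the dual with $\chi(x)\psi(x)=\int \tau(x)\,d\mu(\tau)$ for all $x\in H$, the identity is the constant function $1$ and the involution is complex conjugation; in general such a $\mu$ need not exist, so the dual need not be a hypergroup. *)

theory Defs
  imports "HOL-Probability.Probability" "HOL-Algebra.Group_Action"
begin

section \<open>Radon measures and topological groups\<close>

definition borel_of :: "'a topology \<Rightarrow> 'a measure" where
  "borel_of X = sigma (topspace X) {U. openin X U}"

definition radon_probability :: "'a topology \<Rightarrow> 'a measure \<Rightarrow> bool" where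
  "radon_probability X \<mu> \<longleftrightarrow>
     prob_space \<mu> \<and> sets \<mu> = sets (borel_of X) \<and>
     (\<forall>E\<in>sets \<mu>. emeasure \<mu> E = (SUP C\<in>{C. compactin X C \<and> C \<subseteq> E}. emeasure \<mu> C))"

locale topological_group = group G for G :: "('a, 'b) monoid_scheme" (structure) +
  fixes T :: "'a topology"
  assumes topspace_eq_carrier: "topspace T = carrier G"
    and hausdorff: "Hausdorff_space T"
    and continuous_mult: "continuous_map (prod_topology T T) T (\<lambda>(x, y). x \<otimes> y)"
    and continuous_inv: "continuous_map T T (\<lambda>x. inv x)"

locale lca_group = topological_group G T + comm_group G
  for G :: "('a, 'b) monoid_scheme" (structure) and T :: "'a topology" +
  assumes locally_compact: "locally_compact_space T"

locale compact_group = topological_group K S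
  for K :: "('k, 'b) monoid_scheme" (structure) and S :: "'k topology" +
  assumes compact: "compact_space S"

definition normalized_haar_measure ::
    "('k, 'b) monoid_scheme \<Rightarrow> 'k topology \<Rightarrow> 'k measure \<Rightarrow> bool" where
  "normalized_haar_measure K S m \<longleftrightarrow>
     radon_probability S m \<and>
     (\<forall>k\<in>carrier K. distr m (borel_of S) (\<lambda>l. k \<otimes>\<^bsub>K\<^esub> l) = m)"

text \<open>A continuous action by topological automorphisms. Each \<open>\<phi> k\<close> is extensional on
  \<open>carrier G\<close>, as required by \<^const>\<open>AutoGroup\<close>; it is a homeomorphism because \<open>\<phi>\<close> is jointly
  continuous and \<open>\<phi> (inv k)\<close> is its inverse.\<close>

definition continuous_action_by_automorphisms ::
    "('k, 'b) monoid_scheme \<Rightarrow> 'k topology \<Rightarrow> ('a, 'c) monoid_scheme \<Rightarrow> 'a topology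
      \<Rightarrow> ('k \<Rightarrow> 'a \<Rightarrow> 'a) \<Rightarrow> bool" where
  "continuous_action_by_automorphisms K S G T \<phi> \<longleftrightarrow>
     \<phi> \<in> hom K (AutoGroup G) \<and>
     continuous_map (prod_topology S T) T (\<lambda>(k, x). \<phi> k x)"


section \<open>Pontryagin dual and dual action\<close>

text \<open>The topology of uniform convergence on compact subsets of \<open>X\<close>, on a set \<open>F\<close> of functions.\<close>

definition compact_convergence_topology ::
    "'a topology \<Rightarrow> ('a \<Rightarrow> complex) set \<Rightarrow> ('a \<Rightarrow> complex) topology" where
  "compact_convergence_topology X F = topology (\<lambda>U. U \<subseteq> F \<and>
     (\<forall>f\<in>U. \<exists>C \<epsilon>. compactin X C \<and> \<epsilon> > 0 \<and>
        {g \<in> F. \<forall>x\<in>C. dist (g x) (f x) < \<epsilon>} \<subseteq> U))"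

lemma openin_compact_convergence_topology:
  "openin (compact_convergence_topology X F) U \<longleftrightarrow> U \<subseteq> F \<and>
     (\<forall>f\<in>U. \<exists>C \<epsilon>. compactin X C \<and> \<epsilon> > 0 \<and>
        {g \<in> F. \<forall>x\<in>C. dist (g x) (f x) < \<epsilon>} \<subseteq> U)"
proof -
  define P where "P f U \<longleftrightarrow> (\<exists>C \<epsilon>. compactin X C \<and> \<epsilon> > 0 \<and>
        {g \<in> F. \<forall>x\<in>C. dist (g x) (f x) < \<epsilon>} \<subseteq> U)" for f U
  have int: "P f (U \<inter> V)" if a: "P f U" and b: "P f V" for f U V
  proof -
    obtain C \<epsilon> where "compactin X C" "\<epsilon> > 0"
        "{g \<in> F. \<forall>x\<in>C. dist (g x) (f x) < \<epsilon>} \<subseteq> U"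
      using a unfolding P_def by blast
    moreover obtain D \<delta> where "compactin X D" "\<delta> > 0"
        "{g \<in> F. \<forall>x\<in>D. dist (g x) (f x) < \<delta>} \<subseteq> V"
      using b unfolding P_def by blast
    ultimately have "compactin X (C \<union> D) \<and> min \<epsilon> \<delta> > 0 \<and>
        {g \<in> F. \<forall>x\<in>C \<union> D. dist (g x) (f x) < min \<epsilon> \<delta>} \<subseteq> U \<inter> V"
      by (auto intro: compactin_Un)
    then show ?thesis unfolding P_def by blast
  qed
  have mono: "P f V" if "P f U" "U \<subseteq> V" for f U V
    using that unfolding P_def by (meson subset_trans)
  have "istopology (\<lambda>U. U \<subseteq> F \<and> (\<forall>f\<in>U. P f U))"
    unfolding istopology_def
  proof (intro conjI allI impI)
    fix \<U> assume "\<forall>U\<in>\<U>. U \<subseteq> F \<and> (\<forall>f\<in>U. P f U)"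
    then show "\<Union>\<U> \<subseteq> F" "\<forall>f\<in>\<Union>\<U>. P f (\<Union>\<U>)"
      using mono by (blast, meson UnionE Union_upper)
  qed (use int in blast)+
  then show ?thesis
    by (simp add: compact_convergence_topology_def P_def topology_inverse')
qed

lemma topspace_compact_convergence_topology [simp]:
  "topspace (compact_convergence_topology X F) = F"
proof
  show "topspace (compact_convergence_topology X F) \<subseteq> F"
    using openin_topspace openin_compact_convergence_topology by blast
  have "openin (compact_convergence_topology X F) F"
    unfolding openin_compact_convergence_topology
    by (auto intro!: exI[of _ "{}"] exI[of _ "1::real"])
  then show "F \<subseteq> topspace (compact_convergence_topology X F)"
    by (rule openin_subset)
qed

text \<open>Functions on a carrier are represented by their extensional versions, so that equality of
  characters is equality of functions.\<close>

definition pontryagin_dual ::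
    "('a, 'b) monoid_scheme \<Rightarrow> 'a topology \<Rightarrow> ('a \<Rightarrow> complex) monoid" where
  "pontryagin_dual G T =
     \<lparr>carrier = {\<xi> \<in> extensional (carrier G).
          continuous_map T euclidean \<xi> \<and>
          (\<forall>x\<in>carrier G. norm (\<xi> x) = 1) \<and>
          (\<forall>x\<in>carrier G. \<forall>y\<in>carrier G. \<xi> (x \<otimes>\<^bsub>G\<^esub> y) = \<xi> x * \<xi> y)},
      mult = (\<lambda>\<xi> \<psi>. \<lambda>x\<in>carrier G. \<xi> x * \<psi> x),
      one = (\<lambda>x\<in>carrier G. 1)\<rparr>"

definition pontryagin_topology ::
    "('a, 'b) monoid_scheme \<Rightarrow> 'a topology \<Rightarrow> ('a \<Rightarrow> complex) topology" where
  "pontryagin_topology G T =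
     compact_convergence_topology T (carrier (pontryagin_dual G T))"

definition dual_action ::
    "('k, 'c) monoid_scheme \<Rightarrow> ('a, 'b) monoid_scheme \<Rightarrow> 'a topology \<Rightarrow> ('k \<Rightarrow> 'a \<Rightarrow> 'a)
      \<Rightarrow> 'k \<Rightarrow> ('a \<Rightarrow> complex) \<Rightarrow> 'a \<Rightarrow> complex" where
  "dual_action K G T \<phi> =
     (\<lambda>k. \<lambda>\<xi>\<in>carrier (pontryagin_dual G T). \<lambda>x\<in>carrier G. \<xi> (\<phi> (inv\<^bsub>K\<^esub> k) x))"


section \<open>Hypergroups\<close>

text \<open>The data of a hypergroup: its topology, the hyperproducts \<open>x * y\<close> of points (probability
  measures), the involution and the identity. The convolution of arbitrary measures is determined
  by the hyperproducts of points.\<close>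

record 'h hypergroup =
  htop :: "'h topology"
  hprod :: "'h \<Rightarrow> 'h \<Rightarrow> 'h measure"
  hinv :: "'h \<Rightarrow> 'h"
  hone :: "'h"

definition hypergroup_isomorphism :: "'h hypergroup \<Rightarrow> 'i hypergroup \<Rightarrow> ('h \<Rightarrow> 'i) \<Rightarrow> bool" where
  "hypergroup_isomorphism H L f \<longleftrightarrow>
     homeomorphic_map (htop H) (htop L) f \<and>
     (\<forall>x\<in>topspace (htop H). \<forall>y\<in>topspace (htop H).
        distr (hprod H x y) (borel_of (htop L)) f = hprod L (f x) (f y)) \<and>
     (\<forall>x\<in>topspace (htop H). f (hinv H x) = hinv L (f x)) \<and>
     f (hone H) = hone L"

definition hypergroup_isomorphic :: "'h hypergroup \<Rightarrow> 'i hypergroup \<Rightarrow> bool" where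
  "hypergroup_isomorphic H L \<longleftrightarrow> (\<exists>f. hypergroup_isomorphism H L f)"


subsection \<open>Orbit hypergroups\<close>

text \<open>The average of a function over \<open>K\<close>, and its adjoint on finite Radon measures, given by
  \<open>\<integral> f d\<pi>(\<mu>) = \<integral> \<pi>(f) d\<mu>\<close> with \<open>f\<close> the indicator of a Borel set.
  The convolution is likewise given by \<open>\<integral> f d(\<mu> * \<nu>) = \<integral> \<integral> f(x y) d\<nu>(y) d\<mu>(x)\<close>. It is not the
  image of the measure \<open>\<mu> \<Otimes>\<^sub>M \<nu>\<close>: beyond second countable groups, the multiplication
  need not be measurable for the product of the Borel sigma-algebras. The iterated integrals make
  sense for all finite Radon measures.\<close>

definition average :: "'k measure \<Rightarrow> ('k \<Rightarrow> 'a \<Rightarrow> 'a) \<Rightarrow> ('a \<Rightarrow> ennreal) \<Rightarrow> 'a \<Rightarrow> ennreal" where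
  "average m \<phi> f x = (\<integral>\<^sup>+k. f (\<phi> k x) \<partial>m)"

definition average_measure ::
    "'k measure \<Rightarrow> 'a topology \<Rightarrow> ('k \<Rightarrow> 'a \<Rightarrow> 'a) \<Rightarrow> 'a measure \<Rightarrow> 'a measure" where
  "average_measure m T \<phi> \<mu> =
     measure_of (topspace T) (sets (borel_of T)) (\<lambda>E. \<integral>\<^sup>+x. average m \<phi> (indicator E) x \<partial>\<mu>)"

definition convolution_measure ::
    "('a, 'b) monoid_scheme \<Rightarrow> 'a topology \<Rightarrow> 'a measure \<Rightarrow> 'a measure \<Rightarrow> 'a measure" where
  "convolution_measure G T \<mu> \<nu> =
     measure_of (topspace T) (sets (borel_of T))
       (\<lambda>E. \<integral>\<^sup>+x. (\<integral>\<^sup>+y. indicator E (x \<otimes>\<^bsub>G\<^esub> y) \<partial>\<nu>) \<partial>\<mu>)"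

definition orbit_topology ::
    "('k, 'c) monoid_scheme \<Rightarrow> 'a topology \<Rightarrow> ('k \<Rightarrow> 'a \<Rightarrow> 'a) \<Rightarrow> 'a set topology" where
  "orbit_topology K T \<phi> = topology (\<lambda>U. U \<subseteq> orbits K (topspace T) \<phi> \<and>
     openin T {x \<in> topspace T. orbit K \<phi> x \<in> U})"

lemma openin_orbit_topology:
  "openin (orbit_topology K T \<phi>) U \<longleftrightarrow> U \<subseteq> orbits K (topspace T) \<phi> \<and>
     openin T {x \<in> topspace T. orbit K \<phi> x \<in> U}"
proof -
  have "istopology (\<lambda>U. U \<subseteq> orbits K (topspace T) \<phi> \<and>
     openin T {x \<in> topspace T. orbit K \<phi> x \<in> U})"
    unfolding istopology_def
  proof (intro conjI allI impI)
    fix U V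
    assume U: "U \<subseteq> orbits K (topspace T) \<phi> \<and> openin T {x \<in> topspace T. orbit K \<phi> x \<in> U}"
      and V: "V \<subseteq> orbits K (topspace T) \<phi> \<and> openin T {x \<in> topspace T. orbit K \<phi> x \<in> V}"
    show "U \<inter> V \<subseteq> orbits K (topspace T) \<phi>" using U by blast
    have "{x \<in> topspace T. orbit K \<phi> x \<in> U \<inter> V} =
        {x \<in> topspace T. orbit K \<phi> x \<in> U} \<inter> {x \<in> topspace T. orbit K \<phi> x \<in> V}"
      by blast
    then show "openin T {x \<in> topspace T. orbit K \<phi> x \<in> U \<inter> V}"
      using U V by (simp add: openin_Int)
  next
    fix \<U>
    assume *: "\<forall>U\<in>\<U>. U \<subseteq> orbits K (topspace T) \<phi> \<and>
        openin T {x \<in> topspace T. orbit K \<phi> x \<in> U}"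
    show "\<Union>\<U> \<subseteq> orbits K (topspace T) \<phi>" using * by blast
    have "{x \<in> topspace T. orbit K \<phi> x \<in> \<Union>\<U>} =
        (\<Union>U\<in>\<U>. {x \<in> topspace T. orbit K \<phi> x \<in> U})"
      by blast
    then show "openin T {x \<in> topspace T. orbit K \<phi> x \<in> \<Union>\<U>}"
      using * by (metis (no_types, lifting) imageE openin_Union)
  qed
  then show ?thesis
    by (simp add: orbit_topology_def topology_inverse')
qed

lemma topspace_orbit_topology [simp]:
  "topspace (orbit_topology K T \<phi>) = orbits K (topspace T) \<phi>"
proof
  show "topspace (orbit_topology K T \<phi>) \<subseteq> orbits K (topspace T) \<phi>"
    using openin_topspace openin_orbit_topology by blast
  have "{x \<in> topspace T. orbit K \<phi> x \<in> orbits K (topspace T) \<phi>} = topspace T"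
    by (auto simp: orbits_def)
  then have "openin (orbit_topology K T \<phi>) (orbits K (topspace T) \<phi>)"
    by (simp add: openin_orbit_topology)
  then show "orbits K (topspace T) \<phi> \<subseteq> topspace (orbit_topology K T \<phi>)"
    by (rule openin_subset)
qed

text \<open>Under the identification of measures on the orbit space with \<open>K\<close>-radial measures on \<open>G\<close> that
  sends the point mass at \<open>K \<cdot> x\<close> to \<open>\<pi>(\<delta>\<^sub>x)\<close>, a radial measure corresponds to its image under the
  quotient map. Neither hyperproduct nor involution depends on the representatives chosen below.\<close>

definition orbit_hypergroup ::
    "('k, 'c) monoid_scheme \<Rightarrow> 'k measure \<Rightarrow> ('a, 'b) monoid_scheme \<Rightarrow> 'a topology
      \<Rightarrow> ('k \<Rightarrow> 'a \<Rightarrow> 'a) \<Rightarrow> 'a set hypergroup" where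
  "orbit_hypergroup K m G T \<phi> =
     (let rep = (\<lambda>A. SOME x. x \<in> A);
          \<pi>\<delta> = (\<lambda>x. average_measure m T \<phi> (return (borel_of T) x))
      in \<lparr>htop = orbit_topology K T \<phi>,
          hprod = (\<lambda>A B. distr (convolution_measure G T (\<pi>\<delta> (rep A)) (\<pi>\<delta> (rep B)))
                     (borel_of (orbit_topology K T \<phi>)) (orbit K \<phi>)),
          hinv = (\<lambda>A. orbit K \<phi> (inv\<^bsub>G\<^esub> (rep A))),
          hone = {\<one>\<^bsub>G\<^esub>}\<rparr>)"


subsection \<open>The dual of a commutative hypergroup\<close>

definition hypergroup_characters :: "'h hypergroup \<Rightarrow> ('h \<Rightarrow> complex) set" where
  "hypergroup_characters H =
     {\<xi> \<in> extensional (topspace (htop H)).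
        (\<exists>x\<in>topspace (htop H). \<xi> x \<noteq> 0) \<and>
        bounded (\<xi> ` topspace (htop H)) \<and>
        continuous_map (htop H) euclidean \<xi> \<and>
        (\<forall>x\<in>topspace (htop H). \<forall>y\<in>topspace (htop H).
           (LINT z|hprod H x y. \<xi> z) = \<xi> x * \<xi> y) \<and>
        (\<forall>x\<in>topspace (htop H). \<xi> (hinv H x) = cnj (\<xi> x))}"

definition character_topology :: "'h hypergroup \<Rightarrow> ('h \<Rightarrow> complex) topology" where
  "character_topology H = compact_convergence_topology (htop H) (hypergroup_characters H)"

definition is_dual_hyperproduct ::
    "'h hypergroup \<Rightarrow> ('h \<Rightarrow> complex) \<Rightarrow> ('h \<Rightarrow> complex) \<Rightarrow> ('h \<Rightarrow> complex) measure \<Rightarrow> bool" where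
  "is_dual_hyperproduct H \<xi> \<psi> \<mu> \<longleftrightarrow>
     radon_probability (character_topology H) \<mu> \<and>
     (\<forall>x\<in>topspace (htop H). \<xi> x * \<psi> x = (LINT \<tau>|\<mu>. \<tau> x))"

text \<open>The hyperproduct on the dual is well defined. This is not automatic, and
  \<open>dual_hypergroup H\<close> is meaningful only under this condition.\<close>

definition dual_hyperproducts_exist :: "'h hypergroup \<Rightarrow> bool" where
  "dual_hyperproducts_exist H \<longleftrightarrow>
     (\<forall>\<xi>\<in>hypergroup_characters H. \<forall>\<psi>\<in>hypergroup_characters H.
        \<exists>!\<mu>. is_dual_hyperproduct H \<xi> \<psi> \<mu>)"

definition dual_hypergroup :: "'h hypergroup \<Rightarrow> ('h \<Rightarrow> complex) hypergroup" where
  "dual_hypergroup H =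
     \<lparr>htop = character_topology H,
      hprod = (\<lambda>\<xi> \<psi>. THE \<mu>. is_dual_hyperproduct H \<xi> \<psi> \<mu>),
      hinv = (\<lambda>\<xi>. \<lambda>x\<in>topspace (htop H). cnj (\<xi> x)),
      hone = (\<lambda>x\<in>topspace (htop H). 1)\<rparr>"

end

theory Submission
  imports Defs "HOL-Real_Asymp.Real_Asymp"
begin

text \<open>Averaging a character \<open>\<xi>\<close> of \<open>G\<close> over \<open>K\<close> gives a character of the orbit hypergroup, constant
  on the dual orbit of \<open>\<xi>\<close>. Conversely, a character of the orbit hypergroup is a bounded \<open>K\<close>-invariant
  function \<open>f\<close> on \<open>G\<close> with \<open>\<integral> f(x (k\<cdot>y)) dk = f(x) f(y)\<close> and \<open>f(x\<^sup>-\<^sup>1) = cnj (f(x))\<close>. As the powers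
  of a compact neighbourhood grow polynomially, averaging \<open>f(x y) cnj (f(y))\<close> over such powers shows
  that \<open>f\<close> is positive definite. The functions \<open>g\<close> that are positive definite, normalized and satisfy
  \<open>\<integral> g(x (k\<cdot>w)) dk = f(w) g(x)\<close> form a set that is compact for pointwise convergence, because
  smoothing with a kernel makes them equicontinuous. It contains \<open>f\<close>, and each of its extreme points is
  a character of \<open>G\<close> with average \<open>f\<close>.

  The averages of characters in different orbits differ: otherwise the two orbit measures have the
  same moments, contradicting the Stone--Weierstrass theorem on the union of the two compact orbits.
  The same argument shows that a Radon measure on the dual is determined by its moments, which gives
  uniqueness of the hyperproducts. The equicontinuity above shows that characters whose averages
  are close to a given one on a suitable compact set stay in a compact set, hence the bijection is a
  homeomorphism.\<close>

text \<open>Without second countability, Borel sets of a product may escape the product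
  sigma-algebra and Tonelli's theorem does not apply. Exchanges of integrals rest instead on
  compactness of \<open>K\<close>: a jointly continuous integrand is equicontinuous in
  \<open>k\<close> on compact sets, so its integral over \<open>K\<close> is uniformly close to
  finite weighted sums (\<open>integral_exchange\<close>). The other integration then only has to be
  linear and bounded for the uniform norm, which is why a finitely additive functional can play the
  role of Haar integration on \<open>G\<close>. It is built by summing over a separated set and
  applying an invariant mean. Commutativity of \<open>G\<close> enters in three ways: it produces
  the mean, it makes powers of a compact set grow polynomially, and it lets translates of an
  eigenfunction satisfy the same equation. Multiplicativity of \<open>f\<close> is not a convex
  condition. Freezing \<open>f\<close> as the eigenvalue and letting only \<open>g\<close> vary
  makes the equation linear in \<open>g\<close>, so that extreme points can be used; positive
  definiteness bounds \<open>g\<close> by its value at the unit.\<close>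

lemma space_borel_of [simp]: "space (borel_of X) = topspace X"
  by (simp add: borel_of_def space_measure_of_conv)

lemma sets_borel_of: "sets (borel_of X) = sigma_sets (topspace X) {U. openin X U}"
  unfolding borel_of_def by (intro sets_measure_of) (auto dest: openin_subset)

lemma openin_sets_borel_of [intro]: "openin X U \<Longrightarrow> U \<in> sets (borel_of X)"
  by (simp add: sets_borel_of)

lemma closedin_sets_borel_of [intro]: "closedin X C \<Longrightarrow> C \<in> sets (borel_of X)"
proof -
  assume C: "closedin X C"
  then have "topspace X - (topspace X - C) \<in> sets (borel_of X)"
    by (metis closedin_def openin_sets_borel_of sets.compl_sets space_borel_of)
  then show ?thesis
    using C by (simp add: closedin_subset double_diff)
qed

lemma measurable_borel_of: "continuous_map X Y f \<Longrightarrow> f \<in> measurable (borel_of X) (borel_of Y)"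
proof -
  assume f: "continuous_map X Y f"
  show ?thesis
    unfolding borel_of_def[of Y]
  proof (rule measurable_measure_of)
    show "{U. openin Y U} \<subseteq> Pow (topspace Y)" by (auto dest: openin_subset)
    show "f \<in> space (borel_of X) \<rightarrow> topspace Y"
      using f by (auto simp: continuous_map_def)
    fix U assume "U \<in> {U. openin Y U}"
    then have "openin X {x \<in> topspace X. f x \<in> U}"
      using f by (simp add: continuous_map_def)
    moreover have "f -` U \<inter> space (borel_of X) = {x \<in> topspace X. f x \<in> U}" by auto
    ultimately show "f -` U \<inter> space (borel_of X) \<in> sets (borel_of X)" by auto
  qed
qed

lemma borel_of_euclidean [simp]: "borel_of euclidean = borel"
  unfolding borel_of_def borel_def by simp

lemma borel_measurable_continuous_map:
  fixes f :: "'a \<Rightarrow> 'b::topological_space"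
  assumes "sets m = sets (borel_of X)" "continuous_map X euclidean f"
  shows "f \<in> borel_measurable m"
  using measurable_borel_of[OF assms(2)] measurable_cong_sets[OF assms(1)] by auto

lemma radon_probability_prob: "radon_probability X \<mu> \<Longrightarrow> prob_space \<mu>"
  by (simp add: radon_probability_def)

lemma radon_probability_sets: "radon_probability X \<mu> \<Longrightarrow> sets \<mu> = sets (borel_of X)"
  by (simp add: radon_probability_def)

lemma radon_probability_space: "radon_probability X \<mu> \<Longrightarrow> space \<mu> = topspace X"
  using sets_eq_imp_space_eq[OF radon_probability_sets] by force

lemma radon_probability_inner:
  assumes "radon_probability X \<mu>" "E \<in> sets \<mu>" "a < emeasure \<mu> E"
  obtains C where "compactin X C" "C \<subseteq> E" "a < emeasure \<mu> C"
  using assms unfolding radon_probability_def by (auto simp: less_SUP_iff)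

lemma compactin_sets_borel_of: "Hausdorff_space X \<Longrightarrow> compactin X C \<Longrightarrow> C \<in> sets (borel_of X)"
  by (simp add: closedin_sets_borel_of compactin_imp_closedin)

text \<open>Images of compact sets are compact: a compact subset of the preimage of \<open>E\<close>
  has as image a compact subset of \<open>E\<close> of at least the same mass. This makes the
  candidate hyperproducts on the dual Radon measures.\<close>

lemma radon_distr:
  assumes m: "radon_probability S m" and X: "Hausdorff_space X" and g: "continuous_map S X g"
  shows "radon_probability X (distr m (borel_of X) g)"
proof -
  interpret prob_space m by (rule radon_probability_prob[OF m])
  have gm: "g \<in> measurable m (borel_of X)"
    using measurable_borel_of[OF g] measurable_cong_sets[OF radon_probability_sets[OF m]] by auto
  let ?d = "distr m (borel_of X) g"
  have "emeasure ?d E = (SUP C\<in>{C. compactin X C \<and> C \<subseteq> E}. emeasure ?d C)" if E: "E \<in> sets ?d" for E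
  proof (rule antisym)
    let ?E = "g -` E \<inter> space m"
    have Em: "?E \<in> sets m" using gm E by (simp add: measurable_sets)
    have "emeasure ?d E = emeasure m ?E" using gm E by (simp add: emeasure_distr)
    also have "\<dots> = (SUP C\<in>{C. compactin S C \<and> C \<subseteq> ?E}. emeasure m C)"
      using m Em unfolding radon_probability_def by blast
    also have "\<dots> \<le> (SUP C\<in>{C. compactin X C \<and> C \<subseteq> E}. emeasure ?d C)"
    proof (rule SUP_mono)
      fix C assume "C \<in> {C. compactin S C \<and> C \<subseteq> ?E}"
      then have C: "compactin S C" "C \<subseteq> ?E" by auto
      have 1: "compactin X (g ` C)" using C(1) g by (rule image_compactin)
      have 2: "g ` C \<in> sets (borel_of X)" using X 1 by (rule compactin_sets_borel_of)
      have "emeasure m C \<le> emeasure m (g -` (g ` C) \<inter> space m)"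
        using C(2) gm 2 by (intro emeasure_mono) (auto simp: measurable_sets)
      also have "\<dots> = emeasure ?d (g ` C)" using gm 2 by (simp add: emeasure_distr)
      finally show "\<exists>n\<in>{C. compactin X C \<and> C \<subseteq> E}. emeasure m C \<le> emeasure ?d n"
        using 1 C(2) by (intro bexI[of _ "g ` C"]) auto
    qed
    finally show "emeasure ?d E \<le> (SUP C\<in>{C. compactin X C \<and> C \<subseteq> E}. emeasure ?d C)" .
    show "(SUP C\<in>{C. compactin X C \<and> C \<subseteq> E}. emeasure ?d C) \<le> emeasure ?d E"
      using E by (intro SUP_least) (auto intro: emeasure_mono)
  qed
  then show ?thesis
    unfolding radon_probability_def using prob_space_distr[OF gm] by simp
qed

section \<open>Continuity into normed spaces and finite partitions of a compact space\<close>

lemma openin_euclidean_preimage: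
  "continuous_map X euclidean f \<Longrightarrow> open U \<Longrightarrow> openin X {x \<in> topspace X. f x \<in> U}"
  using openin_continuous_map_preimage[of X euclidean f U] by simp

text \<open>The non-strict bound is the form in which estimates of integrals arrive; half the radius
  of a ball restores strictness.\<close>

lemma continuous_map_normI:
  fixes g :: "'k \<Rightarrow> 'b::real_normed_vector"
  assumes "\<And>e k0. e > 0 \<Longrightarrow> k0 \<in> topspace S \<Longrightarrow>
      \<exists>U. openin S U \<and> k0 \<in> U \<and> (\<forall>k\<in>U. norm (g k - g k0) \<le> e)"
  shows "continuous_map S euclidean g"
  unfolding continuous_map_def
proof (intro conjI allI impI)
  show "g \<in> topspace S \<rightarrow> topspace euclidean" by auto
  fix W :: "'b set" assume "openin euclidean W"
  then have W: "open W" by simp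
  show "openin S {x \<in> topspace S. g x \<in> W}"
    unfolding openin_subopen[of S "{x \<in> topspace S. g x \<in> W}"]
  proof
    fix x assume x: "x \<in> {x \<in> topspace S. g x \<in> W}"
    then obtain e where e: "e > 0" "ball (g x) e \<subseteq> W" using W openE by blast
    obtain U where U: "openin S U" "x \<in> U" "\<forall>k\<in>U. norm (g k - g x) \<le> e / 2"
      using assms[of "e/2" x] e x by auto
    have "U \<subseteq> {x \<in> topspace S. g x \<in> W}"
    proof
      fix k assume k: "k \<in> U"
      have "norm (g k - g x) \<le> e / 2" using k U by blast
      then have "g k \<in> ball (g x) e" using e(1) by (simp add: dist_norm norm_minus_commute)
      then show "k \<in> {x \<in> topspace S. g x \<in> W}"
        using k U e openin_subset[OF U(1)] by auto
    qed
    then show "\<exists>T. openin S T \<and> x \<in> T \<and> T \<subseteq> {x \<in> topspace S. g x \<in> W}" using U by blast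
  qed
qed

lemma continuous_map_norm_le:
  fixes g :: "'k \<Rightarrow> 'b::real_normed_vector"
  assumes "continuous_map S euclidean g" "e > 0" "k0 \<in> topspace S"
  obtains U where "openin S U" "k0 \<in> U" "\<And>k. k \<in> U \<Longrightarrow> norm (g k - g k0) < e"
proof -
  have "openin S {k \<in> topspace S. g k \<in> ball (g k0) e}"
    using assms(1) open_ball by (rule openin_euclidean_preimage)
  then show thesis
    by (rule that) (use assms(2,3) in \<open>auto simp: dist_norm norm_minus_commute\<close>)
qed

text \<open>The set where \<open>F k x\<close> is within \<open>e\<close> of \<open>F k0 x\<close>
  is open and contains the slice over \<open>k0\<close>. Since \<open>C\<close> is compact, the tube
  lemma widens the slice to a product neighbourhood.\<close>

lemma equicontinuous_on_compact:
  fixes F :: "'k \<Rightarrow> 'x \<Rightarrow> complex"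
  assumes F: "continuous_map (prod_topology S X) euclidean (\<lambda>(k, x). F k x)"
    and C: "compactin X C" and e: "e > 0" and k0: "k0 \<in> topspace S"
  shows "\<exists>U. openin S U \<and> k0 \<in> U \<and> (\<forall>k\<in>U. \<forall>x\<in>C. norm (F k x - F k0 x) \<le> e)"
proof -
  have C': "C \<subseteq> topspace X" using C compactin_subset_topspace by blast
  have 1: "continuous_map (prod_topology S X) euclidean (\<lambda>z. F k0 (snd z))"
  proof -
    have "continuous_map (prod_topology S X) (prod_topology S X) (\<lambda>z. (k0, snd z))"
      using k0 by (auto intro!: continuous_map_pairedI continuous_map_snd)
    from continuous_map_compose[OF this F] show ?thesis by (simp add: o_def)
  qed
  have 2: "continuous_map (prod_topology S X) euclidean (\<lambda>z. norm ((\<lambda>(k, x). F k x) z - F k0 (snd z)))"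
    using F 1 by (intro continuous_map_norm continuous_map_diff)
  let ?W = "{z \<in> topspace (prod_topology S X). norm ((\<lambda>(k, x). F k x) z - F k0 (snd z)) \<in> {..<e}}"
  have "openin (prod_topology S X) ?W"
    using 2 open_lessThan by (rule openin_euclidean_preimage)
  moreover have "{k0} \<times> C \<subseteq> ?W" using k0 C' e by auto
  ultimately have "\<exists>U V. openin S U \<and> openin X V \<and> k0 \<in> U \<and> C \<subseteq> V \<and> U \<times> V \<subseteq> ?W"
    by (intro tube_lemma_right C k0)
  then obtain U V where UV: "openin S U" "openin X V" "k0 \<in> U" "C \<subseteq> V" "U \<times> V \<subseteq> ?W"
    by (elim exE conjE) (rule that)
  have "norm (F k x - F k0 x) \<le> e" if "k \<in> U" "x \<in> C" for k x
  proof -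
    have "(k, x) \<in> ?W" using UV that by blast
    then show ?thesis by auto
  qed
  then show ?thesis using UV by blast
qed

lemma disjoint_refinement:
  assumes "finite P" "\<And>p. p \<in> P \<Longrightarrow> U p \<in> sets m"
  shows "\<exists>B. (\<forall>p\<in>P. B p \<in> sets m \<and> B p \<subseteq> U p) \<and> disjoint_family_on B P \<and> (\<Union>p\<in>P. B p) = (\<Union>p\<in>P. U p)"
  using assms
proof (induction P)
  case empty
  then show ?case by (auto simp: disjoint_family_on_def)
next
  case (insert p P)
  then obtain B where B: "\<forall>p\<in>P. B p \<in> sets m \<and> B p \<subseteq> U p" "disjoint_family_on B P"
    "(\<Union>p\<in>P. B p) = (\<Union>p\<in>P. U p)" by auto
  \<comment> \<open>The new cell keeps only what the earlier sets leave uncovered, so the union is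
    unchanged and disjointness is automatic.\<close>
  define B' where "B' = B(p := U p - (\<Union>q\<in>P. U q))"
  have eq: "B' q = B q" if "q \<in> P" for q using that insert.hyps by (auto simp: B'_def)
  have p: "B' p = U p - (\<Union>q\<in>P. U q)" by (simp add: B'_def)
  have "disjoint_family_on B' (insert p P)"
    unfolding disjoint_family_on_def
  proof (intro ballI impI)
    fix a b assume ab: "a \<in> insert p P" "b \<in> insert p P" "a \<noteq> b"
    have *: "B q \<subseteq> (\<Union>q\<in>P. U q)" if "q \<in> P" for q using B(1) that by blast
    consider "a = p" "b \<in> P" | "b = p" "a \<in> P" | "a \<in> P" "b \<in> P" using ab by blast
    then show "B' a \<inter> B' b = {}"
    proof cases
      case 1
      then show ?thesis using p eq[of b] *[of b] by blast
    next
      case 2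
      then show ?thesis using p eq[of a] *[of a] by blast
    next
      case 3
      then show ?thesis using B(2) ab(3) eq by (simp add: disjoint_family_on_def)
    qed
  qed
  moreover have "(\<Union>q\<in>insert p P. B' q) = (\<Union>q\<in>insert p P. U q)"
    using B(3) eq p by auto
  moreover have "\<forall>q\<in>insert p P. B' q \<in> sets m \<and> B' q \<subseteq> U q"
  proof
    fix q assume q: "q \<in> insert p P"
    have "U p - (\<Union>q\<in>P. U q) \<in> sets m"
      using insert by (intro sets.Diff sets.finite_UN) auto
    then show "B' q \<in> sets m \<and> B' q \<subseteq> U q"
      using q B(1) eq p by (cases "q = p") auto
  qed
  ultimately show ?case by blast
qed

text \<open>A finite subcover made disjoint. A centre \<open>p\<close> need not lie in its own cell
  \<open>B p\<close>, which may even be empty; what survives is the relation \<open>R p k\<close>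
  between the centre and the points of the cell.\<close>

lemma finite_measurable_partition:
  assumes S: "compact_space S" and m: "sets m = sets (borel_of S)"
    and R: "\<And>k0. k0 \<in> topspace S \<Longrightarrow> \<exists>U. openin S U \<and> k0 \<in> U \<and> (\<forall>k\<in>U. R k0 k)"
  obtains P B where "finite P" "P \<subseteq> topspace S" "\<And>p. p \<in> P \<Longrightarrow> B p \<in> sets m"
    "disjoint_family_on B P" "(\<Union>p\<in>P. B p) = topspace S" "\<And>p k. p \<in> P \<Longrightarrow> k \<in> B p \<Longrightarrow> R p k"
proof -
  obtain U where U: "\<And>k0. k0 \<in> topspace S \<Longrightarrow> openin S (U k0) \<and> k0 \<in> U k0 \<and> (\<forall>k\<in>U k0. R k0 k)"
    using R by metis
  have "compactin S (topspace S)" using S by (simp add: compact_space_def)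
  then obtain \<F> where F: "finite \<F>" "\<F> \<subseteq> U ` topspace S" "topspace S \<subseteq> \<Union>\<F>"
    using compactinD[of S "topspace S" "U ` topspace S"] U by blast
  then obtain P where P: "finite P" "P \<subseteq> topspace S" "\<F> = U ` P"
    by (meson finite_subset_image)
  have Us: "U p \<in> sets m" if "p \<in> P" for p using U P that m by auto
  obtain B where B: "\<forall>p\<in>P. B p \<in> sets m \<and> B p \<subseteq> U p" "disjoint_family_on B P" "(\<Union>p\<in>P. B p) = (\<Union>p\<in>P. U p)"
    using disjoint_refinement[OF P(1), of U m] Us by blast
  have Us': "U p \<subseteq> topspace S" if "p \<in> P" for p
  proof (rule openin_subset)
    show "openin S (U p)" using U[of p] P(2) that by (simp add: subset_iff)
  qed
  have "(\<Union>p\<in>P. U p) = topspace S"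
    using F(3) Us' unfolding P(3) by (auto simp del: UN_iff simp: UN_subset_iff)
  then have un: "(\<Union>p\<in>P. B p) = topspace S" using B(3) by simp
  show thesis
  proof (rule that[OF P(1,2) _ B(2) un])
    show "B p \<in> sets m" if "p \<in> P" for p using B(1) that by simp
    show "R p k" if "p \<in> P" "k \<in> B p" for p k
      using B(1) U[of p] P(2) that by (auto simp: subset_iff)
  qed
qed

lemma continuous_map_times:
  fixes f g :: "'x \<Rightarrow> complex"
  assumes "continuous_map X euclidean f" "continuous_map X euclidean g"
  shows "continuous_map X euclidean (\<lambda>x. f x * g x)"
proof -
  have "continuous_map X (prod_topology euclidean euclidean) (\<lambda>x. (f x, g x))"
    using assms by (simp add: continuous_map_pairedI del: prod_topology_euclidean)
  then have 1: "continuous_map X euclidean (\<lambda>x. (f x, g x))" by simp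
  have 2: "continuous_map euclidean euclidean (\<lambda>(a, b). a * b :: complex)"
    by (simp add: case_prod_unfold continuous_intros)
  show ?thesis using continuous_map_compose[OF 1 2] by (simp add: o_def)
qed

lemma continuous_map_cnj:
  assumes "continuous_map X euclidean f"
  shows "continuous_map X euclidean (\<lambda>x. cnj (f x))"
proof -
  have "continuous_map euclidean euclidean cnj" by (simp add: continuous_intros)
  from continuous_map_compose[OF assms this] show ?thesis by (simp add: o_def)
qed

section \<open>Integration of continuous functions over a compact probability space\<close>

locale compact_probability =
  fixes S :: "'k topology" and m :: "'k measure"
  assumes compact_S: "compact_space S" and prob_m: "prob_space m" and sets_m: "sets m = sets (borel_of S)"
begin

sublocale prob_space m by (rule prob_m)

lemma space_m: "space m = topspace S"
  using sets_eq_imp_space_eq[OF sets_m] by simp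

lemma integrable_continuous:
  fixes g :: "'k \<Rightarrow> complex"
  assumes "continuous_map S euclidean g"
  shows "integrable m g"
proof -
  have "compact (g ` topspace S)"
    using image_compactin[OF _ assms] compact_S by (metis compact_space_def compactin_euclidean_iff)
  then obtain b where "\<forall>x\<in>g ` topspace S. norm x \<le> b"
    using compact_imp_bounded bounded_iff by blast
  then show ?thesis
    using borel_measurable_continuous_map[OF sets_m assms]
    by (intro integrable_const_bound[where B = b]) (auto simp: space_m)
qed

text \<open>The sum is the integral of the step function with value \<open>g p\<close> on
  \<open>B p\<close>, which is within \<open>d\<close> of \<open>g\<close> everywhere; the total
  mass is 1.\<close>

lemma partition_approx:
  fixes g :: "'k \<Rightarrow> complex"
  assumes P: "finite P" "P \<subseteq> topspace S" "\<And>p. p \<in> P \<Longrightarrow> B p \<in> sets m"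
    "disjoint_family_on B P" "(\<Union>p\<in>P. B p) = topspace S"
    and g: "integrable m g" and d: "\<And>p k. p \<in> P \<Longrightarrow> k \<in> B p \<Longrightarrow> norm (g k - g p) \<le> d"
  shows "norm ((LINT k|m. g k) - (\<Sum>p\<in>P. complex_of_real (measure m (B p)) * g p)) \<le> d"
proof -
  define s where "s = (\<lambda>k. \<Sum>p\<in>P. indicat_real (B p) k *\<^sub>R g p)"
  have "integrable m (indicat_real (B p))" if "p \<in> P" for p
    by (rule integrable_real_indicator[OF P(3)[OF that]]) (simp add: less_top[symmetric])
  then have ii: "integrable m (\<lambda>k. indicat_real (B p) k *\<^sub>R g p)" if "p \<in> P" for p
    using that by (intro integrable_scaleR_left) auto
  have si: "integrable m s"
    unfolding s_def using ii by (rule Bochner_Integration.integrable_sum)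
  have "(LINT k|m. s k) = (\<Sum>p\<in>P. (LINT k|m. indicat_real (B p) k *\<^sub>R g p))"
    unfolding s_def using ii by (rule Bochner_Integration.integral_sum)
  also have "\<dots> = (\<Sum>p\<in>P. complex_of_real (measure m (B p)) * g p)"
  proof (rule sum.cong[OF refl])
    fix p assume p: "p \<in> P"
    have "B p \<inter> space m = B p" using P(3)[OF p] sets.sets_into_space by blast
    then show "(LINT k|m. indicat_real (B p) k *\<^sub>R g p) = complex_of_real (measure m (B p)) * g p"
      by (simp add: scaleR_conv_of_real)
  qed
  finally have s: "(LINT k|m. s k) = (\<Sum>p\<in>P. complex_of_real (measure m (B p)) * g p)" .
  have sv: "norm (g k - s k) \<le> d" if k: "k \<in> space m" for k
  proof -
    obtain p where p: "p \<in> P" "k \<in> B p" using k P(5) space_m by auto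
    have "k \<notin> B q" if "q \<in> P" "q \<noteq> p" for q
      using P(4) that p unfolding disjoint_family_on_def by blast
    then have "s k = (\<Sum>q\<in>P. if q = p then g p else 0)"
      unfolding s_def by (intro sum.cong) (auto simp: p)
    then have "s k = g p" using p P(1) by simp
    then show ?thesis using d[OF p] by simp
  qed
  have "norm ((LINT k|m. g k) - (LINT k|m. s k)) = norm (LINT k|m. g k - s k)"
    using g si by simp
  also have "\<dots> \<le> (LINT k|m. norm (g k - s k))" by (rule integral_norm_bound)
  also have "\<dots> \<le> (LINT k|m. d)"
    using g si sv by (intro integral_mono) auto
  also have "\<dots> = d" by (simp add: prob_space)
  finally show ?thesis unfolding s .
qed

lemma norm_integral_le:
  fixes u :: "'k \<Rightarrow> complex"
  assumes "continuous_map S euclidean u" "\<And>k. k \<in> topspace S \<Longrightarrow> norm (u k) \<le> b"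
  shows "norm (LINT k|m. u k) \<le> b"
proof -
  have "norm (LINT k|m. u k) \<le> (LINT k|m. norm (u k))" by (rule integral_norm_bound)
  also have "\<dots> \<le> (LINT k|m. b)"
    using assms(2) integrable_continuous[OF assms(1)] by (intro integral_mono) (auto simp: space_m)
  finally show ?thesis by (simp add: prob_space)
qed

text \<open>Fubini's theorem for a functional \<open>L\<close> that is only known to be bounded for the uniform norm
  on \<open>J\<close>; no measurability is needed besides equicontinuity in the variable of integration.\<close>

lemma integral_exchange:
  fixes F :: "'k \<Rightarrow> 'i \<Rightarrow> complex" and L :: "('i \<Rightarrow> complex) \<Rightarrow> complex"
  assumes equi: "\<And>e k0. e > 0 \<Longrightarrow> k0 \<in> topspace S \<Longrightarrow>
      \<exists>U. openin S U \<and> k0 \<in> U \<and> (\<forall>k\<in>U. \<forall>i\<in>J. norm (F k i - F k0 i) \<le> e)"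
    and lin: "\<And>P w. finite P \<Longrightarrow> P \<subseteq> topspace S \<Longrightarrow>
      L (\<lambda>i. \<Sum>p\<in>P. complex_of_real (w p) * F p i) = (\<Sum>p\<in>P. complex_of_real (w p) * L (F p))"
    and bd: "\<And>u v e. u \<in> V \<Longrightarrow> v \<in> V \<Longrightarrow> e \<ge> 0 \<Longrightarrow> (\<And>i. i \<in> J \<Longrightarrow> norm (u i - v i) \<le> e) \<Longrightarrow>
      norm (L u - L v) \<le> c * e"
    and V1: "\<And>k. k \<in> topspace S \<Longrightarrow> F k \<in> V"
    and V2: "\<And>P w. finite P \<Longrightarrow> P \<subseteq> topspace S \<Longrightarrow> (\<lambda>i. \<Sum>p\<in>P. complex_of_real (w p) * F p i) \<in> V"
    and V3: "(\<lambda>i. LINT k|m. F k i) \<in> V"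
  shows "continuous_map S euclidean (\<lambda>k. L (F k))"
    and "L (\<lambda>i. LINT k|m. F k i) = (LINT k|m. L (F k))"
proof -
  \<comment> \<open>The given constant may vanish or be negative; a positive one is wanted to divide
    by.\<close>
  define c' where "c' = max c 1"
  have bd': "norm (L u - L v) \<le> c' * e" if "u \<in> V" "v \<in> V" "e \<ge> 0" "\<And>i. i \<in> J \<Longrightarrow> norm (u i - v i) \<le> e" for u v e
    using bd[OF that] mult_right_mono[of c c' e] that(3) by (simp add: c'_def)
  have c': "c' > 0" by (simp add: c'_def)
  show cont: "continuous_map S euclidean (\<lambda>k. L (F k))"
  proof (rule continuous_map_normI)
    fix e :: real and k0 assume e: "e > 0" and k0: "k0 \<in> topspace S"
    obtain U where U: "openin S U" "k0 \<in> U" "\<forall>k\<in>U. \<forall>i\<in>J. norm (F k i - F k0 i) \<le> e / c'"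
      using equi[of "e / c'" k0] e c' k0 by auto
    have "norm (L (F k) - L (F k0)) \<le> c' * (e / c')" if "k \<in> U" for k
      using U that k0 openin_subset[OF U(1)] e c' by (intro bd') (auto intro: V1)
    then show "\<exists>U. openin S U \<and> k0 \<in> U \<and> (\<forall>k\<in>U. norm (L (F k) - L (F k0)) \<le> e)"
      using U c' by auto
  qed
  have contF: "continuous_map S euclidean (\<lambda>k. F k i)" if i: "i \<in> J" for i
  proof (rule continuous_map_normI)
    fix e :: real and k0 assume "e > 0" "k0 \<in> topspace S"
    from equi[OF this] i show "\<exists>U. openin S U \<and> k0 \<in> U \<and> (\<forall>k\<in>U. norm (F k i - F k0 i) \<le> e)"
      by blast
  qed
  have "norm (L (\<lambda>i. LINT k|m. F k i) - (LINT k|m. L (F k))) \<le> 0 + e" if e: "e > 0" for e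
  proof -
    \<comment> \<open>One and the same finite sum approximates both sides, each with error
      \<open>c' * d\<close>; the factor 2 makes the two errors add up to \<open>e\<close>.\<close>
    define d where "d = e / (2 * c')"
    have d: "d > 0" using e c' by (simp add: d_def)
    define R where "R = (\<lambda>k0 k. \<forall>i\<in>J. norm (F k i - F k0 i) \<le> d)"
    obtain P B where P: "finite P" "P \<subseteq> topspace S" "\<And>p. p \<in> P \<Longrightarrow> B p \<in> sets m"
      "disjoint_family_on B P" "(\<Union>p\<in>P. B p) = topspace S" "\<And>p k. p \<in> P \<Longrightarrow> k \<in> B p \<Longrightarrow> R p k"
      by (rule finite_measurable_partition[OF compact_S sets_m, of R]) (use equi[OF d] in \<open>auto simp: R_def\<close>)
    let ?s = "\<lambda>i. \<Sum>p\<in>P. complex_of_real (measure m (B p)) * F p i"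
    have 1: "norm ((LINT k|m. F k i) - ?s i) \<le> d" if "i \<in> J" for i
      using P that integrable_continuous[OF contF[OF that]]
      by (intro partition_approx) (auto simp: R_def)
    have 2: "norm (L (\<lambda>i. LINT k|m. F k i) - L ?s) \<le> c' * d"
      using 1 P d by (intro bd' V2 V3) auto
    have 3: "norm ((LINT k|m. L (F k)) - (\<Sum>p\<in>P. complex_of_real (measure m (B p)) * L (F p))) \<le> c' * d"
    proof (rule partition_approx[OF P(1-5) integrable_continuous[OF cont]])
      fix p k assume pk: "p \<in> P" "k \<in> B p"
      show "norm (L (F k) - L (F p)) \<le> c' * d"
        using P pk d by (intro bd' V1) (auto simp: R_def)
    qed
    have 4: "L ?s = (\<Sum>p\<in>P. complex_of_real (measure m (B p)) * L (F p))"
      by (rule lin[OF P(1,2)])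
    have "norm (L (\<lambda>i. LINT k|m. F k i) - (LINT k|m. L (F k))) \<le> c' * d + c' * d"
      using norm_diff_triangle_le[OF 2[unfolded 4] 3[unfolded norm_minus_commute[of "LINT k|m. L (F k)"]]] .
    also have "\<dots> = e" using c' by (simp add: d_def)
    finally show ?thesis by simp
  qed
  then have "norm (L (\<lambda>i. LINT k|m. F k i) - (LINT k|m. L (F k))) \<le> 0"
    using field_le_epsilon by blast
  then show "L (\<lambda>i. LINT k|m. F k i) = (LINT k|m. L (F k))" by simp
qed

text \<open>Here \<open>S\<close> plays the part of the compact set: for \<open>x\<close> near
  \<open>x0\<close> the values \<open>F k x\<close> and \<open>F k x0\<close> are close for all
  \<open>k\<close> at once, and integration against a probability measure keeps that bound.\<close>

lemma continuous_average:
  fixes F :: "'k \<Rightarrow> 'x \<Rightarrow> complex"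
  assumes F: "continuous_map (prod_topology S X) euclidean (\<lambda>(k, x). F k x)"
  shows "continuous_map X euclidean (\<lambda>x. LINT k|m. F k x)"
proof (rule continuous_map_normI)
  fix e :: real and x0 assume e: "e > 0" and x0: "x0 \<in> topspace X"
  have swap: "continuous_map (prod_topology X S) euclidean (\<lambda>(x, k). F k x)"
  proof -
    have "continuous_map (prod_topology X S) (prod_topology S X) (\<lambda>z. (snd z, fst z))"
      by (intro continuous_map_pairedI continuous_map_snd continuous_map_fst)
    from continuous_map_compose[OF this F] show ?thesis by (simp add: o_def case_prod_unfold)
  qed
  have "compactin S (topspace S)" using compact_S by (simp add: compact_space_def)
  from equicontinuous_on_compact[OF swap this e x0] obtain U where U: "openin X U" "x0 \<in> U"
    "\<forall>x\<in>U. \<forall>k\<in>topspace S. norm (F k x - F k x0) \<le> e" by blast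
  have cont: "continuous_map S euclidean (\<lambda>k. F k x)" if "x \<in> topspace X" for x
  proof -
    have "continuous_map S (prod_topology S X) (\<lambda>k. (k, x))"
      using that by (auto intro!: continuous_map_pairedI)
    from continuous_map_compose[OF this F] show ?thesis by (simp add: o_def)
  qed
  have "norm ((LINT k|m. F k x) - (LINT k|m. F k x0)) \<le> e" if x: "x \<in> U" for x
  proof -
    have xt: "x \<in> topspace X" using x U openin_subset by blast
    have i: "integrable m (\<lambda>k. F k x)" "integrable m (\<lambda>k. F k x0)"
      using integrable_continuous cont xt x0 by auto
    have "norm ((LINT k|m. F k x) - (LINT k|m. F k x0)) = norm (LINT k|m. F k x - F k x0)"
      using i by simp
    also have "\<dots> \<le> (LINT k|m. norm (F k x - F k x0))" by (rule integral_norm_bound)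
    also have "\<dots> \<le> (LINT k|m. e)"
      using i U x space_m by (intro integral_mono) auto
    also have "\<dots> = e" by (simp add: prob_space)
    finally show ?thesis .
  qed
  then show "\<exists>U. openin X U \<and> x0 \<in> U \<and> (\<forall>k\<in>U. norm ((LINT ka|m. F ka k) - (LINT k|m. F k x0)) \<le> e)"
    using U by blast
qed

end

text \<open>For open \<open>E\<close> the function is lower semicontinuous: inner regularity gives a
  compact \<open>C\<close> inside the section with enough mass, and the tube lemma keeps
  \<open>C\<close> inside all neighbouring sections. Disjoint unions and complements then reach
  every Borel set. This stands in for Tonelli's theorem, as the preimage of \<open>E\<close> under
  \<open>f\<close> need not be measurable for the product sigma-algebra.\<close>

lemma borel_measurable_emeasure_section:
  assumes \<nu>: "radon_probability Y \<nu>" and f: "continuous_map (prod_topology X Y) Z f"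
    and E: "E \<in> sets (borel_of Z)"
  shows "(\<lambda>x. emeasure \<nu> {y \<in> topspace Y. f (x, y) \<in> E}) \<in> borel_measurable (borel_of X)"
proof -
  interpret prob_space \<nu> by (rule radon_probability_prob[OF \<nu>])
  have sp: "space \<nu> = topspace Y" by (rule radon_probability_space[OF \<nu>])
  define h where "h E x = emeasure \<nu> {y \<in> topspace Y. f (x, y) \<in> E}" for E x
  have cont: "continuous_map Y Z (\<lambda>y. f (x, y))" if "x \<in> topspace X" for x
  proof -
    have "continuous_map Y (prod_topology X Y) (\<lambda>y. (x, y))"
      using that by (intro continuous_map_pairedI) auto
    from continuous_map_compose[OF this f] show ?thesis by (simp add: o_def)
  qed
  have fs: "f (x, y) \<in> topspace Z" if "x \<in> topspace X" "y \<in> topspace Y" for x y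
    using continuous_map_image_subset_topspace[OF f] that by auto
  have secs: "{y \<in> topspace Y. f (x, y) \<in> E} \<in> sets \<nu>"
    if "x \<in> topspace X" "E \<in> sets (borel_of Z)" for x E
  proof -
    have "(\<lambda>y. f (x, y)) -` E \<inter> space (borel_of Y) \<in> sets (borel_of Y)"
      using measurable_sets[OF measurable_borel_of[OF cont[OF that(1)]] that(2)] .
    moreover have "(\<lambda>y. f (x, y)) -` E \<inter> space (borel_of Y) = {y \<in> topspace Y. f (x, y) \<in> E}" by auto
    ultimately show ?thesis using radon_probability_sets[OF \<nu>] by simp
  qed
  have "Int_stable {U. openin Z U}" by (auto simp: Int_stable_def)
  moreover have "{U. openin Z U} \<subseteq> Pow (topspace Z)" by (auto dest: openin_subset)
  moreover have "E \<in> sigma_sets (topspace Z) {U. openin Z U}" using E by (simp add: sets_borel_of)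
  ultimately have "h E \<in> borel_measurable (borel_of X)"
  proof (induction rule: sigma_sets_induct_disjoint)
    case (basic U)
    then have U: "openin Z U" by simp
    show ?case
    proof (rule borel_measurableI_greater)
      fix a
      have "openin X {x \<in> topspace X. a < h U x}"
        unfolding openin_subopen[of X "{x \<in> topspace X. a < h U x}"]
      proof
        fix x assume "x \<in> {x \<in> topspace X. a < h U x}"
        then have x: "x \<in> topspace X" "a < h U x" by auto
        obtain C where C: "compactin Y C" "C \<subseteq> {y \<in> topspace Y. f (x, y) \<in> U}" "a < emeasure \<nu> C"
          using radon_probability_inner[OF \<nu> secs[OF x(1) openin_sets_borel_of[OF U]]] x(2)
          unfolding h_def by blast
        let ?W = "{z \<in> topspace (prod_topology X Y). f z \<in> U}"
        have "openin (prod_topology X Y) ?W"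
          using f U by (rule openin_continuous_map_preimage)
        moreover have "{x} \<times> C \<subseteq> ?W" using C(2) x(1) by auto
        ultimately have "\<exists>A B. openin X A \<and> openin Y B \<and> x \<in> A \<and> C \<subseteq> B \<and> A \<times> B \<subseteq> ?W"
          by (intro tube_lemma_right C(1) x(1))
        then obtain A B where AB: "openin X A" "x \<in> A" "C \<subseteq> B" "A \<times> B \<subseteq> ?W"
          by blast
        have "a < h U x'" if x': "x' \<in> A" for x'
        proof -
          have x't: "x' \<in> topspace X" using x' AB(1) openin_subset by blast
          have "C \<subseteq> {y \<in> topspace Y. f (x', y) \<in> U}"
          proof
            fix y assume "y \<in> C"
            then have "(x', y) \<in> ?W" using AB x' by blast
            then show "y \<in> {y \<in> topspace Y. f (x', y) \<in> U}" by auto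
          qed
          then have "emeasure \<nu> C \<le> h U x'"
            unfolding h_def using secs[OF x't openin_sets_borel_of[OF U]] by (rule emeasure_mono)
          then show ?thesis using C(3) by simp
        qed
        then show "\<exists>T. openin X T \<and> x \<in> T \<and> T \<subseteq> {x \<in> topspace X. a < h U x}"
          using AB openin_subset[OF AB(1)] by blast
      qed
      then show "{x \<in> space (borel_of X). a < h U x} \<in> sets (borel_of X)" by auto
    qed
  next
    case empty
    have "h {} = (\<lambda>x. 0)" by (auto simp: h_def fun_eq_iff)
    then show ?case by simp
  next
    case (compl E)
    then have E: "E \<in> sets (borel_of Z)" by (simp add: sets_borel_of)
    have "h (topspace Z - E) x = 1 - h E x" if x: "x \<in> topspace X" for x
    proof -
      have "{y \<in> topspace Y. f (x, y) \<in> topspace Z - E} = space \<nu> - {y \<in> topspace Y. f (x, y) \<in> E}"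
        using fs[OF x] sp by auto
      then show ?thesis
        unfolding h_def using secs[OF x E] by (simp add: emeasure_compl emeasure_space_1)
    qed
    then have "h (topspace Z - E) \<in> borel_measurable (borel_of X) \<longleftrightarrow>
        (\<lambda>x. 1 - h E x) \<in> borel_measurable (borel_of X)"
      by (intro measurable_cong) simp
    then show ?case using compl.IH by simp
  next
    case (union E)
    then have E: "E i \<in> sets (borel_of Z)" for i by (auto simp: sets_borel_of)
    have "h (\<Union>i. E i) x = (\<Sum>i. h (E i) x)" if x: "x \<in> topspace X" for x
    proof -
      have "(\<Sum>i. emeasure \<nu> {y \<in> topspace Y. f (x, y) \<in> E i}) = emeasure \<nu> (\<Union>i. {y \<in> topspace Y. f (x, y) \<in> E i})"
        using secs[OF x E] union.hyps by (intro suminf_emeasure) (auto simp: disjoint_family_on_def)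
      moreover have "(\<Union>i. {y \<in> topspace Y. f (x, y) \<in> E i}) = {y \<in> topspace Y. f (x, y) \<in> (\<Union>i. E i)}" by auto
      ultimately show ?thesis unfolding h_def by simp
    qed
    then have "h (\<Union>i. E i) \<in> borel_measurable (borel_of X) \<longleftrightarrow>
        (\<lambda>x. \<Sum>i. h (E i) x) \<in> borel_measurable (borel_of X)"
      by (intro measurable_cong) simp
    then show ?case using union.IH by simp
  qed
  then show ?thesis unfolding h_def[abs_def] .
qed

section \<open>Continuous actions of a compact group by automorphisms and their orbit spaces\<close>

context topological_group
begin

lemma continuous_map_mult [continuous_intros]:
  assumes "continuous_map Z T f" "continuous_map Z T g"
  shows "continuous_map Z T (\<lambda>z. f z \<otimes> g z)"
  using continuous_map_compose[OF continuous_map_pairedI[OF assms] continuous_mult] by (simp add: o_def)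

lemma continuous_map_inv [continuous_intros]:
  assumes "continuous_map Z T f"
  shows "continuous_map Z T (\<lambda>z. inv (f z))"
  using continuous_map_compose[OF assms continuous_inv] by (simp add: o_def)

end

text \<open>Formulated for topological groups in general so that one development serves both
  \<open>G\<close> with \<open>\<phi>\<close> and the dual group with the dual action.\<close>

locale group_orbit = topological_group G T + K: compact_group K S
  for G :: "('a, 'b) monoid_scheme" (structure) and T :: "'a topology"
    and K :: "('k, 'c) monoid_scheme" and S :: "'k topology" +
  fixes m :: "'k measure" and \<phi> :: "'k \<Rightarrow> 'a \<Rightarrow> 'a"
  assumes haar: "normalized_haar_measure K S m"
    and action: "continuous_action_by_automorphisms K S G T \<phi>"
begin

lemma radon_m: "radon_probability S m"
  using haar by (simp add: normalized_haar_measure_def)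

sublocale compact_probability S m
  by (rule compact_probability.intro[OF K.compact radon_probability_prob[OF radon_m]
        radon_probability_sets[OF radon_m]])

lemma space_m': "space m = carrier K"
  by (simp add: space_m K.topspace_eq_carrier)

lemma phi_auto: "k \<in> carrier K \<Longrightarrow> \<phi> k \<in> auto G"
  using action by (auto simp: continuous_action_by_automorphisms_def hom_def AutoGroup_def)

lemma phi_closed [simp, intro]: "k \<in> carrier K \<Longrightarrow> x \<in> carrier G \<Longrightarrow> \<phi> k x \<in> carrier G"
  using phi_auto[of k] by (auto simp: auto_def hom_def)

lemma phi_mult: "k \<in> carrier K \<Longrightarrow> x \<in> carrier G \<Longrightarrow> y \<in> carrier G \<Longrightarrow> \<phi> k (x \<otimes> y) = \<phi> k x \<otimes> \<phi> k y"
  using phi_auto[of k] by (auto simp: auto_def hom_def)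

lemma phi_comp:
  assumes "k \<in> carrier K" "l \<in> carrier K" "x \<in> carrier G"
  shows "\<phi> (k \<otimes>\<^bsub>K\<^esub> l) x = \<phi> k (\<phi> l x)"
proof -
  have "\<phi> (k \<otimes>\<^bsub>K\<^esub> l) = \<phi> k \<otimes>\<^bsub>AutoGroup G\<^esub> \<phi> l"
    using action assms by (auto simp: continuous_action_by_automorphisms_def hom_def)
  then show ?thesis
    using phi_auto[of k] phi_auto[of l] assms
    by (simp add: AutoGroup_def BijGroup_def auto_def compose_def)
qed

lemma phi_one [simp]: "x \<in> carrier G \<Longrightarrow> \<phi> \<one>\<^bsub>K\<^esub> x = x"
proof -
  assume x: "x \<in> carrier G"
  have "\<phi> \<one>\<^bsub>K\<^esub> (\<phi> \<one>\<^bsub>K\<^esub> x) = \<phi> \<one>\<^bsub>K\<^esub> x"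
    using phi_comp[of "\<one>\<^bsub>K\<^esub>" "\<one>\<^bsub>K\<^esub>" x] x by simp
  moreover have "inj_on (\<phi> \<one>\<^bsub>K\<^esub>) (carrier G)"
    using phi_auto[of "\<one>\<^bsub>K\<^esub>"] by (auto simp: auto_def Bij_def bij_betw_def)
  ultimately show ?thesis using x by (auto dest: inj_onD)
qed

lemma phi_inv_left [simp]: "k \<in> carrier K \<Longrightarrow> x \<in> carrier G \<Longrightarrow> \<phi> (inv\<^bsub>K\<^esub> k) (\<phi> k x) = x"
  by (simp add: phi_comp[symmetric])

lemma phi_inv_right [simp]: "k \<in> carrier K \<Longrightarrow> x \<in> carrier G \<Longrightarrow> \<phi> k (\<phi> (inv\<^bsub>K\<^esub> k) x) = x"
  by (simp add: phi_comp[symmetric])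

lemma phi_unit [simp]: "k \<in> carrier K \<Longrightarrow> \<phi> k \<one> = \<one>"
  by (metis l_cancel_one' one_closed phi_closed phi_mult r_one)

lemma phi_inverse: "k \<in> carrier K \<Longrightarrow> x \<in> carrier G \<Longrightarrow> \<phi> k (inv x) = inv (\<phi> k x)"
  by (metis inv_closed inv_equality l_inv phi_closed phi_mult phi_unit)

lemma continuous_map_phi [continuous_intros]:
  assumes "continuous_map Z S a" "continuous_map Z T b"
  shows "continuous_map Z T (\<lambda>z. \<phi> (a z) (b z))"
proof -
  have "continuous_map (prod_topology S T) T (\<lambda>(k, x). \<phi> k x)"
    using action by (simp add: continuous_action_by_automorphisms_def)
  from continuous_map_compose[OF continuous_map_pairedI[OF assms] this] show ?thesis by (simp add: o_def)
qed

lemma orbit_alt: "orbit K \<phi> x = (\<lambda>k. \<phi> k x) ` carrier K"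
  by (auto simp: orbit_def)

lemma orbit_subset: "x \<in> carrier G \<Longrightarrow> orbit K \<phi> x \<subseteq> carrier G"
  by (auto simp: orbit_alt)

lemma orbit_self: "x \<in> carrier G \<Longrightarrow> x \<in> orbit K \<phi> x"
  unfolding orbit_alt by (rule image_eqI[of _ _ "\<one>\<^bsub>K\<^esub>"]) auto

lemma orbit_phi [simp]:
  assumes k: "k \<in> carrier K" and x: "x \<in> carrier G"
  shows "orbit K \<phi> (\<phi> k x) = orbit K \<phi> x"
proof
  show "orbit K \<phi> (\<phi> k x) \<subseteq> orbit K \<phi> x"
    using k x by (auto simp: orbit_alt phi_comp[symmetric])
  have "\<phi> l x = \<phi> (l \<otimes>\<^bsub>K\<^esub> inv\<^bsub>K\<^esub> k) (\<phi> k x)" if "l \<in> carrier K" for l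
    using that k x by (simp add: phi_comp)
  then show "orbit K \<phi> x \<subseteq> orbit K \<phi> (\<phi> k x)"
    unfolding orbit_alt using k by (intro image_subsetI) (metis (no_types, lifting) K.inv_closed K.m_closed image_eqI)
qed

lemma orbit_eq: "x \<in> carrier G \<Longrightarrow> y \<in> orbit K \<phi> x \<Longrightarrow> orbit K \<phi> y = orbit K \<phi> x"
  by (auto simp: orbit_alt[of x])

lemma orbits_carrier: "orbits K (carrier G) \<phi> = orbit K \<phi> ` carrier G"
  by (auto simp: orbits_def)

text \<open>The same choice as inside \<open>orbit_hypergroup\<close>, named so that hyperproduct
  and involution can be rewritten with it.\<close>

definition rep :: "'a set \<Rightarrow> 'a" where "rep A = (SOME x. x \<in> A)"

lemma rep_props:
  assumes "A \<in> orbit K \<phi> ` carrier G"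
  shows "rep A \<in> carrier G" "orbit K \<phi> (rep A) = A" "rep A \<in> A"
proof -
  obtain x where x: "x \<in> carrier G" "A = orbit K \<phi> x" using assms by blast
  have "rep A \<in> A" unfolding rep_def using orbit_self[OF x(1)] x(2) by (metis someI_ex)
  then show r: "rep A \<in> A" .
  show "rep A \<in> carrier G" using r orbit_subset[OF x(1)] x(2) by blast
  show "orbit K \<phi> (rep A) = A" using r orbit_eq[OF x(1)] x(2) by simp
qed

lemma continuous_map_orbit: "continuous_map T (orbit_topology K T \<phi>) (orbit K \<phi>)"
  unfolding continuous_map_def
  using openin_orbit_topology[of K T \<phi>] by (auto simp: orbits_carrier topspace_eq_carrier)

text \<open>The universal property of the quotient topology.\<close>

lemma continuous_map_from_orbit_topology:
  assumes "continuous_map T Y (\<lambda>x. f (orbit K \<phi> x))"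
  shows "continuous_map (orbit_topology K T \<phi>) Y f"
  unfolding continuous_map_def
proof (intro conjI allI impI)
  show "f \<in> topspace (orbit_topology K T \<phi>) \<rightarrow> topspace Y"
    using assms by (auto simp: continuous_map_def orbits_carrier topspace_eq_carrier)
  fix U assume "openin Y U"
  then have "openin T {x \<in> topspace T. f (orbit K \<phi> x) \<in> U}"
    using assms by (simp add: continuous_map_def)
  moreover have "{x \<in> topspace T. orbit K \<phi> x \<in> {A \<in> topspace (orbit_topology K T \<phi>). f A \<in> U}}
      = {x \<in> topspace T. f (orbit K \<phi> x) \<in> U}"
    by (auto simp: orbits_carrier topspace_eq_carrier)
  ultimately show "openin (orbit_topology K T \<phi>) {A \<in> topspace (orbit_topology K T \<phi>). f A \<in> U}"
    unfolding openin_orbit_topology by auto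
qed

lemma continuous_map_of_orbit:
  assumes "continuous_map (orbit_topology K T \<phi>) Y f"
  shows "continuous_map T Y (\<lambda>x. f (orbit K \<phi> x))"
  using continuous_map_compose[OF continuous_map_orbit assms] by (simp add: o_def)

subsection \<open>Invariance of the Haar measure\<close>

lemma emeasure_left_translate:
  assumes k: "k \<in> carrier K" and A: "A \<in> sets m"
  shows "emeasure m {l \<in> carrier K. k \<otimes>\<^bsub>K\<^esub> l \<in> A} = emeasure m A"
proof -
  have c: "continuous_map S S (\<lambda>l. k \<otimes>\<^bsub>K\<^esub> l)"
    using k by (intro K.continuous_map_mult) (auto simp: K.topspace_eq_carrier)
  have "(\<lambda>l. k \<otimes>\<^bsub>K\<^esub> l) \<in> measurable m (borel_of S)"
    using measurable_borel_of[OF c] measurable_cong_sets[OF sets_m] by auto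
  then have "emeasure (distr m (borel_of S) (\<lambda>l. k \<otimes>\<^bsub>K\<^esub> l)) A = emeasure m ((\<lambda>l. k \<otimes>\<^bsub>K\<^esub> l) -` A \<inter> space m)"
    using A sets_m by (intro emeasure_distr) auto
  moreover have "(\<lambda>l. k \<otimes>\<^bsub>K\<^esub> l) -` A \<inter> space m = {l \<in> carrier K. k \<otimes>\<^bsub>K\<^esub> l \<in> A}"
    by (auto simp: space_m')
  ultimately show ?thesis
    using haar k by (simp add: normalized_haar_measure_def)
qed

lemma integral_left_translate:
  fixes g :: "'k \<Rightarrow> complex"
  assumes k: "k \<in> carrier K" and g: "continuous_map S euclidean g"
  shows "(LINT l|m. g (k \<otimes>\<^bsub>K\<^esub> l)) = (LINT l|m. g l)"
proof -
  have c: "continuous_map S S (\<lambda>l. k \<otimes>\<^bsub>K\<^esub> l)"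
    using k by (intro K.continuous_map_mult) (auto simp: K.topspace_eq_carrier)
  have "(LINT l|distr m (borel_of S) (\<lambda>l. k \<otimes>\<^bsub>K\<^esub> l). g l) = (LINT l|m. g (k \<otimes>\<^bsub>K\<^esub> l))"
  proof (rule integral_distr)
    show "(\<lambda>l. k \<otimes>\<^bsub>K\<^esub> l) \<in> measurable m (borel_of S)"
      using measurable_borel_of[OF c] measurable_cong_sets[OF sets_m] by auto
    show "g \<in> borel_measurable (borel_of S)"
      by (rule borel_measurable_continuous_map[OF refl g])
  qed
  then show ?thesis
    using haar k by (simp add: normalized_haar_measure_def)
qed

text \<open>The instance of \<open>integral_exchange\<close> in which the second integration is
  again over \<open>S\<close>: integration over \<open>l\<close> is bounded for the uniform norm on
  the compact space \<open>S\<close>.\<close>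

lemma integral_swap:
  fixes F :: "'k \<Rightarrow> 'k \<Rightarrow> complex"
  assumes F: "continuous_map (prod_topology S S) euclidean (\<lambda>(k, l). F k l)"
  shows "(LINT l|m. (LINT k|m. F k l)) = (LINT k|m. (LINT l|m. F k l))"
proof -
  have F1: "continuous_map S euclidean (F k)" if "k \<in> topspace S" for k
  proof -
    have "continuous_map S (prod_topology S S) (\<lambda>l. (k, l))"
      using that by (intro continuous_map_pairedI) auto
    from continuous_map_compose[OF this F] show ?thesis by (simp add: o_def)
  qed
  show ?thesis
  proof (rule integral_exchange(2)[where J = "topspace S" and V = "{u. integrable m u}" and c = 1
        and L = "\<lambda>u. LINT l|m. u l"])
    fix e :: real and k0 assume "e > 0" "k0 \<in> topspace S"
    then show "\<exists>U. openin S U \<and> k0 \<in> U \<and> (\<forall>k\<in>U. \<forall>i\<in>topspace S. norm (F k i - F k0 i) \<le> e)"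
      using equicontinuous_on_compact[OF F] compact_S unfolding compact_space_def by blast
  next
    fix P and w :: "'k \<Rightarrow> real" assume "finite P" "P \<subseteq> topspace S"
    then have i: "integrable m (F p)" if "p \<in> P" for p using F1 integrable_continuous that by blast
    show "(LINT l|m. (\<Sum>p\<in>P. complex_of_real (w p) * F p l)) = (\<Sum>p\<in>P. complex_of_real (w p) * (LINT l|m. F p l))"
      using i by (subst Bochner_Integration.integral_sum) auto
    show "(\<lambda>i. \<Sum>p\<in>P. complex_of_real (w p) * F p i) \<in> {u. integrable m u}"
      using i by auto
  next
    fix u v :: "'k \<Rightarrow> complex" and e :: real
    assume uv: "u \<in> {u. integrable m u}" "v \<in> {u. integrable m u}" "\<And>i. i \<in> topspace S \<Longrightarrow> norm (u i - v i) \<le> e"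
    have "norm ((LINT l|m. u l) - (LINT l|m. v l)) = norm (LINT l|m. u l - v l)"
      using uv by simp
    also have "\<dots> \<le> (LINT l|m. norm (u l - v l))" by (rule integral_norm_bound)
    also have "\<dots> \<le> (LINT l|m. e)"
      using uv by (intro integral_mono) (auto simp: space_m)
    finally show "norm ((LINT l|m. u l) - (LINT l|m. v l)) \<le> 1 * e" by (simp add: prob_space)
  next
    show "F k \<in> {u. integrable m u}" if "k \<in> topspace S" for k
      using F1[OF that] integrable_continuous by blast
    show "(\<lambda>i. LINT k|m. F k i) \<in> {u. integrable m u}"
      using continuous_average[OF F] integrable_continuous by blast
  qed
qed

text \<open>Compact groups are unimodular. Integrate the function \<open>g\<close> of
  \<open>inv k\<close> times \<open>l\<close> in both orders: integrating over \<open>l\<close>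
  first gives the integral of \<open>g\<close> by left invariance; integrating over \<open>k\<close>
  first, with the argument rewritten as the inverse of \<open>inv l\<close> times \<open>k\<close>,
  gives the integral of \<open>g\<close> composed with inversion.\<close>

lemma integral_inverse:
  fixes g :: "'k \<Rightarrow> complex"
  assumes g: "continuous_map S euclidean g"
  shows "(LINT l|m. g (inv\<^bsub>K\<^esub> l)) = (LINT l|m. g l)"
proof -
  have ginv: "continuous_map S euclidean (\<lambda>k. g (inv\<^bsub>K\<^esub> k))"
    using continuous_map_compose[OF K.continuous_inv g] by (simp add: o_def)
  define F where "F k l = g (inv\<^bsub>K\<^esub> k \<otimes>\<^bsub>K\<^esub> l)" for k l
  have F: "continuous_map (prod_topology S S) euclidean (\<lambda>(k, l). F k l)"
  proof -
    have "continuous_map (prod_topology S S) S (\<lambda>z. inv\<^bsub>K\<^esub> fst z \<otimes>\<^bsub>K\<^esub> snd z)"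
      by (intro K.continuous_map_mult K.continuous_map_inv continuous_map_fst continuous_map_snd)
    from continuous_map_compose[OF this g] show ?thesis by (simp add: o_def F_def case_prod_unfold)
  qed
  have "(LINT l|m. (LINT k|m. F k l)) = (LINT k|m. (LINT l|m. F k l))"
    by (rule integral_swap[OF F])
  moreover have "(LINT k|m. (LINT l|m. F k l)) = (LINT k|m. (LINT l|m. g l))"
    unfolding F_def by (intro Bochner_Integration.integral_cong refl integral_left_translate g) (simp add: space_m')
  moreover have "(LINT l|m. (LINT k|m. F k l)) = (LINT l|m. (LINT k|m. g (inv\<^bsub>K\<^esub> k)))"
  proof (rule Bochner_Integration.integral_cong[OF refl])
    fix l assume l: "l \<in> space m"
    have "(LINT k|m. F k l) = (LINT k|m. g (inv\<^bsub>K\<^esub> (inv\<^bsub>K\<^esub> l \<otimes>\<^bsub>K\<^esub> k)))"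
      unfolding F_def using l
      by (intro Bochner_Integration.integral_cong refl) (simp add: space_m' K.inv_mult_group)
    also have "\<dots> = (LINT k|m. g (inv\<^bsub>K\<^esub> k))"
      using integral_left_translate[OF _ ginv, of "inv\<^bsub>K\<^esub> l"] l by (simp add: space_m')
    finally show "(LINT k|m. F k l) = (LINT k|m. g (inv\<^bsub>K\<^esub> k))" .
  qed
  ultimately show ?thesis by (simp add: prob_space)
qed

text \<open>Inversion turns right translations into left translations and preserves the
  integral.\<close>

lemma integral_right_translate:
  fixes g :: "'k \<Rightarrow> complex"
  assumes h: "h \<in> carrier K" and g: "continuous_map S euclidean g"
  shows "(LINT l|m. g (l \<otimes>\<^bsub>K\<^esub> h)) = (LINT l|m. g l)"
proof -
  have ginv: "continuous_map S euclidean (\<lambda>k. g (inv\<^bsub>K\<^esub> k))"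
    using continuous_map_compose[OF K.continuous_inv g] by (simp add: o_def)
  have "continuous_map S S (\<lambda>l. l \<otimes>\<^bsub>K\<^esub> h)"
    using h by (intro K.continuous_map_mult) (auto simp: K.topspace_eq_carrier)
  from continuous_map_compose[OF this g] have gh: "continuous_map S euclidean (\<lambda>l. g (l \<otimes>\<^bsub>K\<^esub> h))"
    by (simp add: o_def)
  have "(LINT l|m. g (l \<otimes>\<^bsub>K\<^esub> h)) = (LINT l|m. g (inv\<^bsub>K\<^esub> l \<otimes>\<^bsub>K\<^esub> h))"
    using integral_inverse[OF gh] by simp
  also have "\<dots> = (LINT l|m. g (inv\<^bsub>K\<^esub> (inv\<^bsub>K\<^esub> h \<otimes>\<^bsub>K\<^esub> l)))"
    using h by (intro Bochner_Integration.integral_cong refl) (simp add: space_m' K.inv_mult_group)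
  also have "\<dots> = (LINT l|m. g (inv\<^bsub>K\<^esub> l))"
    using integral_left_translate[OF _ ginv, of "inv\<^bsub>K\<^esub> h"] h by simp
  also have "\<dots> = (LINT l|m. g l)" by (rule integral_inverse[OF g])
  finally show ?thesis .
qed

subsection \<open>The hyperproduct of two orbits\<close>

lemma measurable_m: "continuous_map S Y g \<Longrightarrow> g \<in> measurable m (borel_of Y)"
  using measurable_borel_of[of S Y g] measurable_cong_sets[OF sets_m, of "borel_of Y" "borel_of Y"] by auto

lemma continuous_map_phi_left: "x \<in> carrier G \<Longrightarrow> continuous_map S T (\<lambda>k. \<phi> k x)"
  by (intro continuous_map_phi) (auto simp: topspace_eq_carrier)

text \<open>Integrating against a point mass requires the averaged indicator to be Borel measurable
  in the point; this is \<open>borel_measurable_emeasure_section\<close> applied to the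
  action.\<close>

lemma average_measure_return:
  assumes x: "x \<in> carrier G"
  shows "average_measure m T \<phi> (return (borel_of T) x) = distr m (borel_of T) (\<lambda>k. \<phi> k x)"
proof -
  let ?d = "distr m (borel_of T) (\<lambda>k. \<phi> k x)"
  have E: "(\<integral>\<^sup>+y. average m \<phi> (indicator E) y \<partial>return (borel_of T) x) = emeasure ?d E"
    if E: "E \<in> sets (borel_of T)" for E
  proof -
    have av: "average m \<phi> (indicator E) y = emeasure m {k \<in> topspace S. (\<lambda>(y, k). \<phi> k y) (y, k) \<in> E}"
      if y: "y \<in> carrier G" for y
    proof -
      have m: "(\<lambda>k. \<phi> k y) -` E \<inter> space m \<in> sets m"
        using measurable_sets[OF measurable_m[OF continuous_map_phi_left[OF y]] E] .
      have "average m \<phi> (indicator E) y = (\<integral>\<^sup>+k. indicator ((\<lambda>k. \<phi> k y) -` E \<inter> space m) k \<partial>m)"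
        unfolding average_def by (intro nn_integral_cong) (auto simp: indicator_def)
      also have "\<dots> = emeasure m ((\<lambda>k. \<phi> k y) -` E \<inter> space m)" using m by simp
      also have "(\<lambda>k. \<phi> k y) -` E \<inter> space m = {k \<in> topspace S. (\<lambda>(y, k). \<phi> k y) (y, k) \<in> E}"
        by (auto simp: space_m)
      finally show ?thesis .
    qed
    have c: "continuous_map (prod_topology T S) T (\<lambda>(y, k). \<phi> k y)"
      unfolding case_prod_unfold by (intro continuous_map_phi continuous_map_fst continuous_map_snd)
    have "average m \<phi> (indicator E) \<in> borel_measurable (borel_of T) \<longleftrightarrow>
        (\<lambda>y. emeasure m {k \<in> topspace S. (\<lambda>(y, k). \<phi> k y) (y, k) \<in> E}) \<in> borel_measurable (borel_of T)"
      using av by (intro measurable_cong) (simp add: topspace_eq_carrier)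
    then have "average m \<phi> (indicator E) \<in> borel_measurable (borel_of T)"
      using borel_measurable_emeasure_section[OF radon_m c E] by simp
    then have "(\<integral>\<^sup>+y. average m \<phi> (indicator E) y \<partial>return (borel_of T) x) = average m \<phi> (indicator E) x"
      using x by (intro nn_integral_return) (simp_all add: topspace_eq_carrier)
    also have "\<dots> = emeasure ?d E"
      using emeasure_distr[OF measurable_m[OF continuous_map_phi_left[OF x]] E] av[OF x] 
      by (simp add: space_m vimage_def Int_def conj_commute)
    finally show ?thesis .
  qed
  have "average_measure m T \<phi> (return (borel_of T) x) = measure_of (space ?d) (sets ?d) (emeasure ?d)"
    unfolding average_measure_def space_distr sets_distr space_borel_of
  proof (rule measure_of_eq)
    show "sets (borel_of T) \<subseteq> Pow (topspace T)" using sets.space_closed[of "borel_of T"] by simp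
    fix E assume "E \<in> sigma_sets (topspace T) (sets (borel_of T))"
    then have "E \<in> sets (borel_of T)" using sets.sigma_sets_eq[of "borel_of T"] by simp
    from E[OF this] show "(\<integral>\<^sup>+y. average m \<phi> (indicator E) y \<partial>return (borel_of T) x) = emeasure ?d E" .
  qed
  then show ?thesis by (simp only: measure_of_of_measure)
qed

text \<open>\<open>measure_of\<close> yields the zero measure unless its set function is countably
  additive. Additivity of the iterated integral rests on monotone convergence, hence on
  measurability of the inner integral \<open>h E z\<close> in \<open>z\<close>, which semicontinuity
  of sections provides.\<close>

lemma emeasure_convolution:
  assumes x: "x \<in> carrier G" and y: "y \<in> carrier G" and E: "E \<in> sets (borel_of T)"
  shows "emeasure (convolution_measure G T (distr m (borel_of T) (\<lambda>k. \<phi> k x)) (distr m (borel_of T) (\<lambda>k. \<phi> k y))) E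
    = (\<integral>\<^sup>+k. emeasure m {l \<in> topspace S. \<phi> k x \<otimes> \<phi> l y \<in> E} \<partial>m)"
proof -
  let ?x = "distr m (borel_of T) (\<lambda>k. \<phi> k x)" and ?y = "distr m (borel_of T) (\<lambda>k. \<phi> k y)"
  define h where "h E z = emeasure m {l \<in> topspace S. (\<lambda>(z, l). z \<otimes> \<phi> l y) (z, l) \<in> E}" for E z
  have c: "continuous_map (prod_topology T S) T (\<lambda>(z, l). z \<otimes> \<phi> l y)"
    unfolding case_prod_unfold
    using y by (intro continuous_map_mult continuous_map_phi continuous_map_fst continuous_map_snd)
      (auto simp: topspace_eq_carrier)
  have c1: "continuous_map T T (\<lambda>w. z \<otimes> w)" if "z \<in> carrier G" for z
    using that by (intro continuous_map_mult) (auto simp: topspace_eq_carrier)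
  have c2: "continuous_map S T (\<lambda>l. z \<otimes> \<phi> l y)" if "z \<in> carrier G" for z
    using continuous_map_compose[OF continuous_map_phi_left[OF y] c1[OF that]] by (simp add: o_def)
  have hm: "h E \<in> borel_measurable (borel_of T)" if "E \<in> sets (borel_of T)" for E
    unfolding h_def by (rule borel_measurable_emeasure_section[OF radon_m c that])
  have inner: "(\<integral>\<^sup>+w. indicator E (z \<otimes> w) \<partial>?y) = h E z" if z: "z \<in> carrier G" and E: "E \<in> sets (borel_of T)" for z E
  proof -
    have "(\<lambda>w. z \<otimes> w) \<in> measurable (borel_of T) (borel_of T)"
      using c1[OF z] by (rule measurable_borel_of)
    then have "(\<lambda>w. indicator E (z \<otimes> w)) \<in> borel_measurable (borel_of T)"
      using E by measurable
    then have "(\<integral>\<^sup>+w. indicator E (z \<otimes> w) \<partial>?y) = (\<integral>\<^sup>+l. indicator E (z \<otimes> \<phi> l y) \<partial>m)"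
      by (intro nn_integral_distr measurable_m continuous_map_phi_left y) auto
    also have "\<dots> = (\<integral>\<^sup>+l. indicator {l \<in> topspace S. z \<otimes> \<phi> l y \<in> E} l \<partial>m)"
      by (intro nn_integral_cong) (auto simp: indicator_def space_m)
    also have "\<dots> = h E z"
    proof -
      have "(\<lambda>l. z \<otimes> \<phi> l y) -` E \<inter> space m \<in> sets m"
        using measurable_sets[OF measurable_m[OF c2[OF z]] E] .
      moreover have "(\<lambda>l. z \<otimes> \<phi> l y) -` E \<inter> space m = {l \<in> topspace S. z \<otimes> \<phi> l y \<in> E}"
        by (auto simp: space_m)
      ultimately show ?thesis by (simp add: h_def)
    qed
    finally show ?thesis .
  qed
  define \<mu> where "\<mu> E = (\<integral>\<^sup>+z. (\<integral>\<^sup>+w. indicator E (z \<otimes> w) \<partial>?y) \<partial>?x)" for E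
  have mu: "\<mu> E = (\<integral>\<^sup>+z. h E z \<partial>?x)" if "E \<in> sets (borel_of T)" for E
    unfolding \<mu>_def using inner that by (intro nn_integral_cong) (simp add: topspace_eq_carrier)
  let ?M = "convolution_measure G T ?x ?y"
  have M: "?M = measure_of (topspace T) (sets (borel_of T)) \<mu>"
    unfolding convolution_measure_def \<mu>_def ..
  have sub: "sets (borel_of T) \<subseteq> Pow (topspace T)" using sets.space_closed[of "borel_of T"] by simp
  have setsM: "sets ?M = sets (borel_of T)"
    unfolding M using sub sets.sigma_sets_eq[of "borel_of T"] by simp
  have "emeasure ?M E = \<mu> E"
  proof (rule emeasure_measure_of[OF M sub])
    show "positive (sets ?M) \<mu>"
      unfolding positive_def \<mu>_def by simp
    show "countably_additive (sets ?M) \<mu>"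
      unfolding setsM
    proof (rule countably_additiveI)
      fix A :: "nat \<Rightarrow> 'a set"
      assume A: "range A \<subseteq> sets (borel_of T)" "disjoint_family A" "(\<Union>i. A i) \<in> sets (borel_of T)"
      have "(\<Sum>i. \<mu> (A i)) = (\<Sum>i. (\<integral>\<^sup>+z. h (A i) z \<partial>?x))"
        using A by (intro suminf_cong mu) auto
      also have "\<dots> = (\<integral>\<^sup>+z. (\<Sum>i. h (A i) z) \<partial>?x)"
        using hm A by (intro nn_integral_suminf[symmetric]) auto
      also have "\<dots> = (\<integral>\<^sup>+z. h (\<Union>i. A i) z \<partial>?x)"
      proof (rule nn_integral_cong)
        fix z assume "z \<in> space ?x"
        then have z: "z \<in> carrier G" by (simp add: topspace_eq_carrier)
        have s: "{l \<in> topspace S. (\<lambda>(z, l). z \<otimes> \<phi> l y) (z, l) \<in> A i} \<in> sets m" for i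
        proof -
          have "(\<lambda>l. z \<otimes> \<phi> l y) -` A i \<inter> space m \<in> sets m"
            using A(1) by (intro measurable_sets[OF measurable_m[OF c2[OF z]]]) auto
          moreover have "(\<lambda>l. z \<otimes> \<phi> l y) -` A i \<inter> space m = {l \<in> topspace S. z \<otimes> \<phi> l y \<in> A i}"
            by (auto simp: space_m)
          ultimately show ?thesis by simp
        qed
        have "(\<Sum>i. h (A i) z) = emeasure m (\<Union>i. {l \<in> topspace S. (\<lambda>(z, l). z \<otimes> \<phi> l y) (z, l) \<in> A i})"
          unfolding h_def using s A(2) by (intro suminf_emeasure) (auto simp: disjoint_family_on_def)
        also have "(\<Union>i. {l \<in> topspace S. (\<lambda>(z, l). z \<otimes> \<phi> l y) (z, l) \<in> A i})
            = {l \<in> topspace S. (\<lambda>(z, l). z \<otimes> \<phi> l y) (z, l) \<in> (\<Union>i. A i)}" by auto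
        finally show "(\<Sum>i. h (A i) z) = h (\<Union>i. A i) z" by (simp add: h_def)
      qed
      also have "\<dots> = \<mu> (\<Union>i. A i)" using mu[OF A(3)] by simp
      finally show "(\<Sum>i. \<mu> (A i)) = \<mu> (\<Union>i. A i)" .
    qed
    show "E \<in> sets ?M" using E setsM by simp
  qed
  also have "\<mu> E = (\<integral>\<^sup>+k. h E (\<phi> k x) \<partial>m)"
    unfolding mu[OF E] by (intro nn_integral_distr measurable_m continuous_map_phi_left x) (use hm[OF E] in auto)
  finally show ?thesis by (simp add: h_def)
qed

lemma htop_orbit_hypergroup: "htop (orbit_hypergroup K m G T \<phi>) = orbit_topology K T \<phi>"
  by (simp add: orbit_hypergroup_def Let_def)

lemma topspace_orbit_hypergroup: "topspace (htop (orbit_hypergroup K m G T \<phi>)) = orbit K \<phi> ` carrier G"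
  by (simp add: htop_orbit_hypergroup topspace_eq_carrier orbits_carrier)

lemma hone_orbit_hypergroup: "hone (orbit_hypergroup K m G T \<phi>) = {\<one>}"
  by (simp add: orbit_hypergroup_def Let_def)

lemma hinv_orbit_hypergroup:
  assumes "x \<in> carrier G"
  shows "hinv (orbit_hypergroup K m G T \<phi>) (orbit K \<phi> x) = orbit K \<phi> (inv x)"
proof -
  let ?r = "rep (orbit K \<phi> x)"
  have "?r \<in> orbit K \<phi> x" using rep_props[of "orbit K \<phi> x"] assms by auto
  then obtain k where k: "k \<in> carrier K" "?r = \<phi> k x" by (auto simp: orbit_alt)
  have "hinv (orbit_hypergroup K m G T \<phi>) (orbit K \<phi> x) = orbit K \<phi> (inv ?r)"
    by (simp add: orbit_hypergroup_def Let_def rep_def)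
  also have "\<dots> = orbit K \<phi> (inv x)" using k assms by (simp add: phi_inverse[symmetric])
  finally show ?thesis .
qed

lemma continuous_map_orbit_product:
  assumes "x \<in> carrier G" "y \<in> carrier G"
  shows "continuous_map S (orbit_topology K T \<phi>) (\<lambda>l. orbit K \<phi> (x \<otimes> \<phi> l y))"
proof -
  have "continuous_map S T (\<lambda>l. x \<otimes> \<phi> l y)"
    using assms by (intro continuous_map_mult continuous_map_phi) (auto simp: topspace_eq_carrier)
  from continuous_map_compose[OF this continuous_map_orbit] show ?thesis by (simp add: o_def)
qed

text \<open>One of the two averages is absorbed: \<open>\<phi> k x \<otimes> \<phi> l y\<close> has
  the same orbit as \<open>x \<otimes> \<phi> l' y\<close> with \<open>l'\<close> the product of
  \<open>inv k\<close> and \<open>l\<close>. Left invariance of \<open>m\<close> removes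
  \<open>k\<close> from the inner measure, and the outer integral is then over a constant.\<close>

lemma hprod_orbit_hypergroup:
  assumes A: "A \<in> orbit K \<phi> ` carrier G" and B: "B \<in> orbit K \<phi> ` carrier G"
  shows "hprod (orbit_hypergroup K m G T \<phi>) A B =
    distr m (borel_of (orbit_topology K T \<phi>)) (\<lambda>l. orbit K \<phi> (rep A \<otimes> \<phi> l (rep B)))"
proof -
  let ?O = "orbit_topology K T \<phi>"
  let ?x = "rep A" and ?y = "rep B"
  have x: "?x \<in> carrier G" and y: "?y \<in> carrier G" using rep_props A B by auto
  let ?M = "convolution_measure G T (distr m (borel_of T) (\<lambda>k. \<phi> k ?x)) (distr m (borel_of T) (\<lambda>k. \<phi> k ?y))"
  have sub: "sets (borel_of T) \<subseteq> Pow (topspace T)" using sets.space_closed[of "borel_of T"] by simp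
  have setsM: "sets ?M = sets (borel_of T)"
    unfolding convolution_measure_def using sub sets.sigma_sets_eq[of "borel_of T"] by simp
  have om: "orbit K \<phi> \<in> measurable ?M (borel_of ?O)"
    using measurable_borel_of[OF continuous_map_orbit] measurable_cong_sets[OF setsM] by auto
  have "hprod (orbit_hypergroup K m G T \<phi>) A B = distr ?M (borel_of ?O) (orbit K \<phi>)"
    using x y by (simp add: orbit_hypergroup_def Let_def rep_def[symmetric] average_measure_return)
  also have "\<dots> = distr m (borel_of ?O) (\<lambda>l. orbit K \<phi> (?x \<otimes> \<phi> l ?y))"
  proof (rule measure_eqI)
    fix E assume "E \<in> sets (distr ?M (borel_of ?O) (orbit K \<phi>))"
    then have E: "E \<in> sets (borel_of ?O)" by simp
    let ?E = "orbit K \<phi> -` E \<inter> space ?M"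
    have E': "?E \<in> sets (borel_of T)" using measurable_sets[OF om E] setsM by simp
    have spM: "space ?M = carrier G" using sets_eq_imp_space_eq[OF setsM] by (simp add: topspace_eq_carrier)
    let ?B = "{l \<in> carrier K. orbit K \<phi> (?x \<otimes> \<phi> l ?y) \<in> E}"
    have cm: "(\<lambda>l. orbit K \<phi> (?x \<otimes> \<phi> l ?y)) \<in> measurable m (borel_of ?O)"
      by (intro measurable_m continuous_map_orbit_product x y)
    have Beq: "(\<lambda>l. orbit K \<phi> (?x \<otimes> \<phi> l ?y)) -` E \<inter> space m = ?B" by (auto simp: space_m')
    have Bm: "?B \<in> sets m" using measurable_sets[OF cm E] Beq by simp
    have "emeasure (distr ?M (borel_of ?O) (orbit K \<phi>)) E = emeasure ?M ?E"
      by (rule emeasure_distr[OF om E])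
    also have "\<dots> = (\<integral>\<^sup>+k. emeasure m {l \<in> topspace S. \<phi> k ?x \<otimes> \<phi> l ?y \<in> ?E} \<partial>m)"
      by (rule emeasure_convolution[OF x y E'])
    also have "\<dots> = (\<integral>\<^sup>+k. emeasure m ?B \<partial>m)"
    proof (rule nn_integral_cong)
      fix k assume "k \<in> space m"
      then have k: "k \<in> carrier K" by (simp add: space_m')
      have "orbit K \<phi> (\<phi> k ?x \<otimes> \<phi> l ?y) = orbit K \<phi> (?x \<otimes> \<phi> (inv\<^bsub>K\<^esub> k \<otimes>\<^bsub>K\<^esub> l) ?y)" if l: "l \<in> carrier K" for l
      proof -
        have "\<phi> k (?x \<otimes> \<phi> (inv\<^bsub>K\<^esub> k \<otimes>\<^bsub>K\<^esub> l) ?y) = \<phi> k ?x \<otimes> \<phi> l ?y"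
          using k l x y by (simp add: phi_mult phi_comp)
        then show ?thesis using orbit_phi[of k "?x \<otimes> \<phi> (inv\<^bsub>K\<^esub> k \<otimes>\<^bsub>K\<^esub> l) ?y"] k l x y by simp
      qed
      then have "{l \<in> topspace S. \<phi> k ?x \<otimes> \<phi> l ?y \<in> ?E} = {l \<in> carrier K. inv\<^bsub>K\<^esub> k \<otimes>\<^bsub>K\<^esub> l \<in> ?B}"
        using k x y by (auto simp: spM K.topspace_eq_carrier)
      then show "emeasure m {l \<in> topspace S. \<phi> k ?x \<otimes> \<phi> l ?y \<in> ?E} = emeasure m ?B"
        using emeasure_left_translate[OF _ Bm, of "inv\<^bsub>K\<^esub> k"] k by simp
    qed
    also have "\<dots> = emeasure m ?B" by (simp add: emeasure_space_1)
    also have "\<dots> = emeasure (distr m (borel_of ?O) (\<lambda>l. orbit K \<phi> (?x \<otimes> \<phi> l ?y))) E"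
      using emeasure_distr[OF cm E] Beq by simp
    finally show "emeasure (distr ?M (borel_of ?O) (orbit K \<phi>)) E =
        emeasure (distr m (borel_of ?O) (\<lambda>l. orbit K \<phi> (?x \<otimes> \<phi> l ?y))) E" .
  qed simp
  finally show ?thesis .
qed

end

lemma compact_Pi_UNIV:
  fixes B :: "'i \<Rightarrow> 'b::topological_space set"
  assumes "\<And>i. compact (B i)"
  shows "compact {f. \<forall>i. f i \<in> B i}"
proof -
  have "compactin (product_topology (\<lambda>i. euclidean) UNIV) (PiE UNIV B)"
    using assms by (simp add: compactin_PiE)
  moreover have "PiE UNIV B = {f. \<forall>i. f i \<in> B i}" by (auto simp: PiE_def)
  ultimately show ?thesis by (simp add: euclidean_product_topology)
qed

lemma continuous_on_coordinate [continuous_intros]: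
  "continuous_on A (\<lambda>h :: 'i \<Rightarrow> 'b::topological_space. h x)"
  using continuous_on_product_coordinates[of x] continuous_on_subset by blast

section \<open>An invariant functional on a locally compact abelian group\<close>

context group
begin

definition bounded_fun :: "('a \<Rightarrow> complex) \<Rightarrow> bool" where
  "bounded_fun u \<longleftrightarrow> (\<exists>b. \<forall>x\<in>carrier G. norm (u x) \<le> b)"

lemma bounded_fun_add: "bounded_fun u \<Longrightarrow> bounded_fun v \<Longrightarrow> bounded_fun (\<lambda>x. u x + v x)"
  unfolding bounded_fun_def by (meson add_mono norm_triangle_le)

lemma bounded_fun_scale: "bounded_fun u \<Longrightarrow> bounded_fun (\<lambda>x. c * u x)"
  unfolding bounded_fun_def norm_mult by (meson mult_left_mono norm_ge_zero)

lemma bounded_fun_translate: "bounded_fun u \<Longrightarrow> y \<in> carrier G \<Longrightarrow> bounded_fun (\<lambda>x. u (y \<otimes> x))"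
  unfolding bounded_fun_def by (meson m_closed)

lemma bounded_fun_const: "bounded_fun (\<lambda>x. c)"
  unfolding bounded_fun_def by blast

lemma bounded_fun_sum:
  assumes "finite J" "\<And>j. j \<in> J \<Longrightarrow> bounded_fun (u j)"
  shows "bounded_fun (\<lambda>x. \<Sum>j\<in>J. u j x)"
  using assms by (induction J rule: finite_induct) (auto simp: bounded_fun_const intro: bounded_fun_add)

text \<open>Means on all bounded functions, with no measurability involved. Values on unbounded
  functions are pinned to 0 so that the set can be compact in the full function space. The
  domination clause combines positivity with the bound by the uniform norm for complex-valued
  functions.\<close>

definition means :: "(('a \<Rightarrow> complex) \<Rightarrow> complex) set" where
  "means = {M. (\<forall>u. \<not> bounded_fun u \<longrightarrow> M u = 0) \<and>
     (\<forall>u v. bounded_fun u \<and> bounded_fun v \<longrightarrow> M (\<lambda>x. u x + v x) = M u + M v) \<and>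
     (\<forall>u c. bounded_fun u \<longrightarrow> M (\<lambda>x. c * u x) = c * M u) \<and>
     (\<forall>u v. bounded_fun u \<and> bounded_fun v \<and> (\<forall>x\<in>carrier G. norm (u x) \<le> Re (v x)) \<longrightarrow>
        norm (M u) \<le> Re (M v)) \<and>
     M (\<lambda>x. 1) = 1}"

lemma means_scale: "M \<in> means \<Longrightarrow> bounded_fun u \<Longrightarrow> M (\<lambda>x. c * u x) = c * M u"
  by (simp add: means_def)

lemma bounded_fun_diff: "bounded_fun u \<Longrightarrow> bounded_fun v \<Longrightarrow> bounded_fun (\<lambda>x. u x - v x)"
  using bounded_fun_add[of u "\<lambda>x. (-1) * v x"] bounded_fun_scale[of v "-1"] by simp

lemma means_add:
  "M \<in> means \<Longrightarrow> bounded_fun u \<Longrightarrow> bounded_fun v \<Longrightarrow> M (\<lambda>x. u x + v x) = M u + M v"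
  by (simp add: means_def)

lemma means_diff:
  assumes "M \<in> means" "bounded_fun u" "bounded_fun v"
  shows "M (\<lambda>x. u x - v x) = M u - M v"
  using means_add[OF assms(1,2) bounded_fun_scale[OF assms(3), of "-1"]] means_scale[OF assms(1,3), of "-1"]
  by simp

lemma means_mono:
  "M \<in> means \<Longrightarrow> bounded_fun u \<Longrightarrow> bounded_fun v \<Longrightarrow> (\<And>x. x \<in> carrier G \<Longrightarrow> norm (u x) \<le> Re (v x)) \<Longrightarrow>
    norm (M u) \<le> Re (M v)"
  by (simp add: means_def)

lemma means_bound:
  assumes M: "M \<in> means" and u: "\<And>x. x \<in> carrier G \<Longrightarrow> norm (u x) \<le> b"
  shows "norm (M u) \<le> b"
proof -
  have bu: "bounded_fun u" using u by (auto simp: bounded_fun_def)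
  have "norm (M u) \<le> Re (M (\<lambda>x. complex_of_real b * 1))"
    using M u bu bounded_fun_const[of "complex_of_real b * 1"] by (simp add: means_def)
  also have "M (\<lambda>x. complex_of_real b * 1) = complex_of_real b * 1"
    using means_scale[OF M bounded_fun_const[of 1], of "complex_of_real b"] M by (simp add: means_def)
  finally show ?thesis by simp
qed

text \<open>Banach-Alaoglu by way of Tychonoff: \<open>M u\<close> is confined to a ball of radius
  \<open>r u\<close>, or to \<open>{0}\<close> for unbounded \<open>u\<close>, and every clause of
  \<open>means\<close> is a closed condition on finitely many values of \<open>M\<close>.\<close>

lemma compact_means: "compact means"
proof -
  define r where "r u = (SOME b. \<forall>x\<in>carrier G. norm (u x) \<le> b)" for u :: "'a \<Rightarrow> complex"
  define R where "R u = (if bounded_fun u then cball 0 (r u) else {0 :: complex})" for u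
  have r: "norm (u x) \<le> r u" if "bounded_fun u" "x \<in> carrier G" for u x
    using someI_ex[of "\<lambda>b. \<forall>x\<in>carrier G. norm (u x) \<le> b"] that
    by (auto simp: r_def bounded_fun_def)
  have "means \<subseteq> {M. \<forall>u. M u \<in> R u}"
  proof
    fix M assume M: "M \<in> means"
    have "M u \<in> R u" for u
      using means_bound[OF M, of u "r u"] r[of u] M by (auto simp: R_def means_def)
    then show "M \<in> {M. \<forall>u. M u \<in> R u}" by simp
  qed
  moreover have "compact {M. \<forall>u. M u \<in> R u}"
    by (rule compact_Pi_UNIV) (simp add: R_def)
  moreover have "closed means"
    unfolding means_def
    by (intro closed_Collect_conj closed_Collect_all closed_Collect_imp open_Collect_const
        closed_Collect_eq closed_Collect_le continuous_intros)
  ultimately have "compact ({M. \<forall>u. M u \<in> R u} \<inter> means)" and "{M. \<forall>u. M u \<in> R u} \<inter> means = means"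
    by (auto intro: compact_Int_closed)
  then show ?thesis by simp
qed

end

context comm_group
begin

text \<open>The averaging step of the Markov-Kakutani theorem: composing a mean with the average
  over the first \<open>N\<close> powers of a new element makes it almost invariant under that
  element. As \<open>G\<close> is commutative, the almost invariance obtained for the earlier
  elements is not disturbed.\<close>

lemma almost_invariant_mean:
  assumes "finite Y" "Y \<subseteq> carrier G" "N > (0::nat)"
  shows "\<exists>M\<in>means. \<forall>y\<in>Y. \<forall>u b. (\<forall>x\<in>carrier G. norm (u x) \<le> b) \<longrightarrow>
    norm (M (\<lambda>x. u (y \<otimes> x)) - M u) \<le> 2 * b / N"
  using assms
proof (induction Y rule: finite_induct)
  case empty
  \<comment> \<open>Evaluation at the unit, cut off to 0 on unbounded functions as
    \<open>means\<close> demands.\<close>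
  let ?M = "\<lambda>u. if bounded_fun u then u \<one> else (0::complex)"
  have "?M \<in> means"
    unfolding means_def
    by (auto simp: bounded_fun_add bounded_fun_scale bounded_fun_const)
  then show ?case by blast
next
  case (insert y Y)
  then have y: "y \<in> carrier G" and Y: "Y \<subseteq> carrier G" by auto
  obtain M where M: "M \<in> means" and inv': "\<forall>z\<in>Y. \<forall>u b. (\<forall>x\<in>carrier G. norm (u x) \<le> b) \<longrightarrow>
    norm (M (\<lambda>x. u (z \<otimes> x)) - M u) \<le> 2 * b / N"
    using insert.IH[OF Y insert.prems(2)] by (elim bexE)
  have inv: "norm (M (\<lambda>x. u (z \<otimes> x)) - M u) \<le> 2 * b / N"
    if "z \<in> Y" "\<And>x. x \<in> carrier G \<Longrightarrow> norm (u x) \<le> b" for z u b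
    using inv' that by simp
  define P where "P u x = inverse (of_nat N) * (\<Sum>i<N. u (y [^] i \<otimes> x))" for u :: "'a \<Rightarrow> complex" and x
  define M' where "M' u = (if bounded_fun u then M (P u) else 0)" for u
  have Pb: "norm (P u x) \<le> b" if "\<And>x. x \<in> carrier G \<Longrightarrow> norm (u x) \<le> b" "x \<in> carrier G" for u b x
  proof -
    have "norm (\<Sum>i<N. u (y [^] i \<otimes> x)) \<le> (\<Sum>i<N. b)"
      using that y by (intro sum_norm_le) auto
    then have "norm (P u x) \<le> inverse (real N) * (real N * b)"
      unfolding P_def norm_mult by (intro mult_mono) (auto simp: norm_inverse)
    moreover have "inverse (real N) * (real N * b) = b" using insert.prems by (simp add: field_simps)
    ultimately show ?thesis by simp
  qed
  have Pbdd: "bounded_fun (P u)" if "bounded_fun u" for u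
    using that unfolding bounded_fun_def by (elim exE) (rule exI, intro ballI Pb, auto)
  have Padd: "P (\<lambda>x. u x + v x) = (\<lambda>x. P u x + P v x)" for u v
    by (simp add: P_def sum.distrib algebra_simps fun_eq_iff)
  have Pscale: "P (\<lambda>x. c * u x) = (\<lambda>x. c * P u x)" for c u
    by (simp add: P_def sum_distrib_left algebra_simps fun_eq_iff)
  have P1: "P (\<lambda>x. 1) = (\<lambda>x. 1)"
    using insert.prems by (simp add: P_def fun_eq_iff)
  have Pmono: "norm (P u x) \<le> Re (P v x)" if "\<forall>x\<in>carrier G. norm (u x) \<le> Re (v x)" "x \<in> carrier G" for u v x
  proof -
    have "norm (\<Sum>i<N. u (y [^] i \<otimes> x)) \<le> (\<Sum>i<N. Re (v (y [^] i \<otimes> x)))"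
      using that y by (intro sum_norm_le) auto
    then have "inverse (real N) * norm (\<Sum>i<N. u (y [^] i \<otimes> x)) \<le> inverse (real N) * (\<Sum>i<N. Re (v (y [^] i \<otimes> x)))"
      by (intro mult_left_mono) auto
    moreover have "Re (P v x) = inverse (real N) * (\<Sum>i<N. Re (v (y [^] i \<otimes> x)))"
    proof -
      have "P v x = complex_of_real (inverse (real N)) * (\<Sum>i<N. v (y [^] i \<otimes> x))"
        by (simp add: P_def)
      moreover have "Re (complex_of_real r * s) = r * Re s" for r s by simp
      ultimately show ?thesis by (simp only: Re_sum)
    qed
    ultimately show ?thesis by (simp add: P_def norm_mult norm_inverse)
  qed
  have M'm: "M' \<in> means"
    using M Pbdd Pmono
    by (simp add: means_def M'_def bounded_fun_add bounded_fun_scale bounded_fun_const Padd Pscale P1)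
  have "norm (M' (\<lambda>x. u (z \<otimes> x)) - M' u) \<le> 2 * b / N"
    if z: "z \<in> insert y Y" and u: "\<forall>x\<in>carrier G. norm (u x) \<le> b" for z b and u :: "'a \<Rightarrow> complex"
  proof -
    have bu: "bounded_fun u" using u by (auto simp: bounded_fun_def)
    have zc: "z \<in> carrier G" using z y Y by auto
    have buz: "bounded_fun (\<lambda>x. u (z \<otimes> x))" by (rule bounded_fun_translate[OF bu zc])
    show ?thesis
    proof (cases "z = y")
      case False
      then have zY: "z \<in> Y" using z by simp
      \<comment> \<open>Translation by \<open>z\<close> commutes with the powers of
        \<open>y\<close>, so the error bound of \<open>M\<close> at \<open>z\<close> carries over to
        \<open>P u\<close>, which has the same uniform bound as \<open>u\<close>.\<close>
      have eq: "P (\<lambda>x. u (z \<otimes> x)) x = P u (z \<otimes> x)" if x: "x \<in> carrier G" for x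
        unfolding P_def using x zc y by (simp add: m_lcomm)
      have "M (P (\<lambda>x. u (z \<otimes> x))) = M (\<lambda>x. P u (z \<otimes> x))"
      proof -
        have b1: "bounded_fun (P (\<lambda>x. u (z \<otimes> x)))" by (rule Pbdd[OF buz])
        have b2: "bounded_fun (\<lambda>x. P u (z \<otimes> x))"
          by (intro bounded_fun_translate Pbdd bu zc)
        have "norm (M (\<lambda>x. P (\<lambda>x. u (z \<otimes> x)) x - P u (z \<otimes> x))) \<le> 0"
          using eq by (intro means_bound[OF M]) simp
        then show ?thesis unfolding means_diff[OF M b1 b2] by simp
      qed
      then show ?thesis
        using inv[OF zY, of "P u" b] Pb[of u b] u bu buz by (simp add: M'_def)
    next
      case True
      have b1: "bounded_fun (P (\<lambda>x. u (z \<otimes> x)))" by (rule Pbdd[OF buz])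
      have b2: "bounded_fun (P u)" by (rule Pbdd[OF bu])
      \<comment> \<open>For \<open>y\<close> itself the difference of the two averages telescopes:
        only the exponents \<open>N\<close> and 0 remain, each contributing at most
        \<open>b\<close>, divided by \<open>N\<close>.\<close>
      have "norm (M (\<lambda>x. P (\<lambda>x. u (z \<otimes> x)) x - P u x)) \<le> 2 * b / N"
      proof (rule means_bound[OF M])
        fix x assume x: "x \<in> carrier G"
        have "y [^] i \<otimes> (y \<otimes> x) = y [^] Suc i \<otimes> x" for i
          using x y by (simp add: m_assoc)
        then have "P (\<lambda>x. u (z \<otimes> x)) x = inverse (of_nat N) * (\<Sum>i<N. u (y [^] Suc i \<otimes> x))"
          unfolding P_def True using x y by (simp add: m_lcomm)
        then have "P (\<lambda>x. u (z \<otimes> x)) x - P u x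
            = inverse (of_nat N) * (\<Sum>i<N. u (y [^] Suc i \<otimes> x) - u (y [^] i \<otimes> x))"
          by (simp only: P_def sum_subtractf right_diff_distrib)
        also have "\<dots> = inverse (of_nat N) * (u (y [^] N \<otimes> x) - u (y [^] (0::nat) \<otimes> x))"
          by (subst sum_lessThan_telescope) (rule refl)
        finally have eq: "norm (P (\<lambda>x. u (z \<otimes> x)) x - P u x) =
            inverse (real N) * norm (u (y [^] N \<otimes> x) - u (y [^] (0::nat) \<otimes> x))"
          by (simp add: norm_mult norm_inverse)
        have "norm (u (y [^] N \<otimes> x) - u (y [^] (0::nat) \<otimes> x)) \<le> b + b"
          using u x y by (intro order_trans[OF norm_triangle_ineq4] add_mono) auto
        then have "inverse (real N) * norm (u (y [^] N \<otimes> x) - u (y [^] (0::nat) \<otimes> x)) \<le> inverse (real N) * (2 * b)"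
          by (intro mult_left_mono) auto
        then show "norm (P (\<lambda>x. u (z \<otimes> x)) x - P u x) \<le> 2 * b / N"
          unfolding eq by (simp only: divide_inverse mult.commute)
      qed
      then show ?thesis using bu buz means_diff[OF M b1 b2] by (simp add: M'_def)
    qed
  qed
  then show ?case by (intro bexI[OF _ M'm]) simp
qed

lemma invariant_mean:
  obtains M where "M \<in> means"
    "\<And>y u. y \<in> carrier G \<Longrightarrow> bounded_fun u \<Longrightarrow> M (\<lambda>x. u (y \<otimes> x)) = M u"
proof -
  define C where "C = (\<lambda>(y, n). {M :: ('a \<Rightarrow> complex) \<Rightarrow> complex. \<forall>u b. (\<forall>x\<in>carrier G. norm (u x) \<le> b) \<longrightarrow>
    norm (M (\<lambda>x. u (y \<otimes> x)) - M u) \<le> 2 * b / real (Suc n)})"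
  have "means \<inter> (\<Inter>i\<in>carrier G \<times> UNIV. C i) \<noteq> {}"
  proof (rule compact_imp_fip_image[OF compact_means])
    fix i assume "i \<in> carrier G \<times> (UNIV :: nat set)"
    show "closed (C i)"
      unfolding C_def case_prod_unfold
      by (intro closed_Collect_all closed_Collect_imp open_Collect_const closed_Collect_le continuous_intros)
  next
    fix J assume J: "finite J" "J \<subseteq> carrier G \<times> (UNIV :: nat set)"
    \<comment> \<open>A single \<open>N\<close> at least as large as \<open>Suc n\<close> for every
      index \<open>n\<close> occurring in \<open>J\<close>, so that one almost invariant mean meets
      all the finitely many conditions.\<close>
    define N where "N = Suc (\<Sum>i\<in>J. snd i)"
    have "finite (fst ` J)" "fst ` J \<subseteq> carrier G" "N > 0" using J by (auto simp: N_def)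
    from almost_invariant_mean[OF this] obtain M where M1: "M \<in> means" and
      M2: "\<forall>y\<in>fst ` J. \<forall>u b. (\<forall>x\<in>carrier G. norm (u x) \<le> b) \<longrightarrow> norm (M (\<lambda>x. u (y \<otimes> x)) - M u) \<le> 2 * b / N"
      by (elim bexE)
    have "M \<in> C i" if i: "i \<in> J" for i
    proof -
      have "snd i \<le> (\<Sum>i\<in>J. snd i)" using i J(1) by (intro member_le_sum) auto
      then have "Suc (snd i) \<le> N" by (simp add: N_def)
      then have le: "real (Suc (snd i)) \<le> real N" by (simp only: of_nat_le_iff)
      have "norm (M (\<lambda>x. u (fst i \<otimes> x)) - M u) \<le> 2 * b / real (Suc (snd i))"
        if u: "\<forall>x\<in>carrier G. norm (u x) \<le> b" for u b
      proof -
        have "0 \<le> b" using u one_closed norm_ge_zero order_trans by blast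
        then have "2 * b / N \<le> 2 * b / real (Suc (snd i))"
          using le by (intro divide_left_mono) auto
        moreover have "norm (M (\<lambda>x. u (fst i \<otimes> x)) - M u) \<le> 2 * b / N"
          using M2 u i by simp
        ultimately show ?thesis by linarith
      qed
      then show ?thesis by (simp add: C_def case_prod_unfold)
    qed
    then show "means \<inter> (\<Inter>i\<in>J. C i) \<noteq> {}" using M1 by auto
  qed
  then obtain M where M: "M \<in> means" "\<And>i. i \<in> carrier G \<times> UNIV \<Longrightarrow> M \<in> C i" by blast
  have "M (\<lambda>x. u (y \<otimes> x)) = M u" if y: "y \<in> carrier G" and u: "bounded_fun u" for y u
  proof -
    obtain b where b: "\<forall>x\<in>carrier G. norm (u x) \<le> b" using u by (auto simp: bounded_fun_def)
    have n: "norm (M (\<lambda>x. u (y \<otimes> x)) - M u) \<le> 2 * b / real (Suc n)" for n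
      using M(2)[of "(y, n)"] y b by (simp add: C_def)
    have "(\<lambda>n. 2 * b / real (Suc n)) \<longlonglongrightarrow> 0"
      using LIMSEQ_Suc[OF lim_const_over_n[of "2 * b"]] by simp
    then have "norm (M (\<lambda>x. u (y \<otimes> x)) - M u) \<le> 0"
      using n by (intro LIMSEQ_le_const[where X = "\<lambda>n. 2 * b / real (Suc n)"]) auto
    then show ?thesis by simp
  qed
  then show thesis using that M(1) by blast
qed

end

section \<open>Compact supports, separated sets and the construction of the functional\<close>

context topological_group
begin

definition compactly_supported :: "('a \<Rightarrow> complex) \<Rightarrow> bool" where
  "compactly_supported u \<longleftrightarrow> bounded_fun u \<and> (\<exists>C. compactin T C \<and> (\<forall>x\<in>carrier G - C. u x = 0))"

end

text \<open>The functional is a finitely additive substitute for integration against Haar measure. It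
  is defined on all bounded functions of compact support, without any continuity, so that
  indicator functions of compact sets are allowed.\<close>

locale invariant_functional = lca_group G T
  for G :: "('a, 'b) monoid_scheme" (structure) and T :: "'a topology" +
  fixes I :: "('a \<Rightarrow> complex) \<Rightarrow> complex"
  assumes I_add: "compactly_supported u \<Longrightarrow> compactly_supported v \<Longrightarrow> I (\<lambda>x. u x + v x) = I u + I v"
    and I_scale: "compactly_supported u \<Longrightarrow> I (\<lambda>x. c * u x) = c * I u"
    and I_mono: "compactly_supported u \<Longrightarrow> compactly_supported v \<Longrightarrow>
      (\<And>x. x \<in> carrier G \<Longrightarrow> norm (u x) \<le> Re (v x)) \<Longrightarrow> norm (I u) \<le> Re (I v)"
    and I_translate: "compactly_supported u \<Longrightarrow> y \<in> carrier G \<Longrightarrow> I (\<lambda>x. u (y \<otimes> x)) = I u"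

context group
begin

lemma inv_mult_cancel_left:
  assumes "w \<in> carrier G" "a \<in> carrier G" "b \<in> carrier G"
  shows "inv (w \<otimes> a) \<otimes> (w \<otimes> b) = inv a \<otimes> b"
proof -
  have 1: "inv w \<otimes> (w \<otimes> b) = b" using assms by (simp add: m_assoc[symmetric])
  have "inv (w \<otimes> a) \<otimes> (w \<otimes> b) = inv a \<otimes> (inv w \<otimes> (w \<otimes> b))"
    using assms by (simp add: inv_mult_group m_assoc)
  then show ?thesis by (simp only: 1)
qed

text \<open>Zorn's lemma. If no \<open>inv a \<otimes> x\<close> lay in \<open>D\<close>, then
  \<open>x\<close> could be added to \<open>A\<close>: symmetry of \<open>D\<close> excludes
  \<open>inv x \<otimes> a\<close> as well, and \<open>\<one> \<in> D\<close> shows that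
  \<open>x\<close> was not already in \<open>A\<close>. The set is thin enough for sums over it to
  be finite on compact sets and dense enough for such sums not to vanish.\<close>

lemma maximal_separated_set:
  assumes D: "\<one> \<in> D" "\<And>x. x \<in> D \<Longrightarrow> inv x \<in> D" "D \<subseteq> carrier G"
  obtains A where "A \<subseteq> carrier G" "\<And>a b. a \<in> A \<Longrightarrow> b \<in> A \<Longrightarrow> a \<noteq> b \<Longrightarrow> inv a \<otimes> b \<notin> D"
    "\<And>x. x \<in> carrier G \<Longrightarrow> \<exists>a\<in>A. inv a \<otimes> x \<in> D"
proof -
  define \<A> where "\<A> = {A. A \<subseteq> carrier G \<and> (\<forall>a\<in>A. \<forall>b\<in>A. a \<noteq> b \<longrightarrow> inv a \<otimes> b \<notin> D)}"
  have "\<exists>A\<in>\<A>. \<forall>B\<in>\<A>. A \<subseteq> B \<longrightarrow> B = A"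
  proof (rule subset_Zorn')
    fix \<C> assume c: "subset.chain \<A> \<C>"
    show "\<Union>\<C> \<in> \<A>"
      unfolding \<A>_def
    proof (intro CollectI conjI ballI impI)
      show "\<Union>\<C> \<subseteq> carrier G" using c by (auto simp: subset.chain_def \<A>_def)
      fix a b assume "a \<in> \<Union>\<C>" "b \<in> \<Union>\<C>" and ne: "a \<noteq> b"
      then obtain X Y where XY: "X \<in> \<C>" "a \<in> X" "Y \<in> \<C>" "b \<in> Y" by blast
      then have "X \<subseteq> Y \<or> Y \<subseteq> X" using c by (auto simp: subset.chain_def)
      then obtain Z where "Z \<in> \<C>" "a \<in> Z" "b \<in> Z" using XY by blast
      then show "inv a \<otimes> b \<notin> D" using c ne by (auto simp: subset.chain_def \<A>_def)
    qed
  qed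
  then obtain A where A: "A \<in> \<A>" "\<And>B. B \<in> \<A> \<Longrightarrow> A \<subseteq> B \<Longrightarrow> B = A" by blast
  have A1: "A \<subseteq> carrier G" "\<And>a b. a \<in> A \<Longrightarrow> b \<in> A \<Longrightarrow> a \<noteq> b \<Longrightarrow> inv a \<otimes> b \<notin> D"
    using A(1) by (auto simp: \<A>_def)
  have "\<exists>a\<in>A. inv a \<otimes> x \<in> D" if x: "x \<in> carrier G" for x
  proof (rule ccontr)
    assume n: "\<not> (\<exists>a\<in>A. inv a \<otimes> x \<in> D)"
    have n': "inv x \<otimes> a \<notin> D" if "a \<in> A" for a
    proof
      assume "inv x \<otimes> a \<in> D"
      then have "inv (inv x \<otimes> a) \<in> D" by (rule D(2))
      then have "inv a \<otimes> x \<in> D" using that A1(1) x by (auto simp: inv_mult_group)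
      then show False using n that by blast
    qed
    have "insert x A \<in> \<A>" using A1 x n n' by (auto simp: \<A>_def)
    then have "x \<in> A" using A(2) by blast
    then show False using n x D(1) by force
  qed
  then show thesis using that A1 by blast
qed

end

context topological_group
begin

lemma open_nbhd_division:
  assumes "openin T W" "\<one> \<in> W"
  obtains U where "openin T U" "\<one> \<in> U" "\<And>x y. x \<in> U \<Longrightarrow> y \<in> U \<Longrightarrow> inv x \<otimes> y \<in> W"
proof -
  have c: "continuous_map (prod_topology T T) T (\<lambda>z. inv fst z \<otimes> snd z)"
    using continuous_map_compose[OF continuous_map_pairedI[OF continuous_map_compose[OF continuous_map_fst continuous_inv]
        continuous_map_snd] continuous_mult] by (simp add: o_def)
  have "openin (prod_topology T T) {z \<in> topspace (prod_topology T T). inv fst z \<otimes> snd z \<in> W}"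
    (is "openin _ ?W") by (rule openin_continuous_map_preimage[OF c assms(1)])
  moreover have "(\<one>, \<one>) \<in> ?W" using assms(2) by (simp add: topspace_eq_carrier)
  ultimately obtain A B where AB: "openin T A" "openin T B" "\<one> \<in> A" "\<one> \<in> B" "A \<times> B \<subseteq> ?W"
    unfolding openin_prod_topology_alt by meson
  show thesis
  proof (rule that[of "A \<inter> B"])
    show "inv x \<otimes> y \<in> W" if "x \<in> A \<inter> B" "y \<in> A \<inter> B" for x y
    proof -
      have "(x, y) \<in> ?W" using AB that by blast
      then show ?thesis by simp
    qed
  qed (use AB in auto)
qed

lemma openin_translate:
  assumes "openin T U" "x \<in> carrier G"
  shows "openin T {z \<in> carrier G. x \<otimes> z \<in> U}"
proof -
  have "continuous_map T T (\<lambda>z. x \<otimes> z)"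
    using continuous_map_compose[OF continuous_map_pairedI[of T T "\<lambda>_. x" T "\<lambda>z. z"] continuous_mult] assms(2)
    by (simp add: o_def topspace_eq_carrier)
  from openin_continuous_map_preimage[OF this assms(1)] show ?thesis by (simp add: topspace_eq_carrier)
qed

lemma compactin_translate_cover:
  assumes C: "compactin T C" and U: "openin T U" "\<one> \<in> U"
  obtains X where "finite X" "X \<subseteq> carrier G" "\<And>x. x \<in> C \<Longrightarrow> \<exists>s\<in>X. inv s \<otimes> x \<in> U"
proof -
  have Cc: "C \<subseteq> carrier G" using compactin_subset_topspace[OF C] topspace_eq_carrier by simp
  define V where "V s = {z \<in> carrier G. inv s \<otimes> z \<in> U}" for s
  have "openin T (V s)" if "s \<in> C" for s
    unfolding V_def using openin_translate[OF U(1), of "inv s"] that Cc by auto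
  moreover have "s \<in> V s" if "s \<in> C" for s using that Cc U(2) by (auto simp: V_def)
  ultimately obtain \<F> where F: "finite \<F>" "\<F> \<subseteq> V ` C" "C \<subseteq> \<Union>\<F>"
    using compactinD[OF C, of "V ` C"] by blast
  then obtain X where X: "finite X" "X \<subseteq> C" "\<F> = V ` X" by (meson finite_subset_image)
  show thesis
  proof (rule that[of X])
    show "\<exists>s\<in>X. inv s \<otimes> x \<in> U" if "x \<in> C" for x
      using that F(3) X(3) by (auto simp: V_def)
  qed (use X Cc in auto)
qed

lemma compactly_supported_add:
  assumes "compactly_supported u" "compactly_supported v"
  shows "compactly_supported (\<lambda>x. u x + v x)"
proof -
  obtain C D where CD: "compactin T C" "\<forall>x\<in>carrier G - C. u x = 0" "compactin T D" "\<forall>x\<in>carrier G - D. v x = 0"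
    using assms by (auto simp: compactly_supported_def)
  then have "compactin T (C \<union> D)" "\<forall>x\<in>carrier G - (C \<union> D). u x + v x = 0" by (auto intro: compactin_Un)
  then show ?thesis using assms unfolding compactly_supported_def by (metis bounded_fun_add)
qed

lemma compactly_supported_mult:
  assumes "compactly_supported u" "bounded_fun v"
  shows "compactly_supported (\<lambda>x. v x * u x)"
proof -
  obtain b c where "\<forall>x\<in>carrier G. norm (u x) \<le> b" "\<forall>x\<in>carrier G. norm (v x) \<le> c"
    using assms by (auto simp: compactly_supported_def bounded_fun_def)
  then have "\<forall>x\<in>carrier G. norm (v x * u x) \<le> c * b"
    unfolding norm_mult by (meson mult_mono norm_ge_zero order_trans)
  then have "bounded_fun (\<lambda>x. v x * u x)" by (auto simp: bounded_fun_def)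
  then show ?thesis using assms(1) by (fastforce simp: compactly_supported_def)
qed

lemma compactly_supported_scale: "compactly_supported u \<Longrightarrow> compactly_supported (\<lambda>x. c * u x)"
  using compactly_supported_mult[OF _ bounded_fun_const[of c]] .

lemma compactly_supported_translate:
  assumes "compactly_supported u" and y: "y \<in> carrier G"
  shows "compactly_supported (\<lambda>x. u (y \<otimes> x))"
proof -
  obtain C where C: "compactin T C" "\<forall>x\<in>carrier G - C. u x = 0"
    using assms by (auto simp: compactly_supported_def)
  have "continuous_map T T (\<lambda>z. inv y \<otimes> z)"
    using continuous_map_compose[OF continuous_map_pairedI[of T T "\<lambda>_. inv y" T "\<lambda>z. z"] continuous_mult] y
    by (simp add: o_def topspace_eq_carrier)
  then have "compactin T ((\<lambda>z. inv y \<otimes> z) ` C)" using C(1) by (simp add: image_compactin)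
  moreover have "u (y \<otimes> x) = 0" if x: "x \<in> carrier G - (\<lambda>z. inv y \<otimes> z) ` C" for x
  proof -
    have "x = inv y \<otimes> (y \<otimes> x)" using x y by (simp add: m_assoc[symmetric])
    then have "y \<otimes> x \<notin> C" using x by blast
    then show ?thesis using C(2) x y by auto
  qed
  ultimately show ?thesis
    using assms bounded_fun_translate unfolding compactly_supported_def by blast
qed

lemma compactly_supported_indicator:
  assumes "compactin T C"
  shows "compactly_supported (indicator C)"
  using assms unfolding compactly_supported_def bounded_fun_def
  by (intro conjI exI[of _ 1] exI[of _ C]) (auto simp: indicator_def)

end

text \<open>A substitute for Haar integration: sum \<open>u\<close> over the translate by
  \<open>x\<close> of a maximal separated set \<open>A\<close>, which gives a bounded function of
  \<open>x\<close>, and apply an invariant mean. Translating \<open>u\<close> translates this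
  function, so invariance is that of the mean. Maximality makes each translate of \<open>A\<close>
  meet \<open>W\<close>, whence the lower bound 1.\<close>

lemma (in lca_group) exists_invariant_functional:
  assumes U: "openin T U" "\<one> \<in> U" "U \<subseteq> W" and W: "compactin T W"
  obtains I where "invariant_functional G T I" "Re (I (indicator W)) \<ge> 1"
proof -
  obtain U' where U': "openin T U'" "\<one> \<in> U'" "\<And>x y. x \<in> U' \<Longrightarrow> y \<in> U' \<Longrightarrow> inv x \<otimes> y \<in> U"
    by (rule open_nbhd_division[OF U(1,2)]) (rule that)
  have U'c: "U' \<subseteq> carrier G" using openin_subset[OF U'(1)] topspace_eq_carrier by simp
  \<comment> \<open>\<open>D\<close> is symmetric, contains the unit and lies in \<open>U\<close>.
    Two points in a common translate of \<open>U'\<close> have their quotient in \<open>D\<close>,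
    which is what the counting below uses.\<close>
  define D where "D = {inv x \<otimes> y |x y. x \<in> U' \<and> y \<in> U'}"
  have "inv x \<otimes> y \<in> carrier G" if "x \<in> U'" "y \<in> U'" for x y using that U'c by auto
  then have D2: "D \<subseteq> carrier G" unfolding D_def by blast
  have D0: "\<one> \<in> D" using U'(2) by (force simp: D_def)
  have D1: "inv z \<in> D" if z: "z \<in> D" for z
  proof -
    obtain x y where xy: "x \<in> U'" "y \<in> U'" "z = inv x \<otimes> y" using z by (auto simp: D_def)
    then have "x \<in> carrier G" "y \<in> carrier G" using U'c by auto
    then have "inv z = inv y \<otimes> x" using xy(3) by (simp add: inv_mult_group)
    then show ?thesis using xy by (auto simp: D_def)
  qed
  obtain A where A: "A \<subseteq> carrier G" "\<And>a b. a \<in> A \<Longrightarrow> b \<in> A \<Longrightarrow> a \<noteq> b \<Longrightarrow> inv a \<otimes> b \<notin> D"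
    "\<And>x. x \<in> carrier G \<Longrightarrow> \<exists>a\<in>A. inv a \<otimes> x \<in> D"
    by (rule maximal_separated_set[OF D0 D1 D2]) (assumption, rule that)
  obtain M where M: "M \<in> means" "\<And>y u. y \<in> carrier G \<Longrightarrow> bounded_fun u \<Longrightarrow> M (\<lambda>x. u (y \<otimes> x)) = M u"
    by (rule invariant_mean) (rule that)
  \<comment> \<open>Keeping only the nonzero terms makes the index set finite for compactly
    supported \<open>u\<close>, even though \<open>A\<close> may be infinite.\<close>
  define \<sigma> where "\<sigma> u x = (\<Sum>a\<in>{a\<in>A. u (x \<otimes> a) \<noteq> 0}. u (x \<otimes> a))" for u :: "'a \<Rightarrow> complex" and x
  define I where "I u = M (\<sigma> u)" for u
  have count: "\<exists>N. \<forall>x\<in>carrier G. finite {a\<in>A. x \<otimes> a \<in> C} \<and> card {a\<in>A. x \<otimes> a \<in> C} \<le> N"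
    if C: "compactin T C" for C
  proof -
    obtain X where X: "finite X" "X \<subseteq> carrier G" "\<And>x. x \<in> C \<Longrightarrow> \<exists>s\<in>X. inv s \<otimes> x \<in> U'"
      using compactin_translate_cover[OF C U'(1,2)] by blast
    have "finite {a\<in>A. x \<otimes> a \<in> C} \<and> card {a\<in>A. x \<otimes> a \<in> C} \<le> card X" if x: "x \<in> carrier G" for x
    proof -
      let ?Y = "{a\<in>A. x \<otimes> a \<in> C}"
      define s where "s a = (SOME s. s \<in> X \<and> inv s \<otimes> (x \<otimes> a) \<in> U')" for a
      have s: "s a \<in> X \<and> inv (s a) \<otimes> (x \<otimes> a) \<in> U'" if a: "a \<in> ?Y" for a
      proof -
        have "\<exists>s. s \<in> X \<and> inv s \<otimes> (x \<otimes> a) \<in> U'" using X(3)[of "x \<otimes> a"] a by blast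
        then show ?thesis unfolding s_def by (rule someI_ex)
      qed
      \<comment> \<open>Two points \<open>a\<close>, \<open>b\<close> assigned to the same translate
        of \<open>U'\<close> would have \<open>inv a \<otimes> b\<close> in \<open>D\<close>,
        against separation. So \<open>C\<close> receives at most as many points as translates of
        \<open>U'\<close> cover it, independently of \<open>x\<close>.\<close>
      have "inj_on s ?Y"
      proof (rule inj_onI, rule ccontr)
        fix a b assume ab: "a \<in> ?Y" "b \<in> ?Y" "s a = s b" "a \<noteq> b"
        have c: "a \<in> carrier G" "b \<in> carrier G" "s a \<in> carrier G" using ab A(1) X(2) s[of a] by auto
        have "inv (inv (s a) \<otimes> (x \<otimes> a)) \<otimes> (inv (s a) \<otimes> (x \<otimes> b)) = inv a \<otimes> b"
          using inv_mult_cancel_left[of "inv (s a) \<otimes> x" a b] c x by (simp add: m_assoc)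
        moreover have "inv (inv (s a) \<otimes> (x \<otimes> a)) \<otimes> (inv (s a) \<otimes> (x \<otimes> b)) \<in> D"
          using s[OF ab(1)] s[OF ab(2)] ab(3) by (auto simp: D_def)
        ultimately show False using A(2) ab by auto
      qed
      moreover have "s ` ?Y \<subseteq> X" using s by blast
      ultimately show ?thesis using X(1) by (meson card_inj_on_le finite_imageD finite_subset)
    qed
    then show ?thesis by blast
  qed
  have fin: "finite {a\<in>A. u (x \<otimes> a) \<noteq> 0}" if u: "compactly_supported u" and x: "x \<in> carrier G" for u x
  proof -
    obtain C where C: "compactin T C" "\<forall>x\<in>carrier G - C. u x = 0" using u by (auto simp: compactly_supported_def)
    have "{a\<in>A. u (x \<otimes> a) \<noteq> 0} \<subseteq> {a\<in>A. x \<otimes> a \<in> C}" using C(2) A(1) x by blast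
    then show ?thesis using count[OF C(1)] x finite_subset by blast
  qed
  have \<sigma>_eq: "\<sigma> u x = (\<Sum>a\<in>Y. u (x \<otimes> a))" if "finite Y" "{a\<in>A. u (x \<otimes> a) \<noteq> 0} \<subseteq> Y" "Y \<subseteq> A" for u x Y
    unfolding \<sigma>_def using that by (intro sum.mono_neutral_left) auto
  have \<sigma>_bdd: "bounded_fun (\<sigma> u)" if u: "compactly_supported u" for u
  proof -
    obtain C where C: "compactin T C" "\<forall>x\<in>carrier G - C. u x = 0" using u by (auto simp: compactly_supported_def)
    obtain b where b: "\<forall>x\<in>carrier G. norm (u x) \<le> b" using u by (auto simp: compactly_supported_def bounded_fun_def)
    obtain N where N: "\<And>x. x \<in> carrier G \<Longrightarrow> finite {a\<in>A. x \<otimes> a \<in> C}" "\<And>x. x \<in> carrier G \<Longrightarrow> card {a\<in>A. x \<otimes> a \<in> C} \<le> N"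
      using count[OF C(1)] by blast
    have "0 \<le> b" using b one_closed norm_ge_zero order_trans by blast
    have "norm (\<sigma> u x) \<le> N * b" if x: "x \<in> carrier G" for x
    proof -
      have "{a\<in>A. u (x \<otimes> a) \<noteq> 0} \<subseteq> {a\<in>A. x \<otimes> a \<in> C}" using C(2) A(1) x by blast
      then have "\<sigma> u x = (\<Sum>a\<in>{a\<in>A. x \<otimes> a \<in> C}. u (x \<otimes> a))"
        using N(1)[OF x] by (intro \<sigma>_eq) auto
      also have "norm \<dots> \<le> (\<Sum>a\<in>{a\<in>A. x \<otimes> a \<in> C}. b)"
        using b x A(1) by (intro sum_norm_le) auto
      also have "\<dots> \<le> N * b" using N(2)[OF x] \<open>0 \<le> b\<close> by (simp add: mult_right_mono)
      finally show ?thesis .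
    qed
    then show ?thesis by (auto simp: bounded_fun_def)
  qed
  have M_cong: "M u = M v" if "bounded_fun u" "bounded_fun v" "\<And>x. x \<in> carrier G \<Longrightarrow> u x = v x" for u v
  proof -
    have "norm (M (\<lambda>x. u x - v x)) \<le> 0"
      using that by (intro means_bound[OF M(1)]) simp
    then show ?thesis unfolding means_diff[OF M(1) that(1,2)] by simp
  qed
  have "invariant_functional G T I"
  proof
    fix u v assume uv: "compactly_supported u" "compactly_supported v"
    have "\<sigma> (\<lambda>x. u x + v x) x = \<sigma> u x + \<sigma> v x" if x: "x \<in> carrier G" for x
    proof -
      let ?Y = "{a\<in>A. u (x \<otimes> a) \<noteq> 0} \<union> {a\<in>A. v (x \<otimes> a) \<noteq> 0}"
      have f: "finite ?Y" using fin uv x by simp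
      have "\<sigma> (\<lambda>x. u x + v x) x = (\<Sum>a\<in>?Y. u (x \<otimes> a) + v (x \<otimes> a))"
        using f by (intro \<sigma>_eq) auto
      also have "\<dots> = (\<Sum>a\<in>?Y. u (x \<otimes> a)) + (\<Sum>a\<in>?Y. v (x \<otimes> a))" by (rule sum.distrib)
      also have "(\<Sum>a\<in>?Y. u (x \<otimes> a)) = \<sigma> u x" using f by (intro \<sigma>_eq[symmetric]) auto
      also have "(\<Sum>a\<in>?Y. v (x \<otimes> a)) = \<sigma> v x" using f by (intro \<sigma>_eq[symmetric]) auto
      finally show ?thesis .
    qed
    then have "I (\<lambda>x. u x + v x) = M (\<lambda>x. \<sigma> u x + \<sigma> v x)"
      unfolding I_def using uv by (intro M_cong \<sigma>_bdd compactly_supported_add bounded_fun_add) auto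
    then show "I (\<lambda>x. u x + v x) = I u + I v"
      using means_add[OF M(1) \<sigma>_bdd \<sigma>_bdd, OF uv] by (simp add: I_def)
  next
    fix u c assume u: "compactly_supported u"
    have "\<sigma> (\<lambda>x. c * u x) x = c * \<sigma> u x" if x: "x \<in> carrier G" for x
    proof -
      let ?Y = "{a\<in>A. u (x \<otimes> a) \<noteq> 0}"
      have "\<sigma> (\<lambda>x. c * u x) x = (\<Sum>a\<in>?Y. c * u (x \<otimes> a))"
        using fin[OF u x] by (intro \<sigma>_eq) auto
      then show ?thesis by (simp add: sum_distrib_left \<sigma>_def)
    qed
    then have "I (\<lambda>x. c * u x) = M (\<lambda>x. c * \<sigma> u x)"
      unfolding I_def using u by (intro M_cong \<sigma>_bdd compactly_supported_scale bounded_fun_scale) auto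
    then show "I (\<lambda>x. c * u x) = c * I u"
      using means_scale[OF M(1) \<sigma>_bdd[OF u]] by (simp add: I_def)
  next
    fix u v assume uv: "compactly_supported u" "compactly_supported v" and le: "\<And>x. x \<in> carrier G \<Longrightarrow> norm (u x) \<le> Re (v x)"
    show "norm (I u) \<le> Re (I v)"
      unfolding I_def
    proof (intro means_mono[OF M(1)] \<sigma>_bdd uv)
      fix x assume x: "x \<in> carrier G"
      let ?Y = "{a\<in>A. v (x \<otimes> a) \<noteq> 0}"
      have sub: "{a\<in>A. u (x \<otimes> a) \<noteq> 0} \<subseteq> ?Y"
      proof (intro subsetI CollectI conjI; elim CollectE conjE)
        fix a assume a: "a \<in> A" "u (x \<otimes> a) \<noteq> 0"
        then have "norm (u (x \<otimes> a)) \<le> Re (v (x \<otimes> a))" using le A(1) x by auto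
        then show "v (x \<otimes> a) \<noteq> 0" using a(2) by auto
      qed
      have "\<sigma> u x = (\<Sum>a\<in>?Y. u (x \<otimes> a))" using fin[OF uv(2) x] sub by (intro \<sigma>_eq) auto
      also have "norm \<dots> \<le> (\<Sum>a\<in>?Y. Re (v (x \<otimes> a)))" using le A(1) x by (intro sum_norm_le) auto
      also have "\<dots> = Re (\<sigma> v x)" by (simp add: \<sigma>_def)
      finally show "norm (\<sigma> u x) \<le> Re (\<sigma> v x)" .
    qed
  next
    fix u y assume u: "compactly_supported u" and y: "y \<in> carrier G"
    have "y \<otimes> (x \<otimes> a) = (y \<otimes> x) \<otimes> a" if "x \<in> carrier G" "a \<in> A" for x a
      using that y A(1) by (auto simp: m_assoc)
    then have "\<sigma> (\<lambda>x. u (y \<otimes> x)) x = \<sigma> u (y \<otimes> x)" if "x \<in> carrier G" for x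
      unfolding \<sigma>_def using that by (intro sum.cong) auto
    then have "I (\<lambda>x. u (y \<otimes> x)) = M (\<lambda>x. \<sigma> u (y \<otimes> x))"
      unfolding I_def using u y by (intro M_cong \<sigma>_bdd compactly_supported_translate bounded_fun_translate) auto
    then show "I (\<lambda>x. u (y \<otimes> x)) = I u" using M(2)[OF y \<sigma>_bdd[OF u]] by (simp add: I_def)
  qed
  moreover have "Re (I (indicator W)) \<ge> 1"
  proof -
    have cW: "compactly_supported (indicator W)" by (rule compactly_supported_indicator[OF W])
    have "norm (M (\<lambda>x. 1)) \<le> Re (I (indicator W))"
      unfolding I_def
    proof (intro means_mono[OF M(1)] \<sigma>_bdd cW bounded_fun_const)
      fix x assume x: "x \<in> carrier G"
      \<comment> \<open>Maximality is applied to \<open>inv x\<close>: the inverse of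
        \<open>inv a \<otimes> inv x\<close> is \<open>x \<otimes> a\<close>, which lies in
        \<open>D\<close> by symmetry and hence in \<open>W\<close>.\<close>
      obtain a where a: "a \<in> A" "inv a \<otimes> inv x \<in> D" using A(3)[of "inv x"] x by auto
      have "inv (inv a \<otimes> inv x) = x \<otimes> a" using a A(1) x by (auto simp: inv_mult_group)
      then have "x \<otimes> a \<in> D" using D1[OF a(2)] by simp
      then have "x \<otimes> a \<in> W" using U'(3) U(3) by (auto simp: D_def)
      then have "a \<in> {a\<in>A. (indicator W (x \<otimes> a) :: complex) \<noteq> 0}" using a(1) by simp
      then have "1 \<le> (\<Sum>a\<in>{a\<in>A. (indicator W (x \<otimes> a) :: complex) \<noteq> 0}. indicat_real W (x \<otimes> a))"
        using fin[OF cW x] member_le_sum[of a "{a\<in>A. (indicator W (x \<otimes> a) :: complex) \<noteq> 0}" "\<lambda>a. indicat_real W (x \<otimes> a)"] \<open>x \<otimes> a \<in> W\<close>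
        by auto
      also have "\<dots> = Re (\<sigma> (indicator W) x)"
        unfolding \<sigma>_def Re_sum by (intro sum.cong refl) (auto simp: indicator_def)
      finally show "norm (1::complex) \<le> Re (\<sigma> (indicator W) x)" by simp
    qed
    moreover have "M (\<lambda>x. 1) = 1" using M(1) by (simp add: means_def)
    ultimately show ?thesis by simp
  qed
  ultimately show thesis by (rule that)
qed

section \<open>Extreme points and separation of compact sets\<close>

text \<open>The existence half of Krein-Milman. A minimal closed face exists by compactness and
  Zorn's lemma. The maximizers of a continuous real affine function on a face form a smaller closed
  face, so such functions are constant on a minimal one; the real and imaginary parts of the
  coordinates then leave just one point.\<close>

lemma exists_extreme_point:
  fixes Q :: "('i \<Rightarrow> complex) set"
  assumes Q: "compact Q" "Q \<noteq> {}"
  obtains g where "g \<in> Q"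
    "\<And>p q t. p \<in> Q \<Longrightarrow> q \<in> Q \<Longrightarrow> 0 < t \<Longrightarrow> t < 1 \<Longrightarrow>
      (\<And>i. g i = complex_of_real t * p i + complex_of_real (1 - t) * q i) \<Longrightarrow> p = g"
proof -
  define comb where "comb g p q t \<longleftrightarrow> 0 < t \<and> t < 1 \<and>
    (\<forall>i. g i = complex_of_real t * p i + complex_of_real (1 - t) * q i)"
    for g p q :: "'i \<Rightarrow> complex" and t :: real
  define face where "face F \<longleftrightarrow> F \<noteq> {} \<and> (\<exists>Z. closed Z \<and> F = Q \<inter> Z) \<and>
    (\<forall>g\<in>F. \<forall>p\<in>Q. \<forall>q\<in>Q. \<forall>t. comb g p q t \<longrightarrow> p \<in> F \<and> q \<in> F)" for F
  \<comment> \<open>Faces are represented by their complements in \<open>Q\<close>, so that the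
    maximal element delivered by Zorn's lemma is a minimal face.\<close>
  define \<A> where "\<A> = {A. A \<subseteq> Q \<and> face (Q - A)}"
  have faceQ: "face Q"
    unfolding face_def using Q(2) by (auto intro!: exI[of _ UNIV])
  have "\<exists>A\<in>\<A>. \<forall>B\<in>\<A>. A \<subseteq> B \<longrightarrow> B = A"
  proof (rule subset_Zorn')
    fix \<C> assume c: "subset.chain \<A> \<C>"
    have cA: "A \<in> \<A>" if "A \<in> \<C>" for A using c that by (auto simp: subset.chain_def)
    have cc: "A \<subseteq> B \<or> B \<subseteq> A" if "A \<in> \<C>" "B \<in> \<C>" for A B using c that by (auto simp: subset.chain_def)
    define Z where "Z A = (SOME Z. closed Z \<and> Q - A = Q \<inter> Z)" for A
    have Z: "closed (Z A) \<and> Q - A = Q \<inter> Z A" if "A \<in> \<C>" for A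
    proof -
      have "\<exists>Z. closed Z \<and> Q - A = Q \<inter> Z" using cA[OF that] by (simp add: \<A>_def face_def)
      then show ?thesis unfolding Z_def by (rule someI_ex)
    qed
    \<comment> \<open>A finite part of the chain has a largest member, whose complement is a
      nonempty face inside all the others; compactness passes to the whole chain.\<close>
    have ne: "Q \<inter> (\<Inter>A\<in>\<C>. Z A) \<noteq> {}"
    proof (rule compact_imp_fip_image[OF Q(1)])
      show "closed (Z A)" if "A \<in> \<C>" for A using Z[OF that] by simp
      fix J assume J: "finite J" "J \<subseteq> \<C>"
      show "Q \<inter> (\<Inter>A\<in>J. Z A) \<noteq> {}"
      proof (cases "J = {}")
        case False
        then obtain A where A: "A \<in> J" "\<And>B. B \<in> J \<Longrightarrow> A \<subseteq> B \<Longrightarrow> A = B"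
          using finite_has_maximal[OF J(1)] by auto
        have "B \<subseteq> A" if "B \<in> J" for B using cc[of A B] A that J(2) by auto
        then have "Q - A \<subseteq> Q \<inter> Z B" if "B \<in> J" for B using Z[of B] that J(2) by auto
        then have "Q - A \<subseteq> Q \<inter> (\<Inter>A\<in>J. Z A)" using False by auto
        moreover have "Q - A \<noteq> {}" using cA[of A] A(1) J(2) by (auto simp: \<A>_def face_def)
        ultimately show ?thesis by auto
      qed (use Q(2) in simp)
    qed
    have eq: "Q - \<Union>\<C> = Q \<inter> (\<Inter>A\<in>\<C>. Z A)"
    proof (intro equalityI subsetI)
      fix g assume g: "g \<in> Q - \<Union>\<C>"
      then have "g \<in> Z A" if "A \<in> \<C>" for A using Z[OF that] that by blast
      then show "g \<in> Q \<inter> (\<Inter>A\<in>\<C>. Z A)" using g by simp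
    next
      fix g assume g: "g \<in> Q \<inter> (\<Inter>A\<in>\<C>. Z A)"
      then have "g \<notin> A" if "A \<in> \<C>" for A using Z[OF that] that by blast
      then show "g \<in> Q - \<Union>\<C>" using g by simp
    qed
    have "face (Q - \<Union>\<C>)"
      unfolding face_def
    proof (intro conjI ballI allI impI)
      show "Q - \<Union>\<C> \<noteq> {}" using ne eq by simp
      have "closed (\<Inter>A\<in>\<C>. Z A)" using Z by (intro closed_INT) simp
      then show "\<exists>Z. closed Z \<and> Q - \<Union>\<C> = Q \<inter> Z" using eq by auto
      fix g p q t assume gpq: "g \<in> Q - \<Union>\<C>" "p \<in> Q" "q \<in> Q" "comb g p q t"
      have "p \<in> Q - A \<and> q \<in> Q - A" if A: "A \<in> \<C>" for A
      proof -
        have "face (Q - A)" using cA[OF A] by (simp add: \<A>_def)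
        moreover have "g \<in> Q - A" using gpq(1) A by blast
        ultimately show ?thesis using gpq unfolding face_def by blast
      qed
      then show "p \<in> Q - \<Union>\<C>" "q \<in> Q - \<Union>\<C>" using gpq by auto
    qed
    moreover have "\<Union>\<C> \<subseteq> Q" using cA by (auto simp: \<A>_def)
    ultimately show "\<Union>\<C> \<in> \<A>" by (simp add: \<A>_def)
  qed
  then obtain A where A: "A \<in> \<A>" "\<And>B. B \<in> \<A> \<Longrightarrow> A \<subseteq> B \<Longrightarrow> B = A" by blast
  define F where "F = Q - A"
  have F: "face F" and AQ: "A \<subseteq> Q" using A(1) by (simp_all add: \<A>_def F_def)
  obtain Z where Z: "closed Z" "F = Q \<inter> Z" using F by (auto simp: face_def)
  have Fc: "compact F" unfolding Z(2) by (rule compact_Int_closed[OF Q(1) Z(1)])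
  have Fext: "p \<in> F \<and> q \<in> F" if "g \<in> F" "p \<in> Q" "q \<in> Q" "comb g p q t" for g p q t
  proof -
    have "\<forall>g\<in>F. \<forall>p\<in>Q. \<forall>q\<in>Q. \<forall>t. comb g p q t \<longrightarrow> p \<in> F \<and> q \<in> F"
      using F unfolding face_def by (elim conjE)
    then show ?thesis using that by fast
  qed
  \<comment> \<open>At a maximizer of \<open>L\<close> that is a proper convex combination, both
    ends must be maximizers too. The face of maximizers therefore equals \<open>F\<close> by
    minimality.\<close>
  have const: "L g = L h"
    if L: "continuous_on UNIV L" "\<And>g p q t. comb g p q t \<Longrightarrow> L g = t * L p + (1 - t) * L q"
      and gh: "g \<in> F" "h \<in> F" for L :: "('i \<Rightarrow> complex) \<Rightarrow> real" and g h
  proof -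
    have "F \<noteq> {}" using gh by auto
    then obtain g0 where g0: "g0 \<in> F" "\<And>g. g \<in> F \<Longrightarrow> L g \<le> L g0"
      using continuous_attains_sup[OF Fc, of L] continuous_on_subset[OF L(1)] by auto
    define F' where "F' = {g \<in> F. L g = L g0}"
    have "face F'"
      unfolding face_def
    proof (intro conjI ballI allI impI)
      show "F' \<noteq> {}" using g0(1) by (auto simp: F'_def)
      have "closed (Z \<inter> {g. L g = L g0})"
        using Z(1) L(1) by (intro closed_Int closed_Collect_eq continuous_on_const)
      then show "\<exists>Z. closed Z \<and> F' = Q \<inter> Z" using Z(2) by (intro exI[of _ "Z \<inter> {g. L g = L g0}"]) (auto simp: F'_def)
      fix g p q t assume gpq: "g \<in> F'" "p \<in> Q" "q \<in> Q" "comb g p q t"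
      have pq: "p \<in> F" "q \<in> F" using Fext[OF _ gpq(2-4)] gpq(1) by (auto simp: F'_def)
      have t: "0 < t" "t < 1" using gpq(4) by (auto simp: comb_def)
      have e: "L g0 = t * L p + (1 - t) * L q" using L(2)[OF gpq(4)] gpq(1) by (simp add: F'_def)
      have le: "t * L p \<le> t * L g0" "(1 - t) * L q \<le> (1 - t) * L g0"
        using g0(2)[OF pq(1)] g0(2)[OF pq(2)] t by (auto intro: mult_left_mono)
      moreover have "t * L g0 + (1 - t) * L g0 = L g0" by (simp add: algebra_simps)
      ultimately have "t * L p = t * L g0" "(1 - t) * L q = (1 - t) * L g0" using e by linarith+
      then show "p \<in> F'" "q \<in> F'" using t pq by (auto simp: F'_def)
    qed
    moreover have sub: "F' \<subseteq> Q" "Q - (Q - F') = F'" using Z(2) by (auto simp: F'_def)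
    ultimately have "Q - F' \<in> \<A>" by (simp add: \<A>_def)
    moreover have "A \<subseteq> Q - F'" using AQ by (auto simp: F'_def F_def)
    ultimately have "Q - F' = A" by (rule A(2))
    then have "F = F'" using sub by (auto simp: F_def)
    then have "g \<in> F'" "h \<in> F'" using gh by simp_all
    then show ?thesis by (simp add: F'_def)
  qed
  have single: "g = h" if gh: "g \<in> F" "h \<in> F" for g h
  proof
    fix i
    have "Re (g i) = Re (h i)"
      by (rule const[OF _ _ gh]) (auto intro!: continuous_intros simp: comb_def)
    moreover have "Im (g i) = Im (h i)"
      by (rule const[OF _ _ gh]) (auto intro!: continuous_intros simp: comb_def)
    ultimately show "g i = h i" by (simp add: complex_eq_iff)
  qed
  have "F \<noteq> {}" using F unfolding face_def by (elim conjE)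
  then obtain g where g: "g \<in> F" by blast
  show thesis
  proof (rule that[of g])
    show "g \<in> Q" using g Z(2) by blast
    fix p q t assume "p \<in> Q" "q \<in> Q" "0 < t" "t < 1"
      "\<And>i. g i = complex_of_real t * p i + complex_of_real (1 - t) * q i"
    then have "p \<in> F" using Fext[OF g, of p q t] by (simp add: comb_def)
    then show "p = g" using single g by blast
  qed
qed

text \<open>The function space itself has no Hausdorff instance in the library, which the
  Stone-Weierstrass theorem requires.\<close>

typedef 'i point = "UNIV :: ('i \<Rightarrow> complex) set" morphisms coord Point by simp

instantiation point :: (type) t2_space
begin

definition open_point :: "'a point set \<Rightarrow> bool" where
  "open_point U \<longleftrightarrow> open (coord ` U)"

instance
proof
  have bij: "bij (coord :: 'a point \<Rightarrow> _)"
    by (rule bijI) (auto simp: inj_def coord_inject Point_inverse intro!: surjI[of _ Point])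
  show "open (UNIV :: 'a point set)"
    using bij by (simp add: open_point_def bij_is_surj)
  show "open (U \<inter> V)" if "open U" "open V" for U V :: "'a point set"
    using that bij by (simp add: open_point_def image_Int bij_is_inj open_Int)
  show "open (\<Union>\<U>)" if "\<forall>U\<in>\<U>. open U" for \<U> :: "'a point set set"
    using that by (auto simp: open_point_def image_Union)
  fix p q :: "'a point" assume "p \<noteq> q"
  then have "coord p \<noteq> coord q" by (simp add: coord_inject)
  then obtain x where ne: "coord p x \<noteq> coord q x" by auto
  from hausdorff[OF ne] obtain U V
    where UV: "open U" "open V" "coord p x \<in> U" "coord q x \<in> V" "U \<inter> V = {}"
    by (elim exE conjE) (rule that)
  have im: "coord ` {p. coord p x \<in> W} = (\<lambda>h. h x) -` W" for W :: "complex set"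
  proof (intro equalityI subsetI)
    fix h :: "'a \<Rightarrow> complex" assume "h \<in> (\<lambda>h. h x) -` W"
    then show "h \<in> coord ` {p. coord p x \<in> W}"
      by (intro image_eqI[of h coord "Point h"]) (auto simp: Point_inverse)
  qed auto
  have "open ((\<lambda>h :: 'a \<Rightarrow> complex. h x) -` W)" if "open W" for W
    using that by (intro open_vimage) auto
  then show "\<exists>U V. open U \<and> open V \<and> p \<in> U \<and> q \<in> V \<and> U \<inter> V = {}"
    using UV by (intro exI[of _ "{p. coord p x \<in> U}"] exI[of _ "{p. coord p x \<in> V}"])
      (auto simp: open_point_def im)
qed

end

lemma continuous_on_Point: "continuous_on A Point"
proof -
  have "open (Point -` U)" if "open U" for U :: "'a point set"
  proof -
    have "Point -` U = coord ` U"
    proof (intro equalityI subsetI)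
      fix h assume "h \<in> Point -` U"
      then show "h \<in> coord ` U" by (intro image_eqI[of h coord "Point h"]) (auto simp: Point_inverse)
    qed (auto simp: coord_inverse)
    then show ?thesis using that by (simp add: open_point_def)
  qed
  then have "continuous_on UNIV (Point :: ('a \<Rightarrow> complex) \<Rightarrow> _)"
    by (simp add: continuous_on_open_vimage)
  then show ?thesis using continuous_on_subset by blast
qed

lemma continuous_on_coord: "continuous_on A coord"
proof -
  have "open (coord -` U)" if "open U" for U :: "('a \<Rightarrow> complex) set"
  proof -
    have "coord ` (coord -` U) = U"
    proof (intro equalityI subsetI)
      fix h assume "h \<in> U"
      then show "h \<in> coord ` (coord -` U)" by (intro image_eqI[of h coord "Point h"]) (auto simp: Point_inverse)
    qed auto
    then show ?thesis using that by (simp add: open_point_def)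
  qed
  then have "continuous_on UNIV (coord :: 'a point \<Rightarrow> _)"
    by (simp add: continuous_on_open_vimage)
  then show ?thesis using continuous_on_subset by blast
qed

text \<open>After transport to \<open>point\<close>, the set \<open>R\<close> becomes a ring of
  functions separating the points of a compact Hausdorff set. What is taken from the
  Stone-Weierstrass proof is its intermediate step \<open>two\<close>: a ring element almost 0 on
  \<open>A\<close> and almost 1 on \<open>B\<close>.\<close>

lemma compact_separation:
  fixes A B :: "('i \<Rightarrow> complex) set" and R :: "(('i \<Rightarrow> complex) \<Rightarrow> real) set"
  assumes AB: "compact A" "compact B" "A \<inter> B = {}"
    and R: "\<And>r. r \<in> R \<Longrightarrow> continuous_on UNIV r"
      "\<And>r s. r \<in> R \<Longrightarrow> s \<in> R \<Longrightarrow> (\<lambda>x. r x + s x) \<in> R"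
      "\<And>r s. r \<in> R \<Longrightarrow> s \<in> R \<Longrightarrow> (\<lambda>x. r x * s x) \<in> R"
      "\<And>c. (\<lambda>x. c) \<in> R"
      "\<And>x y. x \<in> A \<union> B \<Longrightarrow> y \<in> A \<union> B \<Longrightarrow> x \<noteq> y \<Longrightarrow> \<exists>r\<in>R. r x \<noteq> r y"
    and e: "0 < e" "e < 1"
  obtains r where "r \<in> R" "\<And>x. x \<in> A \<union> B \<Longrightarrow> 0 \<le> r x \<and> r x \<le> 1"
    "\<And>x. x \<in> A \<Longrightarrow> r x < e" "\<And>x. x \<in> B \<Longrightarrow> r x > 1 - e"
proof -
  define R' where "R' = (\<lambda>r. \<lambda>p. r (coord p)) ` R"
  have cP: "coord (Point h) = h" for h :: "'i \<Rightarrow> complex" by (simp add: Point_inverse)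
  have cA: "compact (Point ` A)" "compact (Point ` B)" "compact (Point ` (A \<union> B))"
    using AB by (auto intro: compact_continuous_image continuous_on_Point compact_Un)
  interpret function_ring_on R' "Point ` (A \<union> B)"
  proof
    show "compact (Point ` (A \<union> B))" by fact
    fix f assume "f \<in> R'"
    then obtain r where r: "r \<in> R" "f = (\<lambda>p. r (coord p))" by (auto simp: R'_def)
    show "continuous_on (Point ` (A \<union> B)) f"
      unfolding r(2) using continuous_on_compose2[OF R(1)[OF r(1)] continuous_on_coord] by simp
    fix g assume "g \<in> R'"
    then obtain s where s: "s \<in> R" "g = (\<lambda>p. s (coord p))" by (auto simp: R'_def)
    show "(\<lambda>x. f x + g x) \<in> R'" "(\<lambda>x. f x * g x) \<in> R'"
      unfolding r(2) s(2) R'_def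
      using imageI[OF R(2)[OF r(1) s(1)]] imageI[OF R(3)[OF r(1) s(1)]] by auto
  next
    show "(\<lambda>_. c) \<in> R'" for c unfolding R'_def using imageI[OF R(4)[of c]] by auto
    fix x y assume xy: "x \<in> Point ` (A \<union> B)" "y \<in> Point ` (A \<union> B)" "x \<noteq> y"
    then have "coord x \<in> A \<union> B" "coord y \<in> A \<union> B" "coord x \<noteq> coord y"
      by (auto simp: cP)
    then show "\<exists>f\<in>R'. f x \<noteq> f y" using R(5) by (auto simp: R'_def)
  qed
  have disj: "Point ` A \<inter> Point ` B = {}"
    using AB(3) by (auto simp: Point_inject)
  have "\<exists>f\<in>R'. f ` Point ` (A \<union> B) \<subseteq> {0..1} \<and> (\<forall>x\<in>Point ` A. f x < e) \<and> (\<forall>x\<in>Point ` B. f x > 1 - e)"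
    by (rule two[OF compact_imp_closed[OF cA(1)] _ compact_imp_closed[OF cA(2)] _ disj e]) auto
  then obtain f where f: "f \<in> R'" "f ` (Point ` (A \<union> B)) \<subseteq> {0..1}" "\<forall>x\<in>Point ` A. f x < e" "\<forall>x\<in>Point ` B. f x > 1 - e"
    by (elim bexE conjE) (rule that)
  then obtain r where r: "r \<in> R" "f = (\<lambda>p. r (coord p))" by (auto simp: R'_def)
  show thesis
    using that[OF r(1)] f(2-4) unfolding r(2) by (auto simp: cP image_subset_iff)
qed

section \<open>The topology of compact convergence\<close>

lemma continuous_map_into_compact_convergence:
  assumes F: "\<And>z. z \<in> topspace Z \<Longrightarrow> h z \<in> F"
    and c: "\<And>z0 C e. z0 \<in> topspace Z \<Longrightarrow> compactin X C \<Longrightarrow> e > 0 \<Longrightarrow>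
      \<exists>U. openin Z U \<and> z0 \<in> U \<and> (\<forall>z\<in>U. \<forall>x\<in>C. dist (h z x) (h z0 x) < e)"
  shows "continuous_map Z (compact_convergence_topology X F) h"
  unfolding continuous_map_def
proof (intro conjI allI impI)
  show "h \<in> topspace Z \<rightarrow> topspace (compact_convergence_topology X F)" using F by simp
  fix W assume "openin (compact_convergence_topology X F) W"
  then have W: "\<And>f. f \<in> W \<Longrightarrow> \<exists>C e. compactin X C \<and> e > 0 \<and> {g \<in> F. \<forall>x\<in>C. dist (g x) (f x) < e} \<subseteq> W"
    by (simp add: openin_compact_convergence_topology)
  show "openin Z {z \<in> topspace Z. h z \<in> W}"
    unfolding openin_subopen[of Z "{z \<in> topspace Z. h z \<in> W}"]
  proof
    fix z0 assume "z0 \<in> {z \<in> topspace Z. h z \<in> W}"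
    then have z0: "z0 \<in> topspace Z" "h z0 \<in> W" by auto
    obtain C e where C: "compactin X C" "e > 0" "{g \<in> F. \<forall>x\<in>C. dist (g x) (h z0 x) < e} \<subseteq> W"
      using W[OF z0(2)] by blast
    obtain U where U: "openin Z U" "z0 \<in> U" "\<forall>z\<in>U. \<forall>x\<in>C. dist (h z x) (h z0 x) < e"
      using c[OF z0(1) C(1,2)] by blast
    have Ut: "U \<subseteq> topspace Z" by (rule openin_subset[OF U(1)])
    have "h z \<in> {g \<in> F. \<forall>x\<in>C. dist (g x) (h z0 x) < e}" if "z \<in> U" for z
      using U(3) F[of z] Ut that by auto
    then have "U \<subseteq> {z \<in> topspace Z. h z \<in> W}" using C(3) Ut by blast
    then show "\<exists>T. openin Z T \<and> z0 \<in> T \<and> T \<subseteq> {z \<in> topspace Z. h z \<in> W}" using U by blast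
  qed
qed

lemma compact_convergence_nbhd:
  assumes f: "f \<in> F" and C: "compactin X C" and e: "e > 0"
  obtains U where "openin (compact_convergence_topology X F) U" "f \<in> U" "U \<subseteq> F"
    "\<And>g x. g \<in> U \<Longrightarrow> x \<in> C \<Longrightarrow> dist (g x) (f x) < e"
proof -
  \<comment> \<open>The pointwise condition \<open>dist (g x) (f x) < e\<close> on \<open>C\<close>
    need not define an open set, because the distances of a discontinuous \<open>g\<close> could
    approach \<open>e\<close> without a maximum. One bound \<open>d < e\<close> valid on all of
    \<open>C\<close> leaves room for a neighbourhood.\<close>
  define U where "U = {g \<in> F. \<exists>d. d < e \<and> (\<forall>x\<in>C. dist (g x) (f x) \<le> d)}"
  have "openin (compact_convergence_topology X F) U"
    unfolding openin_compact_convergence_topology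
  proof (intro conjI ballI)
    show "U \<subseteq> F" by (auto simp: U_def)
    fix g assume "g \<in> U"
    then obtain d where d: "d < e" "\<And>x. x \<in> C \<Longrightarrow> dist (g x) (f x) \<le> d" by (auto simp: U_def)
    have "h \<in> U" if h: "h \<in> F" "\<forall>x\<in>C. dist (h x) (g x) < (e - d) / 2" for h
    proof -
      have "dist (h x) (f x) \<le> (e - d) / 2 + d" if x: "x \<in> C" for x
        using dist_triangle[of "h x" "f x" "g x"] bspec[OF h(2) x] d(2)[OF x] by linarith
      then show ?thesis
        unfolding U_def using h(1) d(1) by (intro CollectI conjI exI[of _ "(e - d) / 2 + d"]) (auto simp: field_simps)
    qed
    then show "\<exists>C e. compactin X C \<and> e > 0 \<and> {h \<in> F. \<forall>x\<in>C. dist (h x) (g x) < e} \<subseteq> U"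
      using C d(1) by (intro exI[of _ C] exI[of _ "(e - d) / 2"]) auto
  qed
  moreover have "f \<in> U" using f e by (auto simp: U_def intro!: exI[of _ 0])
  ultimately show thesis using that[of U] by (force simp: U_def)
qed

lemma Hausdorff_compact_convergence:
  assumes "F \<subseteq> extensional (topspace X)"
  shows "Hausdorff_space (compact_convergence_topology X F)"
  unfolding Hausdorff_space_def
proof (intro allI impI)
  fix f g assume fg: "f \<in> topspace (compact_convergence_topology X F) \<and> g \<in> topspace (compact_convergence_topology X F) \<and> f \<noteq> g"
  then have F: "f \<in> F" "g \<in> F" by auto
  then obtain x where x: "x \<in> topspace X" "f x \<noteq> g x"
    using fg assms extensionalityI[of f "topspace X" g] by blast
  have C: "compactin X {x}" using x by simp
  have e: "dist (f x) (g x) / 2 > 0" using x by simp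
  obtain U where U: "openin (compact_convergence_topology X F) U" "f \<in> U" 
      "\<And>h y. h \<in> U \<Longrightarrow> y \<in> {x} \<Longrightarrow> dist (h y) (f y) < dist (f x) (g x) / 2"
    by (rule compact_convergence_nbhd[OF F(1) C e]) (rule that)
  obtain V where V: "openin (compact_convergence_topology X F) V" "g \<in> V" 
      "\<And>h y. h \<in> V \<Longrightarrow> y \<in> {x} \<Longrightarrow> dist (h y) (g y) < dist (f x) (g x) / 2"
    by (rule compact_convergence_nbhd[OF F(2) C e]) (rule that)
  have "disjnt U V"
    unfolding disjnt_iff
  proof (intro allI notI; elim conjE)
    fix h assume h: "h \<in> U" "h \<in> V"
    show False
      using U(3)[OF h(1), of x] V(3)[OF h(2), of x] dist_triangle_half_r[of "h x" "f x" "dist (f x) (g x)" "g x"]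
      by simp
  qed
  then show "\<exists>U V. openin (compact_convergence_topology X F) U \<and> openin (compact_convergence_topology X F) V \<and>
      f \<in> U \<and> g \<in> V \<and> disjnt U V" using U V by blast
qed

lemma continuous_map_evaluation:
  assumes "x \<in> topspace X"
  shows "continuous_map (compact_convergence_topology X F) euclidean (\<lambda>f. f x)"
proof (rule continuous_map_normI)
  fix e :: real and f assume e: "e > 0" and f: "f \<in> topspace (compact_convergence_topology X F)"
  have fF: "f \<in> F" and C: "compactin X {x}" using f assms by auto
  obtain U where "openin (compact_convergence_topology X F) U" "f \<in> U" 
      "\<And>h y. h \<in> U \<Longrightarrow> y \<in> {x} \<Longrightarrow> dist (h y) (f y) < e"
    by (rule compact_convergence_nbhd[OF fF C e]) (rule that)
  then show "\<exists>U. openin (compact_convergence_topology X F) U \<and> f \<in> U \<and> (\<forall>k\<in>U. norm (k x - f x) \<le> e)"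
    by (intro exI[of _ U]) (auto simp: dist_norm intro: less_imp_le)
qed

text \<open>Compact convergence is finer than pointwise convergence. Coordinates outside the space
  are constant, because the functions are extensional.\<close>

lemma continuous_map_to_product:
  fixes F :: "('a \<Rightarrow> complex) set"
  assumes "F \<subseteq> extensional (topspace X)"
  shows "continuous_map (compact_convergence_topology X F) euclidean (\<lambda>f. f)"
proof -
  have "continuous_map (compact_convergence_topology X F) euclidean (\<lambda>f. f x)" for x
  proof (cases "x \<in> topspace X")
    case False
    have "continuous_map (compact_convergence_topology X F) euclidean (\<lambda>f. undefined :: complex)" by simp
    then show ?thesis
    proof (rule continuous_map_eq)
      fix f assume "f \<in> topspace (compact_convergence_topology X F)"
      then have "f \<in> extensional (topspace X)" using assms by auto
      then show "undefined = f x" using False by (simp add: extensional_def)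
    qed
  qed (rule continuous_map_evaluation)
  then have "continuous_map (compact_convergence_topology X F) (product_topology (\<lambda>i. euclidean) UNIV) (\<lambda>f. f)"
    by (simp add: continuous_map_componentwise_UNIV)
  then show ?thesis by (simp add: euclidean_product_topology)
qed

section \<open>The dual action\<close>

context topological_group
begin

abbreviation "D \<equiv> pontryagin_dual G T"
abbreviation "DT \<equiv> pontryagin_topology G T"

lemma dual_carrier_iff: "\<xi> \<in> carrier D \<longleftrightarrow> \<xi> \<in> extensional (carrier G) \<and> continuous_map T euclidean \<xi> \<and>
    (\<forall>x\<in>carrier G. norm (\<xi> x) = 1) \<and> (\<forall>x\<in>carrier G. \<forall>y\<in>carrier G. \<xi> (x \<otimes> y) = \<xi> x * \<xi> y)"
  by (simp add: pontryagin_dual_def)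

lemma dual_carrierD:
  assumes "\<xi> \<in> carrier D"
  shows "\<xi> \<in> extensional (carrier G)" "continuous_map T euclidean \<xi>"
    "x \<in> carrier G \<Longrightarrow> norm (\<xi> x) = 1" "x \<in> carrier G \<Longrightarrow> y \<in> carrier G \<Longrightarrow> \<xi> (x \<otimes> y) = \<xi> x * \<xi> y"
  using assms by (auto simp: dual_carrier_iff)

lemma dual_one: "\<xi> \<in> carrier D \<Longrightarrow> \<xi> \<one> = 1"
proof -
  assume x: "\<xi> \<in> carrier D"
  then have "\<xi> \<one> * \<xi> \<one> = \<xi> \<one>" using dual_carrierD(4)[OF x, of \<one> \<one>] by simp
  moreover have "\<xi> \<one> \<noteq> 0" using dual_carrierD(3)[OF x, of \<one>] by auto
  ultimately show ?thesis by simp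
qed

lemma dual_inv: "\<xi> \<in> carrier D \<Longrightarrow> x \<in> carrier G \<Longrightarrow> \<xi> (inv x) = cnj (\<xi> x)"
proof -
  assume xi: "\<xi> \<in> carrier D" and x: "x \<in> carrier G"
  have 1: "\<xi> (inv x) * \<xi> x = 1" using dual_carrierD(4)[OF xi, of "inv x" x] dual_one[OF xi] x by simp
  have 2: "\<xi> x * cnj (\<xi> x) = 1" using dual_carrierD(3)[OF xi x] by (simp add: complex_norm_square[symmetric])
  have "\<xi> (inv x) = \<xi> (inv x) * (\<xi> x * cnj (\<xi> x))" by (simp add: 2)
  also have "\<dots> = cnj (\<xi> x)" using 1 by (simp add: mult.assoc[symmetric])
  finally show ?thesis .
qed

lemma continuous_map_restrict_carrier:
  assumes "continuous_map T Y f"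
  shows "continuous_map T Y (\<lambda>x\<in>carrier G. f x)"
  by (rule continuous_map_eq[OF assms]) (simp add: topspace_eq_carrier)

lemma dual_mult: "\<xi> \<otimes>\<^bsub>D\<^esub> \<psi> = (\<lambda>x\<in>carrier G. \<xi> x * \<psi> x)"
  and dual_unit: "\<one>\<^bsub>D\<^esub> = (\<lambda>x\<in>carrier G. 1)"
  by (simp_all add: pontryagin_dual_def)

lemma dual_mult_closed:
  assumes "\<xi> \<in> carrier D" "\<psi> \<in> carrier D"
  shows "(\<lambda>x\<in>carrier G. \<xi> x * \<psi> x) \<in> carrier D"
  unfolding dual_carrier_iff
proof (intro conjI)
  show "continuous_map T euclidean (\<lambda>x\<in>carrier G. \<xi> x * \<psi> x)"
    by (intro continuous_map_restrict_carrier continuous_map_times dual_carrierD(2) assms)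
qed (use assms in \<open>auto simp: dual_carrierD norm_mult\<close>)

lemma dual_cnj_closed:
  assumes "\<xi> \<in> carrier D"
  shows "(\<lambda>x\<in>carrier G. cnj (\<xi> x)) \<in> carrier D"
  unfolding dual_carrier_iff
proof (intro conjI)
  show "continuous_map T euclidean (\<lambda>x\<in>carrier G. cnj (\<xi> x))"
    by (intro continuous_map_restrict_carrier continuous_map_cnj dual_carrierD(2) assms)
qed (use assms in \<open>auto simp: dual_carrierD\<close>)

lemma dual_one_closed: "(\<lambda>x\<in>carrier G. 1) \<in> carrier D"
  unfolding dual_carrier_iff by (auto intro!: continuous_map_restrict_carrier)

lemma dual_group: "group D"
proof (rule groupI)
  show "\<one>\<^bsub>D\<^esub> \<in> carrier D" unfolding dual_unit by (rule dual_one_closed)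
  fix \<xi> assume xi: "\<xi> \<in> carrier D"
  have ex: "\<xi> \<in> extensional (carrier G)" by (rule dual_carrierD(1)[OF xi])
  show "\<one>\<^bsub>D\<^esub> \<otimes>\<^bsub>D\<^esub> \<xi> = \<xi>"
    unfolding dual_mult dual_unit by (rule extensionalityI[OF _ ex]) auto
  have "(\<lambda>x\<in>carrier G. cnj (\<xi> x)) \<otimes>\<^bsub>D\<^esub> \<xi> = \<one>\<^bsub>D\<^esub>"
    unfolding dual_mult dual_unit
    by (rule extensionalityI[where A = "carrier G"])
      (auto simp: mult.commute[of "cnj _"] complex_norm_square[symmetric] dual_carrierD(3)[OF xi])
  then show "\<exists>\<psi>\<in>carrier D. \<psi> \<otimes>\<^bsub>D\<^esub> \<xi> = \<one>\<^bsub>D\<^esub>" using dual_cnj_closed[OF xi] by blast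
  fix \<psi> assume psi: "\<psi> \<in> carrier D"
  show "\<xi> \<otimes>\<^bsub>D\<^esub> \<psi> \<in> carrier D" unfolding dual_mult by (rule dual_mult_closed[OF xi psi])
  fix \<tau> assume tau: "\<tau> \<in> carrier D"
  show "\<xi> \<otimes>\<^bsub>D\<^esub> \<psi> \<otimes>\<^bsub>D\<^esub> \<tau> = \<xi> \<otimes>\<^bsub>D\<^esub> (\<psi> \<otimes>\<^bsub>D\<^esub> \<tau>)"
    unfolding dual_mult by (rule extensionalityI[where A = "carrier G"]) auto
qed

lemma dual_inverse:
  assumes xi: "\<xi> \<in> carrier D"
  shows "inv\<^bsub>D\<^esub> \<xi> = (\<lambda>x\<in>carrier G. cnj (\<xi> x))"
proof (rule group.inv_equality[OF dual_group _ xi dual_cnj_closed[OF xi]])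
  show "(\<lambda>x\<in>carrier G. cnj (\<xi> x)) \<otimes>\<^bsub>D\<^esub> \<xi> = \<one>\<^bsub>D\<^esub>"
    unfolding dual_mult dual_unit
    by (rule extensionalityI[where A = "carrier G"])
      (auto simp: mult.commute[of "cnj _"] complex_norm_square[symmetric] dual_carrierD(3)[OF xi])
qed

lemma topspace_dual: "topspace DT = carrier D"
  by (simp add: pontryagin_topology_def)

lemma dual_nbhd:
  assumes "\<xi> \<in> carrier D" "compactin T C" "e > 0"
  obtains U where "openin DT U" "\<xi> \<in> U" "U \<subseteq> carrier D"
    "\<And>\<psi> x. \<psi> \<in> U \<Longrightarrow> x \<in> C \<Longrightarrow> dist (\<psi> x) (\<xi> x) < e"
proof -
  obtain U where U: "openin (compact_convergence_topology T (carrier D)) U" "\<xi> \<in> U" "U \<subseteq> carrier D"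
    "\<And>\<psi> x. \<psi> \<in> U \<Longrightarrow> x \<in> C \<Longrightarrow> dist (\<psi> x) (\<xi> x) < e"
    by (rule compact_convergence_nbhd[OF assms]) (rule that)
  show thesis by (rule that[of U]) (use U in \<open>simp_all add: pontryagin_topology_def\<close>)
qed

lemma dual_extensional: "carrier D \<subseteq> extensional (topspace T)"
  by (auto simp: dual_carrierD topspace_eq_carrier)

lemma dual_topological_group: "topological_group D DT"
proof (intro topological_group.intro topological_group_axioms.intro)
  show "group D" by (rule dual_group)
  show "topspace DT = carrier D" by (rule topspace_dual)
  show "Hausdorff_space DT"
    unfolding pontryagin_topology_def by (rule Hausdorff_compact_convergence[OF dual_extensional])
  show "continuous_map (prod_topology DT DT) DT (\<lambda>(\<xi>, \<psi>). \<xi> \<otimes>\<^bsub>D\<^esub> \<psi>)"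
    unfolding pontryagin_topology_def[of G T]
  proof (rule continuous_map_into_compact_convergence; unfold pontryagin_topology_def[symmetric])
    fix z assume "z \<in> topspace (prod_topology DT DT)"
    then show "(\<lambda>(\<xi>, \<psi>). \<xi> \<otimes>\<^bsub>D\<^esub> \<psi>) z \<in> carrier D"
      by (auto simp: topspace_dual dual_mult dual_mult_closed)
  next
    fix z0 C and e :: real assume z0: "z0 \<in> topspace (prod_topology DT DT)" and C: "compactin T C" and e: "e > 0"
    obtain \<xi>0 \<psi>0 where z: "z0 = (\<xi>0, \<psi>0)" "\<xi>0 \<in> carrier D" "\<psi>0 \<in> carrier D" using z0 by (auto simp: topspace_dual)
    have Cc: "C \<subseteq> carrier G" using compactin_subset_topspace[OF C] by (simp add: topspace_eq_carrier)
    have e2: "e / 2 > 0" using e by simp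
    obtain U where U: "openin DT U" "\<xi>0 \<in> U" "U \<subseteq> carrier D" "\<And>g x. g \<in> U \<Longrightarrow> x \<in> C \<Longrightarrow> dist (g x) (\<xi>0 x) < e / 2"
      by (rule dual_nbhd[OF z(2) C e2]) (rule that)
    obtain V where V: "openin DT V" "\<psi>0 \<in> V" "V \<subseteq> carrier D" "\<And>g x. g \<in> V \<Longrightarrow> x \<in> C \<Longrightarrow> dist (g x) (\<psi>0 x) < e / 2"
      by (rule dual_nbhd[OF z(3) C e2]) (rule that)
    have "dist ((\<xi> \<otimes>\<^bsub>D\<^esub> \<psi>) x) ((\<xi>0 \<otimes>\<^bsub>D\<^esub> \<psi>0) x) < e" if h: "\<xi> \<in> U" "\<psi> \<in> V" "x \<in> C" for \<xi> \<psi> x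
    proof -
      have xc: "x \<in> carrier G" using h(3) Cc by blast
      have n: "norm (\<psi> x) = 1" "norm (\<xi>0 x) = 1"
        using dual_carrierD(3)[OF z(2) xc] dual_carrierD(3)[of \<psi>] V(3) h(2) xc by auto
      \<comment> \<open>One factor is changed at a time; as characters have modulus 1, the two
        errors simply add.\<close>
      have "norm (\<xi> x * \<psi> x - \<xi>0 x * \<psi>0 x) \<le> norm ((\<xi> x - \<xi>0 x) * \<psi> x) + norm (\<xi>0 x * (\<psi> x - \<psi>0 x))"
        by (rule order_trans[OF _ norm_triangle_ineq]) (simp add: algebra_simps)
      also have "\<dots> < e / 2 + e / 2"
        using U(4)[OF h(1,3)] V(4)[OF h(2,3)] n by (intro add_strict_mono) (auto simp: norm_mult dist_norm)
      finally show ?thesis using xc by (simp add: dual_mult dist_norm)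
    qed
    then show "\<exists>W. openin (prod_topology DT DT) W \<and> z0 \<in> W \<and>
        (\<forall>z\<in>W. \<forall>x\<in>C. dist ((\<lambda>(\<xi>, \<psi>). \<xi> \<otimes>\<^bsub>D\<^esub> \<psi>) z x) ((\<lambda>(\<xi>, \<psi>). \<xi> \<otimes>\<^bsub>D\<^esub> \<psi>) z0 x) < e)"
      using U(1,2) V(1,2) z(1) by (intro exI[of _ "U \<times> V"]) (auto simp: openin_prod_Times_iff)
  qed
  show "continuous_map DT DT (\<lambda>\<xi>. inv\<^bsub>D\<^esub> \<xi>)"
    unfolding pontryagin_topology_def[of G T]
  proof (rule continuous_map_into_compact_convergence; unfold pontryagin_topology_def[symmetric])
    fix \<xi> assume "\<xi> \<in> topspace DT"
    then show "inv\<^bsub>D\<^esub> \<xi> \<in> carrier D" by (simp add: topspace_dual dual_inverse dual_cnj_closed)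
  next
    fix \<xi>0 C and e :: real assume xi0: "\<xi>0 \<in> topspace DT" and C: "compactin T C" and e: "e > 0"
    have xi0': "\<xi>0 \<in> carrier D" using xi0 by (simp add: topspace_dual)
    have Cc: "C \<subseteq> carrier G" using compactin_subset_topspace[OF C] by (simp add: topspace_eq_carrier)
    obtain U where U: "openin DT U" "\<xi>0 \<in> U" "U \<subseteq> carrier D" "\<And>g x. g \<in> U \<Longrightarrow> x \<in> C \<Longrightarrow> dist (g x) (\<xi>0 x) < e"
      by (rule dual_nbhd[OF xi0' C e]) (rule that)
    have "dist ((inv\<^bsub>D\<^esub> \<xi>) x) ((inv\<^bsub>D\<^esub> \<xi>0) x) < e" if h: "\<xi> \<in> U" "x \<in> C" for \<xi> x
    proof -
      have xc: "x \<in> carrier G" "\<xi> \<in> carrier D" using h Cc U(3) by auto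
      have "dist (cnj (\<xi> x)) (cnj (\<xi>0 x)) = dist (\<xi> x) (\<xi>0 x)"
        unfolding dist_norm by (metis complex_cnj_diff complex_mod_cnj)
      then show ?thesis using U(4)[OF h] xc xi0' by (simp add: dual_inverse)
    qed
    then show "\<exists>W. openin DT W \<and> \<xi>0 \<in> W \<and> (\<forall>\<xi>\<in>W. \<forall>x\<in>C. dist ((inv\<^bsub>D\<^esub> \<xi>) x) ((inv\<^bsub>D\<^esub> \<xi>0) x) < e)"
      using U(1,2) by blast
  qed
qed

end

context group_orbit
begin

abbreviation "\<Psi> \<equiv> dual_action K G T \<phi>"

lemma dual_action_apply:
  "\<xi> \<in> carrier D \<Longrightarrow> \<Psi> k \<xi> = (\<lambda>x\<in>carrier G. \<xi> (\<phi> (inv\<^bsub>K\<^esub> k) x))"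
  by (simp add: dual_action_def)

lemma continuous_map_phi_right: "k \<in> carrier K \<Longrightarrow> continuous_map T T (\<phi> k)"
  using continuous_map_phi[of T "\<lambda>_. k" "\<lambda>x. x"] by (simp add: K.topspace_eq_carrier)

lemma dual_action_closed:
  assumes k: "k \<in> carrier K" and xi: "\<xi> \<in> carrier D"
  shows "\<Psi> k \<xi> \<in> carrier D"
  unfolding dual_action_apply[OF xi] dual_carrier_iff
proof (intro conjI)
  have "continuous_map T T (\<phi> (inv\<^bsub>K\<^esub> k))" using k by (intro continuous_map_phi_right) simp
  from continuous_map_compose[OF this dual_carrierD(2)[OF xi]]
  show "continuous_map T euclidean (\<lambda>x\<in>carrier G. \<xi> (\<phi> (inv\<^bsub>K\<^esub> k) x))"
    by (intro continuous_map_restrict_carrier) (simp add: o_def)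
qed (use k xi in \<open>auto simp: dual_carrierD phi_mult\<close>)

lemma dual_action_val: "\<xi> \<in> carrier D \<Longrightarrow> x \<in> carrier G \<Longrightarrow> \<Psi> k \<xi> x = \<xi> (\<phi> (inv\<^bsub>K\<^esub> k) x)"
  by (simp add: dual_action_apply)

lemma dual_action_comp:
  assumes "k \<in> carrier K" "l \<in> carrier K" and xi: "\<xi> \<in> carrier D"
  shows "\<Psi> (k \<otimes>\<^bsub>K\<^esub> l) \<xi> = \<Psi> k (\<Psi> l \<xi>)"
proof (rule extensionalityI[where A = "carrier G"])
  have l: "\<Psi> l \<xi> \<in> carrier D" using assms by (intro dual_action_closed)
  then show "\<Psi> k (\<Psi> l \<xi>) \<in> extensional (carrier G)"
    using assms by (intro dual_carrierD dual_action_closed)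
  show "\<Psi> (k \<otimes>\<^bsub>K\<^esub> l) \<xi> \<in> extensional (carrier G)"
    using assms by (intro dual_carrierD dual_action_closed) auto
  fix x assume x: "x \<in> carrier G"
  show "\<Psi> (k \<otimes>\<^bsub>K\<^esub> l) \<xi> x = \<Psi> k (\<Psi> l \<xi>) x"
    using x assms by (simp add: dual_action_val[OF l] dual_action_val[OF xi] K.inv_mult_group phi_comp)
qed

lemma dual_action_one: "\<xi> \<in> carrier D \<Longrightarrow> \<Psi> \<one>\<^bsub>K\<^esub> \<xi> = \<xi>"
  unfolding dual_action_apply
  by (rule extensionalityI[where A = "carrier G"]) (auto simp: dual_carrierD)

lemma dual_action_auto:
  assumes k: "k \<in> carrier K"
  shows "\<Psi> k \<in> auto D"
proof -
  have "\<Psi> k \<in> hom D D"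
  proof (rule homI)
    show "\<Psi> k \<xi> \<in> carrier D" if "\<xi> \<in> carrier D" for \<xi> using dual_action_closed[OF k that] .
    fix \<xi> \<psi> assume xi: "\<xi> \<in> carrier D" and psi: "\<psi> \<in> carrier D"
    have m: "\<xi> \<otimes>\<^bsub>D\<^esub> \<psi> \<in> carrier D" unfolding dual_mult by (rule dual_mult_closed[OF xi psi])
    show "\<Psi> k (\<xi> \<otimes>\<^bsub>D\<^esub> \<psi>) = \<Psi> k \<xi> \<otimes>\<^bsub>D\<^esub> \<Psi> k \<psi>"
      unfolding dual_action_apply[OF xi] dual_action_apply[OF psi] dual_action_apply[OF m]
      by (rule extensionalityI[where A = "carrier G"]) (use k in \<open>auto simp: dual_mult\<close>)
  qed
  moreover have "bij_betw (\<Psi> k) (carrier D) (carrier D)"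
  proof (rule bij_betwI)
    show "\<Psi> k \<in> carrier D \<rightarrow> carrier D" "\<Psi> (inv\<^bsub>K\<^esub> k) \<in> carrier D \<rightarrow> carrier D"
      using k by (auto simp: dual_action_closed)
    show "\<Psi> (inv\<^bsub>K\<^esub> k) (\<Psi> k \<xi>) = \<xi>" "\<Psi> k (\<Psi> (inv\<^bsub>K\<^esub> k) \<xi>) = \<xi>" if "\<xi> \<in> carrier D" for \<xi>
      using that k by (simp_all add: dual_action_comp[symmetric] dual_action_one)
  qed
  moreover have "\<Psi> k \<in> extensional (carrier D)" by (simp add: dual_action_def)
  ultimately show ?thesis by (simp add: auto_def Bij_def)
qed

lemma group_orbit_dual: "group_orbit D DT K S m \<Psi>"
proof (intro group_orbit.intro group_orbit_axioms.intro dual_topological_group haar)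
  show "compact_group K S" by (rule K.compact_group_axioms)
  show "continuous_action_by_automorphisms K S D DT \<Psi>"
    unfolding continuous_action_by_automorphisms_def
  proof
    show "\<Psi> \<in> hom K (AutoGroup D)"
    proof (rule homI)
      show "\<Psi> k \<in> carrier (AutoGroup D)" if "k \<in> carrier K" for k
        using dual_action_auto[OF that] by (simp add: AutoGroup_def)
      fix k l assume kl: "k \<in> carrier K" "l \<in> carrier K"
      have B: "\<Psi> k \<in> Bij (carrier D)" "\<Psi> l \<in> Bij (carrier D)"
        using dual_action_auto kl by (auto simp: auto_def)
      have "\<Psi> (k \<otimes>\<^bsub>K\<^esub> l) = compose (carrier D) (\<Psi> k) (\<Psi> l)"
      proof (rule extensionalityI[where A = "carrier D"])
        show "\<Psi> (k \<otimes>\<^bsub>K\<^esub> l) \<in> extensional (carrier D)" by (simp add: dual_action_def)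
        show "compose (carrier D) (\<Psi> k) (\<Psi> l) \<in> extensional (carrier D)" by simp
        show "\<Psi> (k \<otimes>\<^bsub>K\<^esub> l) \<xi> = compose (carrier D) (\<Psi> k) (\<Psi> l) \<xi>" if "\<xi> \<in> carrier D" for \<xi>
          using that kl by (simp add: compose_eq dual_action_comp)
      qed
      then show "\<Psi> (k \<otimes>\<^bsub>K\<^esub> l) = \<Psi> k \<otimes>\<^bsub>AutoGroup D\<^esub> \<Psi> l"
        using B by (simp add: AutoGroup_def BijGroup_def)
    qed
    show "continuous_map (prod_topology S DT) DT (\<lambda>(k, \<xi>). \<Psi> k \<xi>)"
      unfolding pontryagin_topology_def[of G T]
    proof (rule continuous_map_into_compact_convergence; unfold pontryagin_topology_def[symmetric])
      fix z assume "z \<in> topspace (prod_topology S DT)"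
      then show "(\<lambda>(k, \<xi>). \<Psi> k \<xi>) z \<in> carrier D"
        by (auto simp: topspace_dual K.topspace_eq_carrier dual_action_closed)
    next
      fix z0 C and e :: real assume z0: "z0 \<in> topspace (prod_topology S DT)" and C: "compactin T C" and e: "e > 0"
      obtain k0 \<xi>0 where z: "z0 = (k0, \<xi>0)" "k0 \<in> carrier K" "\<xi>0 \<in> carrier D"
        using z0 by (auto simp: topspace_dual K.topspace_eq_carrier)
      have Cc: "C \<subseteq> carrier G" using compactin_subset_topspace[OF C] by (simp add: topspace_eq_carrier)
      have c: "continuous_map (prod_topology S T) T (\<lambda>z. \<phi> (inv\<^bsub>K\<^esub> fst z) (snd z))"
        by (intro continuous_map_phi K.continuous_map_inv continuous_map_fst continuous_map_snd)
      \<comment> \<open>For joint continuity the character must be controlled at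
        \<open>\<phi> (inv k) x\<close> for all \<open>k\<close> at once, so closeness is demanded
        on the whole saturation of \<open>C\<close>, which is compact. The remaining dependence on
        \<open>k\<close> concerns the fixed \<open>\<xi>0\<close>, where equicontinuity
        applies.\<close>
      define C' where "C' = (\<lambda>z. \<phi> (inv\<^bsub>K\<^esub> fst z) (snd z)) ` (topspace S \<times> C)"
      have "compactin (prod_topology S T) (topspace S \<times> C)"
        using C K.compact by (simp add: compactin_Times compact_space_def)
      then have C': "compactin T C'" unfolding C'_def using c by (rule image_compactin)
      have e2: "e / 2 > 0" using e by simp
      obtain V where V: "openin DT V" "\<xi>0 \<in> V" "V \<subseteq> carrier D" "\<And>g x. g \<in> V \<Longrightarrow> x \<in> C' \<Longrightarrow> dist (g x) (\<xi>0 x) < e / 2"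
        by (rule dual_nbhd[OF z(3) C' e2]) (rule that)
      have "continuous_map (prod_topology S T) euclidean (\<lambda>(k, x). \<xi>0 (\<phi> (inv\<^bsub>K\<^esub> k) x))"
        using continuous_map_compose[OF c dual_carrierD(2)[OF z(3)]] by (simp add: o_def case_prod_unfold)
      from equicontinuous_on_compact[OF this C e2, of k0] obtain U where U: "openin S U" "k0 \<in> U"
          "\<forall>k\<in>U. \<forall>x\<in>C. norm (\<xi>0 (\<phi> (inv\<^bsub>K\<^esub> k) x) - \<xi>0 (\<phi> (inv\<^bsub>K\<^esub> k0) x)) \<le> e / 2"
        using z(2) by (auto simp: K.topspace_eq_carrier)
      have "dist (\<Psi> k \<xi> x) (\<Psi> k0 \<xi>0 x) < e" if h: "k \<in> U" "\<xi> \<in> V" "x \<in> C" for k \<xi> x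
      proof -
        have kc: "k \<in> topspace S" using h openin_subset[OF U(1)] by auto
        have "\<phi> (inv\<^bsub>K\<^esub> k) x \<in> C'" unfolding C'_def using kc h(3) by (intro image_eqI[of _ _ "(k, x)"]) auto
        then have 1: "dist (\<xi> (\<phi> (inv\<^bsub>K\<^esub> k) x)) (\<xi>0 (\<phi> (inv\<^bsub>K\<^esub> k) x)) < e / 2" using V(4) h by blast
        have 2: "dist (\<xi>0 (\<phi> (inv\<^bsub>K\<^esub> k) x)) (\<xi>0 (\<phi> (inv\<^bsub>K\<^esub> k0) x)) \<le> e / 2"
          using U(3) h by (simp add: dist_norm)
        have "dist (\<xi> (\<phi> (inv\<^bsub>K\<^esub> k) x)) (\<xi>0 (\<phi> (inv\<^bsub>K\<^esub> k0) x)) < e"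
          using dist_triangle[of "\<xi> (\<phi> (inv\<^bsub>K\<^esub> k) x)" "\<xi>0 (\<phi> (inv\<^bsub>K\<^esub> k0) x)" "\<xi>0 (\<phi> (inv\<^bsub>K\<^esub> k) x)"] 1 2 by linarith
        moreover have "x \<in> carrier G" "\<xi> \<in> carrier D" using V(3) h Cc by auto
        ultimately show ?thesis using z(3) by (simp add: dual_action_val)
      qed
      then show "\<exists>W. openin (prod_topology S DT) W \<and> z0 \<in> W \<and>
          (\<forall>z\<in>W. \<forall>x\<in>C. dist ((\<lambda>(k, \<xi>). \<Psi> k \<xi>) z x) ((\<lambda>(k, \<xi>). \<Psi> k \<xi>) z0 x) < e)"
        using U(1,2) V(1,2) z(1) by (intro exI[of _ "U \<times> V"]) (auto simp: openin_prod_Times_iff)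
    qed
  qed
qed

end

section \<open>Smoothing by the invariant functional\<close>

context invariant_functional
begin

lemma I_cong:
  assumes "compactly_supported u" "compactly_supported v" "\<And>x. x \<in> carrier G \<Longrightarrow> u x = v x"
  shows "I u = I v"
proof -
  have c: "compactly_supported (\<lambda>x. (-1) * v x)" by (rule compactly_supported_scale[OF assms(2)])
  \<comment> \<open>The difference vanishes on the carrier and is thus dominated by the zero
    function, written \<open>0 * u\<close> so that linearity evaluates \<open>I\<close> on
    it.\<close>
  have "norm (I (\<lambda>x. u x + (-1) * v x)) \<le> Re (I (\<lambda>x. 0 * u x))"
    using assms c by (intro I_mono compactly_supported_add compactly_supported_scale) auto
  then show ?thesis
    unfolding I_scale[OF assms(1)] I_add[OF assms(1) c] I_scale[OF assms(2)] by simp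
qed

lemma I_diff:
  assumes "compactly_supported u" "compactly_supported v"
  shows "I (\<lambda>x. u x - v x) = I u - I v"
proof -
  have c: "compactly_supported (\<lambda>x. (-1) * v x)" by (rule compactly_supported_scale[OF assms(2)])
  show ?thesis using I_add[OF assms(1) c] I_scale[OF assms(2), of "-1"] by simp
qed

lemma I_sum:
  assumes "finite P" "\<And>p. p \<in> P \<Longrightarrow> compactly_supported (u p)"
  shows "compactly_supported (\<lambda>x. \<Sum>p\<in>P. u p x) \<and> I (\<lambda>x. \<Sum>p\<in>P. u p x) = (\<Sum>p\<in>P. I (u p))"
  using assms
proof (induction P rule: finite_induct)
  case empty
  have "compactly_supported (\<lambda>x. 0 * indicator {} x)"
    by (intro compactly_supported_scale compactly_supported_indicator) simp
  moreover have "I (\<lambda>x. 0 * indicator {} x) = 0 * I (indicator {})"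
    by (intro I_scale compactly_supported_indicator) simp
  ultimately show ?case by simp
next
  case (insert p P)
  then show ?case using compactly_supported_add[of "u p" "\<lambda>x. \<Sum>p\<in>P. u p x"] I_add[of "u p" "\<lambda>x. \<Sum>p\<in>P. u p x"]
    by simp
qed

lemma I_bound:
  assumes u: "compactly_supported u" and C: "compactin T C"
    and le: "\<And>x. x \<in> C \<Longrightarrow> norm (u x) \<le> e" and z: "\<And>x. x \<in> carrier G - C \<Longrightarrow> u x = 0"
  shows "norm (I u) \<le> e * Re (I (indicator C))"
proof -
  have ci: "compactly_supported (indicator C)" by (rule compactly_supported_indicator[OF C])
  have "norm (I u) \<le> Re (I (\<lambda>x. complex_of_real e * indicator C x))"
  proof (rule I_mono[OF u compactly_supported_scale[OF ci]])
    fix x assume "x \<in> carrier G"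
    then show "norm (u x) \<le> Re (complex_of_real e * indicator C x)"
      using le[of x] z[of x] by (auto simp: indicator_def)
  qed
  then show ?thesis unfolding I_scale[OF ci] by simp
qed

lemma I_indicator_nonneg: "compactin T C \<Longrightarrow> 0 \<le> Re (I (indicator C))"
proof -
  assume C: "compactin T C"
  have "norm (I (indicator C)) \<le> Re (I (indicator C))"
    by (rule I_mono[OF compactly_supported_indicator[OF C] compactly_supported_indicator[OF C]]) (simp add: indicator_def)
  then show ?thesis using norm_ge_zero order_trans by blast
qed

end

context topological_group
begin

lemma compactly_supported_off:
  "compactin T C \<Longrightarrow> bounded_fun u \<Longrightarrow> (\<And>x. x \<in> carrier G - C \<Longrightarrow> u x = 0) \<Longrightarrow> compactly_supported u"
  unfolding compactly_supported_def by (intro conjI exI[of _ C] ballI)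

lemma bounded_fun_mult:
  assumes "bounded_fun u" "bounded_fun v"
  shows "bounded_fun (\<lambda>x. u x * v x)"
proof -
  obtain b c where bc: "\<forall>x\<in>carrier G. norm (u x) \<le> b" "\<forall>x\<in>carrier G. norm (v x) \<le> c"
    using assms by (auto simp: bounded_fun_def)
  have "norm (u x * v x) \<le> b * c" if x: "x \<in> carrier G" for x
  proof -
    have "norm (u x) \<le> b" "norm (v x) \<le> c" using bc x by auto
    moreover have "0 \<le> b" using calculation(1) norm_ge_zero order_trans by blast
    ultimately show ?thesis unfolding norm_mult by (intro mult_mono) auto
  qed
  then show ?thesis unfolding bounded_fun_def by blast
qed

lemma bounded_fun_cnj: "bounded_fun u \<Longrightarrow> bounded_fun (\<lambda>x. cnj (u x))"
  unfolding bounded_fun_def by simp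

lemma bounded_fun_indicator: "bounded_fun (indicator C)"
  unfolding bounded_fun_def by (rule exI[of _ 1]) (simp add: indicator_def)

lemma compactly_supported_times_indicator:
  "compactin T C \<Longrightarrow> bounded_fun u \<Longrightarrow> compactly_supported (\<lambda>x. u x * indicator C x)"
  by (rule compactly_supported_off) (auto intro: bounded_fun_mult bounded_fun_indicator)

lemma bounded_fun_compact_support:
  fixes h :: "'a \<Rightarrow> complex"
  assumes "continuous_map T euclidean h" "compactin T C" "\<And>x. x \<in> carrier G - C \<Longrightarrow> h x = 0"
  shows "bounded_fun h"
proof -
  have "compact (h ` C)" using image_compactin[OF assms(2,1)] by simp
  then obtain b where b: "\<forall>y\<in>h ` C. norm y \<le> b" using compact_imp_bounded bounded_iff by blast
  have "norm (h x) \<le> max b 0" if "x \<in> carrier G" for x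
  proof (cases "x \<in> C")
    case True
    then have "norm (h x) \<le> b" using b by simp
    then show ?thesis by (rule max.coboundedI1)
  qed (use assms(3) that in simp)
  then show ?thesis unfolding bounded_fun_def by blast
qed

lemma compactin_mult:
  assumes "compactin T A" "compactin T B"
  shows "compactin T ((\<lambda>(x, y). x \<otimes> y) ` (A \<times> B))"
  by (rule image_compactin[OF _ continuous_mult]) (simp add: compactin_Times assms)

lemma compactin_inv: "compactin T A \<Longrightarrow> compactin T ((\<lambda>x. inv x) ` A)"
  by (rule image_compactin[OF _ continuous_inv])

end

section \<open>Smoothing kernels and equicontinuity of eigenfunctions\<close>

locale lca_orbit = group_orbit G T K S m \<phi> + lca_group G T
  for G :: "('a, 'b) monoid_scheme" (structure) and T :: "'a topology"
    and K :: "('k, 'c) monoid_scheme" and S :: "'k topology" and m :: "'k measure"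
    and \<phi> :: "'k \<Rightarrow> 'a \<Rightarrow> 'a"
begin

definition sat :: "'a set \<Rightarrow> 'a set" where
  "sat C = (\<lambda>(k, x). \<phi> k x) ` (topspace S \<times> C)"

lemma compactin_sat: "compactin T C \<Longrightarrow> compactin T (sat C)"
  unfolding sat_def
proof (rule image_compactin)
  show "continuous_map (prod_topology S T) T (\<lambda>(k, x). \<phi> k x)"
    using action by (simp add: continuous_action_by_automorphisms_def)
  show "compactin (prod_topology S T) (topspace S \<times> C)" if "compactin T C"
    using that K.compact by (simp add: compactin_Times compact_space_def)
qed

lemma sat_phi: "C \<subseteq> carrier G \<Longrightarrow> k \<in> carrier K \<Longrightarrow> x \<in> C \<Longrightarrow> \<phi> k x \<in> sat C"
  by (force simp: sat_def K.topspace_eq_carrier)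

lemma sat_superset: "C \<subseteq> carrier G \<Longrightarrow> C \<subseteq> sat C"
  using sat_phi[of C "\<one>\<^bsub>K\<^esub>"] by force

lemma sat_invariant:
  assumes C: "C \<subseteq> carrier G" and k: "k \<in> carrier K" and x: "x \<in> sat C"
  shows "\<phi> k x \<in> sat C"
proof -
  obtain l y where ly: "l \<in> carrier K" "y \<in> C" "x = \<phi> l y" using x by (auto simp: sat_def K.topspace_eq_carrier)
  have yc: "y \<in> carrier G" using ly(2) C by blast
  have "\<phi> k x = \<phi> (k \<otimes>\<^bsub>K\<^esub> l) y" using k ly(1,3) yc by (simp add: phi_comp)
  then show ?thesis using sat_phi[OF C _ ly(2), of "k \<otimes>\<^bsub>K\<^esub> l"] k ly(1) by simp
qed

lemma compact_nbhd:
  assumes "openin T U" "\<one> \<in> U"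
  obtains V W where "openin T V" "\<one> \<in> V" "V \<subseteq> W" "compactin T W" "W \<subseteq> U"
proof -
  have "neighbourhood_base_of (compactin T) T"
    using locally_compact_space_neighbourhood_base[of T] hausdorff locally_compact by blast
  then have "\<exists>V W. openin T V \<and> compactin T W \<and> \<one> \<in> V \<and> V \<subseteq> W \<and> W \<subseteq> U"
    using assms unfolding neighbourhood_base_of by blast
  then show thesis using that by blast
qed

lemma continuous_phi_compose:
  assumes "continuous_map T euclidean g" "x \<in> carrier G"
  shows "continuous_map (prod_topology S T) euclidean (\<lambda>(k, w). g (x \<otimes> \<phi> k w))"
proof -
  have "continuous_map (prod_topology S T) T (\<lambda>z. x \<otimes> \<phi> (fst z) (snd z))"
    using assms(2) by (intro continuous_map_mult continuous_map_phi continuous_map_fst continuous_map_snd)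
      (simp add: topspace_eq_carrier)
  from continuous_map_compose[OF this assms(1)] show ?thesis by (simp add: o_def case_prod_unfold)
qed

lemma continuous_phi_section:
  assumes "continuous_map T euclidean g" "x \<in> carrier G" "w \<in> carrier G"
  shows "continuous_map S euclidean (\<lambda>k. g (x \<otimes> \<phi> k w))"
proof -
  have "continuous_map S T (\<lambda>k. x \<otimes> \<phi> k w)"
    using assms by (intro continuous_map_mult continuous_map_phi_left) (auto simp: topspace_eq_carrier)
  from continuous_map_compose[OF this assms(1)] show ?thesis by (simp add: o_def)
qed

lemma norm_average_le:
  fixes u :: "'k \<Rightarrow> complex"
  assumes "\<And>k. k \<in> carrier K \<Longrightarrow> norm (u k) \<le> b" and u: "continuous_map S euclidean u"
  shows "norm (LINT k|m. u k) \<le> b"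
  by (rule norm_integral_le[OF u assms(1)]) (simp add: K.topspace_eq_carrier)

text \<open>The kernel \<open>h\<close> is the \<open>K\<close>-average of a bump function near the identity.\<close>

lemma smoothing_kernel:
  assumes f: "continuous_map T euclidean f" "f \<one> = (1::complex)"
    and fK: "\<And>k x. k \<in> carrier K \<Longrightarrow> x \<in> carrier G \<Longrightarrow> f (\<phi> k x) = f x"
  obtains I and h :: "'a \<Rightarrow> complex" and C where "invariant_functional G T I" "continuous_map T euclidean h"
    "\<And>k x. k \<in> carrier K \<Longrightarrow> x \<in> carrier G \<Longrightarrow> h (\<phi> k x) = h x"
    "compactin T C" "\<And>x. x \<in> carrier G - C \<Longrightarrow> h x = 0"
    "\<And>k x. k \<in> carrier K \<Longrightarrow> x \<in> C \<Longrightarrow> \<phi> k x \<in> C"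
    "I (\<lambda>x. h x * f x) \<noteq> 0"
proof -
  have onet: "\<one> \<in> topspace T" by (simp add: topspace_eq_carrier)
  \<comment> \<open>The kernel will live on the saturation of a compact subset of \<open>U\<close>.
    Since \<open>f\<close> is \<open>K\<close>-invariant, it stays within 1/2 of 1 on that
    saturation.\<close>
  obtain U where U: "openin T U" "\<one> \<in> U" "\<And>x. x \<in> U \<Longrightarrow> norm (f x - f \<one>) < 1 / 2"
    by (rule continuous_map_norm_le[OF f(1) _ onet, of "1/2"]) (simp, rule that)
  obtain V0 C0 where V0: "openin T V0" "\<one> \<in> V0" "V0 \<subseteq> C0" "compactin T C0" "C0 \<subseteq> U"
    by (rule compact_nbhd[OF U(1,2)]) (rule that)
  have C0c: "C0 \<subseteq> carrier G" using compactin_subset_topspace[OF V0(4)] by (simp add: topspace_eq_carrier)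
  have "completely_regular_space T"
    using hausdorff locally_compact
    by (simp add: locally_compact_regular_imp_completely_regular_space locally_compact_Hausdorff_imp_regular_space)
  \<comment> \<open>\<open>b\<close> vanishes at the unit and equals 1 off \<open>V0\<close>, so
    \<open>1 - b\<close> is the bump. Its average over \<open>K\<close> still has value 1 at the
    unit, which the action fixes.\<close>
  then obtain b where b: "continuous_map T (top_of_set {0..1::real}) b" "b \<one> = 0" "b ` (topspace T - V0) \<subseteq> {1}"
    using V0(1,2) onet unfolding completely_regular_space_def by (metis Diff_Diff_Int Diff_iff closedin_diff closedin_topspace inf.absorb_iff2 openin_subset)
  have b01: "b x \<in> {0..1}" if "x \<in> carrier G" for x
    using b(1) that by (auto simp: continuous_map_in_subtopology topspace_eq_carrier)
  have bc: "continuous_map T euclideanreal b" using b(1) by (simp add: continuous_map_in_subtopology)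
  define h0 where "h0 x = complex_of_real (1 - b x)" for x
  have h0c: "continuous_map T euclidean h0"
  proof -
    have "continuous_map euclideanreal euclidean (\<lambda>t. complex_of_real (1 - t))"
      by (simp add: continuous_intros)
    from continuous_map_compose[OF bc this] show ?thesis by (simp add: h0_def[abs_def] o_def)
  qed
  have h0z: "h0 x = 0" if "x \<in> carrier G - C0" for x
    using b(3) that V0(3) by (auto simp: h0_def topspace_eq_carrier image_subset_iff)
  define h where "h x = (LINT k|m. h0 (\<phi> k x))" for x
  define C where "C = sat C0"
  have C: "compactin T C" unfolding C_def by (rule compactin_sat[OF V0(4)])
  have Cinv: "\<phi> k x \<in> C" if "k \<in> carrier K" "x \<in> C" for k x
    unfolding C_def using sat_invariant[OF C0c] that by (simp add: C_def)
  have sec: "continuous_map S euclidean (\<lambda>k. h0 (\<phi> k x))" if x: "x \<in> carrier G" for x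
    using continuous_map_compose[OF continuous_map_phi_left[OF x] h0c] by (simp add: o_def)
  have hc: "continuous_map T euclidean h"
    unfolding h_def[abs_def]
  proof (rule continuous_average)
    have "continuous_map (prod_topology S T) T (\<lambda>(k, x). \<phi> k x)"
      using action by (simp add: continuous_action_by_automorphisms_def)
    from continuous_map_compose[OF this h0c]
    show "continuous_map (prod_topology S T) euclidean (\<lambda>(k, x). h0 (\<phi> k x))" by (simp add: o_def case_prod_unfold)
  qed
  have hz: "h x = 0" if x: "x \<in> carrier G - C" for x
  proof -
    have "h0 (\<phi> k x) = 0" if k: "k \<in> carrier K" for k
    proof (rule h0z)
      have "\<phi> k x \<notin> C0"
      proof
        assume "\<phi> k x \<in> C0"
        then have "\<phi> (inv\<^bsub>K\<^esub> k) (\<phi> k x) \<in> C" unfolding C_def using k by (intro sat_phi[OF C0c]) auto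
        then show False using k x by simp
      qed
      then show "\<phi> k x \<in> carrier G - C0" using k x by simp
    qed
    then have "h x = (LINT k|m. 0)"
      unfolding h_def by (intro Bochner_Integration.integral_cong refl) (simp add: space_m')
    then show ?thesis by simp
  qed
  have hK: "h (\<phi> k x) = h x" if k: "k \<in> carrier K" and x: "x \<in> carrier G" for k x
  proof -
    have "h (\<phi> k x) = (LINT l|m. h0 (\<phi> (l \<otimes>\<^bsub>K\<^esub> k) x))"
      unfolding h_def using k x by (intro Bochner_Integration.integral_cong refl) (simp add: space_m' phi_comp)
    also have "\<dots> = h x" unfolding h_def by (rule integral_right_translate[OF k sec[OF x]])
    finally show ?thesis .
  qed
  have hreal: "h x = complex_of_real (Re (h x)) \<and> 0 \<le> Re (h x)" if x: "x \<in> carrier G" for x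
  proof -
    have "h x = complex_of_real (LINT k|m. 1 - b (\<phi> k x))"
      unfolding h_def h0_def by (rule integral_complex_of_real)
    moreover have "0 \<le> (LINT k|m. 1 - b (\<phi> k x))"
      using b01 x by (intro Bochner_Integration.integral_nonneg_AE AE_I2) (auto simp: space_m')
    ultimately show ?thesis by simp
  qed
  have h1: "h \<one> = 1"
  proof -
    have "h \<one> = (LINT k|m. 1)"
      unfolding h_def by (intro Bochner_Integration.integral_cong refl) (simp add: space_m' h0_def b(2))
    then show ?thesis by (simp add: prob_space)
  qed
  obtain U1 where U1: "openin T U1" "\<one> \<in> U1" "\<And>x. x \<in> U1 \<Longrightarrow> norm (h x - h \<one>) < 1 / 2"
    by (rule continuous_map_norm_le[OF hc _ onet, of "1/2"]) (simp, rule that)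
  \<comment> \<open>On \<open>W\<close> the kernel is at least 1/2. Choosing \<open>I\<close> with
    \<open>Re (I (indicator W)) \<ge> 1\<close> then gives
    \<open>1 / 2 \<le> Re (I h)\<close>.\<close>
  obtain V1 W where W: "openin T V1" "\<one> \<in> V1" "V1 \<subseteq> W" "compactin T W" "W \<subseteq> U1"
    by (rule compact_nbhd[OF U1(1,2)]) (rule that)
  obtain I where I: "invariant_functional G T I" "Re (I (indicator W)) \<ge> 1"
    by (rule exists_invariant_functional[OF W(1-4)]) (rule that)
  interpret IF: invariant_functional G T I by (rule I(1))
  have hb: "bounded_fun h" by (rule bounded_fun_compact_support[OF hc C hz])
  have hs: "compactly_supported h" by (rule compactly_supported_off[OF C hb hz])
  have fC: "norm (f x - 1) \<le> 1 / 2" if x: "x \<in> C" for x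
  proof -
    obtain k y where ky: "k \<in> carrier K" "y \<in> C0" "x = \<phi> k y" using x by (auto simp: C_def sat_def K.topspace_eq_carrier)
    have "f x = f y" using ky C0c fK by auto
    then show ?thesis using U(3)[of y] ky(2) V0(5) f(2) by (auto simp: less_imp_le)
  qed
  have hf: "compactly_supported (\<lambda>x. h x * f x)"
  proof (rule compactly_supported_off[OF C])
    have fb: "norm (f x) \<le> 2" if "x \<in> C" for x
      using fC[OF that] norm_triangle_ineq2[of "f x" 1] by simp
    obtain B where B: "\<forall>x\<in>carrier G. norm (h x) \<le> B" using hb by (auto simp: bounded_fun_def)
    have "0 \<le> B" using B one_closed norm_ge_zero order_trans by blast
    have "norm (h x * f x) \<le> B * 2" if "x \<in> carrier G" for x
    proof (cases "x \<in> C")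
      case True
      then show ?thesis unfolding norm_mult using B that fb \<open>0 \<le> B\<close> by (intro mult_mono) auto
    next
      case False
      then show ?thesis using hz that \<open>0 \<le> B\<close> by simp
    qed
    then show "bounded_fun (\<lambda>x. h x * f x)" unfolding bounded_fun_def by blast
  qed (use hz in simp)
  \<comment> \<open>\<open>h\<close> is nonnegative and \<open>f\<close> is within 1/2 of 1 where
    \<open>h\<close> is nonzero, so replacing \<open>h * f\<close> by \<open>h\<close> changes the
    functional by at most half of \<open>I h\<close>. As \<open>I h\<close> has positive real part,
    \<open>I (h f)\<close> cannot vanish.\<close>
  have dif: "norm (I (\<lambda>x. h x * f x - h x)) \<le> Re (I (\<lambda>x. complex_of_real (1/2) * h x))"
  proof (rule IF.I_mono)
    have "compactly_supported (\<lambda>x. h x * f x + (-1) * h x)"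
      by (intro compactly_supported_add hf compactly_supported_scale hs)
    then show "compactly_supported (\<lambda>x. h x * f x - h x)" by simp
    show "compactly_supported (\<lambda>x. complex_of_real (1/2) * h x)" by (rule compactly_supported_scale[OF hs])
    fix x assume x: "x \<in> carrier G"
    show "norm (h x * f x - h x) \<le> Re (complex_of_real (1/2) * h x)"
    proof (cases "x \<in> C")
      case True
      have "norm (h x * f x - h x) = norm (h x) * norm (f x - 1)"
        by (simp add: norm_mult[symmetric] algebra_simps)
      also have "\<dots> \<le> norm (h x) * (1 / 2)" by (intro mult_left_mono fC True) auto
      also have "norm (h x) = Re (h x)" using hreal[OF x] by (metis abs_of_nonneg norm_of_real)
      finally show ?thesis by simp
    next
      case False
      then show ?thesis using hz x by simp
    qed
  qed
  have low: "1 / 2 \<le> Re (I h)"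
  proof -
    have ci: "compactly_supported (indicator W)" by (rule compactly_supported_indicator[OF W(4)])
    have "norm (I (\<lambda>x. complex_of_real (1/2) * indicator W x)) \<le> Re (I h)"
    proof (rule IF.I_mono[OF compactly_supported_scale[OF ci] hs])
      fix x assume x: "x \<in> carrier G"
      show "norm (complex_of_real (1/2) * indicator W x) \<le> Re (h x)"
      proof (cases "x \<in> W")
        case True
        have "norm (h x - 1) < 1 / 2" using U1(3) W(5) True h1 by auto
        then have "\<bar>Re (h x) - 1\<bar> < 1 / 2" using abs_Re_le_cmod[of "h x - 1"] by simp
        then have "1 / 2 \<le> Re (h x)" unfolding abs_less_iff by linarith
        then show ?thesis using True by simp
      next
        case False
        then show ?thesis using hreal[OF x] by simp
      qed
    qed
    then show ?thesis
      unfolding IF.I_scale[OF ci] using I(2) abs_Re_le_cmod[of "complex_of_real (1/2) * I (indicator W)"] by simp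
  qed
  have "I (\<lambda>x. h x * f x) \<noteq> 0"
  proof
    assume z: "I (\<lambda>x. h x * f x) = 0"
    have "norm (I h) \<le> 1 / 2 * Re (I h)"
      using dif unfolding IF.I_diff[OF hf hs] IF.I_scale[OF hs] z by simp
    then show False using low complex_Re_le_cmod[of "I h"] by linarith
  qed
  then show thesis using that[OF I(1) hc hK C hz Cinv] by blast
qed

text \<open>If \<open>c = I(h f)\<close>, the eigenvalue equation for \<open>g\<close> and the invariance of \<open>h\<close> give
  \<open>c g(x) = \<integral> I (\<lambda>w. h (\<phi>\<^sub>k w) g (x \<phi>\<^sub>k w)) dk\<close>. Translating by \<open>\<phi>\<^sub>k\<^sup>-\<^sup>1 x\<close> moves \<open>x\<close> from \<open>g\<close> to the
  uniformly continuous function \<open>h\<close>.\<close>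

lemma eigenfunction_smoothing:
  assumes I: "invariant_functional G T I" and h: "continuous_map T euclidean h"
    and hK: "\<And>k x. k \<in> carrier K \<Longrightarrow> x \<in> carrier G \<Longrightarrow> h (\<phi> k x) = h x"
    and C: "compactin T C" "\<And>x. x \<in> carrier G - C \<Longrightarrow> h x = 0"
    and g: "continuous_map T euclidean g" "\<And>x. x \<in> carrier G \<Longrightarrow> norm (g x) \<le> 1"
    and eig: "\<And>x w. x \<in> carrier G \<Longrightarrow> w \<in> carrier G \<Longrightarrow> (LINT k|m. g (x \<otimes> \<phi> k w)) = f w * g x"
    and fb: "bounded_fun f" and x: "x \<in> carrier G"
  shows "continuous_map S euclidean (\<lambda>k. I (\<lambda>w. h (inv x \<otimes> \<phi> k w) * g (\<phi> k w)))"
    and "I (\<lambda>w. h w * f w) * g x = (LINT k|m. I (\<lambda>w. h (inv x \<otimes> \<phi> k w) * g (\<phi> k w)))"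
proof -
  interpret IF: invariant_functional G T I by (rule I)
  have hb: "bounded_fun h" by (rule bounded_fun_compact_support[OF h C])
  obtain B where B: "\<forall>x\<in>carrier G. norm (h x) \<le> B" using hb by (auto simp: bounded_fun_def)
  have B0: "0 \<le> B" using B one_closed norm_ge_zero order_trans by blast
  have Cc: "C \<subseteq> carrier G" using compactin_subset_topspace[OF C(1)] by (simp add: topspace_eq_carrier)
  have cs: "compactly_supported (\<lambda>w. h w * u w)" if "bounded_fun u" for u
    using C(2) by (intro compactly_supported_off[OF C(1)] bounded_fun_mult hb that) simp
  define F where "F k w = g (x \<otimes> \<phi> k w)" for k w
  \<comment> \<open>\<open>L\<close> is bounded for the uniform norm on \<open>C\<close>, off which
    \<open>h\<close> vanishes, so the integral over \<open>K\<close> can be pulled through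
    it.\<close>
  define L where "L u = I (\<lambda>w. h w * u w)" for u
  have Fb: "bounded_fun (F k)" if "k \<in> topspace S" for k
    using g(2) x that unfolding bounded_fun_def F_def by (intro exI[of _ 1]) (auto simp: K.topspace_eq_carrier)
  have avF: "(LINT k|m. F k w) = f w * g x" if "w \<in> carrier G" for w
    using eig[OF x that] by (simp add: F_def)
  have avb: "bounded_fun (\<lambda>w. LINT k|m. F k w)"
  proof -
    have "bounded_fun (\<lambda>w. g x * f w)" by (rule bounded_fun_scale[OF fb])
    then show ?thesis unfolding bounded_fun_def using avF by (simp add: mult.commute)
  qed
  note ex = integral_exchange[where F = F and L = L and J = C and V = "{u. bounded_fun u}"
      and c = "B * Re (I (indicator C))"]
  have equi: "\<exists>U. openin S U \<and> k0 \<in> U \<and> (\<forall>k\<in>U. \<forall>i\<in>C. norm (F k i - F k0 i) \<le> e)"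
    if "e > 0" "k0 \<in> topspace S" for e k0
    using equicontinuous_on_compact[OF continuous_phi_compose[OF g(1) x] C(1) that] by (simp add: F_def)
  have lin: "L (\<lambda>i. \<Sum>p\<in>P. complex_of_real (w p) * F p i) = (\<Sum>p\<in>P. complex_of_real (w p) * L (F p))"
    if P: "finite P" "P \<subseteq> topspace S" for P and w :: "'k \<Rightarrow> real"
  proof -
    have "L (\<lambda>i. \<Sum>p\<in>P. complex_of_real (w p) * F p i) = I (\<lambda>i. \<Sum>p\<in>P. complex_of_real (w p) * (h i * F p i))"
      unfolding L_def by (simp add: sum_distrib_left mult.left_commute)
    also have "\<dots> = (\<Sum>p\<in>P. I (\<lambda>i. complex_of_real (w p) * (h i * F p i)))"
      using P Fb by (intro IF.I_sum[THEN conjunct2] compactly_supported_scale cs) auto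
    also have "\<dots> = (\<Sum>p\<in>P. complex_of_real (w p) * L (F p))"
      unfolding L_def using P Fb by (intro sum.cong refl IF.I_scale cs) auto
    finally show ?thesis .
  qed
  have bd: "norm (L u - L v) \<le> B * Re (I (indicator C)) * e"
    if uv: "u \<in> {u. bounded_fun u}" "v \<in> {u. bounded_fun u}" "e \<ge> 0" "\<And>i. i \<in> C \<Longrightarrow> norm (u i - v i) \<le> e" for u v e
  proof -
    have "norm (I (\<lambda>w. h w * u w - h w * v w)) \<le> B * e * Re (I (indicator C))"
    proof (rule IF.I_bound[OF _ C(1)])
      have "bounded_fun (\<lambda>w. u w - v w)" using bounded_fun_diff uv by simp
      from cs[OF this] show "compactly_supported (\<lambda>w. h w * u w - h w * v w)" by (simp add: right_diff_distrib)
      fix w assume w: "w \<in> C"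
      have "norm (h w * u w - h w * v w) = norm (h w) * norm (u w - v w)"
        by (simp add: norm_mult[symmetric] right_diff_distrib)
      also have "\<dots> \<le> B * e" using B Cc w uv(4)[OF w] B0 by (intro mult_mono) auto
      finally show "norm (h w * u w - h w * v w) \<le> B * e" .
    qed (simp add: C(2))
    then show ?thesis
      unfolding L_def using IF.I_diff[OF cs cs, of u v] uv by (simp add: mult.assoc mult.commute[of e])
  qed
  have sums: "(\<lambda>i. \<Sum>p\<in>P. complex_of_real (w p) * F p i) \<in> {u. bounded_fun u}"
    if "finite P" "P \<subseteq> topspace S" for P and w :: "'k \<Rightarrow> real"
    using that Fb by (auto intro!: bounded_fun_sum bounded_fun_scale)
  have e1: "continuous_map S euclidean (\<lambda>k. L (F k))"
    by (rule ex(1)) (use equi lin bd sums Fb avb in auto)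
  have e2: "L (\<lambda>w. LINT k|m. F k w) = (LINT k|m. L (F k))"
    by (rule ex(2)) (use equi lin bd sums Fb avb in auto)
  have tr: "L (F k) = I (\<lambda>w. h (inv x \<otimes> \<phi> k w) * g (\<phi> k w))" if k: "k \<in> carrier K" for k
  proof -
    let ?y = "\<phi> (inv\<^bsub>K\<^esub> k) (inv x)"
    have y: "?y \<in> carrier G" using k x by simp
    have c: "compactly_supported (\<lambda>w. h w * F k w)" using Fb k by (intro cs) (simp add: K.topspace_eq_carrier)
    have "L (F k) = I (\<lambda>w. (\<lambda>w. h w * F k w) (?y \<otimes> w))"
      unfolding L_def by (rule IF.I_translate[OF c y, symmetric])
    also have "\<dots> = I (\<lambda>w. h (inv x \<otimes> \<phi> k w) * g (\<phi> k w))"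
    proof (rule IF.I_cong)
      have eq: "h (?y \<otimes> w) * F k (?y \<otimes> w) = h (inv x \<otimes> \<phi> k w) * g (\<phi> k w)" if w: "w \<in> carrier G" for w
      proof -
        have p: "\<phi> k (?y \<otimes> w) = inv x \<otimes> \<phi> k w" using k w x by (simp add: phi_mult)
        have "h (?y \<otimes> w) = h (inv x \<otimes> \<phi> k w)" using hK[OF k, of "?y \<otimes> w"] y w p by simp
        moreover have "F k (?y \<otimes> w) = g (\<phi> k w)"
          unfolding F_def p using k w x by (simp add: m_assoc[symmetric])
        ultimately show ?thesis by simp
      qed
      show 1: "compactly_supported (\<lambda>w. (\<lambda>w. h w * F k w) (?y \<otimes> w))"
        by (rule compactly_supported_translate[OF c y])
      show "(\<lambda>w. h w * F k w) (?y \<otimes> w) = h (inv x \<otimes> \<phi> k w) * g (\<phi> k w)" if "w \<in> carrier G" for w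
        using eq[OF that] .
      show "compactly_supported (\<lambda>w. h (inv x \<otimes> \<phi> k w) * g (\<phi> k w))"
        using 1 eq unfolding compactly_supported_def bounded_fun_def by simp
    qed
    finally show ?thesis .
  qed
  show "continuous_map S euclidean (\<lambda>k. I (\<lambda>w. h (inv x \<otimes> \<phi> k w) * g (\<phi> k w)))"
    by (rule continuous_map_eq[OF e1]) (simp add: tr K.topspace_eq_carrier)
  have "L (\<lambda>w. LINT k|m. F k w) = I (\<lambda>w. g x * (h w * f w))"
    unfolding L_def
  proof (rule IF.I_cong)
    show "compactly_supported (\<lambda>w. h w * (LINT k|m. F k w))" by (rule cs[OF avb])
    show "compactly_supported (\<lambda>w. g x * (h w * f w))" by (intro compactly_supported_scale cs fb)
  qed (simp add: avF)
  also have "\<dots> = g x * I (\<lambda>w. h w * f w)" by (rule IF.I_scale[OF cs[OF fb]])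
  finally have "I (\<lambda>w. h w * f w) * g x = (LINT k|m. L (F k))" using e2 by (simp add: mult.commute)
  also have "\<dots> = (LINT k|m. I (\<lambda>w. h (inv x \<otimes> \<phi> k w) * g (\<phi> k w)))"
    by (intro Bochner_Integration.integral_cong refl) (simp add: tr space_m')
  finally show "I (\<lambda>w. h w * f w) * g x = (LINT k|m. I (\<lambda>w. h (inv x \<otimes> \<phi> k w) * g (\<phi> k w)))" .
qed

text \<open>By the smoothing formula, \<open>I (h f) * (g z - g \<one>)\<close> is an average of
  \<open>I\<close> applied to a difference of translates of \<open>h\<close> times a function
  bounded by 1; so the modulus of continuity of \<open>g\<close> is that of \<open>h\<close>. The
  neighbourhood depends only on \<open>I\<close>, \<open>h\<close>, \<open>C\<close>,
  \<open>c0\<close> and \<open>e\<close>: this uniformity in \<open>f\<close> and \<open>g\<close>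
  feeds the two compactness arguments below, one for fixed \<open>f\<close> and one for varying
  \<open>f\<close>.\<close>

lemma eigenfunctions_equicontinuous:
  assumes I: "invariant_functional G T I" and h: "continuous_map T euclidean h"
    and hK: "\<And>k x. k \<in> carrier K \<Longrightarrow> x \<in> carrier G \<Longrightarrow> h (\<phi> k x) = h x"
    and C: "compactin T C" "\<And>x. x \<in> carrier G - C \<Longrightarrow> h x = 0"
    and c0: "c0 > 0" and e: "e > 0"
  obtains N where "openin T N" "\<one> \<in> N"
    "\<And>f g x z. bounded_fun f \<Longrightarrow> norm (I (\<lambda>w. h w * f w)) \<ge> c0 \<Longrightarrow> continuous_map T euclidean g \<Longrightarrow>
      (\<And>x. x \<in> carrier G \<Longrightarrow> norm (g x) \<le> 1) \<Longrightarrow>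
      (\<And>x w. x \<in> carrier G \<Longrightarrow> w \<in> carrier G \<Longrightarrow> (LINT k|m. g (x \<otimes> \<phi> k w)) = f w * g x) \<Longrightarrow>
      x \<in> carrier G \<Longrightarrow> z \<in> N \<Longrightarrow> norm (g (x \<otimes> z) - g x) \<le> e"
proof -
  interpret IF: invariant_functional G T I by (rule I)
  have Cc: "C \<subseteq> carrier G" using compactin_subset_topspace[OF C(1)] by (simp add: topspace_eq_carrier)
  have ot: "openin T (topspace T)" by (rule openin_topspace)
  have onet: "\<one> \<in> topspace T" by (simp add: topspace_eq_carrier)
  obtain V W where VW: "openin T V" "\<one> \<in> V" "V \<subseteq> W" "compactin T W" "W \<subseteq> topspace T"
    by (rule compact_nbhd[OF ot onet]) (rule that)
  have Wc: "W \<subseteq> carrier G" using VW(5) by (simp add: topspace_eq_carrier)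
  \<comment> \<open>For \<open>z\<close> in \<open>W\<close>, the value
    \<open>h (inv z \<otimes> \<phi> k w)\<close> is nonzero only if \<open>\<phi> k w\<close> lies
    in \<open>WC\<close>, hence only if \<open>w\<close> lies in its saturation \<open>C'\<close>.
    One compact set serves all \<open>z\<close> and \<open>k\<close>.\<close>
  define WC where "WC = (\<lambda>(x, y). x \<otimes> y) ` (W \<times> C)"
  have WCc: "WC \<subseteq> carrier G" using Wc Cc by (auto simp: WC_def)
  define C' where "C' = sat WC"
  have C': "compactin T C'"
    unfolding C'_def WC_def by (intro compactin_sat compactin_mult VW(4) C(1))
  have C'c: "C' \<subseteq> carrier G" using compactin_subset_topspace[OF C'] by (simp add: topspace_eq_carrier)
  have inC': "w \<in> C'" if z: "z \<in> W" and k: "k \<in> carrier K" and w: "w \<in> carrier G"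
    and n: "h (inv z \<otimes> \<phi> k w) \<noteq> 0" for z k w
  proof -
    have zc: "z \<in> carrier G" using z Wc by blast
    have "inv z \<otimes> \<phi> k w \<in> C" using C(2) n zc k w by (meson Diff_iff inv_closed m_closed phi_closed)
    then have "z \<otimes> (inv z \<otimes> \<phi> k w) \<in> WC" unfolding WC_def using z by force
    then have "\<phi> k w \<in> WC" using zc k w by (simp add: m_assoc[symmetric])
    then have "\<phi> (inv\<^bsub>K\<^esub> k) (\<phi> k w) \<in> C'" unfolding C'_def using k by (intro sat_phi[OF WCc]) auto
    then show ?thesis using k w by simp
  qed
  define M where "M = Re (I (indicator C')) + 1"
  have M: "M > 0" using IF.I_indicator_nonneg[OF C'] by (simp add: M_def)
  \<comment> \<open>The variation of \<open>h\<close> permitted on \<open>C'\<close>: applying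
    \<open>I\<close> multiplies it by at most \<open>M\<close>, dividing by \<open>c0\<close> then
    gives \<open>e\<close>.\<close>
  define d where "d = e * c0 / M"
  have d: "d > 0" using e c0 M by (simp add: d_def)
  have "continuous_map (prod_topology T T) euclidean (\<lambda>(z, v). h (inv z \<otimes> v))"
  proof -
    have "continuous_map (prod_topology T T) T (\<lambda>p. inv fst p \<otimes> snd p)"
      by (intro continuous_map_mult continuous_map_inv continuous_map_fst continuous_map_snd)
    from continuous_map_compose[OF this h] show ?thesis by (simp add: o_def case_prod_unfold)
  qed
  from equicontinuous_on_compact[OF this C' d onet] obtain U where U: "openin T U" "\<one> \<in> U"
    "\<forall>z\<in>U. \<forall>v\<in>C'. norm (h (inv z \<otimes> v) - h (inv \<one> \<otimes> v)) \<le> d" by (elim exE conjE) (rule that)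
  have oneW: "\<one> \<in> W" using VW by blast
  \<comment> \<open>It is enough to work at the unit: \<open>y \<mapsto> g (x \<otimes> y)\<close>
    satisfies the same bound and the same equation with the same eigenvalue
    \<open>f\<close>.\<close>
  have at_one: "norm (g z - g \<one>) \<le> e"
    if fb: "bounded_fun f" and c: "norm (I (\<lambda>w. h w * f w)) \<ge> c0" and g: "continuous_map T euclidean g"
      "\<And>x. x \<in> carrier G \<Longrightarrow> norm (g x) \<le> 1"
      and eig: "\<And>x w. x \<in> carrier G \<Longrightarrow> w \<in> carrier G \<Longrightarrow> (LINT k|m. g (x \<otimes> \<phi> k w)) = f w * g x"
      and z: "z \<in> U \<inter> V" for f g z
  proof -
    have zW: "z \<in> W" and zU: "z \<in> U" and zc: "z \<in> carrier G" using z VW(3) Wc by auto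
    define G1 where "G1 x k = I (\<lambda>w. h (inv x \<otimes> \<phi> k w) * g (\<phi> k w))" for x k
    have sm1: "continuous_map S euclidean (G1 x)" if x: "x \<in> carrier G" for x
      unfolding G1_def[abs_def]
      by (rule eigenfunction_smoothing(1)[OF I h _ C(1) _ g(1) _ _ fb x]; (rule hK C(2) g(2) eig; assumption))
    have sm2: "I (\<lambda>w. h w * f w) * g x = (LINT k|m. G1 x k)" if x: "x \<in> carrier G" for x
      unfolding G1_def[abs_def]
      by (rule eigenfunction_smoothing(2)[OF I h _ C(1) _ g(1) _ _ fb x]; (rule hK C(2) g(2) eig; assumption))
    have gb: "bounded_fun (\<lambda>w. g (\<phi> k w))" if "k \<in> carrier K" for k
      unfolding bounded_fun_def using g(2) that by (intro exI[of _ 1]) auto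
    have hb: "bounded_fun h" by (rule bounded_fun_compact_support[OF h C])
    have cs: "compactly_supported (\<lambda>w. h (inv x \<otimes> \<phi> k w) * g (\<phi> k w))"
      if xW: "x \<in> W" and k: "k \<in> carrier K" for x k
    proof (rule compactly_supported_off[OF C'])
      have xc: "x \<in> carrier G" using xW Wc by blast
      have "bounded_fun (\<lambda>w. h (inv x \<otimes> \<phi> k w))"
        using hb xc k unfolding bounded_fun_def by (meson inv_closed m_closed phi_closed)
      then show "bounded_fun (\<lambda>w. h (inv x \<otimes> \<phi> k w) * g (\<phi> k w))" by (rule bounded_fun_mult[OF _ gb[OF k]])
      fix w assume "w \<in> carrier G - C'"
      then show "h (inv x \<otimes> \<phi> k w) * g (\<phi> k w) = 0" using inC'[OF xW k, of w] by auto
    qed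
    have bound: "norm (G1 z k - G1 \<one> k) \<le> d * M" if k: "k \<in> carrier K" for k
    proof -
      have kC': "\<phi> k w \<in> C'" if "w \<in> C'" for w unfolding C'_def using sat_invariant[OF WCc k] that by (simp add: C'_def)
      have "norm (I (\<lambda>w. h (inv z \<otimes> \<phi> k w) * g (\<phi> k w) - h (inv \<one> \<otimes> \<phi> k w) * g (\<phi> k w))) \<le> d * Re (I (indicator C'))"
      proof (rule IF.I_bound[OF _ C'])
        have "compactly_supported (\<lambda>w. h (inv z \<otimes> \<phi> k w) * g (\<phi> k w) + (-1) * (h (inv \<one> \<otimes> \<phi> k w) * g (\<phi> k w)))"
          by (intro compactly_supported_add compactly_supported_scale cs zW oneW k)
        then show "compactly_supported (\<lambda>w. h (inv z \<otimes> \<phi> k w) * g (\<phi> k w) - h (inv \<one> \<otimes> \<phi> k w) * g (\<phi> k w))" by simp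
        fix w
        show "norm (h (inv z \<otimes> \<phi> k w) * g (\<phi> k w) - h (inv \<one> \<otimes> \<phi> k w) * g (\<phi> k w)) \<le> d" if w: "w \<in> C'"
        proof -
          have wc: "w \<in> carrier G" using w C'c by blast
          have "norm (h (inv z \<otimes> \<phi> k w) * g (\<phi> k w) - h (inv \<one> \<otimes> \<phi> k w) * g (\<phi> k w))
              = norm (h (inv z \<otimes> \<phi> k w) - h (inv \<one> \<otimes> \<phi> k w)) * norm (g (\<phi> k w))"
            by (simp only: norm_mult[symmetric] left_diff_distrib)
          also have "\<dots> \<le> d * 1"
            using bspec[OF bspec[OF U(3) zU] kC'[OF w]] g(2)[OF phi_closed[OF k wc]] d by (intro mult_mono) (assumption | simp)+
          finally show ?thesis by simp
        qed
        show "h (inv z \<otimes> \<phi> k w) * g (\<phi> k w) - h (inv \<one> \<otimes> \<phi> k w) * g (\<phi> k w) = 0" if "w \<in> carrier G - C'"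
        proof -
          have "h (inv z \<otimes> \<phi> k w) = 0" "h (inv \<one> \<otimes> \<phi> k w) = 0"
            using inC'[OF zW k, of w] inC'[OF oneW k, of w] that by blast+
          then show ?thesis by simp
        qed
      qed
      also have "\<dots> \<le> d * M" using d by (simp add: M_def)
      finally show ?thesis
        unfolding G1_def IF.I_diff[OF cs[OF zW k] cs[OF oneW k]] .
    qed
    have ci: "continuous_map S euclidean (G1 z)" "continuous_map S euclidean (G1 \<one>)"
      using sm1[OF zc] sm1[OF one_closed] by auto
    have cd: "continuous_map S euclidean (\<lambda>k. G1 z k - G1 \<one> k)"
      by (rule continuous_map_diff[OF ci])
    have "I (\<lambda>w. h w * f w) * (g z - g \<one>) = (LINT k|m. G1 z k) - (LINT k|m. G1 \<one> k)"
      unfolding right_diff_distrib sm2[OF zc] sm2[OF one_closed] ..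
    also have "\<dots> = (LINT k|m. G1 z k - G1 \<one> k)"
      using integrable_continuous[OF ci(1)] integrable_continuous[OF ci(2)] by simp
    finally have "norm (I (\<lambda>w. h w * f w)) * norm (g z - g \<one>) = norm (LINT k|m. G1 z k - G1 \<one> k)"
      by (simp only: norm_mult[symmetric])
    also have "\<dots> \<le> d * M" by (rule norm_average_le[OF bound cd])
    also have "\<dots> = e * c0" using M by (simp add: d_def)
    finally have "norm (I (\<lambda>w. h w * f w)) * norm (g z - g \<one>) \<le> e * c0" .
    moreover have "c0 * norm (g z - g \<one>) \<le> norm (I (\<lambda>w. h w * f w)) * norm (g z - g \<one>)"
      using c by (rule mult_right_mono) simp
    ultimately have "c0 * norm (g z - g \<one>) \<le> c0 * e" by (simp add: mult.commute)
    then show ?thesis using c0 by simp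
  qed
  show thesis
  proof (rule that[of "U \<inter> V"])
    show "openin T (U \<inter> V)" "\<one> \<in> U \<inter> V" using U VW by auto
    fix f g x z
    assume fb: "bounded_fun f" and c: "norm (I (\<lambda>w. h w * f w)) \<ge> c0" and g: "continuous_map T euclidean g"
      "\<And>x. x \<in> carrier G \<Longrightarrow> norm (g x) \<le> 1"
      and eig: "\<And>x w. x \<in> carrier G \<Longrightarrow> w \<in> carrier G \<Longrightarrow> (LINT k|m. g (x \<otimes> \<phi> k w)) = f w * g x"
      and x: "x \<in> carrier G" and z: "z \<in> U \<inter> V"
    have "continuous_map T T (\<lambda>y. x \<otimes> y)" using x by (intro continuous_map_mult) (auto simp: topspace_eq_carrier)
    from continuous_map_compose[OF this g(1)] have gx: "continuous_map T euclidean (\<lambda>y. g (x \<otimes> y))" by (simp add: o_def)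
    have "(LINT k|m. g (x \<otimes> (x' \<otimes> \<phi> k w))) = f w * g (x \<otimes> x')" if "x' \<in> carrier G" "w \<in> carrier G" for x' w
    proof -
      have "(LINT k|m. g (x \<otimes> (x' \<otimes> \<phi> k w))) = (LINT k|m. g ((x \<otimes> x') \<otimes> \<phi> k w))"
        using x that by (intro Bochner_Integration.integral_cong refl) (simp add: space_m' m_assoc)
      then show ?thesis using eig[of "x \<otimes> x'" w] x that by simp
    qed
    from at_one[OF fb c gx _ this z] show "norm (g (x \<otimes> z) - g x) \<le> e" using g(2) x by simp
  qed
qed

end

section \<open>Bounded spherical functions are positive definite\<close>

context lca_group
begin

primrec power_set :: "'a set \<Rightarrow> nat \<Rightarrow> 'a set" where
  "power_set V 0 = {\<one>}"
| "power_set V (Suc n) = (\<lambda>(x, y). x \<otimes> y) ` (V \<times> power_set V n)"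

lemma power_set_carrier: "V \<subseteq> carrier G \<Longrightarrow> power_set V n \<subseteq> carrier G"
  by (induction n) auto

lemma compactin_power_set: "compactin T V \<Longrightarrow> compactin T (power_set V n)"
  by (induction n) (simp_all add: compactin_mult topspace_eq_carrier)

lemma power_set_mult: "v \<in> V \<Longrightarrow> y \<in> power_set V n \<Longrightarrow> v \<otimes> y \<in> power_set V (Suc n)"
  by force

lemma power_set_mono:
  assumes "V \<subseteq> carrier G" "\<one> \<in> V"
  shows "power_set V n \<subseteq> power_set V (Suc n)"
proof
  fix y assume y: "y \<in> power_set V n"
  then have "y \<in> carrier G" using power_set_carrier[OF assms(1), of n] by blast
  then have "y = \<one> \<otimes> y" by simp
  then show "y \<in> power_set V (Suc n)" using power_set_mult[OF assms(2) y] by metis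
qed

lemma power_set_1: "V \<subseteq> carrier G \<Longrightarrow> power_set V (Suc 0) = V"
  by (force simp: image_iff)

text \<open>Products of powers of the listed elements with each exponent at most \<open>n\<close>,
  so that their number is polynomial in \<open>n\<close> of degree the length of the list.\<close>

primrec monomials :: "'a list \<Rightarrow> nat \<Rightarrow> 'a set" where
  "monomials [] n = {\<one>}"
| "monomials (a # as) n = (\<lambda>(i, y). a [^] (i::nat) \<otimes> y) ` ({..n} \<times> monomials as n)"

lemma monomials_finite: "finite (monomials as n) \<and> card (monomials as n) \<le> (n + 1) ^ length as"
proof (induction as)
  case (Cons a as)
  have "card (monomials (a # as) n) \<le> card ({..n} \<times> monomials as n)"
    unfolding monomials.simps by (rule card_image_le) (use Cons in simp)
  also have "\<dots> = (n + 1) * card (monomials as n)" by (simp add: card_cartesian_product)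
  also have "\<dots> \<le> (n + 1) * (n + 1) ^ length as"
    by (rule mult_le_mono2) (use Cons in simp)
  finally show ?case using Cons by simp
qed simp

lemma monomials_carrier: "set as \<subseteq> carrier G \<Longrightarrow> monomials as n \<subseteq> carrier G"
  by (induction as) auto

lemma monomials_mono: "n \<le> n' \<Longrightarrow> monomials as n \<subseteq> monomials as n'"
  by (induction as) (auto intro!: image_mono Sigma_mono)

text \<open>Commutativity lets the new factor join the power of the same generator, raising a single
  exponent by one.\<close>

lemma monomials_mult:
  "set as \<subseteq> carrier G \<Longrightarrow> b \<in> set as \<Longrightarrow> g \<in> monomials as n \<Longrightarrow> b \<otimes> g \<in> monomials as (Suc n)"
proof (induction as arbitrary: g)
  case (Cons a as)
  obtain i y where iy: "i \<le> n" "y \<in> monomials as n" "g = a [^] i \<otimes> y" using Cons.prems(3) by auto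
  have c: "a \<in> carrier G" "b \<in> carrier G" "y \<in> carrier G"
    using Cons.prems iy(2) monomials_carrier[of as n] by auto
  show ?case
  proof (cases "b \<in> set as")
    case True
    then have "b \<otimes> y \<in> monomials as (Suc n)" using Cons.IH[OF _ True iy(2)] Cons.prems by auto
    moreover have "b \<otimes> g = a [^] i \<otimes> (b \<otimes> y)" using c iy(3) by (simp add: m_lcomm)
    ultimately show ?thesis using iy(1) by (force simp: image_iff)
  next
    case False
    then have "b = a" using Cons.prems(2) by auto
    then have "b \<otimes> g = (a \<otimes> a [^] i) \<otimes> y" using c iy(3) by (simp add: m_assoc)
    then have "b \<otimes> g = a [^] Suc i \<otimes> y" by (simp only: nat_pow_Suc2[OF c(1)])
    moreover have "y \<in> monomials as (Suc n)" using monomials_mono[of n "Suc n" as] iy(2) by auto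
    ultimately show ?thesis using iy(1) by (force simp: image_iff)
  qed
qed simp

text \<open>\<open>V\<close> times \<open>V\<close> is covered by finitely many translates of
  \<open>V\<close>. Each further factor from \<open>V\<close> can therefore be traded for one of
  finitely many elements \<open>s\<close>, and in a commutative group the collected elements form a
  monomial. So \<open>n + 1\<close> factors fit into polynomially many translates of
  \<open>V\<close>.\<close>

lemma power_set_growth:
  assumes V: "compactin T V" and U: "openin T U" "\<one> \<in> U" "U \<subseteq> V"
  obtains as where "set as \<subseteq> carrier G"
    "\<And>n y. y \<in> power_set V (Suc n) \<Longrightarrow> \<exists>g\<in>monomials as n. inv g \<otimes> y \<in> V"
proof -
  have Vc: "V \<subseteq> carrier G" using compactin_subset_topspace[OF V] by (simp add: topspace_eq_carrier)
  have VV: "compactin T ((\<lambda>(x, y). x \<otimes> y) ` (V \<times> V))" by (rule compactin_mult[OF V V])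
  obtain X where X: "finite X" "X \<subseteq> carrier G" "\<And>x. x \<in> (\<lambda>(x, y). x \<otimes> y) ` (V \<times> V) \<Longrightarrow> \<exists>s\<in>X. inv s \<otimes> x \<in> U"
    by (rule compactin_translate_cover[OF VV U(1,2)]) (rule that)
  obtain as where as: "set as = X" using finite_list[OF X(1)] by blast
  have one: "\<one> \<in> monomials as n" for as n
  proof (induction as)
    case (Cons a as)
    then show ?case by (force intro!: image_eqI[of _ _ "(0, \<one>)"])
  qed simp
  have "\<exists>g\<in>monomials as n. inv g \<otimes> y \<in> V" if "y \<in> power_set V (Suc n)" for n y
    using that
  proof (induction n arbitrary: y)
    case 0
    then have "inv \<one> \<otimes> y \<in> V" using Vc by auto
    then show ?case using one by blast
  next
    case (Suc n)
    then obtain v y' where vy: "v \<in> V" "y' \<in> power_set V (Suc n)" "y = v \<otimes> y'" by auto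
    obtain g where g: "g \<in> monomials as n" "inv g \<otimes> y' \<in> V" using Suc.IH[OF vy(2)] by blast
    have gc: "g \<in> carrier G" using g(1) monomials_carrier[of as n] as X(2) by auto
    have y'c: "y' \<in> carrier G" using power_set_carrier[OF Vc, of "Suc n"] vy(2) by blast
    have vc: "v \<in> carrier G" using vy(1) Vc by blast
    have "v \<otimes> (inv g \<otimes> y') \<in> (\<lambda>(x, y). x \<otimes> y) ` (V \<times> V)" using vy(1) g(2) by force
    then obtain s where s: "s \<in> X" "inv s \<otimes> (v \<otimes> (inv g \<otimes> y')) \<in> U" using X(3) by blast
    have sc: "s \<in> carrier G" using s(1) X(2) by blast
    have "inv (s \<otimes> g) \<otimes> y = inv s \<otimes> (v \<otimes> (inv g \<otimes> y'))"
      using sc gc vc y'c vy(3) by (simp add: inv_mult m_ac)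
    then have "inv (s \<otimes> g) \<otimes> y \<in> V" using s(2) U(3) by auto
    moreover have "s \<otimes> g \<in> monomials as (Suc n)" using monomials_mult[OF _ _ g(1)] as X(2) s(1) by auto
    ultimately show ?case by blast
  qed
  then show thesis using that[of as] as X(2) by blast
qed

declare power_set.simps [simp del]

end

text \<open>If every step of length 4 multiplied \<open>s\<close> by more than \<open>1 + e\<close>,
  then \<open>s\<close> would grow exponentially along \<open>1 + 4 * q\<close>, against the
  polynomial bound. The step length matches the boundary layer between the powers \<open>p\<close>
  and \<open>p + 4\<close> in the positivity estimate.\<close>

lemma polynomial_growth_step:
  fixes s :: "nat \<Rightarrow> real"
  assumes s0: "s 1 > 0" and b: "\<And>n. s (Suc n) \<le> B * (real n + 1) ^ r" and e: "e > 0"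
  shows "\<exists>p\<ge>1. s (p + 4) \<le> (1 + e) * s p"
proof (rule ccontr)
  assume n: "\<not> (\<exists>p\<ge>1. s (p + 4) \<le> (1 + e) * s p)"
  then have g: "(1 + e) * s p < s (p + 4)" if "p \<ge> 1" for p
    using that by (meson not_le)
  have low: "(1 + e) ^ q * s 1 \<le> s (1 + 4 * q)" for q
  proof (induction q)
    case (Suc q)
    have "(1 + e) ^ Suc q * s 1 \<le> (1 + e) * s (1 + 4 * q)"
      using Suc e by (simp add: mult.assoc)
    also have "\<dots> \<le> s (1 + 4 * q + 4)" using g[of "1 + 4 * q"] by simp
    also have "1 + 4 * q + 4 = 1 + 4 * Suc q" by simp
    finally show ?case .
  qed simp
  have "((\<lambda>q::nat. (4 * real q + 1) ^ r / (1 + e) ^ q) \<longlonglongrightarrow> 0)"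
    using e by real_asymp
  moreover have "s 1 / (\<bar>B\<bar> + 1) > 0" using s0 by simp
  ultimately have "eventually (\<lambda>q. (4 * real q + 1) ^ r / (1 + e) ^ q < s 1 / (\<bar>B\<bar> + 1)) sequentially"
    by (rule order_tendstoD(2))
  then obtain q :: nat where q: "(4 * real q + 1) ^ r / (1 + e) ^ q < s 1 / (\<bar>B\<bar> + 1)"
    by (auto simp: eventually_sequentially)
  then have h1: "(4 * real q + 1) ^ r * (\<bar>B\<bar> + 1) < (1 + e) ^ q * s 1"
    using e by (simp add: field_simps)
  have h2: "(1 + e) ^ q * s 1 \<le> B * (4 * real q + 1) ^ r"
    using low[of q] b[of "4 * q"] by simp
  have h3: "B * (4 * real q + 1) ^ r \<le> (4 * real q + 1) ^ r * (\<bar>B\<bar> + 1)"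
    by (subst mult.commute) (intro mult_left_mono; simp)
  show False using h1 h2 h3 by (meson not_le order_trans)
qed

context topological_group
begin

text \<open>Since only the real part of the form is required to be nonnegative, Hermitian symmetry
  does not follow and is a clause of its own. Each instance concerns finitely many values of
  \<open>g\<close>, so the property is closed under pointwise convergence.\<close>

definition positive_definite :: "('a \<Rightarrow> complex) \<Rightarrow> bool" where
  "positive_definite g \<longleftrightarrow>
     (\<forall>n (x :: nat \<Rightarrow> 'a) c. (\<forall>i<n. x i \<in> carrier G) \<longrightarrow>
        0 \<le> Re (\<Sum>i<n. \<Sum>j<n. c i * cnj (c j) * g (x i \<otimes> inv (x j)))) \<and>
     (\<forall>x\<in>carrier G. g (inv x) = cnj (g x))"

end

context invariant_functional
begin

text \<open>The function \<open>y \<mapsto> \<Sum> c\<^sub>i c\<^sub>j\<^sup>* f(z\<^sub>i z\<^sub>j\<^sup>-\<^sup>1 y) f(y)\<^sup>*\<close> has, up to boundary terms of \<open>V\<^sup>p\<^sup>+\<^sup>2\<close>, the same integral as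
  \<open>\<bar>\<Sum> c\<^sub>i f(z\<^sub>i y)\<bar>\<^sup>2\<close>: translate the summand by \<open>z\<^sub>j\<close>.\<close>

lemma almost_positive:
  assumes fb: "bounded_fun f" and V: "compactin T V" "\<one> \<in> V"
    and z: "\<And>i. i < (n::nat) \<Longrightarrow> z i \<in> V" "\<And>i. i < n \<Longrightarrow> inv (z i) \<in> V"
  defines "s \<equiv> \<lambda>q. Re (I (\<lambda>y. (f y * cnj (f y)) * indicator (power_set V q) y))"
  shows "- ((\<Sum>i<n. norm (c i))\<^sup>2 * (s (p + 4) - s p))
    \<le> Re (\<Sum>i<n. \<Sum>j<n. c i * cnj (c j) *
        I (\<lambda>y. f (z i \<otimes> inv (z j) \<otimes> y) * (cnj (f y) * indicator (power_set V (p + 2)) y)))"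
proof -
  have Vc: "V \<subseteq> carrier G" using compactin_subset_topspace[OF V(1)] by (simp add: topspace_eq_carrier)
  have zc: "z i \<in> carrier G" if "i < n" for i using z(1)[OF that] Vc by blast
  let ?P = "power_set V"
  have Pc: "compactin T (?P q)" for q by (rule compactin_power_set[OF V(1)])
  have Pcar: "?P q \<subseteq> carrier G" for q by (rule power_set_carrier[OF Vc])
  have Pm: "?P q \<subseteq> ?P (Suc q)" for q by (rule power_set_mono[OF Vc V(2)])
  have move: "v \<otimes> y \<in> ?P (Suc q)" if "v \<in> V" "y \<in> ?P q" for v y q by (rule power_set_mult[OF that])
  define w where "w i j y = f (z i \<otimes> y) * cnj (f (z j \<otimes> y))" for i j y
  have fz: "bounded_fun (\<lambda>y. f (z i \<otimes> y))" if "i < n" for i by (rule bounded_fun_translate[OF fb zc[OF that]])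
  have wb: "bounded_fun (w i j)" if "i < n" "j < n" for i j
    unfolding w_def[abs_def] by (intro bounded_fun_mult bounded_fun_cnj fz that)
  let ?i = "\<lambda>q. indicator (?P q) :: 'a \<Rightarrow> complex"
  have csw: "compactly_supported (\<lambda>y. w i j y * ?i q y)" if "i < n" "j < n" for i j q
    by (rule compactly_supported_times_indicator[OF Pc wb[OF that]])
  have inP: "y \<in> ?P (Suc q)" if "z j \<otimes> y \<in> ?P q" "j < n" "y \<in> carrier G" for j y q
  proof -
    have "inv (z j) \<otimes> (z j \<otimes> y) \<in> ?P (Suc q)" by (rule move[OF z(2)[OF that(2)] that(1)])
    then show ?thesis using zc[OF that(2)] that(3) by (simp add: m_assoc[symmetric])
  qed
  have csz: "compactly_supported (\<lambda>y. w i j y * ?i (p + 2) (z j \<otimes> y))" if ij: "i < n" "j < n" for i j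
  proof (rule compactly_supported_off[OF Pc[of "p + 3"]])
    have "bounded_fun (\<lambda>y. ?i (p + 2) (z j \<otimes> y))" by (rule bounded_fun_translate[OF bounded_fun_indicator zc[OF ij(2)]])
    then show "bounded_fun (\<lambda>y. w i j y * ?i (p + 2) (z j \<otimes> y))" by (rule bounded_fun_mult[OF wb[OF ij]])
    fix y assume y: "y \<in> carrier G - ?P (p + 3)"
    then have "z j \<otimes> y \<notin> ?P (p + 2)" using inP[of j y "p + 2"] ij(2) by (auto simp: eval_nat_numeral)
    then show "w i j y * ?i (p + 2) (z j \<otimes> y) = 0" by simp
  qed
  \<comment> \<open>\<open>A\<close> integrates over the power \<open>p + 2\<close> itself,
    \<open>E\<close> collects the boundary error made by replacing that set by its
    translate.\<close>
  define A where "A i j = I (\<lambda>y. w i j y * ?i (p + 2) y)" for i j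
  define E where "E i j = I (\<lambda>y. w i j y * ?i (p + 2) (z j \<otimes> y) - w i j y * ?i (p + 2) y)" for i j
  have split: "I (\<lambda>y. f (z i \<otimes> inv (z j) \<otimes> y) * (cnj (f y) * ?i (p + 2) y)) = A i j + E i j"
    if ij: "i < n" "j < n" for i j
  proof -
    have zz: "z i \<otimes> inv (z j) \<in> carrier G" using zc ij by simp
    have c: "compactly_supported (\<lambda>y. f (z i \<otimes> inv (z j) \<otimes> y) * (cnj (f y) * ?i (p + 2) y))"
    proof -
      have "compactly_supported (\<lambda>y. (f (z i \<otimes> inv (z j) \<otimes> y) * cnj (f y)) * ?i (p + 2) y)"
        by (intro compactly_supported_times_indicator Pc bounded_fun_mult bounded_fun_cnj fb bounded_fun_translate[OF fb zz])
      then show ?thesis by (simp add: mult.assoc)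
    qed
    have "I (\<lambda>y. f (z i \<otimes> inv (z j) \<otimes> y) * (cnj (f y) * ?i (p + 2) y))
      = I (\<lambda>y. (\<lambda>y. f (z i \<otimes> inv (z j) \<otimes> y) * (cnj (f y) * ?i (p + 2) y)) (z j \<otimes> y))"
      by (rule I_translate[OF c zc[OF ij(2)], symmetric])
    also have "\<dots> = I (\<lambda>y. w i j y * ?i (p + 2) (z j \<otimes> y))"
    proof (rule I_cong[OF compactly_supported_translate[OF c zc[OF ij(2)]] csz[OF ij]])
      fix y assume y: "y \<in> carrier G"
      have "inv (z j) \<otimes> (z j \<otimes> y) = y" using zc[OF ij(2)] y by (simp add: m_assoc[symmetric])
      then have "z i \<otimes> inv (z j) \<otimes> (z j \<otimes> y) = z i \<otimes> y"
        using zc ij y by (simp add: m_assoc)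
      then show "(\<lambda>y. f (z i \<otimes> inv (z j) \<otimes> y) * (cnj (f y) * ?i (p + 2) y)) (z j \<otimes> y) = w i j y * ?i (p + 2) (z j \<otimes> y)"
        by (simp add: w_def)
    qed
    also have "\<dots> = A i j + E i j"
      unfolding A_def E_def I_diff[OF csz[OF ij] csw[OF ij]] by simp
    finally show ?thesis .
  qed
  \<comment> \<open>The main terms recombine into \<open>I\<close> of the squared modulus of
    \<open>g\<close>, restricted to one fixed set, which is nonnegative by monotonicity.\<close>
  have main: "0 \<le> Re (\<Sum>i<n. \<Sum>j<n. c i * cnj (c j) * A i j)"
  proof -
    define g where "g y = (\<Sum>i<n. c i * f (z i \<otimes> y))" for y
    have gb: "bounded_fun g" unfolding g_def[abs_def] by (intro bounded_fun_sum bounded_fun_scale fz) auto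
    have cg: "compactly_supported (\<lambda>y. (g y * cnj (g y)) * ?i (p + 2) y)"
      by (intro compactly_supported_times_indicator Pc bounded_fun_mult bounded_fun_cnj gb)
    have "(\<Sum>i<n. \<Sum>j<n. c i * cnj (c j) * A i j) = (\<Sum>i<n. \<Sum>j<n. I (\<lambda>y. c i * cnj (c j) * (w i j y * ?i (p + 2) y)))"
      unfolding A_def by (intro sum.cong refl I_scale[symmetric] csw) auto
    also have "\<dots> = (\<Sum>i<n. I (\<lambda>y. \<Sum>j<n. c i * cnj (c j) * (w i j y * ?i (p + 2) y)))"
      by (intro sum.cong refl I_sum[THEN conjunct2, symmetric] compactly_supported_scale csw) auto
    also have "\<dots> = I (\<lambda>y. \<Sum>i<n. \<Sum>j<n. c i * cnj (c j) * (w i j y * ?i (p + 2) y))"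
      by (intro I_sum[THEN conjunct2, symmetric] I_sum[THEN conjunct1] compactly_supported_scale csw) auto
    also have "(\<lambda>y. \<Sum>i<n. \<Sum>j<n. c i * cnj (c j) * (w i j y * ?i (p + 2) y)) = (\<lambda>y. (g y * cnj (g y)) * ?i (p + 2) y)"
    proof
      fix y
      have "g y * cnj (g y) = (\<Sum>i<n. \<Sum>j<n. (c i * f (z i \<otimes> y)) * (cnj (c j) * cnj (f (z j \<otimes> y))))"
        by (simp only: g_def cnj_sum complex_cnj_mult sum_product)
      then have "(g y * cnj (g y)) * ?i (p + 2) y =
          (\<Sum>i<n. \<Sum>j<n. ((c i * f (z i \<otimes> y)) * (cnj (c j) * cnj (f (z j \<otimes> y)))) * ?i (p + 2) y)"
        by (simp only: sum_distrib_right)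
      also have "\<dots> = (\<Sum>i<n. \<Sum>j<n. c i * cnj (c j) * (w i j y * ?i (p + 2) y))"
        by (intro sum.cong refl) (simp add: w_def)
      finally show "(\<Sum>i<n. \<Sum>j<n. c i * cnj (c j) * (w i j y * ?i (p + 2) y)) = (g y * cnj (g y)) * ?i (p + 2) y"
        by (rule sym)
    qed
    finally have eq: "(\<Sum>i<n. \<Sum>j<n. c i * cnj (c j) * A i j) = I (\<lambda>y. (g y * cnj (g y)) * ?i (p + 2) y)" .
    have "norm (I (\<lambda>y. (g y * cnj (g y)) * ?i (p + 2) y)) \<le> Re (I (\<lambda>y. (g y * cnj (g y)) * ?i (p + 2) y))"
      by (rule I_mono[OF cg cg]) (auto simp: indicator_def norm_mult complex_norm_square[symmetric] power2_eq_square)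
    then show ?thesis unfolding eq using norm_ge_zero order_trans by blast
  qed
  have mono2: "?P q \<subseteq> ?P (q + 2)" for q using Pm[of q] Pm[of "Suc q"] by auto
  have sq_i: "compactly_supported (\<lambda>y. (f y * cnj (f y)) * ?i q y)" for q
    by (intro compactly_supported_times_indicator Pc bounded_fun_mult bounded_fun_cnj fb)
  \<comment> \<open>Membership in the power \<open>p + 2\<close> can differ between \<open>y\<close>
    and \<open>z j \<otimes> y\<close> only for \<open>y\<close> in the power \<open>p + 3\<close>
    but not in \<open>p + 1\<close>. Translating this layer back by \<open>z i\<close> costs one
    more power on either side, hence the final bound with \<open>p + 4\<close> and
    \<open>p\<close>.\<close>
  define b where "b y = ?i (p + 3) y - ?i (p + 1) y" for y
  have bI: "I (\<lambda>y. (f (z i \<otimes> y) * cnj (f (z i \<otimes> y))) * b y) \<in> {t. Re t \<le> s (p + 4) - s p}"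
    and bcs: "compactly_supported (\<lambda>y. (f (z i \<otimes> y) * cnj (f (z i \<otimes> y))) * b y)" if i: "i < n" for i
  proof -
    have c1: "compactly_supported (\<lambda>y. (f (z i \<otimes> y) * cnj (f (z i \<otimes> y))) * ?i q y)" for q
      by (intro compactly_supported_times_indicator Pc bounded_fun_mult bounded_fun_cnj fz i)
    have "compactly_supported (\<lambda>y. (f (z i \<otimes> y) * cnj (f (z i \<otimes> y))) * ?i (p + 3) y
        + (-1) * ((f (z i \<otimes> y) * cnj (f (z i \<otimes> y))) * ?i (p + 1) y))"
      by (intro compactly_supported_add compactly_supported_scale c1)
    then show cs: "compactly_supported (\<lambda>y. (f (z i \<otimes> y) * cnj (f (z i \<otimes> y))) * b y)"
      by (simp add: b_def right_diff_distrib)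
    have iz: "inv (z i) \<in> carrier G" using zc[OF i] by simp
    let ?u = "\<lambda>y. (f (z i \<otimes> y) * cnj (f (z i \<otimes> y))) * b y"
    let ?d = "\<lambda>y. (f y * cnj (f y)) * ?i (p + 4) y - (f y * cnj (f y)) * ?i p y"
    have dcs: "compactly_supported ?d"
    proof -
      have "compactly_supported (\<lambda>y. (f y * cnj (f y)) * ?i (p + 4) y + (-1) * ((f y * cnj (f y)) * ?i p y))"
        by (intro compactly_supported_add compactly_supported_scale sq_i)
      then show ?thesis by simp
    qed
    have "I ?u = I (\<lambda>y. ?u (inv (z i) \<otimes> y))" by (rule I_translate[OF cs iz, symmetric])
    moreover have "norm (I (\<lambda>y. ?u (inv (z i) \<otimes> y))) \<le> Re (I ?d)"
    proof (rule I_mono[OF compactly_supported_translate[OF cs iz] dcs])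
      fix y assume y: "y \<in> carrier G"
      have zy: "z i \<otimes> (inv (z i) \<otimes> y) = y" using zc[OF i] y by (simp add: m_assoc[symmetric])
      have iy: "inv (z i) \<otimes> y \<in> carrier G" using zc[OF i] y by simp
      have u1: "y \<in> ?P (p + 4)" if "inv (z i) \<otimes> y \<in> ?P (p + 3)"
        using move[OF z(1)[OF i] that] zy by (simp add: eval_nat_numeral)
      have u2: "inv (z i) \<otimes> y \<in> ?P (p + 1)" if "y \<in> ?P p"
        using move[OF z(2)[OF i] that] by simp
      have u3: "?P (p + 1) \<subseteq> ?P (p + 3)" using mono2[of "p + 1"] by (simp add: eval_nat_numeral)
      have u4: "?P p \<subseteq> ?P (p + 4)" using mono2[of p] mono2[of "p + 2"] by (simp add: eval_nat_numeral)
      have bb: "norm (b (inv (z i) \<otimes> y)) \<le> Re (?i (p + 4) y - ?i p y)"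
        using u1 u2 u3 u4 unfolding b_def by (auto simp: indicator_def)
      have "norm (?u (inv (z i) \<otimes> y)) = (norm (f y))\<^sup>2 * norm (b (inv (z i) \<otimes> y))"
        by (simp add: zy norm_mult power2_eq_square)
      also have "\<dots> \<le> (norm (f y))\<^sup>2 * Re (?i (p + 4) y - ?i p y)"
        by (intro mult_left_mono bb) simp
      also have "\<dots> = Re (?d y)"
        unfolding complex_norm_square[symmetric] right_diff_distrib[symmetric] by (simp add: indicator_def)
      finally show "norm (?u (inv (z i) \<otimes> y)) \<le> Re (?d y)" .
    qed
    moreover have "Re (I ?d) = s (p + 4) - s p"
      unfolding s_def I_diff[OF sq_i sq_i] by simp
    ultimately show "I ?u \<in> {t. Re t \<le> s (p + 4) - s p}"
      using complex_Re_le_cmod[of "I ?u"] by simp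
  qed
  have Eb: "norm (E i j) \<le> s (p + 4) - s p" if ij: "i < n" "j < n" for i j
  proof -
    let ?u = "\<lambda>i y. (f (z i \<otimes> y) * cnj (f (z i \<otimes> y))) * b y"
    have cs: "compactly_supported (\<lambda>y. ?u i y + ?u j y)" by (intro compactly_supported_add bcs ij)
    have ecs: "compactly_supported (\<lambda>y. w i j y * ?i (p + 2) (z j \<otimes> y) - w i j y * ?i (p + 2) y)"
    proof -
      have "compactly_supported (\<lambda>y. w i j y * ?i (p + 2) (z j \<otimes> y) + (-1) * (w i j y * ?i (p + 2) y))"
        by (intro compactly_supported_add compactly_supported_scale csz csw ij)
      then show ?thesis by simp
    qed
    have "norm (E i j) \<le> Re (I (\<lambda>y. complex_of_real (1/2) * (?u i y + ?u j y)))"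
      unfolding E_def
    proof (rule I_mono[OF ecs compactly_supported_scale[OF cs]])
      fix y assume y: "y \<in> carrier G"
      have v1: "z j \<otimes> y \<in> ?P (p + 2)" if "y \<in> ?P (p + 1)"
        using move[OF z(1)[OF ij(2)] that] by (simp add: eval_nat_numeral)
      have v2: "y \<in> ?P (p + 3)" if "z j \<otimes> y \<in> ?P (p + 2)"
        using inP[OF that ij(2) y] by (simp add: eval_nat_numeral)
      have v3: "?P (p + 1) \<subseteq> ?P (p + 2)" "?P (p + 2) \<subseteq> ?P (p + 3)"
        using Pm[of "p + 1"] Pm[of "p + 2"] by (simp_all add: eval_nat_numeral)
      have dd: "norm (?i (p + 2) (z j \<otimes> y) - ?i (p + 2) y) \<le> Re (b y)"
        using v1 v2 v3 unfolding b_def by (auto simp: indicator_def)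
      have b0: "0 \<le> Re (b y)" using dd norm_ge_zero order_trans by blast
      have bre: "b y = complex_of_real (Re (b y))" by (simp add: b_def indicator_def)
      have "norm (w i j y * ?i (p + 2) (z j \<otimes> y) - w i j y * ?i (p + 2) y) =
          (norm (f (z i \<otimes> y)) * norm (f (z j \<otimes> y))) * norm (?i (p + 2) (z j \<otimes> y) - ?i (p + 2) y)"
        unfolding right_diff_distrib[symmetric] norm_mult w_def by simp
      \<comment> \<open>The inequality between geometric and arithmetic mean separates the two
        translates of \<open>f\<close>, so that each can be moved back by its own
        \<open>z\<close>.\<close>
      also have "\<dots> \<le> (((norm (f (z i \<otimes> y)))\<^sup>2 + (norm (f (z j \<otimes> y)))\<^sup>2) / 2) * Re (b y)"
      proof (rule mult_mono[OF _ dd])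
        show "norm (f (z i \<otimes> y)) * norm (f (z j \<otimes> y)) \<le> ((norm (f (z i \<otimes> y)))\<^sup>2 + (norm (f (z j \<otimes> y)))\<^sup>2) / 2"
          using sum_squares_bound[of "norm (f (z i \<otimes> y))" "norm (f (z j \<otimes> y))"] by simp
      qed auto
      also have "\<dots> = Re (complex_of_real (1/2) * (?u i y + ?u j y))"
      proof -
        have "?u i y + ?u j y = complex_of_real (((norm (f (z i \<otimes> y)))\<^sup>2 + (norm (f (z j \<otimes> y)))\<^sup>2) * Re (b y))"
          unfolding complex_norm_square[symmetric] by (subst (1 2) bre) (simp add: distrib_right)
        then show ?thesis by simp
      qed
      finally show "norm (w i j y * ?i (p + 2) (z j \<otimes> y) - w i j y * ?i (p + 2) y)
          \<le> Re (complex_of_real (1/2) * (?u i y + ?u j y))" .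
    qed
    also have "\<dots> = (Re (I (?u i)) + Re (I (?u j))) / 2"
      unfolding I_scale[OF cs] I_add[OF bcs[OF ij(1)] bcs[OF ij(2)]] by simp
    also have "\<dots> \<le> s (p + 4) - s p" using bI[OF ij(1)] bI[OF ij(2)] by simp
    finally show ?thesis .
  qed
  have err: "norm (\<Sum>i<n. \<Sum>j<n. c i * cnj (c j) * E i j) \<le> (\<Sum>i<n. norm (c i))\<^sup>2 * (s (p + 4) - s p)"
  proof -
    have "norm (\<Sum>i<n. \<Sum>j<n. c i * cnj (c j) * E i j) \<le> (\<Sum>i<n. \<Sum>j<n. norm (c i) * norm (c j) * (s (p + 4) - s p))"
      using Eb by (intro sum_norm_le) (auto simp: norm_mult intro!: sum_norm_le mult_left_mono)
    also have "\<dots> = (\<Sum>i<n. norm (c i))\<^sup>2 * (s (p + 4) - s p)"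
      unfolding power2_eq_square sum_product by (simp only: sum_distrib_right)
    finally show ?thesis .
  qed
  have "(\<Sum>i<n. \<Sum>j<n. c i * cnj (c j) *
        I (\<lambda>y. f (z i \<otimes> inv (z j) \<otimes> y) * (cnj (f y) * ?i (p + 2) y)))
      = (\<Sum>i<n. \<Sum>j<n. c i * cnj (c j) * A i j) + (\<Sum>i<n. \<Sum>j<n. c i * cnj (c j) * E i j)"
  proof -
    have "(\<Sum>i<n. \<Sum>j<n. c i * cnj (c j) * I (\<lambda>y. f (z i \<otimes> inv (z j) \<otimes> y) * (cnj (f y) * ?i (p + 2) y)))
        = (\<Sum>i<n. \<Sum>j<n. c i * cnj (c j) * (A i j + E i j))"
      by (intro sum.cong refl arg_cong2[where f = "(*)"] split) auto
    then show ?thesis by (simp only: distrib_left sum.distrib)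
  qed
  then have "Re (\<Sum>i<n. \<Sum>j<n. c i * cnj (c j) *
        I (\<lambda>y. f (z i \<otimes> inv (z j) \<otimes> y) * (cnj (f y) * ?i (p + 2) y)))
      = Re (\<Sum>i<n. \<Sum>j<n. c i * cnj (c j) * A i j) + Re (\<Sum>i<n. \<Sum>j<n. c i * cnj (c j) * E i j)"
    by (simp only: plus_complex.sel)
  moreover have "- norm (\<Sum>i<n. \<Sum>j<n. c i * cnj (c j) * E i j) \<le> Re (\<Sum>i<n. \<Sum>j<n. c i * cnj (c j) * E i j)"
    using abs_Re_le_cmod[of "\<Sum>i<n. \<Sum>j<n. c i * cnj (c j) * E i j"] unfolding abs_le_iff by linarith
  ultimately show ?thesis using main err by linarith
qed

end

context lca_orbit
begin

text \<open>The restrictions to \<open>G\<close> of bounded spherical functions for the pair formed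
  by the semidirect product of \<open>G\<close> with \<open>K\<close> and its subgroup
  \<open>K\<close>, with Hermitian symmetry as last clause.\<close>

definition spherical :: "('a \<Rightarrow> complex) \<Rightarrow> bool" where
  "spherical f \<longleftrightarrow> continuous_map T euclidean f \<and> bounded_fun f \<and> f \<one> = 1 \<and>
     (\<forall>k\<in>carrier K. \<forall>x\<in>carrier G. f (\<phi> k x) = f x) \<and>
     (\<forall>x\<in>carrier G. \<forall>y\<in>carrier G. (LINT k|m. f (x \<otimes> \<phi> k y)) = f x * f y) \<and>
     (\<forall>x\<in>carrier G. f (inv x) = cnj (f x))"

text \<open>Apply \<open>almost_positive\<close> to the points \<open>\<phi> k (x i)\<close> and
  integrate over \<open>k\<close>. The functional equation turns the averaged translate of
  \<open>f\<close> into a multiple of \<open>f\<close>, so the form becomes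
  \<open>X * s (p + 2)\<close>, where \<open>X\<close> is the form to be bounded. The error is a
  constant times \<open>s (p + 4) - s p\<close>, and polynomial growth provides \<open>p\<close> for
  which it is negligible against \<open>s (p + 2)\<close>.\<close>

lemma spherical_positive_definite:
  assumes f: "spherical f"
  shows "positive_definite f"
  unfolding positive_definite_def
proof (intro conjI allI impI)
  have fc: "continuous_map T euclidean f" and fb: "bounded_fun f" and f1: "f \<one> = 1"
    and feq: "\<And>x y. x \<in> carrier G \<Longrightarrow> y \<in> carrier G \<Longrightarrow> (LINT k|m. f (x \<otimes> \<phi> k y)) = f x * f y"
    and finv: "\<forall>x\<in>carrier G. f (inv x) = cnj (f x)"
    using f by (auto simp: spherical_def)
  show "\<forall>x\<in>carrier G. f (inv x) = cnj (f x)" by (rule finv)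
  fix n and x :: "nat \<Rightarrow> 'a" and c :: "nat \<Rightarrow> complex"
  assume "\<forall>i<n. x i \<in> carrier G"
  then have x: "\<And>i. i < n \<Longrightarrow> x i \<in> carrier G" by blast
  have onet: "\<one> \<in> topspace T" by (simp add: topspace_eq_carrier)
  obtain U where U: "openin T U" "\<one> \<in> U" "\<And>y. y \<in> U \<Longrightarrow> norm (f y - f \<one>) < 1 / 2"
    by (rule continuous_map_norm_le[OF fc _ onet, of "1/2"]) (simp, rule that)
  obtain V0 W where W: "openin T V0" "\<one> \<in> V0" "V0 \<subseteq> W" "compactin T W" "W \<subseteq> U"
    by (rule compact_nbhd[OF U(1,2)]) (rule that)
  obtain I where I: "invariant_functional G T I" "Re (I (indicator W)) \<ge> 1"
    by (rule exists_invariant_functional[OF W(1-4)]) (rule that)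
  interpret IF: invariant_functional G T I by (rule I(1))
  define V1 where "V1 = W \<union> x ` {..<n}"
  \<comment> \<open>\<open>V\<close> has to contain all \<open>\<phi> k (x i)\<close> and their
    inverses, for every \<open>k\<close>, as the positivity estimate is used for each
    \<open>k\<close> with the same powers. \<open>W\<close> is included to make \<open>s 1\<close>
    positive.\<close>
  define V where "V = sat (V1 \<union> (\<lambda>y. inv y) ` V1)"
  have V1: "compactin T V1"
    unfolding V1_def using x by (intro compactin_Un W(4) finite_imp_compactin) (auto simp: topspace_eq_carrier)
  have V1c: "V1 \<subseteq> carrier G" using compactin_subset_topspace[OF V1] by (simp add: topspace_eq_carrier)
  have V2c: "V1 \<union> (\<lambda>y. inv y) ` V1 \<subseteq> carrier G" using V1c by auto
  have V: "compactin T V" unfolding V_def by (intro compactin_sat compactin_Un V1 compactin_inv)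
  have Vc: "V \<subseteq> carrier G" using compactin_subset_topspace[OF V] by (simp add: topspace_eq_carrier)
  have WV: "W \<subseteq> V" using sat_superset[OF V2c] by (auto simp: V_def V1_def)
  have xV: "\<phi> k (x i) \<in> V" "inv (\<phi> k (x i)) \<in> V" if "k \<in> carrier K" "i < n" for k i
  proof -
    show "\<phi> k (x i) \<in> V" unfolding V_def using that by (intro sat_phi[OF V2c]) (auto simp: V1_def)
    have "\<phi> k (inv (x i)) \<in> V" unfolding V_def using that by (intro sat_phi[OF V2c]) (auto simp: V1_def)
    then show "inv (\<phi> k (x i)) \<in> V" using phi_inverse that x by simp
  qed
  have oneV: "\<one> \<in> V" using W WV by blast
  define s where "s q = Re (I (\<lambda>y. (f y * cnj (f y)) * indicator (power_set V q) y))" for q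
  have Pc: "compactin T (power_set V q)" for q by (rule compactin_power_set[OF V])
  have cs: "compactly_supported (\<lambda>y. (f y * cnj (f y)) * indicator (power_set V q) y)" for q
    by (intro compactly_supported_times_indicator Pc bounded_fun_mult bounded_fun_cnj fb)
  \<comment> \<open>On \<open>W\<close> the modulus of \<open>f\<close> is at least 1/2, whence the
    factor 1/4 for its square.\<close>
  have s1: "s 1 > 0"
  proof -
    have ci: "compactly_supported (indicator W)" by (rule compactly_supported_indicator[OF W(4)])
    have "norm (I (\<lambda>y. complex_of_real (1/4) * indicator W y)) \<le> s 1"
      unfolding s_def
    proof (rule IF.I_mono[OF compactly_supported_scale[OF ci] cs])
      fix y assume y: "y \<in> carrier G"
      have P1: "power_set V 1 = V" using power_set_1[OF Vc] by simp
      show "norm (complex_of_real (1/4) * indicator W y) \<le> Re ((f y * cnj (f y)) * indicator (power_set V 1) y)"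
      proof (cases "y \<in> W")
        case True
        have "norm (1 - f y) < 1 / 2" using U(3) W(5) True f1 by (auto simp: norm_minus_commute)
        then have "1 / 2 \<le> norm (f y)" using norm_triangle_ineq2[of 1 "1 - f y"] by simp
        then have "(1 / 2)\<^sup>2 \<le> (norm (f y))\<^sup>2" by (intro power_mono) auto
        then show ?thesis using True WV unfolding P1 complex_norm_square[symmetric] by (auto simp: power2_eq_square)
      next
        case False
        then show ?thesis unfolding complex_norm_square[symmetric] by (simp add: indicator_def)
      qed
    qed
    moreover have "norm (I (\<lambda>y. complex_of_real (1/4) * indicator W y)) > 0"
      unfolding IF.I_scale[OF ci] using I(2) by auto
    ultimately show ?thesis by linarith
  qed
  obtain as where as: "set as \<subseteq> carrier G"
    "\<And>n y. y \<in> power_set V (Suc n) \<Longrightarrow> \<exists>g\<in>monomials as n. inv g \<otimes> y \<in> V"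
    by (rule power_set_growth[OF V W(1,2)]) (use W(3) WV in blast, rule that)
  obtain b where b: "\<forall>y\<in>carrier G. norm (f y) \<le> b" using fb by (auto simp: bounded_fun_def)
  define B where "B = b\<^sup>2 * Re (I (indicator V))"
  \<comment> \<open>The power \<open>q + 1\<close> is covered by the translates of \<open>V\<close>
    by the monomials; each contributes \<open>I (indicator V)\<close> by invariance, and the squared
    modulus of \<open>f\<close> is at most the square of \<open>b\<close>.\<close>
  have growth: "s (Suc q) \<le> B * (real q + 1) ^ length as" for q
  proof -
    let ?M = "monomials as q"
    have fin: "finite ?M" "card ?M \<le> (q + 1) ^ length as" using monomials_finite by auto
    have Mc: "?M \<subseteq> carrier G" by (rule monomials_carrier[OF as(1)])
    have ct: "compactly_supported (\<lambda>y. indicator V (inv g \<otimes> y))" if "g \<in> ?M" for g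
      using that Mc by (intro compactly_supported_translate[OF compactly_supported_indicator[OF V]]) auto
    have IS: "compactly_supported (\<lambda>y. \<Sum>g\<in>?M. indicator V (inv g \<otimes> y)) \<and>
        I (\<lambda>y. \<Sum>g\<in>?M. indicator V (inv g \<otimes> y)) = (\<Sum>g\<in>?M. I (\<lambda>y. indicator V (inv g \<otimes> y)))"
      by (rule IF.I_sum[OF fin(1)]) (rule ct)
    have cM: "compactly_supported (\<lambda>y. \<Sum>g\<in>?M. indicator V (inv g \<otimes> y))"
      by (rule IS[THEN conjunct1])
    have "norm (I (\<lambda>y. (f y * cnj (f y)) * indicator (power_set V (Suc q)) y))
        \<le> Re (I (\<lambda>y. complex_of_real (b\<^sup>2) * (\<Sum>g\<in>?M. indicator V (inv g \<otimes> y))))"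
    proof (rule IF.I_mono[OF cs compactly_supported_scale[OF cM]])
      fix y assume y: "y \<in> carrier G"
      have re: "Re (complex_of_real (b\<^sup>2) * (\<Sum>g\<in>?M. indicator V (inv g \<otimes> y))) = b\<^sup>2 * (\<Sum>g\<in>?M. indicat_real V (inv g \<otimes> y))"
      proof -
        have "(\<Sum>g\<in>?M. indicator V (inv g \<otimes> y)) = complex_of_real (\<Sum>g\<in>?M. indicat_real V (inv g \<otimes> y))"
          unfolding of_real_sum by (intro sum.cong refl) (simp add: indicator_def)
        then show ?thesis by (simp only: of_real_mult[symmetric] Re_complex_of_real)
      qed
      show "norm ((f y * cnj (f y)) * indicator (power_set V (Suc q)) y)
          \<le> Re (complex_of_real (b\<^sup>2) * (\<Sum>g\<in>?M. indicator V (inv g \<otimes> y)))"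
      proof (cases "y \<in> power_set V (Suc q)")
        case True
        obtain g where g: "g \<in> ?M" "inv g \<otimes> y \<in> V" using as(2)[OF True] by blast
        have "(1::real) \<le> (\<Sum>g\<in>?M. indicat_real V (inv g \<otimes> y))"
          using member_le_sum[of g ?M "\<lambda>g. indicat_real V (inv g \<otimes> y)"] g fin(1) by simp
        then have "b\<^sup>2 * 1 \<le> b\<^sup>2 * (\<Sum>g\<in>?M. indicat_real V (inv g \<otimes> y))" by (intro mult_left_mono) auto
        moreover have "norm ((f y * cnj (f y)) * indicator (power_set V (Suc q)) y) \<le> b\<^sup>2"
          using power_mono[OF bspec[OF b y] norm_ge_zero, of 2] True by (simp add: norm_mult power2_eq_square)
        ultimately show ?thesis unfolding re by linarith
      next
        case False
        have "0 \<le> b\<^sup>2 * (\<Sum>g\<in>?M. indicat_real V (inv g \<otimes> y))" by (intro mult_nonneg_nonneg sum_nonneg) auto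
        then show ?thesis unfolding re using False by simp
      qed
    qed
    also have "I (\<lambda>y. complex_of_real (b\<^sup>2) * (\<Sum>g\<in>?M. indicator V (inv g \<otimes> y))) = complex_of_real (b\<^sup>2) * (\<Sum>g\<in>?M. I (indicator V))"
    proof -
      have "(\<Sum>g\<in>?M. I (\<lambda>y. indicator V (inv g \<otimes> y))) = (\<Sum>g\<in>?M. I (indicator V))"
        using Mc by (intro sum.cong refl IF.I_translate compactly_supported_indicator V) auto
      then show ?thesis unfolding IF.I_scale[OF cM] IS[THEN conjunct2] by (simp only:)
    qed
    also have "Re (complex_of_real (b\<^sup>2) * (\<Sum>g\<in>?M. I (indicator V))) = B * card ?M"
      by (simp add: B_def)
    also have "\<dots> \<le> B * (real q + 1) ^ length as"
    proof (rule mult_left_mono)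
      have "real (card ?M) \<le> real ((q + 1) ^ length as)" using fin(2) by (rule of_nat_mono)
      then show "real (card ?M) \<le> (real q + 1) ^ length as" by (simp add: add.commute)
      show "0 \<le> B" unfolding B_def using IF.I_indicator_nonneg[OF V] by simp
    qed
    finally show ?thesis
      unfolding s_def using complex_Re_le_cmod order_trans by blast
  qed
  have smono: "s q \<le> s q'" if "power_set V q \<subseteq> power_set V q'" for q q'
  proof -
    have "norm (I (\<lambda>y. (f y * cnj (f y)) * indicator (power_set V q) y)) \<le> s q'"
      unfolding s_def
      by (rule IF.I_mono[OF cs cs]) (use that in \<open>auto simp: complex_norm_square[symmetric] indicator_def norm_power\<close>)
    then show ?thesis using complex_Re_le_cmod order_trans unfolding s_def by blast
  qed
  have Pm: "power_set V q \<subseteq> power_set V (Suc q)" for q by (rule power_set_mono[OF Vc oneV])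
  have sr: "I (\<lambda>y. (f y * cnj (f y)) * indicator (power_set V q) y) = complex_of_real (s q)" for q
  proof -
    have "norm (I (\<lambda>y. (f y * cnj (f y)) * indicator (power_set V q) y)) \<le> Re (I (\<lambda>y. (f y * cnj (f y)) * indicator (power_set V q) y))"
      by (rule IF.I_mono[OF cs cs]) (auto simp: complex_norm_square[symmetric] indicator_def norm_power)
    then show ?thesis
      unfolding s_def by (smt (verit) complex_Re_le_cmod complex_eq_iff Re_complex_of_real Im_complex_of_real cmod_power2 power2_eq_imp_eq norm_ge_zero zero_eq_power2 abs_Re_le_cmod cmod_eq_Re)
  qed
  define X where "X = Re (\<Sum>i<n. \<Sum>j<n. c i * cnj (c j) * f (x i \<otimes> inv (x j)))"
  define Cc where "Cc = (\<Sum>i<n. norm (c i))\<^sup>2"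
  \<comment> \<open>The pointwise lower bound in \<open>k\<close> is independent of
    \<open>k\<close>, so it survives integration over \<open>K\<close>.\<close>
  have key: "- (Cc * (s (p + 4) - s p)) \<le> X * s (p + 2)" for p
  proof -
    let ?P = "power_set V (p + 2)"
    define L where "L u = I (\<lambda>y. u y * (cnj (f y) * indicator ?P y))" for u
    define Gf where "Gf i j k = L (\<lambda>y. f (\<phi> k (x i) \<otimes> inv (\<phi> k (x j)) \<otimes> y))" for i j k
    have csu: "compactly_supported (\<lambda>y. u y * (cnj (f y) * indicator ?P y))" if "bounded_fun u" for u
    proof -
      have "compactly_supported (\<lambda>y. (u y * cnj (f y)) * indicator ?P y)"
        by (intro compactly_supported_times_indicator Pc bounded_fun_mult bounded_fun_cnj fb that)
      then show ?thesis by (simp add: mult.assoc)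
    qed
    have ex: "continuous_map S euclidean (Gf i j) \<and> (LINT k|m. Gf i j k) = f (x i \<otimes> inv (x j)) * complex_of_real (s (p + 2))"
      if ij: "i < n" "j < n" for i j
    proof -
      define w where "w = x i \<otimes> inv (x j)"
      have w: "w \<in> carrier G" using x ij by (simp add: w_def)
      \<comment> \<open>Written with the moving factor on the right, the integral over
        \<open>k\<close> is \<open>f y * f w\<close> by the functional equation; commutativity
        identifies \<open>F k y\<close> with the translate occurring in \<open>Gf\<close>.\<close>
      define F where "F k y = f (y \<otimes> \<phi> k w)" for k y
      have FG: "L (F k) = Gf i j k" if k: "k \<in> carrier K" for k
        unfolding Gf_def L_def
      proof (rule IF.I_cong)
        have c1: "bounded_fun (F k)"
          using fb w k unfolding bounded_fun_def F_def by auto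
        have zz: "\<phi> k (x i) \<otimes> inv (\<phi> k (x j)) \<in> carrier G" using x ij k by simp
        show "compactly_supported (\<lambda>y. F k y * (cnj (f y) * indicator ?P y))" by (rule csu[OF c1])
        show "compactly_supported (\<lambda>y. f (\<phi> k (x i) \<otimes> inv (\<phi> k (x j)) \<otimes> y) * (cnj (f y) * indicator ?P y))"
          by (rule csu[OF bounded_fun_translate[OF fb zz]])
        fix y assume y: "y \<in> carrier G"
        have "y \<otimes> \<phi> k w = \<phi> k (x i) \<otimes> inv (\<phi> k (x j)) \<otimes> y"
          using x ij k y by (simp add: w_def phi_mult phi_inverse m_comm)
        then show "F k y * (cnj (f y) * indicator ?P y) = f (\<phi> k (x i) \<otimes> inv (\<phi> k (x j)) \<otimes> y) * (cnj (f y) * indicator ?P y)"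
          by (simp add: F_def)
      qed
      have Fc: "continuous_map (prod_topology S T) euclidean (\<lambda>(k, y). F k y)"
      proof -
        have "continuous_map (prod_topology S T) T (\<lambda>z. snd z \<otimes> \<phi> (fst z) w)"
          using w by (intro continuous_map_mult continuous_map_phi continuous_map_fst continuous_map_snd)
            (simp add: topspace_eq_carrier)
        from continuous_map_compose[OF this fc] show ?thesis by (simp add: o_def F_def case_prod_unfold)
      qed
      have Fb: "bounded_fun (F k)" if "k \<in> topspace S" for k
        using fb w that unfolding bounded_fun_def F_def by (auto simp: K.topspace_eq_carrier)
      have av: "(LINT k|m. F k y) = f w * f y" if "y \<in> carrier G" for y
        unfolding F_def using feq[OF that w] by (simp add: mult.commute)
      have avb: "bounded_fun (\<lambda>y. LINT k|m. F k y)"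
        using bounded_fun_scale[OF fb, of "f w"] av unfolding bounded_fun_def by simp
      obtain b' where b': "\<forall>y\<in>carrier G. norm (f y) \<le> b'" using fb by (auto simp: bounded_fun_def)
      have b'0: "0 \<le> b'" using b' one_closed norm_ge_zero order_trans by blast
      have Pcar: "?P \<subseteq> carrier G" by (rule power_set_carrier[OF Vc])
      note exch = integral_exchange[where F = F and L = L and J = ?P and V = "{u. bounded_fun u}"
        and c = "b' * Re (I (indicator ?P))"]
      have equi: "\<exists>U. openin S U \<and> k0 \<in> U \<and> (\<forall>k\<in>U. \<forall>i\<in>?P. norm (F k i - F k0 i) \<le> e)"
        if "e > 0" "k0 \<in> topspace S" for e k0
        by (rule equicontinuous_on_compact[OF Fc Pc that])
      have lin: "L (\<lambda>i. \<Sum>p\<in>P. complex_of_real (w p) * F p i) = (\<Sum>p\<in>P. complex_of_real (w p) * L (F p))"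
        if P: "finite P" "P \<subseteq> topspace S" for P and w :: "'k \<Rightarrow> real"
      proof -
        have "L (\<lambda>i. \<Sum>p\<in>P. complex_of_real (w p) * F p i)
            = I (\<lambda>i. \<Sum>p\<in>P. complex_of_real (w p) * (F p i * (cnj (f i) * indicator ?P i)))"
          unfolding L_def by (simp add: sum_distrib_right mult.assoc)
        also have "\<dots> = (\<Sum>p\<in>P. I (\<lambda>i. complex_of_real (w p) * (F p i * (cnj (f i) * indicator ?P i))))"
          using P Fb by (intro IF.I_sum[THEN conjunct2] compactly_supported_scale csu) auto
        also have "\<dots> = (\<Sum>p\<in>P. complex_of_real (w p) * L (F p))"
          unfolding L_def using P Fb by (intro sum.cong refl IF.I_scale csu) auto
        finally show ?thesis .
      qed
      have bd: "norm (L u - L v) \<le> b' * Re (I (indicator ?P)) * e"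
        if uv: "u \<in> {u. bounded_fun u}" "v \<in> {u. bounded_fun u}" "e \<ge> 0" "\<And>i. i \<in> ?P \<Longrightarrow> norm (u i - v i) \<le> e" for u v e
      proof -
        have "norm (I (\<lambda>y. u y * (cnj (f y) * indicator ?P y) - v y * (cnj (f y) * indicator ?P y))) \<le> b' * e * Re (I (indicator ?P))"
        proof (rule IF.I_bound[OF _ Pc])
          have "bounded_fun (\<lambda>w. u w - v w)" using bounded_fun_diff uv by simp
          from csu[OF this] show "compactly_supported (\<lambda>y. u y * (cnj (f y) * indicator ?P y) - v y * (cnj (f y) * indicator ?P y))"
            by (simp add: left_diff_distrib)
          fix y assume y: "y \<in> ?P"
          have "norm (u y * (cnj (f y) * indicator ?P y) - v y * (cnj (f y) * indicator ?P y)) = norm (f y) * norm (u y - v y)"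
            using y by (simp add: left_diff_distrib[symmetric] norm_mult)
          also have "\<dots> \<le> b' * e" using b' Pcar y uv(4)[OF y] b'0 by (intro mult_mono) auto
          finally show "norm (u y * (cnj (f y) * indicator ?P y) - v y * (cnj (f y) * indicator ?P y)) \<le> b' * e" .
        qed simp
        then show ?thesis
          unfolding L_def using IF.I_diff[OF csu csu, of u v] uv by (simp add: mult.assoc mult.commute[of e])
      qed
      have sums: "(\<lambda>i. \<Sum>p\<in>P. complex_of_real (w p) * F p i) \<in> {u. bounded_fun u}"
        if "finite P" "P \<subseteq> topspace S" for P and w :: "'k \<Rightarrow> real"
        using that Fb by (auto intro!: bounded_fun_sum bounded_fun_scale)
      have e1: "continuous_map S euclidean (\<lambda>k. L (F k))"
        by (rule exch(1)) (use equi lin bd sums Fb avb in auto)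
      have e2: "L (\<lambda>w. LINT k|m. F k w) = (LINT k|m. L (F k))"
        by (rule exch(2)) (use equi lin bd sums Fb avb in auto)
      have "continuous_map S euclidean (Gf i j)"
        by (rule continuous_map_eq[OF e1]) (simp add: FG K.topspace_eq_carrier)
      moreover have "L (\<lambda>y. LINT k|m. F k y) = I (\<lambda>y. f w * ((f y * cnj (f y)) * indicator ?P y))"
        unfolding L_def by (rule IF.I_cong[OF csu[OF avb] compactly_supported_scale[OF cs]]) (simp add: av)
      moreover have "I (\<lambda>y. f w * ((f y * cnj (f y)) * indicator ?P y)) = f w * complex_of_real (s (p + 2))"
        unfolding IF.I_scale[OF cs] sr ..
      moreover have "(LINT k|m. L (F k)) = (LINT k|m. Gf i j k)"
        by (intro Bochner_Integration.integral_cong refl) (simp add: FG space_m')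
      ultimately show ?thesis using e2 by (simp add: w_def)
    qed
    define H where "H k = (\<Sum>i<n. \<Sum>j<n. c i * cnj (c j) * Gf i j k)" for k
    have gi: "integrable m (Gf i j)" if "i < n" "j < n" for i j using ex[OF that] integrable_continuous by blast
    have gi2: "integrable m (\<lambda>k. c i * cnj (c j) * Gf i j k)" if "i < n" "j < n" for i j
      using gi[OF that] by simp
    have gi3: "integrable m (\<lambda>k. \<Sum>j<n. c i * cnj (c j) * Gf i j k)" if "i < n" for i
      by (rule Bochner_Integration.integrable_sum) (simp add: gi2 that)
    have Hi: "integrable m H"
      unfolding H_def[abs_def] by (rule Bochner_Integration.integrable_sum) (rule gi3, simp)
    have "(LINT k|m. H k) = (\<Sum>i<n. LINT k|m. (\<Sum>j<n. c i * cnj (c j) * Gf i j k))"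
      unfolding H_def by (rule Bochner_Integration.integral_sum) (rule gi3, simp)
    also have "\<dots> = (\<Sum>i<n. \<Sum>j<n. LINT k|m. c i * cnj (c j) * Gf i j k)"
      by (intro sum.cong refl, rule Bochner_Integration.integral_sum) (rule gi2; simp)
    also have "\<dots> = (\<Sum>i<n. \<Sum>j<n. c i * cnj (c j) * (LINT k|m. Gf i j k))"
      by (intro sum.cong refl integral_mult_right gi) auto
    also have "\<dots> = (\<Sum>i<n. \<Sum>j<n. c i * cnj (c j) * (f (x i \<otimes> inv (x j)) * complex_of_real (s (p + 2))))"
      by (intro sum.cong refl arg_cong2[where f = "(*)"] ex[THEN conjunct2]) auto
    also have "\<dots> = (\<Sum>i<n. \<Sum>j<n. c i * cnj (c j) * f (x i \<otimes> inv (x j))) * complex_of_real (s (p + 2))"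
      by (simp only: sum_distrib_right mult.assoc)
    finally have HX: "Re (LINT k|m. H k) = X * s (p + 2)" by (simp add: X_def)
    have low: "- (Cc * (s (p + 4) - s p)) \<le> Re (H k)" if k: "k \<in> carrier K" for k
      unfolding H_def Gf_def L_def Cc_def s_def
      by (rule IF.almost_positive[OF fb V oneV]) (use xV[OF k] in auto)
    have "- (Cc * (s (p + 4) - s p)) = (LINT k|m. - (Cc * (s (p + 4) - s p)))" by (simp add: prob_space)
    also have "\<dots> \<le> (LINT k|m. Re (H k))"
      using low Hi by (intro integral_mono integrable_Re) (auto simp: space_m')
    also have "\<dots> = X * s (p + 2)" using HX Hi by (simp add: integral_Re)
    finally show ?thesis .
  qed
  have "- X \<le> 0 + e" if e: "e > 0" for e
  proof -
    have Cc0: "0 \<le> Cc" by (simp add: Cc_def)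
    \<comment> \<open>Chosen so that \<open>Cc * d \<le> e\<close>, also when \<open>Cc\<close> is
      0.\<close>
    define d where "d = e / (Cc + 1)"
    have d: "d > 0" using e Cc0 by (simp add: d_def)
    obtain p where p: "p \<ge> 1" "s (p + 4) \<le> (1 + d) * s p"
      using polynomial_growth_step[OF s1 growth d] by blast
    have mono: "s p \<le> s (p + 2)" using smono[OF order_trans[OF Pm[of p] Pm[of "Suc p"]]] by simp
    have sp: "0 < s (p + 2)"
    proof -
      have "s 1 \<le> s p"
        using p(1)
      proof (induction p rule: dec_induct)
        case (step q)
        then show ?case using smono[OF Pm[of q]] by simp
      qed simp
      then show ?thesis using s1 mono by linarith
    qed
    have "d * s p \<le> d * s (p + 2)" using mono d by (intro mult_left_mono) auto
    moreover have "(1 + d) * s p = s p + d * s p" by (simp add: distrib_right)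
    ultimately have "s (p + 4) - s p \<le> d * s (p + 2)" using p(2) by linarith
    then have "Cc * (s (p + 4) - s p) \<le> Cc * (d * s (p + 2))" using Cc0 by (rule mult_left_mono)
    also have "\<dots> = (Cc * d) * s (p + 2)" by simp
    also have "\<dots> \<le> e * s (p + 2)"
      using sp Cc0 e by (intro mult_right_mono) (auto simp: d_def field_simps)
    finally have "- X * s (p + 2) \<le> e * s (p + 2)" using key[of p] by simp
    then have "- X \<le> e" using sp by (rule mult_right_le_imp_le)
    then show ?thesis by simp
  qed
  then have "- X \<le> 0" by (rule field_le_epsilon)
  then show "0 \<le> Re (\<Sum>i<n. \<Sum>j<n. c i * cnj (c j) * f (x i \<otimes> inv (x j)))" by (simp add: X_def)
qed

end

section \<open>Characters inside a spherical function\<close>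

lemma (in group) mult_inv_cancel:
  "a \<in> carrier G \<Longrightarrow> b \<in> carrier G \<Longrightarrow> a \<otimes> (inv a \<otimes> b) = b"
  by (simp add: m_assoc[symmetric])

context topological_group
begin

lemma positive_definiteD:
  "positive_definite g \<Longrightarrow> (\<And>i. i < n \<Longrightarrow> x i \<in> carrier G) \<Longrightarrow>
    0 \<le> Re (\<Sum>i<(n::nat). \<Sum>j<n. c i * cnj (c j) * g (x i \<otimes> inv (x j)))"
  unfolding positive_definite_def by blast

lemma positive_definite_inv: "positive_definite g \<Longrightarrow> x \<in> carrier G \<Longrightarrow> g (inv x) = cnj (g x)"
  by (simp add: positive_definite_def)

lemma positive_definite_cong:
  assumes g: "positive_definite g" and h: "\<And>x. x \<in> carrier G \<Longrightarrow> h x = g x"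
  shows "positive_definite h"
  unfolding positive_definite_def
proof (intro conjI allI impI ballI)
  fix n and x :: "nat \<Rightarrow> 'a" and c :: "nat \<Rightarrow> complex" assume x: "\<forall>i<n. x i \<in> carrier G"
  have "(\<Sum>i<n. \<Sum>j<n. c i * cnj (c j) * h (x i \<otimes> inv (x j))) = (\<Sum>i<n. \<Sum>j<n. c i * cnj (c j) * g (x i \<otimes> inv (x j)))"
    by (intro sum.cong refl) (simp add: h x)
  then show "0 \<le> Re (\<Sum>i<n. \<Sum>j<n. c i * cnj (c j) * h (x i \<otimes> inv (x j)))"
    using positive_definiteD[OF g, of n x c] x by (simp only: simp_thms)
qed (simp add: h positive_definite_inv[OF g])

text \<open>Test with the two points \<open>x\<close> and \<open>\<one>\<close>, with weights the
  conjugate phase of \<open>g x\<close> and \<open>- 1\<close>: the cross terms become minus twice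
  the modulus of \<open>g x\<close> and the diagonal terms twice \<open>Re (g \<one>)\<close>, apart
  from the trivial case \<open>g x = 0\<close>.\<close>

lemma positive_definite_bound:
  assumes g: "positive_definite g" and x: "x \<in> carrier G"
  shows "norm (g x) \<le> Re (g \<one>)"
proof -
  define c where "c i = (if i = 0 then cnj (sgn (g x)) else - 1)" for i :: nat
  define y where "y i = (if i = 0 then x else \<one>)" for i :: nat
  have "0 \<le> Re (\<Sum>i<(2::nat). \<Sum>j<2. c i * cnj (c j) * g (y i \<otimes> inv (y j)))"
    by (rule positive_definiteD[OF g]) (simp add: y_def x)
  also have "(\<Sum>i<(2::nat). \<Sum>j<2. c i * cnj (c j) * g (y i \<otimes> inv (y j)))
      = cnj (sgn (g x)) * sgn (g x) * g \<one> - cnj (sgn (g x)) * g x - sgn (g x) * cnj (g x) + g \<one>"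
    using x by (simp add: numeral_2_eq_2 c_def y_def positive_definite_inv[OF g])
  also have "cnj (sgn (g x)) * g x = complex_of_real (norm (g x))"
  proof (cases "g x = 0")
    case False
    have "cnj (g x) * g x = complex_of_real ((norm (g x))\<^sup>2)"
      by (metis complex_norm_square mult.commute)
    then show ?thesis using False by (simp add: sgn_eq power2_eq_square)
  qed simp
  also have "sgn (g x) * cnj (g x) = complex_of_real (norm (g x))"
  proof (cases "g x = 0")
    case False
    have "g x * cnj (g x) = complex_of_real ((norm (g x))\<^sup>2)"
      by (metis complex_norm_square)
    then show ?thesis using False by (simp add: sgn_eq power2_eq_square)
  qed simp
  finally have 1: "0 \<le> Re (cnj (sgn (g x)) * sgn (g x) * g \<one>) - 2 * norm (g x) + Re (g \<one>)" by simp
  show ?thesis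
  proof (cases "g x = 0")
    case True
    then show ?thesis using 1 by simp
  next
    case False
    have "cnj (sgn (g x)) * sgn (g x) = complex_of_real ((norm (sgn (g x)))\<^sup>2)"
      by (metis complex_norm_square mult.commute)
    then have "cnj (sgn (g x)) * sgn (g x) = 1" using False by (simp add: norm_sgn)
    then show ?thesis using 1 by simp
  qed
qed

end

lemma sum_lessThan_add:
  fixes f :: "nat \<Rightarrow> 'b::comm_monoid_add"
  shows "(\<Sum>i<n + m. f i) = (\<Sum>i<n. f i) + (\<Sum>i<m. f (n + i))"
  by (induction m) (auto simp: add.assoc)

context lca_group
begin

text \<open>The weights \<open>c\<^sub>i\<close> at \<open>x\<^sub>i\<close> and \<open>\<lambda> c\<^sub>i\<close> at \<open>x\<^sub>i y\<close>, i.e. the square of \<open>\<delta> + \<lambda> \<delta>\<^sub>y\<close>.\<close>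

lemma positive_definite_twist:
  assumes g: "positive_definite g" and y: "y \<in> carrier G" and l: "norm l = 1"
  shows "positive_definite (\<lambda>x. 2 * g x + l * g (x \<otimes> y) + cnj l * g (x \<otimes> inv y))"
  unfolding positive_definite_def
proof (intro conjI allI impI ballI)
  fix n and x :: "nat \<Rightarrow> 'a" and c :: "nat \<Rightarrow> complex" assume "\<forall>i<n. x i \<in> carrier G"
  then have x: "\<And>i. i < n \<Longrightarrow> x i \<in> carrier G" by blast
  have ll: "l * cnj l = 1" using l by (metis complex_norm_square of_real_1 one_power2)
  define x' where "x' i = (if i < n then x i else x (i - n) \<otimes> y)" for i
  define c' where "c' i = (if i < n then c i else l * c (i - n))" for i
  have "0 \<le> Re (\<Sum>i<n + n. \<Sum>j<n + n. c' i * cnj (c' j) * g (x' i \<otimes> inv (x' j)))"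
    using x y by (intro positive_definiteD[OF g]) (simp add: x'_def)
  also have "(\<Sum>i<n + n. \<Sum>j<n + n. c' i * cnj (c' j) * g (x' i \<otimes> inv (x' j)))
    = (\<Sum>i<n. \<Sum>j<n. c i * cnj (c j) * g (x i \<otimes> inv (x j)))
      + (\<Sum>i<n. \<Sum>j<n. c i * cnj (l * c j) * g (x i \<otimes> inv (x j \<otimes> y)))
      + ((\<Sum>i<n. \<Sum>j<n. (l * c i) * cnj (c j) * g ((x i \<otimes> y) \<otimes> inv (x j)))
      + (\<Sum>i<n. \<Sum>j<n. (l * c i) * cnj (l * c j) * g ((x i \<otimes> y) \<otimes> inv (x j \<otimes> y))))"
    unfolding sum_lessThan_add sum.distrib x'_def c'_def by simp
  also have "\<dots> = (\<Sum>i<n. \<Sum>j<n. c i * cnj (c j) * g (x i \<otimes> inv (x j))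
      + c i * cnj (l * c j) * g (x i \<otimes> inv (x j \<otimes> y))
      + ((l * c i) * cnj (c j) * g ((x i \<otimes> y) \<otimes> inv (x j))
      + (l * c i) * cnj (l * c j) * g ((x i \<otimes> y) \<otimes> inv (x j \<otimes> y))))"
    by (simp only: sum.distrib)
  also have "\<dots> = (\<Sum>i<n. \<Sum>j<n. c i * cnj (c j) *
      (2 * g (x i \<otimes> inv (x j)) + l * g (x i \<otimes> inv (x j) \<otimes> y) + cnj l * g (x i \<otimes> inv (x j) \<otimes> inv y)))"
  proof (intro sum.cong refl)
    fix i j assume "i \<in> {..<n}" "j \<in> {..<n}"
    then have xx: "x i \<in> carrier G" "x j \<in> carrier G" using x by auto
    have 1: "x i \<otimes> inv (x j \<otimes> y) = x i \<otimes> inv (x j) \<otimes> inv y"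
      using xx y by (simp add: inv_mult m_assoc)
    have 2: "(x i \<otimes> y) \<otimes> inv (x j) = x i \<otimes> inv (x j) \<otimes> y"
      using xx y by (simp add: m_ac)
    have 3: "(x i \<otimes> y) \<otimes> inv (x j \<otimes> y) = x i \<otimes> inv (x j)"
    proof -
      have yy: "y \<otimes> (inv y \<otimes> inv (x j)) = inv (x j)" using xx y by (simp add: m_assoc[symmetric])
      have "(x i \<otimes> y) \<otimes> inv (x j \<otimes> y) = ((x i \<otimes> y) \<otimes> inv y) \<otimes> inv (x j)"
        using xx y yy by (simp add: inv_mult_group m_assoc)
      moreover have "(x i \<otimes> y) \<otimes> inv y = x i" using xx y by (simp add: m_assoc)
      ultimately show ?thesis by simp
    qed
    have "(l * c i) * cnj (l * c j) = (l * cnj l) * (c i * cnj (c j))" by (simp add: mult_ac)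
    then have 4: "(l * c i) * cnj (l * c j) = c i * cnj (c j)" by (simp add: ll)
    show "c i * cnj (c j) * g (x i \<otimes> inv (x j)) + c i * cnj (l * c j) * g (x i \<otimes> inv (x j \<otimes> y))
      + ((l * c i) * cnj (c j) * g ((x i \<otimes> y) \<otimes> inv (x j)) + (l * c i) * cnj (l * c j) * g ((x i \<otimes> y) \<otimes> inv (x j \<otimes> y)))
      = c i * cnj (c j) * (2 * g (x i \<otimes> inv (x j)) + l * g (x i \<otimes> inv (x j) \<otimes> y) + cnj l * g (x i \<otimes> inv (x j) \<otimes> inv y))"
      unfolding 1 2 3 4 by (simp add: algebra_simps)
  qed
  finally show "0 \<le> Re (\<Sum>i<n. \<Sum>j<n. c i * cnj (c j) *
      (2 * g (x i \<otimes> inv (x j)) + l * g (x i \<otimes> inv (x j) \<otimes> y) + cnj l * g (x i \<otimes> inv (x j) \<otimes> inv y)))" .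
next
  fix x assume x: "x \<in> carrier G"
  have 1: "inv x \<otimes> y = inv (x \<otimes> inv y)" "inv x \<otimes> inv y = inv (x \<otimes> y)" using x y by (simp_all add: inv_mult)
  show "2 * g (inv x) + l * g (inv x \<otimes> y) + cnj l * g (inv x \<otimes> inv y) = cnj (2 * g x + l * g (x \<otimes> y) + cnj l * g (x \<otimes> inv y))"
    unfolding 1 using x y by (simp add: positive_definite_inv[OF g])
qed

end

section \<open>Compactness and extreme points of the set of eigenfunctions\<close>

context lca_orbit
begin

text \<open>The extreme points of this compact convex set are multiplicative.\<close>

definition eigenstates :: "('a \<Rightarrow> complex) \<Rightarrow> ('a \<Rightarrow> complex) set" where
  "eigenstates f = {g. (\<forall>x. x \<notin> carrier G \<longrightarrow> g x = 0) \<and> g \<one> = 1 \<and> positive_definite g \<and>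
     continuous_map T euclidean g \<and>
     (\<forall>x\<in>carrier G. \<forall>w\<in>carrier G. (LINT k|m. g (x \<otimes> \<phi> k w)) = f w * g x)}"

lemma eigenstates_bound: "g \<in> eigenstates f \<Longrightarrow> x \<in> carrier G \<Longrightarrow> norm (g x) \<le> 1"
  using positive_definite_bound[of g x] by (simp add: eigenstates_def)

text \<open>Neither continuity nor an integral equation is closed under pointwise convergence.
  Equicontinuity with neighbourhoods \<open>N e\<close> common to all members repairs both: it is
  itself a closed condition, and it makes the integral over \<open>K\<close> uniformly approximable
  by finite sums over a fixed partition.\<close>

lemma compact_eigenstates:
  assumes f: "spherical f"
  shows "compact (eigenstates f)"
proof -
  have fc: "continuous_map T euclidean f" and fb: "bounded_fun f" and f1: "f \<one> = 1"
    and fK: "\<And>k x. k \<in> carrier K \<Longrightarrow> x \<in> carrier G \<Longrightarrow> f (\<phi> k x) = f x"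
    using f by (auto simp: spherical_def)
  obtain I and h :: "'a \<Rightarrow> complex" and C where I: "invariant_functional G T I" and h: "continuous_map T euclidean h"
    and hK: "\<And>k x. k \<in> carrier K \<Longrightarrow> x \<in> carrier G \<Longrightarrow> h (\<phi> k x) = h x"
    and C: "compactin T C" "\<And>x. x \<in> carrier G - C \<Longrightarrow> h x = 0"
    and nz: "I (\<lambda>x. h x * f x) \<noteq> 0"
    by (rule smoothing_kernel[OF fc f1 fK]) (assumption, assumption, rule that)
  define c0 where "c0 = norm (I (\<lambda>x. h x * f x))"
  have c0: "c0 > 0" using nz by (simp add: c0_def)
  have exN: "\<exists>N. openin T N \<and> \<one> \<in> N \<and> (\<forall>g\<in>eigenstates f. \<forall>x\<in>carrier G. \<forall>z\<in>N. norm (g (x \<otimes> z) - g x) \<le> e)"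
    if e: "e > 0" for e
  proof -
    show ?thesis
    proof (rule eigenfunctions_equicontinuous[OF I h _ C(1) _ c0 e])
      show "h (\<phi> k x) = h x" if "k \<in> carrier K" "x \<in> carrier G" for k x by (rule hK[OF that])
      show "h x = 0" if "x \<in> carrier G - C" for x by (rule C(2)[OF that])
      fix N assume N: "openin T N" "\<one> \<in> N"
        and eq: "\<And>f g x z. bounded_fun f \<Longrightarrow> norm (I (\<lambda>w. h w * f w)) \<ge> c0 \<Longrightarrow> continuous_map T euclidean g \<Longrightarrow>
      (\<And>x. x \<in> carrier G \<Longrightarrow> norm (g x) \<le> 1) \<Longrightarrow>
      (\<And>x w. x \<in> carrier G \<Longrightarrow> w \<in> carrier G \<Longrightarrow> (LINT k|m. g (x \<otimes> \<phi> k w)) = f w * g x) \<Longrightarrow>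
      x \<in> carrier G \<Longrightarrow> z \<in> N \<Longrightarrow> norm (g (x \<otimes> z) - g x) \<le> e"
      have "norm (g (x \<otimes> z) - g x) \<le> e" if g: "g \<in> eigenstates f" and xz: "x \<in> carrier G" "z \<in> N" for g x z
      proof (rule eq[OF fb _ _ _ _ xz])
        show "c0 \<le> norm (I (\<lambda>w. h w * f w))" by (simp add: c0_def)
        show "continuous_map T euclidean g" using g by (simp add: eigenstates_def)
        show "norm (g x) \<le> 1" if "x \<in> carrier G" for x by (rule eigenstates_bound[OF g that])
        show "(LINT k|m. g (x \<otimes> \<phi> k w)) = f w * g x" if "x \<in> carrier G" "w \<in> carrier G" for x w
          using g that by (simp add: eigenstates_def)
      qed
      then show ?thesis using N by blast
    qed
  qed
  define N where "N e = (SOME N. openin T N \<and> \<one> \<in> N \<and>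
    (\<forall>g\<in>eigenstates f. \<forall>x\<in>carrier G. \<forall>z\<in>N. norm (g (x \<otimes> z) - g x) \<le> e))" for e
  have N: "openin T (N e)" "\<one> \<in> N e" "\<And>g x z. g \<in> eigenstates f \<Longrightarrow> x \<in> carrier G \<Longrightarrow> z \<in> N e \<Longrightarrow> norm (g (x \<otimes> z) - g x) \<le> e"
    if "e > 0" for e
    using someI_ex[OF exN[OF that]] unfolding N_def by blast+
  \<comment> \<open>The partition depends on \<open>e\<close> and \<open>w\<close> only. On each
    cell \<open>\<phi> k w\<close> stays in the \<open>N e\<close>-translate of its value at the
    centre, so every \<open>g\<close> with the common modulus of continuity varies by at most
    \<open>e\<close>.\<close>
  define part where "part e w PB \<longleftrightarrow> finite (fst PB) \<and> fst PB \<subseteq> topspace S \<and> (\<forall>p\<in>fst PB. snd PB p \<in> sets m) \<and>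
    disjoint_family_on (snd PB) (fst PB) \<and> (\<Union>p\<in>fst PB. snd PB p) = topspace S \<and>
    (\<forall>p\<in>fst PB. \<forall>k\<in>snd PB p. inv (\<phi> p w) \<otimes> \<phi> k w \<in> N e)" for e w and PB :: "'k set \<times> ('k \<Rightarrow> 'k set)"
  have exP: "\<exists>PB. part e w PB" if e: "e > 0" and w: "w \<in> carrier G" for e w
  proof -
    have R: "\<exists>U. openin S U \<and> k0 \<in> U \<and> (\<forall>k\<in>U. inv (\<phi> k0 w) \<otimes> \<phi> k w \<in> N e)" if k0: "k0 \<in> topspace S" for k0
    proof -
      have k0c: "k0 \<in> carrier K" using k0 by (simp add: K.topspace_eq_carrier)
      have "continuous_map S T (\<lambda>k. inv (\<phi> k0 w) \<otimes> \<phi> k w)"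
        using k0c w by (intro continuous_map_mult continuous_map_phi_left) (auto simp: topspace_eq_carrier)
      from openin_continuous_map_preimage[OF this N(1)[OF e]]
      have "openin S {k \<in> topspace S. inv (\<phi> k0 w) \<otimes> \<phi> k w \<in> N e}" .
      moreover have "k0 \<in> {k \<in> topspace S. inv (\<phi> k0 w) \<otimes> \<phi> k w \<in> N e}" using k0 k0c w N(2)[OF e] by simp
      ultimately show ?thesis by (intro exI[of _ "{k \<in> topspace S. inv (\<phi> k0 w) \<otimes> \<phi> k w \<in> N e}"]) simp
    qed
    obtain P B where "finite P" "P \<subseteq> topspace S" "\<And>p. p \<in> P \<Longrightarrow> B p \<in> sets m"
      "disjoint_family_on B P" "(\<Union>p\<in>P. B p) = topspace S" "\<And>p k. p \<in> P \<Longrightarrow> k \<in> B p \<Longrightarrow> inv (\<phi> p w) \<otimes> \<phi> k w \<in> N e"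
      by (rule finite_measurable_partition[OF compact_S sets_m R]) (assumption, rule that)
    then have "part e w (P, B)" by (simp add: part_def)
    then show ?thesis by blast
  qed
  define PB where "PB e w = (SOME PB. part e w PB)" for e w
  have PB: "part e w (PB e w)" if "e > 0" "w \<in> carrier G" for e w
    unfolding PB_def by (rule someI_ex[OF exP[OF that]])
  define avg where "avg e w x g = (\<Sum>p\<in>fst (PB e w). complex_of_real (measure m (snd (PB e w) p)) * g (x \<otimes> \<phi> p w))"
    for e w x and g :: "'a \<Rightarrow> complex"
  have approx: "norm ((LINT k|m. g (x \<otimes> \<phi> k w)) - avg e w x g) \<le> e"
    if e: "e > 0" and w: "w \<in> carrier G" and x: "x \<in> carrier G" and gc: "continuous_map T euclidean g"
      and eq: "\<And>x z. x \<in> carrier G \<Longrightarrow> z \<in> N e \<Longrightarrow> norm (g (x \<otimes> z) - g x) \<le> e" for e w x and g :: "'a \<Rightarrow> complex"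
    unfolding avg_def
  proof (rule partition_approx)
    note P = PB[OF e w, unfolded part_def]
    show "finite (fst (PB e w))" "fst (PB e w) \<subseteq> topspace S" "disjoint_family_on (snd (PB e w)) (fst (PB e w))"
      "(\<Union>p\<in>fst (PB e w). snd (PB e w) p) = topspace S"
      using P by simp_all
    show "snd (PB e w) p \<in> sets m" if "p \<in> fst (PB e w)" for p using P that by simp
    show "integrable m (\<lambda>k. g (x \<otimes> \<phi> k w))" by (rule integrable_continuous[OF continuous_phi_section[OF gc x w]])
    fix p k assume pk: "p \<in> fst (PB e w)" "k \<in> snd (PB e w) p"
    have z: "inv (\<phi> p w) \<otimes> \<phi> k w \<in> N e" using P pk by simp
    have pc: "p \<in> carrier K" using P pk(1) by (auto simp: K.topspace_eq_carrier)
    have kc: "k \<in> carrier K"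
    proof -
      have "snd (PB e w) p \<in> sets m" using P pk(1) by simp
      then have "snd (PB e w) p \<subseteq> space m" by (rule sets.sets_into_space)
      then show ?thesis using pk(2) unfolding space_m' by blast
    qed
    have "x \<otimes> \<phi> p w \<otimes> (inv (\<phi> p w) \<otimes> \<phi> k w) = x \<otimes> \<phi> k w"
      using x w pc kc by (simp add: m_assoc mult_inv_cancel)
    then show "norm (g (x \<otimes> \<phi> k w) - g (x \<otimes> \<phi> p w)) \<le> e" using eq[of "x \<otimes> \<phi> p w", OF _ z] x w pc by simp
  qed
  \<comment> \<open>The same set described by closed conditions on finitely many values at a time:
    \<open>avg e w x\<close> replaces the integral up to \<open>e\<close>, and letting
    \<open>e\<close> tend to 0 recovers the equation.\<close>
  define Z where "Z = {g. (\<forall>x. x \<notin> carrier G \<longrightarrow> g x = 0) \<and> g \<one> = 1 \<and> positive_definite g \<and>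
    (\<forall>e>0. \<forall>x\<in>carrier G. \<forall>z\<in>N e. norm (g (x \<otimes> z) - g x) \<le> e) \<and>
    (\<forall>e>0. \<forall>x\<in>carrier G. \<forall>w\<in>carrier G. norm (avg e w x g - f w * g x) \<le> e)}"
  have "eigenstates f = Z"
  proof (intro equalityI subsetI)
    fix g assume g: "g \<in> eigenstates f"
    have "norm (avg e w x g - f w * g x) \<le> e" if "e > 0" "x \<in> carrier G" "w \<in> carrier G" for e x w
    proof -
      have "(LINT k|m. g (x \<otimes> \<phi> k w)) = f w * g x" using g that by (simp add: eigenstates_def)
      moreover have "norm ((LINT k|m. g (x \<otimes> \<phi> k w)) - avg e w x g) \<le> e"
        by (rule approx[OF that(1,3,2)]) (use g N(3)[OF that(1) g] in \<open>simp_all add: eigenstates_def\<close>)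
      ultimately show ?thesis by (simp add: norm_minus_commute)
    qed
    moreover have "norm (g (x \<otimes> z) - g x) \<le> e" if "e > 0" "x \<in> carrier G" "z \<in> N e" for e x z
      by (rule N(3)[OF that(1) g that(2,3)])
    ultimately show "g \<in> Z" using g by (simp add: Z_def eigenstates_def)
  next
    fix g assume g: "g \<in> Z"
    have eq: "norm (g (x \<otimes> z) - g x) \<le> e" if "e > 0" "x \<in> carrier G" "z \<in> N e" for e x z
      using g that by (simp add: Z_def)
    have gc: "continuous_map T euclidean g"
    proof (rule continuous_map_normI)
      fix e :: real and x0 assume e: "e > 0" and "x0 \<in> topspace T"
      then have x0: "x0 \<in> carrier G" by (simp add: topspace_eq_carrier)
      have "norm (g x - g x0) \<le> e" if "x \<in> {x \<in> carrier G. inv x0 \<otimes> x \<in> N e}" for x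
        using eq[OF e x0, of "inv x0 \<otimes> x"] that x0 by (simp add: m_assoc[symmetric])
      moreover have "openin T {x \<in> carrier G. inv x0 \<otimes> x \<in> N e}" by (rule openin_translate[OF N(1)[OF e]]) (simp add: x0)
      moreover have "x0 \<in> {x \<in> carrier G. inv x0 \<otimes> x \<in> N e}" using x0 N(2)[OF e] by simp
      ultimately show "\<exists>U. openin T U \<and> x0 \<in> U \<and> (\<forall>x\<in>U. norm (g x - g x0) \<le> e)" by blast
    qed
    have "(LINT k|m. g (x \<otimes> \<phi> k w)) = f w * g x" if x: "x \<in> carrier G" and w: "w \<in> carrier G" for x w
    proof -
      have "norm ((LINT k|m. g (x \<otimes> \<phi> k w)) - f w * g x) \<le> 0 + e" if e: "e > 0" for e
      proof -
        have e2: "e / 2 > 0" using e by simp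
        have 1: "norm ((LINT k|m. g (x \<otimes> \<phi> k w)) - avg (e/2) w x g) \<le> e / 2"
          by (rule approx[OF e2 w x gc]) (rule eq[OF e2])
        have 2: "norm (avg (e/2) w x g - f w * g x) \<le> e / 2"
          using g e2 x w unfolding Z_def by blast
        show ?thesis using norm_diff_triangle_le[OF 1 2] by simp
      qed
      then have "norm ((LINT k|m. g (x \<otimes> \<phi> k w)) - f w * g x) \<le> 0" by (rule field_le_epsilon)
      then show ?thesis by simp
    qed
    then show "g \<in> eigenstates f" using g gc by (simp add: Z_def eigenstates_def)
  qed
  moreover have "closed Z"
    unfolding Z_def positive_definite_def avg_def Ball_def
    by (intro closed_Collect_conj closed_Collect_all closed_Collect_imp open_Collect_const
        closed_Collect_eq closed_Collect_le continuous_intros)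
  moreover have "eigenstates f \<subseteq> {g. \<forall>x. g x \<in> cball 0 1}"
  proof (intro subsetI CollectI allI)
    fix g x assume g: "g \<in> eigenstates f"
    show "g x \<in> cball 0 1"
      using eigenstates_bound[OF g, of x] g by (cases "x \<in> carrier G") (auto simp: eigenstates_def)
  qed
  moreover have "compact {g :: 'a \<Rightarrow> complex. \<forall>x. g x \<in> cball 0 1}"
    by (rule compact_Pi_UNIV) simp
  ultimately have "compact ({g. \<forall>x. g x \<in> cball 0 1} \<inter> eigenstates f)" "{g. \<forall>x. g x \<in> cball 0 1} \<inter> eigenstates f = eigenstates f"
    by (auto intro: compact_Int_closed)
  then show ?thesis by simp
qed

text \<open>For \<open>q l x = 2 * g x + l * g (x \<otimes> y) + cnj l * g (x \<otimes> inv
  y)\<close> with \<open>l\<close> of modulus 1, both \<open>q l\<close> and \<open>q (- l)\<close>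
  are positive definite and satisfy the eigenvalue equation, and they add up to
  \<open>4 * g\<close>. Extremality makes \<open>q l\<close> proportional to \<open>g\<close>, and
  two values of \<open>l\<close> determine \<open>g (x \<otimes> y)\<close>.\<close>

lemma extreme_eigenstate_multiplicative:
  assumes g: "g \<in> eigenstates f"
    and ext: "\<And>p q t. p \<in> eigenstates f \<Longrightarrow> q \<in> eigenstates f \<Longrightarrow> 0 < t \<Longrightarrow> t < 1 \<Longrightarrow>
      (\<And>i. g i = complex_of_real t * p i + complex_of_real (1 - t) * q i) \<Longrightarrow> p = g"
    and x: "x \<in> carrier G" and y: "y \<in> carrier G"
  shows "g (x \<otimes> y) = g x * g y"
proof -
  have gz: "\<And>x. x \<notin> carrier G \<Longrightarrow> g x = 0" and g1: "g \<one> = 1" and gp: "positive_definite g"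
    and gc: "continuous_map T euclidean g"
    and eig: "\<And>x w. x \<in> carrier G \<Longrightarrow> w \<in> carrier G \<Longrightarrow> (LINT k|m. g (x \<otimes> \<phi> k w)) = f w * g x"
    using g by (auto simp: eigenstates_def)
  have ginv: "g (inv x) = cnj (g x)" if "x \<in> carrier G" for x by (rule positive_definite_inv[OF gp that])
  define q where "q l x = (if x \<in> carrier G then 2 * g x + l * g (x \<otimes> y) + cnj l * g (x \<otimes> inv y) else 0)" for l x
  have qv: "q l x = 2 * g x + l * g (x \<otimes> y) + cnj l * g (x \<otimes> inv y)" if "x \<in> carrier G" for l x
    using that by (simp add: q_def)
  have q1: "q l \<one> = complex_of_real (2 + 2 * Re (l * g y))" for l
    using y by (simp add: qv g1 ginv complex_eq_iff)
  have qp: "positive_definite (q l)" if l: "norm l = 1" for l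
    by (rule positive_definite_cong[OF positive_definite_twist[OF gp y l]]) (rule qv)
  have tr: "continuous_map T euclidean (\<lambda>x. g (x \<otimes> z))" if "z \<in> carrier G" for z
  proof -
    have "continuous_map T T (\<lambda>x. x \<otimes> z)" using that by (intro continuous_map_mult) (auto simp: topspace_eq_carrier)
    from continuous_map_compose[OF this gc] show ?thesis by (simp add: o_def)
  qed
  have qc: "continuous_map T euclidean (q l)" for l
  proof -
    have s: "continuous_map T euclidean (\<lambda>x. c * u x)" if "continuous_map T euclidean u" for c :: complex and u :: "'a \<Rightarrow> complex"
    proof -
      have "continuous_map euclidean euclidean (\<lambda>z :: complex. c * z)" by (simp add: continuous_intros)
      from continuous_map_compose[OF that this] show ?thesis by (simp add: o_def)
    qed
    have "continuous_map T euclidean (\<lambda>x. 2 * g x + l * g (x \<otimes> y) + cnj l * g (x \<otimes> inv y))"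
      using y by (intro continuous_map_add s tr gc) auto
    then show ?thesis by (rule continuous_map_eq) (simp add: qv topspace_eq_carrier)
  qed
  have qe: "(LINT k|m. q l (x \<otimes> \<phi> k w)) = f w * q l x" if x: "x \<in> carrier G" and w: "w \<in> carrier G" for l x w
  proof -
    have sh: "(LINT k|m. g (x \<otimes> \<phi> k w \<otimes> z)) = f w * g (x \<otimes> z) \<and> integrable m (\<lambda>k. g (x \<otimes> \<phi> k w \<otimes> z))" if z: "z \<in> carrier G" for z
    proof -
      have e: "x \<otimes> \<phi> k w \<otimes> z = x \<otimes> z \<otimes> \<phi> k w" if "k \<in> carrier K" for k
        using x z w that by (simp add: m_ac)
      have "(LINT k|m. g (x \<otimes> \<phi> k w \<otimes> z)) = (LINT k|m. g (x \<otimes> z \<otimes> \<phi> k w))"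
        by (intro Bochner_Integration.integral_cong refl) (simp add: space_m' e)
      moreover have "integrable m (\<lambda>k. g (x \<otimes> z \<otimes> \<phi> k w))"
        using x z w by (intro integrable_continuous continuous_phi_section gc) auto
      then have "integrable m (\<lambda>k. g (x \<otimes> \<phi> k w \<otimes> z))"
        by (subst Bochner_Integration.integrable_cong[OF refl, of m _ "\<lambda>k. g (x \<otimes> z \<otimes> \<phi> k w)"]) (simp_all add: space_m' e)
      ultimately show ?thesis using eig[of "x \<otimes> z" w] x z w by simp
    qed
    have "(LINT k|m. q l (x \<otimes> \<phi> k w)) = (LINT k|m. 2 * g (x \<otimes> \<phi> k w) + l * g (x \<otimes> \<phi> k w \<otimes> y) + cnj l * g (x \<otimes> \<phi> k w \<otimes> inv y))"
      using x w by (intro Bochner_Integration.integral_cong refl) (simp add: space_m' qv)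
    also have "\<dots> = 2 * (LINT k|m. g (x \<otimes> \<phi> k w)) + l * (LINT k|m. g (x \<otimes> \<phi> k w \<otimes> y)) + cnj l * (LINT k|m. g (x \<otimes> \<phi> k w \<otimes> inv y))"
      using sh[OF y] sh[of "inv y"] y integrable_continuous[OF continuous_phi_section[OF gc x w]] by simp
    also have "\<dots> = f w * q l x"
      using sh[OF y] sh[of "inv y"] y eig[OF x w] x by (simp add: qv algebra_simps)
    finally show ?thesis .
  qed
  have norm_state: "(\<lambda>x. complex_of_real r * q l x) \<in> eigenstates f"
    if l: "norm l = 1" and r: "r > 0" "r * (2 + 2 * Re (l * g y)) = 1" for l r
    unfolding eigenstates_def
  proof (intro CollectI conjI allI impI ballI)
    show "complex_of_real r * q l x = 0" if "x \<notin> carrier G" for x using that by (simp add: q_def)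
    show "complex_of_real r * q l \<one> = 1" unfolding q1 of_real_mult[symmetric] r(2) by simp
    show "positive_definite (\<lambda>x. complex_of_real r * q l x)"
      unfolding positive_definite_def
    proof (intro conjI allI impI ballI)
      fix n and x :: "nat \<Rightarrow> 'a" and c assume x: "\<forall>i<n. x i \<in> carrier G"
      have "(\<Sum>i<n. \<Sum>j<n. c i * cnj (c j) * (complex_of_real r * q l (x i \<otimes> inv (x j))))
          = complex_of_real r * (\<Sum>i<n. \<Sum>j<n. c i * cnj (c j) * q l (x i \<otimes> inv (x j)))"
        by (simp add: sum_distrib_left mult_ac)
      moreover have "0 \<le> Re (\<Sum>i<n. \<Sum>j<n. c i * cnj (c j) * q l (x i \<otimes> inv (x j)))"
        by (rule positive_definiteD[OF qp[OF l]]) (use x in blast)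
      moreover have "Re (complex_of_real r * z) = r * Re z" for z by simp
      ultimately show "0 \<le> Re (\<Sum>i<n. \<Sum>j<n. c i * cnj (c j) * (complex_of_real r * q l (x i \<otimes> inv (x j))))"
        using r(1) by simp
    next
      fix x assume "x \<in> carrier G"
      then show "complex_of_real r * q l (inv x) = cnj (complex_of_real r * q l x)"
        by (simp add: positive_definite_inv[OF qp[OF l]])
    qed
    have "continuous_map euclidean euclidean (\<lambda>z :: complex. complex_of_real r * z)" by (simp add: continuous_intros)
    from continuous_map_compose[OF qc this] show "continuous_map T euclidean (\<lambda>x. complex_of_real r * q l x)" by (simp add: o_def)
    show "(LINT k|m. complex_of_real r * q l (x \<otimes> \<phi> k w)) = f w * (complex_of_real r * q l x)"
      if "x \<in> carrier G" "w \<in> carrier G" for x w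
      using qe[OF that, of l] by (simp add: mult_ac)
  qed
  have main: "l * g (x \<otimes> y) + cnj l * g (x \<otimes> inv y) = complex_of_real (2 * Re (l * g y)) * g x"
    if l: "norm l = 1" for l
  proof -
    define a where "a = Re (l * g y)"
    have ab: "\<bar>a\<bar> \<le> 1"
      using abs_Re_le_cmod[of "l * g y"] eigenstates_bound[OF g y] l by (simp add: a_def norm_mult)
    have l': "norm (- l) = 1" using l by simp
    have a': "Re (- l * g y) = - a" by (simp add: a_def)
    \<comment> \<open>Where normalization is impossible, the value at the unit is 0 and positive
      definiteness forces the whole function to vanish, which is again proportionality to
      \<open>g\<close>.\<close>
    have zero: "q l' x = 0" if "norm l' = 1" "Re (l' * g y) = - 1" for l'
    proof -
      have "Re (q l' \<one>) = 0" unfolding q1 that(2) by simp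
      then show ?thesis using positive_definite_bound[OF qp[OF that(1)] x] by simp
    qed
    consider "a = 1" | "a = - 1" | "- 1 < a" "a < 1" using ab by linarith
    then show ?thesis
    proof cases
      case 1
      then have "q (- l) x = 0" using a' l' by (intro zero) auto
      then have "l * g (x \<otimes> y) + cnj l * g (x \<otimes> inv y) = 2 * g x"
        unfolding qv[OF x] by (simp add: algebra_simps add_eq_0_iff)
      then show ?thesis using 1 by (simp add: a_def)
    next
      case 2
      then have "q l x = 0" using l by (intro zero) (auto simp: a_def)
      then have "l * g (x \<otimes> y) + cnj l * g (x \<otimes> inv y) = - 2 * g x"
        unfolding qv[OF x] by (simp add: algebra_simps add_eq_0_iff)
      then show ?thesis using 2 by (simp add: a_def)
    next
      case 3
      \<comment> \<open>\<open>r1\<close> and \<open>r2\<close> normalize \<open>q l\<close> and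
        \<open>q (- l)\<close>, whose values at the unit are \<open>2 + 2 * a\<close> and
        \<open>2 - 2 * a\<close>. The weight \<open>t\<close> is a quarter of the first value
        because the two functions add up to \<open>4 * g\<close>.\<close>
      define r1 where "r1 = 1 / (2 + 2 * a)"
      define r2 where "r2 = 1 / (2 - 2 * a)"
      define t where "t = (1 + a) / 2"
      have r: "r1 > 0" "r1 * (2 + 2 * Re (l * g y)) = 1" "r2 > 0" "r2 * (2 + 2 * Re (- l * g y)) = 1"
        using 3 unfolding a' a_def[symmetric] by (simp_all add: r1_def r2_def)
      have t: "0 < t" "t < 1" "t * r1 = 1 / 4" "(1 - t) * r2 = 1 / 4"
        using 3 by (simp_all add: t_def r1_def r2_def field_simps)
      have "(\<lambda>x. complex_of_real r1 * q l x) = g"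
      proof (rule ext[OF norm_state[OF l r(1,2)] norm_state[OF l' r(3,4)] t(1,2)])
        fix i
        show "g i = complex_of_real t * (complex_of_real r1 * q l i) + complex_of_real (1 - t) * (complex_of_real r2 * q (- l) i)"
        proof (cases "i \<in> carrier G")
          case True
          have "complex_of_real t * (complex_of_real r1 * q l i) + complex_of_real (1 - t) * (complex_of_real r2 * q (- l) i)
              = complex_of_real (t * r1) * q l i + complex_of_real ((1 - t) * r2) * q (- l) i"
            by (simp only: of_real_mult mult.assoc)
          also have "\<dots> = g i"
            unfolding t(3,4) qv[OF True] by (simp add: algebra_simps)
          finally show ?thesis by simp
        qed (simp add: gz q_def)
      qed
      then have gx: "complex_of_real r1 * q l x = g x" by (rule fun_cong)
      have k: "complex_of_real (2 + 2 * a) * complex_of_real r1 = 1"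
        unfolding of_real_mult[symmetric] using r(2) by (simp add: a_def mult.commute)
      have "q l x = (complex_of_real (2 + 2 * a) * complex_of_real r1) * q l x" by (simp only: k mult_1)
      also have "\<dots> = complex_of_real (2 + 2 * a) * g x" by (simp only: mult.assoc gx)
      finally have "q l x = complex_of_real (2 + 2 * a) * g x" .
      then show ?thesis unfolding qv[OF x] a_def[symmetric] by (simp add: algebra_simps)
    qed
  qed
  \<comment> \<open>Taking \<open>l = 1\<close> gives the sum and \<open>l = \<i>\<close> the
    difference of the two translates; half of their total is \<open>g x * g y\<close>.\<close>
  have 1: "g (x \<otimes> y) + g (x \<otimes> inv y) = complex_of_real (2 * Re (g y)) * g x"
    using main[of 1] by simp
  have 2: "\<i> * g (x \<otimes> y) - \<i> * g (x \<otimes> inv y) = complex_of_real (- 2 * Im (g y)) * g x"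
    using main[of \<i>] by simp
  have 3: "g (x \<otimes> y) - g (x \<otimes> inv y) = \<i> * complex_of_real (2 * Im (g y)) * g x"
  proof -
    have "g (x \<otimes> y) - g (x \<otimes> inv y) = - \<i> * (\<i> * g (x \<otimes> y) - \<i> * g (x \<otimes> inv y))" by (simp add: algebra_simps)
    then show ?thesis unfolding 2 by simp
  qed
  have "2 * g (x \<otimes> y) = (g (x \<otimes> y) + g (x \<otimes> inv y)) + (g (x \<otimes> y) - g (x \<otimes> inv y))" by simp
  also have "\<dots> = 2 * (complex_of_real (Re (g y)) + \<i> * complex_of_real (Im (g y))) * g x"
    unfolding 1 3 by (simp add: algebra_simps)
  also have "\<dots> = 2 * (g x * g y)" by (simp only: complex_eq[symmetric] mult_ac)
  finally show ?thesis by simp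
qed

text \<open>\<open>f\<close> itself shows that the compact set is nonempty. An extreme point is
  multiplicative, and its eigenvalue equation at the unit says that its average over
  \<open>K\<close> is \<open>f\<close>.\<close>

lemma spherical_is_average:
  assumes f: "spherical f"
  obtains \<xi> where "\<xi> \<in> carrier D" "\<And>w. w \<in> carrier G \<Longrightarrow> (LINT k|m. \<xi> (\<phi> k w)) = f w"
proof -
  have fc: "continuous_map T euclidean f" and f1: "f \<one> = 1"
    and feq: "\<And>x y. x \<in> carrier G \<Longrightarrow> y \<in> carrier G \<Longrightarrow> (LINT k|m. f (x \<otimes> \<phi> k y)) = f x * f y"
    using f by (auto simp: spherical_def)
  \<comment> \<open>Members of \<open>eigenstates\<close> vanish off the carrier, where
    \<open>f\<close> is arbitrary.\<close>
  define f0 where "f0 x = (if x \<in> carrier G then f x else 0)" for x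
  have "f0 \<in> eigenstates f"
    unfolding eigenstates_def
  proof (intro CollectI conjI allI impI ballI)
    show "f0 x = 0" if "x \<notin> carrier G" for x using that by (simp add: f0_def)
    show "f0 \<one> = 1" by (simp add: f0_def f1)
    show "positive_definite f0"
      by (rule positive_definite_cong[OF spherical_positive_definite[OF f]]) (simp add: f0_def)
    show "continuous_map T euclidean f0"
      by (rule continuous_map_eq[OF fc]) (simp add: f0_def topspace_eq_carrier)
    fix x w assume xw: "x \<in> carrier G" "w \<in> carrier G"
    have "(LINT k|m. f0 (x \<otimes> \<phi> k w)) = (LINT k|m. f (x \<otimes> \<phi> k w))"
      using xw by (intro Bochner_Integration.integral_cong refl) (simp add: f0_def space_m')
    then show "(LINT k|m. f0 (x \<otimes> \<phi> k w)) = f w * f0 x"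
      using feq[OF xw] xw by (simp add: f0_def mult.commute)
  qed
  then have ne: "eigenstates f \<noteq> {}" by blast
  have "\<exists>g\<in>eigenstates f. \<forall>x\<in>carrier G. \<forall>y\<in>carrier G. g (x \<otimes> y) = g x * g y"
  proof (rule exists_extreme_point[OF compact_eigenstates[OF f] ne])
    fix g assume g: "g \<in> eigenstates f"
      and ext: "\<And>p q t. p \<in> eigenstates f \<Longrightarrow> q \<in> eigenstates f \<Longrightarrow> 0 < t \<Longrightarrow> t < 1 \<Longrightarrow>
      (\<And>i. g i = complex_of_real t * p i + complex_of_real (1 - t) * q i) \<Longrightarrow> p = g"
    show ?thesis
    proof (intro bexI[OF _ g] ballI)
      fix x y assume xy: "x \<in> carrier G" "y \<in> carrier G"
      show "g (x \<otimes> y) = g x * g y"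
      proof (rule extreme_eigenstate_multiplicative[OF g _ xy])
        fix p q t assume pq: "p \<in> eigenstates f" "q \<in> eigenstates f" "0 < t" "t < 1"
          "\<And>i. g i = complex_of_real t * p i + complex_of_real (1 - t) * q i"
        show "p = g" by (rule ext[OF pq(1-4)]) (rule pq(5))
      qed
    qed
  qed
  then obtain g where g: "g \<in> eigenstates f"
    and mult': "\<forall>x\<in>carrier G. \<forall>y\<in>carrier G. g (x \<otimes> y) = g x * g y" by (elim bexE)
  have mult: "g (x \<otimes> y) = g x * g y" if "x \<in> carrier G" "y \<in> carrier G" for x y
    using mult' that by simp
  have g1: "g \<one> = 1" and gc: "continuous_map T euclidean g"
    and eig: "\<And>x w. x \<in> carrier G \<Longrightarrow> w \<in> carrier G \<Longrightarrow> (LINT k|m. g (x \<otimes> \<phi> k w)) = f w * g x"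
    using g by (auto simp: eigenstates_def)
  \<comment> \<open>The values at \<open>x\<close> and \<open>inv x\<close> have product 1 and
    moduli at most 1, so both moduli are 1.\<close>
  have n1: "norm (g x) = 1" if x: "x \<in> carrier G" for x
  proof -
    have "norm (g x) * norm (g (inv x)) = 1"
      using mult[of x "inv x"] x g1 by (simp add: norm_mult[symmetric])
    moreover have "norm (g x) \<le> 1" "norm (g (inv x)) \<le> 1" using eigenstates_bound[OF g] x by auto
    moreover have "norm (g x) * norm (g (inv x)) \<le> norm (g x) * 1"
      using calculation(3) by (intro mult_left_mono) auto
    ultimately show ?thesis by linarith
  qed
  define \<xi> where "\<xi> = (\<lambda>x\<in>carrier G. g x)"
  have "\<xi> \<in> carrier D"
    unfolding dual_carrier_iff \<xi>_def
  proof (intro conjI ballI)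
    show "continuous_map T euclidean (\<lambda>x\<in>carrier G. g x)" by (rule continuous_map_restrict_carrier[OF gc])
  qed (simp_all add: n1 mult)
  moreover have "(LINT k|m. \<xi> (\<phi> k w)) = f w" if w: "w \<in> carrier G" for w
  proof -
    have "(LINT k|m. \<xi> (\<phi> k w)) = (LINT k|m. g (\<one> \<otimes> \<phi> k w))"
      using w by (intro Bochner_Integration.integral_cong refl) (simp add: \<xi>_def space_m')
    then show ?thesis using eig[OF one_closed w] g1 by simp
  qed
  ultimately show thesis by (rule that)
qed

end

section \<open>The characters of the orbit hypergroup\<close>

lemma (in group_orbit) orbit_one: "orbit K \<phi> \<one> = {\<one>}"
  unfolding orbit_alt using K.one_closed by auto

context lca_orbit
begin

interpretation dual: group_orbit D DT K S m \<Psi>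
  by (rule group_orbit_dual)

abbreviation "H \<equiv> orbit_hypergroup K m G T \<phi>"
abbreviation "\<O> \<equiv> orbit K \<phi> ` carrier G"
abbreviation "OT \<equiv> orbit_topology K T \<phi>"
abbreviation "X \<equiv> character_topology H"

definition avg :: "('a \<Rightarrow> complex) \<Rightarrow> 'a \<Rightarrow> complex" where
  "avg \<xi> x = (LINT k|m. \<xi> (\<phi> k x))"

definition orbital_character :: "('a \<Rightarrow> complex) \<Rightarrow> 'a set \<Rightarrow> complex" where
  "orbital_character \<xi> = (\<lambda>A\<in>\<O>. avg \<xi> (rep A))"

lemma space_mD: "k \<in> space m \<Longrightarrow> k \<in> carrier K"
  by (simp add: space_m')

lemma character_phi_section:
  assumes "\<xi> \<in> carrier D" "x \<in> carrier G"
  shows "continuous_map S euclidean (\<lambda>k. \<xi> (\<phi> k x))"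
  using continuous_map_compose[OF continuous_map_phi_left[OF assms(2)] dual_carrierD(2)[OF assms(1)]]
  by (simp add: o_def)

lemma avg_phi:
  assumes xi: "\<xi> \<in> carrier D" and x: "x \<in> carrier G" and h: "h \<in> carrier K"
  shows "avg \<xi> (\<phi> h x) = avg \<xi> x"
proof -
  have "avg \<xi> (\<phi> h x) = (LINT k|m. \<xi> (\<phi> (k \<otimes>\<^bsub>K\<^esub> h) x))"
    unfolding avg_def by (rule Bochner_Integration.integral_cong[OF refl]) (simp add: phi_comp h x space_m')
  also have "\<dots> = avg \<xi> x"
    unfolding avg_def by (rule integral_right_translate[OF h character_phi_section[OF xi x]])
  finally show ?thesis .
qed

lemma avg_orbit_eq:
  assumes "\<xi> \<in> carrier D" "x \<in> carrier G" "y \<in> carrier G" "orbit K \<phi> x = orbit K \<phi> y"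
  shows "avg \<xi> x = avg \<xi> y"
proof -
  have "x \<in> orbit K \<phi> y" using orbit_self[OF assms(2)] assms(4) by simp
  then obtain k where "k \<in> carrier K" "x = \<phi> k y" unfolding orbit_alt by auto
  then show ?thesis using avg_phi assms by simp
qed

lemma orbital_character_orbit:
  assumes "\<xi> \<in> carrier D" "x \<in> carrier G"
  shows "orbital_character \<xi> (orbit K \<phi> x) = avg \<xi> x"
proof -
  have A: "orbit K \<phi> x \<in> \<O>" using assms by simp
  show ?thesis unfolding orbital_character_def using A
    by (simp add: avg_orbit_eq[OF assms(1) rep_props(1)[OF A] assms(2) rep_props(2)[OF A]])
qed

lemma continuous_avg:
  assumes "\<xi> \<in> carrier D"
  shows "continuous_map T euclidean (avg \<xi>)"
proof -
  have "continuous_map (prod_topology S T) T (\<lambda>z. \<phi> (fst z) (snd z))"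
    by (intro continuous_map_phi continuous_map_fst continuous_map_snd)
  from continuous_map_compose[OF this dual_carrierD(2)[OF assms]]
  have "continuous_map (prod_topology S T) euclidean (\<lambda>(k, x). \<xi> (\<phi> k x))"
    by (simp add: o_def case_prod_unfold)
  from continuous_average[OF this] show ?thesis by (simp add: avg_def[abs_def])
qed

lemma norm_avg_le:
  assumes "\<xi> \<in> carrier D" "x \<in> carrier G"
  shows "norm (avg \<xi> x) \<le> 1"
  unfolding avg_def
  by (rule norm_average_le[OF _ character_phi_section[OF assms]]) (simp add: dual_carrierD(3)[OF assms(1)] assms(2))

lemma avg_one: "\<xi> \<in> carrier D \<Longrightarrow> avg \<xi> \<one> = 1"
proof -
  assume xi: "\<xi> \<in> carrier D"
  have "avg \<xi> \<one> = (LINT k|m. 1)"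
    unfolding avg_def by (rule Bochner_Integration.integral_cong[OF refl]) (simp add: dual_one[OF xi] space_m')
  then show ?thesis by (simp add: prob_space)
qed

lemma avg_inv:
  assumes xi: "\<xi> \<in> carrier D" and x: "x \<in> carrier G"
  shows "avg \<xi> (inv x) = cnj (avg \<xi> x)"
proof -
  have "avg \<xi> (inv x) = (LINT k|m. cnj (\<xi> (\<phi> k x)))"
    unfolding avg_def
    by (rule Bochner_Integration.integral_cong[OF refl]) (simp add: phi_inverse dual_inv[OF xi] x space_m')
  then show ?thesis by (simp add: avg_def)
qed

lemma integral_character_mult:
  assumes xi: "\<xi> \<in> carrier D" and x: "x \<in> carrier G" and w: "w \<in> carrier G"
  shows "(LINT k|m. \<xi> (x \<otimes> \<phi> k w)) = avg \<xi> w * \<xi> x"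
proof -
  have "(LINT k|m. \<xi> (x \<otimes> \<phi> k w)) = (LINT k|m. \<xi> x * \<xi> (\<phi> k w))"
    by (rule Bochner_Integration.integral_cong[OF refl]) (simp add: dual_carrierD(4)[OF xi] x w space_m')
  also have "\<dots> = \<xi> x * avg \<xi> w" by (simp add: avg_def)
  finally show ?thesis by simp
qed

text \<open>After exchanging the integrals, \<open>\<phi> k\<close> distributes over the product,
  left invariance absorbs \<open>k\<close> in the second factor, and multiplicativity of
  \<open>\<xi>\<close> separates the two.\<close>

lemma integral_avg_mult:
  assumes xi: "\<xi> \<in> carrier D" and x: "x \<in> carrier G" and y: "y \<in> carrier G"
  shows "(LINT l|m. avg \<xi> (x \<otimes> \<phi> l y)) = avg \<xi> x * avg \<xi> y"
proof -
  have "continuous_map (prod_topology S S) T (\<lambda>z. \<phi> (fst z) (x \<otimes> \<phi> (snd z) y))"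
    by (intro continuous_map_phi continuous_map_mult continuous_map_fst continuous_map_snd)
      (simp_all add: x y topspace_eq_carrier)
  from continuous_map_compose[OF this dual_carrierD(2)[OF xi]]
  have c: "continuous_map (prod_topology S S) euclidean (\<lambda>(k, l). \<xi> (\<phi> k (x \<otimes> \<phi> l y)))"
    by (simp add: o_def case_prod_unfold)
  have "(LINT l|m. avg \<xi> (x \<otimes> \<phi> l y)) = (LINT k|m. LINT l|m. \<xi> (\<phi> k (x \<otimes> \<phi> l y)))"
    unfolding avg_def by (rule integral_swap[OF c])
  also have "\<dots> = (LINT k|m. \<xi> (\<phi> k x) * avg \<xi> y)"
  proof (rule Bochner_Integration.integral_cong[OF refl])
    fix k assume "k \<in> space m"
    then have k: "k \<in> carrier K" by (rule space_mD)
    have "(LINT l|m. \<xi> (\<phi> k (x \<otimes> \<phi> l y))) = (LINT l|m. \<xi> (\<phi> k x \<otimes> \<phi> (k \<otimes>\<^bsub>K\<^esub> l) y))"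
      by (rule Bochner_Integration.integral_cong[OF refl]) (simp add: phi_comp phi_mult k x y space_m')
    also have "\<dots> = (LINT l|m. \<xi> (\<phi> k x \<otimes> \<phi> l y))"
      by (rule integral_left_translate[OF k continuous_phi_section[OF dual_carrierD(2)[OF xi] phi_closed[OF k x] y]])
    also have "\<dots> = \<xi> (\<phi> k x) * avg \<xi> y" using integral_character_mult[OF xi phi_closed[OF k x] y] by simp
    finally show "(LINT l|m. \<xi> (\<phi> k (x \<otimes> \<phi> l y))) = \<xi> (\<phi> k x) * avg \<xi> y" .
  qed
  also have "\<dots> = avg \<xi> x * avg \<xi> y" by (simp add: avg_def)
  finally show ?thesis .
qed

lemma avg_dual_action:
  assumes xi: "\<xi> \<in> carrier D" and h: "h \<in> carrier K" and x: "x \<in> carrier G"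
  shows "avg (\<Psi> h \<xi>) x = avg \<xi> x"
proof -
  have "avg (\<Psi> h \<xi>) x = (LINT k|m. \<xi> (\<phi> (inv\<^bsub>K\<^esub> h \<otimes>\<^bsub>K\<^esub> k) x))"
    unfolding avg_def
    by (rule Bochner_Integration.integral_cong[OF refl]) (simp add: dual_action_val[OF xi] phi_comp h x space_m')
  also have "\<dots> = avg \<xi> x"
    unfolding avg_def by (rule integral_left_translate[OF K.inv_closed[OF h] character_phi_section[OF xi x]])
  finally show ?thesis .
qed

text \<open>The product formula on the dual side: the integral over \<open>l\<close> of
  \<open>\<eta>\<close> at \<open>\<phi> (inv l) z\<close> is the average of \<open>\<eta>\<close>
  at \<open>z\<close> by inversion invariance, and this average does not change along the orbit of
  \<open>x\<close>. It exhibits the hyperproduct of two averaged characters.\<close>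

lemma integral_avg_dual_mult:
  assumes xi: "\<xi> \<in> carrier D" and eta: "\<eta> \<in> carrier D" and x: "x \<in> carrier G"
  shows "(LINT l|m. avg (\<xi> \<otimes>\<^bsub>D\<^esub> \<Psi> l \<eta>) x) = avg \<xi> x * avg \<eta> x"
proof -
  have "continuous_map (prod_topology S S) T (\<lambda>z. \<phi> (inv\<^bsub>K\<^esub> (snd z)) (\<phi> (fst z) x))"
    by (intro continuous_map_phi K.continuous_map_inv continuous_map_fst continuous_map_snd)
      (simp_all add: x topspace_eq_carrier)
  from continuous_map_compose[OF this dual_carrierD(2)[OF eta]]
  have c1: "continuous_map (prod_topology S S) euclidean (\<lambda>z. \<eta> (\<phi> (inv\<^bsub>K\<^esub> (snd z)) (\<phi> (fst z) x)))"
    by (simp add: o_def)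
  have c2: "continuous_map (prod_topology S S) euclidean (\<lambda>z. \<xi> (\<phi> (fst z) x))"
    using continuous_map_compose[OF continuous_map_fst character_phi_section[OF xi x], of S] by (simp add: o_def)
  have c: "continuous_map (prod_topology S S) euclidean (\<lambda>(k, l). \<xi> (\<phi> k x) * \<eta> (\<phi> (inv\<^bsub>K\<^esub> l) (\<phi> k x)))"
    using continuous_map_times[OF c2 c1] by (simp add: case_prod_unfold)
  have "(LINT l|m. avg (\<xi> \<otimes>\<^bsub>D\<^esub> \<Psi> l \<eta>) x) = (LINT l|m. LINT k|m. \<xi> (\<phi> k x) * \<eta> (\<phi> (inv\<^bsub>K\<^esub> l) (\<phi> k x)))"
    unfolding avg_def
  proof (rule Bochner_Integration.integral_cong[OF refl], rule Bochner_Integration.integral_cong[OF refl])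
    fix l k assume "l \<in> space m" "k \<in> space m"
    then show "(\<xi> \<otimes>\<^bsub>D\<^esub> \<Psi> l \<eta>) (\<phi> k x) = \<xi> (\<phi> k x) * \<eta> (\<phi> (inv\<^bsub>K\<^esub> l) (\<phi> k x))"
      by (simp add: dual_mult dual_action_val[OF eta] x space_m')
  qed
  also have "\<dots> = (LINT k|m. LINT l|m. \<xi> (\<phi> k x) * \<eta> (\<phi> (inv\<^bsub>K\<^esub> l) (\<phi> k x)))" by (rule integral_swap[OF c])
  also have "\<dots> = (LINT k|m. \<xi> (\<phi> k x) * avg \<eta> x)"
  proof (rule Bochner_Integration.integral_cong[OF refl])
    fix k assume "k \<in> space m"
    then have k: "k \<in> carrier K" by (rule space_mD)
    have "(LINT l|m. \<eta> (\<phi> (inv\<^bsub>K\<^esub> l) (\<phi> k x))) = avg \<eta> (\<phi> k x)"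
      unfolding avg_def by (rule integral_inverse[OF character_phi_section[OF eta phi_closed[OF k x]]])
    then show "(LINT l|m. \<xi> (\<phi> k x) * \<eta> (\<phi> (inv\<^bsub>K\<^esub> l) (\<phi> k x))) = \<xi> (\<phi> k x) * avg \<eta> x"
      by (simp add: avg_phi[OF eta x k])
  qed
  also have "\<dots> = avg \<xi> x * avg \<eta> x" by (simp add: avg_def)
  finally show ?thesis .
qed

lemma continuous_orbital_character:
  assumes "\<xi> \<in> carrier D"
  shows "continuous_map OT euclidean (orbital_character \<xi>)"
proof (rule continuous_map_from_orbit_topology)
  show "continuous_map T euclidean (\<lambda>x. orbital_character \<xi> (orbit K \<phi> x))"
    by (rule continuous_map_eq[OF continuous_avg[OF assms]])
      (simp add: orbital_character_orbit[OF assms] topspace_eq_carrier)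
qed

lemma one_orbit: "orbit K \<phi> \<one> \<in> \<O>"
  by simp

lemma orbital_character_in:
  assumes xi: "\<xi> \<in> carrier D"
  shows "orbital_character \<xi> \<in> hypergroup_characters H"
  unfolding hypergroup_characters_def mem_Collect_eq topspace_orbit_hypergroup unfolding htop_orbit_hypergroup
proof (intro conjI ballI)
  show "orbital_character \<xi> \<in> extensional \<O>" by (simp add: orbital_character_def)
  show "\<exists>x\<in>\<O>. orbital_character \<xi> x \<noteq> 0"
    by (rule bexI[OF _ one_orbit]) (simp add: orbital_character_orbit[OF xi] avg_one[OF xi])
  show "bounded (orbital_character \<xi> ` \<O>)"
    unfolding bounded_iff by (rule exI[of _ 1]) (auto simp: orbital_character_orbit[OF xi] norm_avg_le[OF xi])
  show "continuous_map OT euclidean (orbital_character \<xi>)" by (rule continuous_orbital_character[OF xi])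
next
  fix A assume "A \<in> \<O>"
  then obtain x where x: "x \<in> carrier G" "A = orbit K \<phi> x" by auto
  show "orbital_character \<xi> (hinv H A) = cnj (orbital_character \<xi> A)"
    by (simp add: x hinv_orbit_hypergroup orbital_character_orbit[OF xi] avg_inv[OF xi])
next
  fix A B assume A: "A \<in> \<O>" and B: "B \<in> \<O>"
  have a: "rep A \<in> carrier G" "orbit K \<phi> (rep A) = A" and b: "rep B \<in> carrier G" "orbit K \<phi> (rep B) = B"
    using rep_props[OF A] rep_props[OF B] by auto
  have "(LINT z|hprod H A B. orbital_character \<xi> z) = (LINT l|m. orbital_character \<xi> (orbit K \<phi> (rep A \<otimes> \<phi> l (rep B))))"
    unfolding hprod_orbit_hypergroup[OF A B]
    by (rule integral_distr[OF measurable_m[OF continuous_map_orbit_product[OF a(1) b(1)]]])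
      (rule borel_measurable_continuous_map[OF refl continuous_orbital_character[OF xi]])
  also have "\<dots> = (LINT l|m. avg \<xi> (rep A \<otimes> \<phi> l (rep B)))"
    by (rule Bochner_Integration.integral_cong[OF refl]) (simp add: orbital_character_orbit[OF xi] a b space_m')
  also have "\<dots> = avg \<xi> (rep A) * avg \<xi> (rep B)" by (rule integral_avg_mult[OF xi a(1) b(1)])
  finally show "(LINT z|hprod H A B. orbital_character \<xi> z) = orbital_character \<xi> A * orbital_character \<xi> B"
    using A B by (simp add: orbital_character_def)
qed

lemma hypergroup_characterD:
  assumes tau: "\<tau> \<in> hypergroup_characters H"
  shows "\<tau> \<in> extensional \<O>" "continuous_map OT euclidean \<tau>"
    "\<exists>A\<in>\<O>. \<tau> A \<noteq> 0" "bounded (\<tau> ` \<O>)" "x \<in> carrier G \<Longrightarrow> \<tau> (orbit K \<phi> (inv x)) = cnj (\<tau> (orbit K \<phi> x))"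
    "A \<in> \<O> \<Longrightarrow> B \<in> \<O> \<Longrightarrow> (LINT l|m. \<tau> (orbit K \<phi> (rep A \<otimes> \<phi> l (rep B)))) = \<tau> A * \<tau> B"
proof -
  note h = tau[unfolded hypergroup_characters_def mem_Collect_eq topspace_orbit_hypergroup, unfolded htop_orbit_hypergroup]
  show "\<tau> \<in> extensional \<O>" and c: "continuous_map OT euclidean \<tau>" and "\<exists>A\<in>\<O>. \<tau> A \<noteq> 0" and "bounded (\<tau> ` \<O>)"
    using h by auto
  show "\<tau> (orbit K \<phi> (inv x)) = cnj (\<tau> (orbit K \<phi> x))" if x: "x \<in> carrier G"
  proof -
    have "orbit K \<phi> x \<in> \<O>" using x by simp
    then have "\<tau> (hinv H (orbit K \<phi> x)) = cnj (\<tau> (orbit K \<phi> x))"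
      using h by blast
    then show ?thesis by (simp add: hinv_orbit_hypergroup x)
  qed
  assume A: "A \<in> \<O>" and B: "B \<in> \<O>"
  have "(LINT z|hprod H A B. \<tau> z) = (LINT l|m. \<tau> (orbit K \<phi> (rep A \<otimes> \<phi> l (rep B))))"
    unfolding hprod_orbit_hypergroup[OF A B]
    by (rule integral_distr[OF measurable_m[OF continuous_map_orbit_product[OF rep_props(1)[OF A] rep_props(1)[OF B]]]])
      (rule borel_measurable_continuous_map[OF refl c])
  moreover have "(LINT z|hprod H A B. \<tau> z) = \<tau> A * \<tau> B"
    using h A B by blast
  ultimately show "(LINT l|m. \<tau> (orbit K \<phi> (rep A \<otimes> \<phi> l (rep B)))) = \<tau> A * \<tau> B" by simp
qed

text \<open>The hyperproduct is computed with chosen representatives, which differ from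
  \<open>x\<close> and \<open>y\<close> by elements \<open>a\<close> and \<open>b\<close> of
  \<open>K\<close>. \<open>K\<close>-invariance moves both into the integration variable, where left
  and right invariance of \<open>m\<close> absorb them.\<close>

lemma hypergroup_character_spherical:
  assumes tau: "\<tau> \<in> hypergroup_characters H"
  defines "f \<equiv> \<lambda>x. \<tau> (orbit K \<phi> x)"
  shows "spherical f"
proof -
  note tauD = hypergroup_characterD[OF tau]
  have fc: "continuous_map T euclidean f" unfolding f_def by (rule continuous_map_of_orbit[OF tauD(2)])
  have fK: "f (\<phi> k x) = f x" if "k \<in> carrier K" "x \<in> carrier G" for k x using that by (simp add: f_def)
  have mult: "(LINT l|m. f (x \<otimes> \<phi> l y)) = f x * f y" if x: "x \<in> carrier G" and y: "y \<in> carrier G" for x y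
  proof -
    define A where "A = orbit K \<phi> x"
    define B where "B = orbit K \<phi> y"
    have A: "A \<in> \<O>" and B: "B \<in> \<O>" using x y by (auto simp: A_def B_def)
    have "rep A \<in> orbit K \<phi> x" "rep B \<in> orbit K \<phi> y" using rep_props(3)[OF A] rep_props(3)[OF B] by (simp_all add: A_def B_def)
    then obtain a b where ab: "a \<in> carrier K" "rep A = \<phi> a x" "b \<in> carrier K" "rep B = \<phi> b y"
      unfolding orbit_alt by auto
    have e: "f (rep A \<otimes> \<phi> l (rep B)) = f (x \<otimes> \<phi> (inv\<^bsub>K\<^esub> a \<otimes>\<^bsub>K\<^esub> (l \<otimes>\<^bsub>K\<^esub> b)) y)" if l: "l \<in> carrier K" for l
    proof -
      have "f (rep A \<otimes> \<phi> l (rep B)) = f (\<phi> (inv\<^bsub>K\<^esub> a) (rep A \<otimes> \<phi> l (rep B)))"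
        using ab l x y by (simp add: fK)
      also have "\<phi> (inv\<^bsub>K\<^esub> a) (rep A \<otimes> \<phi> l (rep B)) = x \<otimes> \<phi> (inv\<^bsub>K\<^esub> a \<otimes>\<^bsub>K\<^esub> (l \<otimes>\<^bsub>K\<^esub> b)) y"
        using ab l x y by (simp add: phi_mult phi_comp)
      finally show ?thesis .
    qed
    have c: "continuous_map S euclidean (\<lambda>l. f (x \<otimes> \<phi> l y))" by (rule continuous_phi_section[OF fc x y])
    have "continuous_map S S (\<lambda>l. inv\<^bsub>K\<^esub> a \<otimes>\<^bsub>K\<^esub> l)"
      using ab by (intro K.continuous_map_mult) (auto simp: K.topspace_eq_carrier)
    from continuous_map_compose[OF this c]
    have c': "continuous_map S euclidean (\<lambda>l. f (x \<otimes> \<phi> (inv\<^bsub>K\<^esub> a \<otimes>\<^bsub>K\<^esub> l) y))" by (simp add: o_def)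
    have "f x * f y = (LINT l|m. f (rep A \<otimes> \<phi> l (rep B)))"
      using tauD(6)[OF A B] by (simp add: f_def A_def B_def)
    also have "\<dots> = (LINT l|m. f (x \<otimes> \<phi> (inv\<^bsub>K\<^esub> a \<otimes>\<^bsub>K\<^esub> (l \<otimes>\<^bsub>K\<^esub> b)) y))"
      by (rule Bochner_Integration.integral_cong[OF refl]) (simp add: e space_m')
    also have "\<dots> = (LINT l|m. f (x \<otimes> \<phi> (inv\<^bsub>K\<^esub> a \<otimes>\<^bsub>K\<^esub> l) y))"
      by (rule integral_right_translate[OF ab(3) c'])
    also have "\<dots> = (LINT l|m. f (x \<otimes> \<phi> l y))"
      by (rule integral_left_translate[OF K.inv_closed[OF ab(1)] c])
    finally show ?thesis by simp
  qed
  obtain A where A: "A \<in> \<O>" "\<tau> A \<noteq> 0" using tauD(3) by auto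
  then obtain x where x: "x \<in> carrier G" "f x \<noteq> 0" by (auto simp: f_def)
  \<comment> \<open>The action fixes the unit, so the functional equation at the unit gives
    \<open>f x * f \<one> = f x\<close>; a point with \<open>f x \<noteq> 0\<close> forces
    \<open>f \<one> = 1\<close>.\<close>
  have "f x * f \<one> = (LINT l|m. f x)"
    unfolding mult[OF x(1) one_closed, symmetric]
    by (rule Bochner_Integration.integral_cong[OF refl]) (simp add: x space_m')
  then have f1: "f \<one> = 1" using x(2) by (simp add: prob_space)
  obtain b where "\<And>A. A \<in> \<O> \<Longrightarrow> norm (\<tau> A) \<le> b" using tauD(4) unfolding bounded_iff by auto
  then have "bounded_fun f" unfolding bounded_fun_def f_def by (intro exI[of _ b]) auto
  then show ?thesis
    unfolding spherical_def using fc f1 fK mult tauD(5) by (auto simp: f_def)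
qed

lemma hypergroup_characters_orbit: "hypergroup_characters H = orbital_character ` carrier D"
proof
  show "orbital_character ` carrier D \<subseteq> hypergroup_characters H" using orbital_character_in by auto
  show "hypergroup_characters H \<subseteq> orbital_character ` carrier D"
  proof
    fix \<tau> assume tau: "\<tau> \<in> hypergroup_characters H"
    obtain \<xi> where xi: "\<xi> \<in> carrier D" "\<And>w. w \<in> carrier G \<Longrightarrow> (LINT k|m. \<xi> (\<phi> k w)) = \<tau> (orbit K \<phi> w)"
      by (rule spherical_is_average[OF hypergroup_character_spherical[OF tau]]) (rule that)
    have "\<tau> = orbital_character \<xi>"
    proof (rule extensionalityI[where A = \<O>])
      show "\<tau> \<in> extensional \<O>" by (rule hypergroup_characterD(1)[OF tau])
      show "orbital_character \<xi> \<in> extensional \<O>" by (simp add: orbital_character_def)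
      show "\<tau> A = orbital_character \<xi> A" if "A \<in> \<O>" for A
        using that xi(2) by (auto simp: orbital_character_orbit[OF xi(1)] avg_def)
    qed
    then show "\<tau> \<in> orbital_character ` carrier D" using xi(1) by simp
  qed
qed

end

section \<open>Functions of finitely many coordinates\<close>

text \<open>Real polynomials in the real and imaginary parts of the coordinates in \<open>J\<close>;
  the functions are real-valued to fit the Stone-Weierstrass theorem.\<close>

inductive_set coordinate_ring :: "'i set \<Rightarrow> (('i \<Rightarrow> complex) \<Rightarrow> real) set" for J where
  const: "(\<lambda>h. c) \<in> coordinate_ring J"
| Re: "i \<in> J \<Longrightarrow> (\<lambda>h. Re (h i)) \<in> coordinate_ring J"
| Im: "i \<in> J \<Longrightarrow> (\<lambda>h. Im (h i)) \<in> coordinate_ring J"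
| add: "r \<in> coordinate_ring J \<Longrightarrow> s \<in> coordinate_ring J \<Longrightarrow> (\<lambda>h. r h + s h) \<in> coordinate_ring J"
| mult: "r \<in> coordinate_ring J \<Longrightarrow> s \<in> coordinate_ring J \<Longrightarrow> (\<lambda>h. r h * s h) \<in> coordinate_ring J"

lemma continuous_on_coordinate_ring:
  "r \<in> coordinate_ring J \<Longrightarrow> continuous_on UNIV r"
  by (induction rule: coordinate_ring.induct) (auto intro!: continuous_intros)

lemma coordinate_ring_separates:
  assumes "i \<in> J" "f i \<noteq> g i"
  shows "\<exists>r\<in>coordinate_ring J. r f \<noteq> r g"
proof (cases "Re (f i) = Re (g i)")
  case True
  then have "Im (f i) \<noteq> Im (g i)" using assms(2) by (simp add: complex_eq_iff)
  then show ?thesis using coordinate_ring.Im[OF assms(1)] by (rule rev_bexI[rotated])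
next
  case False
  then show ?thesis using coordinate_ring.Re[OF assms(1)] by (rule rev_bexI[rotated])
qed

lemma coordinate_ring_bounded:
  assumes "r \<in> coordinate_ring J" and bd: "\<And>i. i \<in> J \<Longrightarrow> \<exists>b. \<forall>h\<in>E. norm (h i) \<le> b"
  shows "\<exists>b. \<forall>h\<in>E. \<bar>r h\<bar> \<le> b"
  using assms(1)
proof (induction rule: coordinate_ring.induct)
  case (const c)
  then show ?case by auto
next
  case (Re i)
  then obtain b where "\<forall>h\<in>E. norm (h i) \<le> b" using bd by blast
  then show ?case using abs_Re_le_cmod by (intro exI[of _ b] ballI) (meson order_trans)
next
  case (Im i)
  then obtain b where "\<forall>h\<in>E. norm (h i) \<le> b" using bd by blast
  then show ?case using abs_Im_le_cmod by (intro exI[of _ b] ballI) (meson order_trans)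
next
  case (add r s)
  then obtain a b where "\<forall>h\<in>E. \<bar>r h\<bar> \<le> a" "\<forall>h\<in>E. \<bar>s h\<bar> \<le> b" by blast
  then have "\<forall>h\<in>E. \<bar>r h + s h\<bar> \<le> a + b" by (auto intro: order_trans[OF abs_triangle_ineq add_mono])
  then show ?case by blast
next
  case (mult r s)
  then obtain a b where ab: "\<forall>h\<in>E. \<bar>r h\<bar> \<le> a" "\<forall>h\<in>E. \<bar>s h\<bar> \<le> b" by blast
  have "\<bar>r h * s h\<bar> \<le> a * b" if "h \<in> E" for h
  proof -
    have "\<bar>r h\<bar> \<le> a" "\<bar>s h\<bar> \<le> b" "0 \<le> \<bar>r h\<bar>" using ab that by auto
    then show ?thesis unfolding abs_mult by (intro mult_mono) linarith+
  qed
  then show ?case by blast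
qed

text \<open>Below, \<open>P u\<close> will say that two measures give the same integrals against
  \<open>u\<close>. If this survives multiplication by coordinates and their conjugates, it survives
  multiplication by every polynomial; \<open>u\<close> is kept general in the induction so that a
  product is handled by two successive multiplications.\<close>

lemma coordinate_ring_multiplier:
  assumes r: "r \<in> coordinate_ring J" and u: "P u"
    and add: "\<And>u v. P u \<Longrightarrow> P v \<Longrightarrow> P (\<lambda>h. u h + v h)"
    and scale: "\<And>c u. P u \<Longrightarrow> P (\<lambda>h. c * u h)"
    and coord: "\<And>i u. i \<in> J \<Longrightarrow> P u \<Longrightarrow> P (\<lambda>h. h i * u h)"
    and conj: "\<And>i u. i \<in> J \<Longrightarrow> P u \<Longrightarrow> P (\<lambda>h. cnj (h i) * u h)"
  shows "P (\<lambda>h. complex_of_real (r h) * u h)"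
  using r u
proof (induction arbitrary: u rule: coordinate_ring.induct)
  case (const c)
  then show ?case by (rule scale)
next
  case (Re i)
  have eq: "(\<lambda>h. complex_of_real (Re (h i)) * u h) = (\<lambda>h. 1 / 2 * (h i * u h + cnj (h i) * u h))"
    by (rule ext) (simp add: complex_eq_iff field_simps)
  show ?case unfolding eq by (rule scale[OF add[OF coord[OF Re(1,2)] conj[OF Re(1,2)]]])
next
  case (Im i)
  have eq: "(\<lambda>h. complex_of_real (Im (h i)) * u h) = (\<lambda>h. (- \<i> / 2) * (h i * u h + (- 1) * (cnj (h i) * u h)))"
    by (rule ext) (simp add: complex_eq_iff field_simps)
  show ?case unfolding eq by (rule scale[OF add[OF coord[OF Im(1,2)] scale[OF conj[OF Im(1,2)]]]])
next
  case (add r s)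
  have eq: "(\<lambda>h. complex_of_real (r h + s h) * u h) = (\<lambda>h. complex_of_real (r h) * u h + complex_of_real (s h) * u h)"
    by (simp add: algebra_simps)
  show ?case unfolding eq by (rule assms(3)[OF add.IH(1)[OF add.prems] add.IH(2)[OF add.prems]])
next
  case (mult r s)
  have eq: "(\<lambda>h. complex_of_real (r h * s h) * u h) = (\<lambda>h. complex_of_real (r h) * (complex_of_real (s h) * u h))"
    by (simp add: algebra_simps)
  show ?case unfolding eq by (rule mult.IH(1)[OF mult.IH(2)[OF mult.prems]])
qed

lemma coordinate_ring_polynomial:
  assumes "real_polynomial_function q" and r: "r \<in> coordinate_ring J"
  shows "(\<lambda>h. q (r h)) \<in> coordinate_ring J"
  using assms(1)
proof (induction rule: real_polynomial_function.induct)
  case (linear f)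
  have "f x = f 1 * x" for x
    using linear_scale[OF bounded_linear.linear[OF linear], of x 1] by simp
  then have "(\<lambda>h. f (r h)) = (\<lambda>h. f 1 * r h)" by (intro ext) (rule \<open>\<And>x. f x = f 1 * x\<close>)
  then show ?case using coordinate_ring.mult[OF coordinate_ring.const r, of "f 1"] by (simp only:)
next
  case (const c)
  then show ?case by (rule coordinate_ring.const)
next
  case (add f g)
  then show ?case by (intro coordinate_ring.add)
next
  case (mult f g)
  then show ?case by (intro coordinate_ring.mult)
qed

lemma coordinate_ring_separation:
  assumes AB: "compact A" "compact B" "A \<inter> B = {}"
    and sep: "\<And>f g. f \<in> A \<union> B \<Longrightarrow> g \<in> A \<union> B \<Longrightarrow> f \<noteq> g \<Longrightarrow> \<exists>i\<in>J. f i \<noteq> g i"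
    and e: "0 < e" "e < 1"
  obtains r where "r \<in> coordinate_ring J" "\<And>x. x \<in> A \<union> B \<Longrightarrow> 0 \<le> r x \<and> r x \<le> 1"
    "\<And>x. x \<in> A \<Longrightarrow> r x < e" "\<And>x. x \<in> B \<Longrightarrow> r x > 1 - e"
proof (rule compact_separation[OF AB, of "coordinate_ring J" e])
  show "continuous_on UNIV r" if "r \<in> coordinate_ring J" for r by (rule continuous_on_coordinate_ring[OF that])
  show "\<exists>r\<in>coordinate_ring J. r f \<noteq> r g" if "f \<in> A \<union> B" "g \<in> A \<union> B" "f \<noteq> g" for f g
    using sep[OF that] coordinate_ring_separates[of _ J f g] by blast
qed (rule coordinate_ring.add, assumption+, rule coordinate_ring.mult, assumption+, rule coordinate_ring.const,
    rule e, rule e, rule that)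

text \<open>Inner regularity replaces the complement of \<open>C\<close> by a compact
  \<open>L\<close>, up to a small mass of \<open>\<nu>\<close>. A polynomial close to 1 on
  \<open>C\<close> and to 0 on \<open>L\<close> then compares the two measures of
  \<open>C\<close>.\<close>

lemma radon_compact_le:
  fixes \<mu> \<nu> :: "('i \<Rightarrow> complex) measure" and X :: "('i \<Rightarrow> complex) topology"
  assumes mu: "radon_probability X \<mu>" and nu: "radon_probability X \<nu>" and X: "Hausdorff_space X"
    and id: "continuous_map X euclidean (\<lambda>f. f)"
    and sep: "\<And>f g. f \<in> topspace X \<Longrightarrow> g \<in> topspace X \<Longrightarrow> f \<noteq> g \<Longrightarrow> \<exists>i\<in>J. f i \<noteq> g i"
    and bd: "\<And>i. i \<in> J \<Longrightarrow> \<exists>b. \<forall>h\<in>topspace X. norm (h i) \<le> b"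
    and eq: "\<And>r. r \<in> coordinate_ring J \<Longrightarrow> (LINT h|\<mu>. r h) = (LINT h|\<nu>. r h)"
    and C: "compactin X C"
  shows "measure \<mu> C \<le> measure \<nu> C"
proof -
  interpret mu: prob_space \<mu> by (rule radon_probability_prob[OF mu])
  interpret nu: prob_space \<nu> by (rule radon_probability_prob[OF nu])
  note sets = radon_probability_sets[OF mu] radon_probability_sets[OF nu]
  note spaces = radon_probability_space[OF mu] radon_probability_space[OF nu]
  \<comment> \<open>The five errors: the factor \<open>1 - e\<close> on \<open>C\<close>, the mass
    missed by \<open>L\<close>, the bound \<open>e\<close> on \<open>L\<close>, and the polynomial
    approximation of \<open>clamp\<close> once for each measure.\<close>
  have step: "measure \<mu> C \<le> measure \<nu> C + 5 * e" if e: "0 < e" "e < 1" for e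
  proof -
    define E where "E = topspace X - C"
    have Cs: "C \<in> sets (borel_of X)" by (rule compactin_sets_borel_of[OF X C])
    have CX: "C \<subseteq> topspace X" by (rule compactin_subset_topspace[OF C])
    have Es: "E \<in> sets \<nu>" unfolding E_def using Cs sets(2) spaces(2) by (metis sets.compl_sets)
    obtain L where L: "compactin X L" "L \<subseteq> E" "measure \<nu> E \<le> measure \<nu> L + e"
    proof (cases "measure \<nu> E \<le> e")
      case True
      then show ?thesis using that[of "{}"] by simp
    next
      case False
      then have "ennreal (measure \<nu> E - e) < emeasure \<nu> E"
        unfolding nu.emeasure_eq_measure using e by (intro ennreal_lessI) auto
      then obtain L where "compactin X L" "L \<subseteq> E" "ennreal (measure \<nu> E - e) < emeasure \<nu> L"
        by (rule radon_probability_inner[OF nu Es]) (rule that)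
      moreover from this have "measure \<nu> E - e < measure \<nu> L"
        using False by (simp add: nu.emeasure_eq_measure ennreal_less_iff)
      ultimately show ?thesis using that[of L] by linarith
    qed
    have Ls: "L \<in> sets (borel_of X)" by (rule compactin_sets_borel_of[OF X L(1)])
    have LX: "L \<subseteq> topspace X" by (rule compactin_subset_topspace[OF L(1)])
    have cC: "compact C" and cL: "compact L" using image_compactin[OF C id] image_compactin[OF L(1) id] by simp_all
    have LC: "L \<inter> C = {}" using L(2) by (auto simp: E_def)
    obtain r where r: "r \<in> coordinate_ring J" "\<And>x. x \<in> L \<union> C \<Longrightarrow> 0 \<le> r x \<and> r x \<le> 1"
      "\<And>x. x \<in> L \<Longrightarrow> r x < e" "\<And>x. x \<in> C \<Longrightarrow> r x > 1 - e"
    proof (rule coordinate_ring_separation[OF cL cC LC, of J e])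
      show "\<exists>i\<in>J. x i \<noteq> y i" if "x \<in> L \<union> C" "y \<in> L \<union> C" "x \<noteq> y" for x y
        by (rule sep) (use that LX CX in auto)
    qed (rule e, rule e, rule that)
    obtain b where b: "\<And>h. h \<in> topspace X \<Longrightarrow> \<bar>r h\<bar> \<le> b" using coordinate_ring_bounded[OF r(1) bd] by auto
    \<comment> \<open>Outside \<open>C\<close> and \<open>L\<close> nothing controls the range of
      \<open>r\<close> beyond \<open>[-b, b]\<close>. Clamping to \<open>[0, 1]\<close> makes the
      estimate valid there, and a polynomial approximation \<open>q\<close> of \<open>clamp\<close>
      on \<open>[-b, b]\<close> leads back into the ring, where both measures agree.\<close>
    define clamp where "clamp t = max 0 (min 1 t)" for t :: real
    have cl: "0 \<le> clamp t" "clamp t \<le> 1" for t by (auto simp: clamp_def)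
    have "continuous_on {-b..b} clamp" unfolding clamp_def by (intro continuous_intros)
    then obtain q where q: "real_polynomial_function q" "\<And>t. t \<in> {-b..b} \<Longrightarrow> \<bar>clamp t - q t\<bar> < e"
      by (rule Stone_Weierstrass_real_polynomial_function[OF compact_Icc _ e(1)]) (rule that)
    have qr: "(\<lambda>h. q (r h)) \<in> coordinate_ring J" by (rule coordinate_ring_polynomial[OF q(1) r(1)])
    have meas: "s \<in> borel_measurable \<mu>" "s \<in> borel_measurable \<nu>" if "continuous_on UNIV s" for s :: "('i \<Rightarrow> complex) \<Rightarrow> real"
    proof -
      have "continuous_map euclidean euclidean s" using that by simp
      from continuous_map_compose[OF id this] have "continuous_map X euclidean s" unfolding o_def .
      then show "s \<in> borel_measurable \<mu>" "s \<in> borel_measurable \<nu>"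
        using borel_measurable_continuous_map[OF sets(1)] borel_measurable_continuous_map[OF sets(2)] by auto
    qed
    obtain b' where b': "\<And>h. h \<in> topspace X \<Longrightarrow> \<bar>q (r h)\<bar> \<le> b'" using coordinate_ring_bounded[OF qr bd] by auto
    have iq: "integrable \<mu> (\<lambda>h. q (r h))" "integrable \<nu> (\<lambda>h. q (r h))"
      using meas[OF continuous_on_coordinate_ring[OF qr]] b'
      by (auto intro!: mu.integrable_const_bound[where B = b'] nu.integrable_const_bound[where B = b'] simp: spaces)
    have "continuous_on UNIV clamp" unfolding clamp_def by (intro continuous_intros)
    then have "continuous_on UNIV (\<lambda>h. clamp (r h))"
      using continuous_on_coordinate_ring[OF r(1)] by (auto intro: continuous_on_compose2)
    note mc = meas[OF this]
    have ic: "integrable \<mu> (\<lambda>h. clamp (r h))" "integrable \<nu> (\<lambda>h. clamp (r h))"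
      using mc cl by (auto intro!: mu.integrable_const_bound[where B = 1] nu.integrable_const_bound[where B = 1])
    have appr: "clamp (r h) \<le> q (r h) + e" "q (r h) \<le> clamp (r h) + e" if "h \<in> topspace X" for h
    proof -
      have "r h \<in> {-b..b}" using b[OF that] by auto
      from q(2)[OF this] show "clamp (r h) \<le> q (r h) + e" "q (r h) \<le> clamp (r h) + e" by linarith+
    qed
    have Cm: "C \<in> sets \<mu>" "C \<in> sets \<nu>" "L \<in> sets \<nu>" using Cs Ls sets by auto
    have "(1 - e) * measure \<mu> C = (LINT h|\<mu>. (1 - e) * indicator C h)" using Cm by simp
    also have "\<dots> \<le> (LINT h|\<mu>. clamp (r h))"
    proof (rule integral_mono)
      show "integrable \<mu> (\<lambda>h. (1 - e) * indicator C h)" using Cm by (simp add: mu.emeasure_eq_measure)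
      show "(1 - e) * indicator C h \<le> clamp (r h)" if "h \<in> space \<mu>" for h
        using r(4)[of h] cl e by (auto simp: clamp_def indicator_def)
    qed (rule ic)
    also have "\<dots> \<le> (LINT h|\<mu>. q (r h) + e)"
      using appr iq ic by (intro integral_mono) (auto simp: spaces)
    also have "\<dots> = (LINT h|\<nu>. q (r h)) + e" using iq eq[OF qr] by (simp add: mu.prob_space)
    also have "(LINT h|\<nu>. q (r h)) \<le> (LINT h|\<nu>. clamp (r h) + e)"
      using appr iq ic by (intro integral_mono) (auto simp: spaces)
    also have "\<dots> = (LINT h|\<nu>. clamp (r h)) + e" using ic by (simp add: nu.prob_space)
    also have "(LINT h|\<nu>. clamp (r h)) \<le> (LINT h|\<nu>. indicator C h + (indicator E h - indicator L h) + e)"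
    proof (rule integral_mono)
      show "integrable \<nu> (\<lambda>h. indicator C h + (indicator E h - indicator L h) + e)"
        using Cm Es by (simp add: nu.emeasure_eq_measure)
      show "clamp (r h) \<le> indicator C h + (indicator E h - indicator L h) + e" if "h \<in> space \<nu>" for h
      proof -
        have "h \<in> C \<or> h \<in> E" using that by (auto simp: spaces E_def)
        moreover have "h \<notin> E" if "h \<in> C" using that by (simp add: E_def)
        ultimately show ?thesis using r(3)[of h] r(2)[of h] L(2) cl[of "r h"] e by (auto simp: clamp_def indicator_def)
      qed
    qed (rule ic)
    also have "\<dots> = measure \<nu> C + (measure \<nu> E - measure \<nu> L) + e"
      using Cm Es by (simp add: nu.emeasure_eq_measure nu.prob_space)
    finally have "(1 - e) * measure \<mu> C \<le> measure \<nu> C + (measure \<nu> E - measure \<nu> L) + e + e + e" by simp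
    moreover have "e * measure \<mu> C \<le> e * 1" using e by (intro mult_left_mono) auto
    ultimately show ?thesis using L(3) by (simp add: algebra_simps)
  qed
  show ?thesis
  proof (rule field_le_epsilon)
    fix e :: real assume "e > 0"
    then have "measure \<mu> C \<le> measure \<nu> C + 5 * (min e 1 / 10)" by (intro step) auto
    also have "\<dots> \<le> measure \<nu> C + e" using \<open>e > 0\<close> by auto
    finally show "measure \<mu> C \<le> measure \<nu> C + e" .
  qed
qed

lemma radon_probability_eqI:
  fixes \<mu> \<nu> :: "('i \<Rightarrow> complex) measure" and X :: "('i \<Rightarrow> complex) topology"
  assumes mu: "radon_probability X \<mu>" and nu: "radon_probability X \<nu>" and X: "Hausdorff_space X"
    and id: "continuous_map X euclidean (\<lambda>f. f)"
    and sep: "\<And>f g. f \<in> topspace X \<Longrightarrow> g \<in> topspace X \<Longrightarrow> f \<noteq> g \<Longrightarrow> \<exists>i\<in>J. f i \<noteq> g i"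
    and bd: "\<And>i. i \<in> J \<Longrightarrow> \<exists>b. \<forall>h\<in>topspace X. norm (h i) \<le> b"
    and eq: "\<And>r. r \<in> coordinate_ring J \<Longrightarrow> (LINT h|\<mu>. r h) = (LINT h|\<nu>. r h)"
  shows "\<mu> = \<nu>"
proof (rule measure_eqI)
  interpret mu: prob_space \<mu> by (rule radon_probability_prob[OF mu])
  interpret nu: prob_space \<nu> by (rule radon_probability_prob[OF nu])
  note sets = radon_probability_sets[OF mu] radon_probability_sets[OF nu]
  show "sets \<mu> = sets \<nu>" by (simp add: sets)
  fix E assume E: "E \<in> sets \<mu>"
  have "measure \<mu> C = measure \<nu> C" if "compactin X C" for C
    by (rule antisym[OF radon_compact_le[OF mu nu X id sep bd eq that] radon_compact_le[OF nu mu X id sep bd eq[symmetric] that]])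
  then have "emeasure \<mu> C = emeasure \<nu> C" if "compactin X C" for C
    using that by (simp add: mu.emeasure_eq_measure nu.emeasure_eq_measure)
  then have "(SUP C\<in>{C. compactin X C \<and> C \<subseteq> E}. emeasure \<mu> C) = (SUP C\<in>{C. compactin X C \<and> C \<subseteq> E}. emeasure \<nu> C)"
    by (intro SUP_cong) auto
  then show "emeasure \<mu> E = emeasure \<nu> E"
    using mu nu E sets unfolding radon_probability_def by auto
qed

text \<open>\<open>X\<close> need not be compact, so \<open>integral_exchange\<close> is applied to
  the integral over a compact \<open>L\<close> that carries all but \<open>e\<close> of the mass;
  the uniform bound \<open>b\<close> controls the rest.\<close>

lemma (in compact_probability) radon_swap:
  fixes F :: "'k \<Rightarrow> 'x \<Rightarrow> complex"
  assumes mu: "radon_probability X \<mu>" and X: "Hausdorff_space X"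
    and F: "continuous_map (prod_topology S X) euclidean (\<lambda>(k, x). F k x)"
    and b: "b \<ge> 0" "\<And>k x. k \<in> topspace S \<Longrightarrow> x \<in> topspace X \<Longrightarrow> norm (F k x) \<le> b"
  shows "(LINT x|\<mu>. LINT k|m. F k x) = (LINT k|m. LINT x|\<mu>. F k x)"
proof -
  interpret mu: prob_space \<mu> by (rule radon_probability_prob[OF mu])
  note sets = radon_probability_sets[OF mu] and spaces = radon_probability_space[OF mu]
  have sec1: "continuous_map X euclidean (F k)" if "k \<in> topspace S" for k
  proof -
    have "continuous_map X (prod_topology S X) (\<lambda>x. (k, x))"
      using that by (intro continuous_map_pairedI) auto
    from continuous_map_compose[OF this F] show ?thesis by (simp add: o_def)
  qed
  have sec2: "continuous_map S euclidean (\<lambda>k. F k x)" if "x \<in> topspace X" for x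
  proof -
    have "continuous_map S (prod_topology S X) (\<lambda>k. (k, x))"
      using that by (intro continuous_map_pairedI) auto
    from continuous_map_compose[OF this F] show ?thesis by (simp add: o_def)
  qed
  define A where "A x = (LINT k|m. F k x)" for x
  have Ac: "continuous_map X euclidean A" unfolding A_def[abs_def] by (rule continuous_average[OF F])
  have Ab: "norm (A x) \<le> b" if "x \<in> topspace X" for x
    unfolding A_def by (rule norm_integral_le[OF sec2[OF that]]) (rule b(2)[OF _ that])
  have intg: "integrable \<mu> u" if "continuous_map X euclidean u" "\<And>x. x \<in> topspace X \<Longrightarrow> norm (u x) \<le> b" for u :: "'x \<Rightarrow> complex"
    using borel_measurable_continuous_map[OF sets that(1)] that(2)
    by (intro mu.integrable_const_bound[where B = b]) (auto simp: spaces)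
  note iF = intg[OF sec1 b(2)] and iA = intg[OF Ac Ab]
  define G where "G k = (LINT x|\<mu>. F k x)" for k
  have step: "continuous_map S euclidean (\<lambda>k. LINT x|\<mu>. F k x * indicator L x) \<and>
      norm ((LINT x|\<mu>. A x) - (LINT k|m. LINT x|\<mu>. F k x * indicator L x)) \<le> b * e \<and>
      (\<forall>k\<in>topspace S. norm (G k - (LINT x|\<mu>. F k x * indicator L x)) \<le> b * e)"
    if L: "compactin X L" "measure \<mu> (topspace X - L) \<le> e" for L e
  proof -
    have LX: "L \<subseteq> topspace X" by (rule compactin_subset_topspace[OF L(1)])
    have Lm: "L \<in> sets \<mu>" unfolding sets by (rule compactin_sets_borel_of[OF X L(1)])
    have XLm: "topspace X - L \<in> sets \<mu>" using Lm spaces by (metis sets.compl_sets)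
    have int_ind: "integrable \<mu> (\<lambda>x. u x * indicator L x)" if "integrable \<mu> u" for u :: "'x \<Rightarrow> complex"
    proof -
      have "(\<lambda>x. u x * indicator L x) = (\<lambda>x. indicator L x *\<^sub>R u x)" by (auto simp: indicator_def)
      then show ?thesis using integrable_mult_indicator[OF Lm that] by simp
    qed
    have trunc: "norm ((LINT x|\<mu>. u x) - (LINT x|\<mu>. u x * indicator L x)) \<le> b * e"
      if u: "integrable \<mu> u" "\<And>x. x \<in> topspace X \<Longrightarrow> norm (u x) \<le> b" for u :: "'x \<Rightarrow> complex"
    proof -
      have "(LINT x|\<mu>. u x) - (LINT x|\<mu>. u x * indicator L x) = (LINT x|\<mu>. u x - u x * indicator L x)"
        using u int_ind by simp
      also have "norm \<dots> \<le> (LINT x|\<mu>. norm (u x - u x * indicator L x))" by (rule integral_norm_bound)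
      also have "\<dots> \<le> (LINT x|\<mu>. b * indicator (topspace X - L) x)"
      proof (rule integral_mono)
        show "integrable \<mu> (\<lambda>x. norm (u x - u x * indicator L x))" using u int_ind by simp
        show "integrable \<mu> (\<lambda>x. b * indicator (topspace X - L) x)" using XLm by (simp add: mu.emeasure_eq_measure)
        show "norm (u x - u x * indicator L x) \<le> b * indicator (topspace X - L) x" if "x \<in> space \<mu>" for x
          using that u(2)[of x] by (auto simp: indicator_def spaces)
      qed
      also have "\<dots> = b * measure \<mu> (topspace X - L)" using XLm by simp
      also have "\<dots> \<le> b * e" using L(2) b(1) by (rule mult_left_mono)
      finally show ?thesis .
    qed
    define I where "I u = (LINT x|\<mu>. u x * indicator L x)" for u :: "'x \<Rightarrow> complex"
    have I: "continuous_map S euclidean (\<lambda>k. I (F k)) \<and> I (\<lambda>x. LINT k|m. F k x) = (LINT k|m. I (F k))"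
    proof -
      have equi: "\<exists>U. openin S U \<and> k0 \<in> U \<and> (\<forall>k\<in>U. \<forall>x\<in>L. norm (F k x - F k0 x) \<le> e)" if "e > 0" "k0 \<in> topspace S" for e k0
        by (rule equicontinuous_on_compact[OF F L(1) that])
      have sum_V: "(\<lambda>i. \<Sum>p\<in>P. complex_of_real (w p) * F p i) \<in> {u. integrable \<mu> u}" if "finite P" "P \<subseteq> topspace S" for P and w :: "'k \<Rightarrow> real"
        using that iF by (auto intro!: Bochner_Integration.integrable_sum)
      have lin: "I (\<lambda>i. \<Sum>p\<in>P. complex_of_real (w p) * F p i) = (\<Sum>p\<in>P. complex_of_real (w p) * I (F p))"
        if P: "finite P" "P \<subseteq> topspace S" for P and w :: "'k \<Rightarrow> real"
      proof -
        have "I (\<lambda>i. \<Sum>p\<in>P. complex_of_real (w p) * F p i) = (LINT x|\<mu>. (\<Sum>p\<in>P. complex_of_real (w p) * (F p x * indicator L x)))"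
          unfolding I_def by (simp add: sum_distrib_right mult.assoc)
        also have "\<dots> = (\<Sum>p\<in>P. LINT x|\<mu>. complex_of_real (w p) * (F p x * indicator L x))"
          using P int_ind iF by (intro Bochner_Integration.integral_sum) auto
        finally show ?thesis by (simp add: I_def)
      qed
      have bd: "norm (I u - I v) \<le> 1 * e" if uv: "u \<in> {u. integrable \<mu> u}" "v \<in> {u. integrable \<mu> u}" and e: "e \<ge> 0"
        and le: "\<And>i. i \<in> L \<Longrightarrow> norm (u i - v i) \<le> e" for u v e
      proof -
        have i: "integrable \<mu> (\<lambda>x. u x * indicator L x)" "integrable \<mu> (\<lambda>x. v x * indicator L x)" using uv int_ind by auto
        have "I u - I v = (LINT x|\<mu>. u x * indicator L x - v x * indicator L x)" unfolding I_def using i by simp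
        also have "norm \<dots> \<le> (LINT x|\<mu>. norm (u x * indicator L x - v x * indicator L x))" by (rule integral_norm_bound)
        also have "\<dots> \<le> (LINT x|\<mu>. e)"
          using i le e by (intro integral_mono) (auto simp: indicator_def)
        finally show ?thesis by (simp add: mu.prob_space)
      qed
      have V1: "F k \<in> {u. integrable \<mu> u}" if "k \<in> topspace S" for k using iF[OF that that] by simp
      have V3: "(\<lambda>i. LINT k|m. F k i) \<in> {u. integrable \<mu> u}" using iA by (simp add: A_def[abs_def])
      show ?thesis
      proof
        show "continuous_map S euclidean (\<lambda>k. I (F k))"
          by (rule integral_exchange(1)[where F = F and J = L and V = "{u. integrable \<mu> u}" and c = 1 and L = I])
            (fact equi | fact lin | fact bd | fact V1 | fact sum_V | fact V3)+
        show "I (\<lambda>x. LINT k|m. F k x) = (LINT k|m. I (F k))"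
          by (rule integral_exchange(2)[where F = F and J = L and V = "{u. integrable \<mu> u}" and c = 1 and L = I])
            (fact equi | fact lin | fact bd | fact V1 | fact sum_V | fact V3)+
      qed
    qed
    have "norm (G k - I (F k)) \<le> b * e" if "k \<in> topspace S" for k
      unfolding G_def I_def by (rule trunc[OF iF[OF that that] b(2)[OF that]])
    moreover have "norm ((LINT x|\<mu>. A x) - I A) \<le> b * e" unfolding I_def by (rule trunc[OF iA Ab])
    moreover have "I A = (LINT k|m. I (F k))" using I by (simp add: A_def[abs_def])
    ultimately show ?thesis using I by (simp add: I_def)
  qed
  have exL: "\<exists>L. compactin X L \<and> measure \<mu> (topspace X - L) \<le> e" if e: "e > 0" for e
  proof -
    have "ennreal (1 - e) < ennreal 1" using e by (intro ennreal_lessI) auto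
    then have "ennreal (1 - e) < emeasure \<mu> (space \<mu>)" by (simp add: mu.emeasure_space_1)
    then obtain L where L: "compactin X L" "ennreal (1 - e) < emeasure \<mu> L"
      by (rule radon_probability_inner[OF mu sets.top]) (rule that)
    then have "ennreal (1 - e) < ennreal (measure \<mu> L)" by (simp add: mu.emeasure_eq_measure)
    then have "1 - e < measure \<mu> L" by (metis ennreal_leI not_le)
    moreover have "measure \<mu> (topspace X - L) = 1 - measure \<mu> L"
      using mu.prob_compl[of L] compactin_sets_borel_of[OF X L(1)] by (simp add: sets spaces)
    ultimately show ?thesis using L(1) by (intro exI[of _ L]) auto
  qed
  \<comment> \<open>\<open>G\<close> is a uniform limit of the truncated integrals, which are
    continuous; without this it would not be known to be integrable over \<open>m\<close>.\<close>
  have Gc: "continuous_map S euclidean G"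
  proof (rule continuous_map_normI)
    fix e :: real and k0 assume e: "e > 0" and k0: "k0 \<in> topspace S"
    define d where "d = e / (4 * (b + 1))"
    have d: "d > 0" "b * d \<le> e / 4" using b(1) e by (auto simp: d_def field_simps)
    obtain L where L: "compactin X L" "measure \<mu> (topspace X - L) \<le> d" using exL[OF d(1)] by blast
    define g where "g k = (LINT x|\<mu>. F k x * indicator L x)" for k
    have g: "continuous_map S euclidean g" "\<And>k. k \<in> topspace S \<Longrightarrow> norm (G k - g k) \<le> b * d"
      using step[OF L] by (auto simp: g_def[abs_def])
    have "e / 4 > 0" using e by simp
    obtain U where U: "openin S U" "k0 \<in> U" "\<And>k. k \<in> U \<Longrightarrow> norm (g k - g k0) < e / 4"
      by (rule continuous_map_norm_le[OF g(1) \<open>e / 4 > 0\<close> k0]) (rule that)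
    have "norm (G k - G k0) \<le> e" if k: "k \<in> U" for k
    proof -
      have "k \<in> topspace S" using k openin_subset[OF U(1)] by auto
      have "norm (G k - G k0) \<le> norm (G k - g k) + norm (g k - g k0) + norm (G k0 - g k0)"
        using norm_triangle_ineq[of "G k - g k" "g k - g k0"] norm_triangle_ineq4[of "(G k - g k) + (g k - g k0)" "G k0 - g k0"]
        by simp
      then show ?thesis using g(2)[OF \<open>k \<in> topspace S\<close>] g(2)[OF k0] U(3)[OF k] d e by linarith
    qed
    then show "\<exists>U. openin S U \<and> k0 \<in> U \<and> (\<forall>k\<in>U. norm (G k - G k0) \<le> e)" using U by blast
  qed
  have "norm ((LINT x|\<mu>. A x) - (LINT k|m. G k)) \<le> e" if e: "e > 0" for e
  proof -
    define d where "d = e / (4 * (b + 1))"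
    have d: "d > 0" "b * d \<le> e / 4" using b(1) e by (auto simp: d_def field_simps)
    obtain L where L: "compactin X L" "measure \<mu> (topspace X - L) \<le> d" using exL[OF d(1)] by blast
    define g where "g k = (LINT x|\<mu>. F k x * indicator L x)" for k
    have g: "continuous_map S euclidean g" "\<And>k. k \<in> topspace S \<Longrightarrow> norm (G k - g k) \<le> b * d"
      "norm ((LINT x|\<mu>. A x) - (LINT k|m. g k)) \<le> b * d"
      using step[OF L] by (auto simp: g_def[abs_def])
    have ii: "integrable m G" "integrable m g" by (rule integrable_continuous[OF Gc], rule integrable_continuous[OF g(1)])
    have "(LINT k|m. G k) - (LINT k|m. g k) = (LINT k|m. G k - g k)" using ii by simp
    also have "norm \<dots> \<le> (LINT k|m. norm (G k - g k))" by (rule integral_norm_bound)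
    also have "\<dots> \<le> (LINT k|m. b * d)" using ii g(2) by (intro integral_mono) (auto simp: space_m)
    finally have "norm ((LINT k|m. G k) - (LINT k|m. g k)) \<le> b * d" by (simp add: prob_space)
    then show ?thesis
      using g(3) d e norm_triangle_ineq4[of "(LINT x|\<mu>. A x) - (LINT k|m. g k)" "(LINT k|m. G k) - (LINT k|m. g k)"] by simp
  qed
  then have "norm ((LINT x|\<mu>. A x) - (LINT k|m. G k)) \<le> 0" by (rule field_le_epsilon) simp
  then show ?thesis by (simp add: A_def G_def)
qed

section \<open>Uniqueness of characters and of hyperproducts\<close>

context lca_orbit
begin

interpretation dual: group_orbit D DT K S m \<Psi>
  by (rule group_orbit_dual)

lemma continuous_dual_value:
  assumes xi: "\<xi> \<in> carrier D" and x: "x \<in> carrier G"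
  shows "continuous_map S euclidean (\<lambda>k. \<Psi> k \<xi> x)"
proof -
  have "continuous_map DT euclidean (\<lambda>f. f x)"
    unfolding pontryagin_topology_def by (rule continuous_map_evaluation) (simp add: x topspace_eq_carrier)
  from continuous_map_compose[OF dual.continuous_map_phi_left[OF xi] this] show ?thesis by (simp add: o_def)
qed

lemma integral_dual_value:
  assumes xi: "\<xi> \<in> carrier D" and x: "x \<in> carrier G"
  shows "(LINT k|m. \<Psi> k \<xi> x) = avg \<xi> x"
proof -
  have "(LINT k|m. \<Psi> k \<xi> x) = (LINT k|m. \<xi> (\<phi> (inv\<^bsub>K\<^esub> k) x))"
    by (rule Bochner_Integration.integral_cong[OF refl]) (simp add: dual_action_val[OF xi x])
  also have "\<dots> = avg \<xi> x" unfolding avg_def by (rule integral_inverse[OF character_phi_section[OF xi x]])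
  finally show ?thesis .
qed

text \<open>The moments of an orbit measure are the values of the averaged character: products and
  conjugates of values of a character are again its values, at products and inverses. Equal averages
  thus give equal integrals of all polynomials, including one that separates the two disjoint
  compact orbits.\<close>

lemma orbital_character_eq_imp_orbit_eq:
  assumes xi: "\<xi> \<in> carrier D" and psi: "\<psi> \<in> carrier D" and eq: "orbital_character \<xi> = orbital_character \<psi>"
  shows "orbit K \<Psi> \<xi> = orbit K \<Psi> \<psi>"
proof (rule ccontr)
  assume ne: "orbit K \<Psi> \<xi> \<noteq> orbit K \<Psi> \<psi>"
  define A where "A \<zeta> = (\<lambda>k. \<Psi> k \<zeta>) ` topspace S" for \<zeta>
  have sub: "A \<zeta> \<subseteq> carrier D" if "\<zeta> \<in> carrier D" for \<zeta>
    using that by (auto simp: A_def K.topspace_eq_carrier dual_action_closed)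
  have comp: "compact (A \<zeta>)" if zeta: "\<zeta> \<in> carrier D" for \<zeta>
  proof -
    have "continuous_map DT euclidean (\<lambda>f. f)"
      unfolding pontryagin_topology_def by (rule continuous_map_to_product[OF dual_extensional])
    from continuous_map_compose[OF dual.continuous_map_phi_left[OF zeta] this]
    have "continuous_map S euclidean (\<lambda>k. \<Psi> k \<zeta>)" by (simp add: o_def)
    then show ?thesis
      using image_compactin[of S "topspace S" euclidean] compact_S by (simp add: compact_space_def A_def)
  qed
  have disj: "A \<xi> \<inter> A \<psi> = {}"
  proof (rule ccontr)
    assume "A \<xi> \<inter> A \<psi> \<noteq> {}"
    then obtain k l where kl: "k \<in> carrier K" "l \<in> carrier K" "\<Psi> k \<xi> = \<Psi> l \<psi>" by (auto simp: A_def K.topspace_eq_carrier)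
    then have "orbit K \<Psi> (\<Psi> k \<xi>) = orbit K \<Psi> (\<Psi> l \<psi>)" by simp
    then show False using ne dual.orbit_phi[OF kl(1) xi] dual.orbit_phi[OF kl(2) psi] by simp
  qed
  \<comment> \<open>The factor with a free \<open>x\<close> makes the property stable: multiplying
    \<open>v\<close> by the coordinate at \<open>i\<close>, or by its conjugate, only replaces
    \<open>x\<close> by \<open>i \<otimes> x\<close> or \<open>inv i \<otimes> x\<close>. Setting
    \<open>x\<close> to the unit removes it at the end.\<close>
  define P where "P v \<longleftrightarrow> continuous_map S euclidean (\<lambda>k. v (\<Psi> k \<xi>)) \<and> continuous_map S euclidean (\<lambda>k. v (\<Psi> k \<psi>)) \<and>
    (\<forall>x\<in>carrier G. (LINT k|m. v (\<Psi> k \<xi>) * \<Psi> k \<xi> x) = (LINT k|m. v (\<Psi> k \<psi>) * \<Psi> k \<psi> x))" for v :: "('a \<Rightarrow> complex) \<Rightarrow> complex"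
  have Pc: "continuous_map S euclidean (\<lambda>k. v (\<Psi> k \<zeta>))" if "P v" "\<zeta> \<in> {\<xi>, \<psi>}" for v \<zeta>
    using that by (auto simp: P_def)
  have Pe: "(LINT k|m. v (\<Psi> k \<xi>) * \<Psi> k \<xi> x) = (LINT k|m. v (\<Psi> k \<psi>) * \<Psi> k \<psi> x)" if "P v" "x \<in> carrier G" for v x
    using that by (auto simp: P_def)
  have PI: "P v" if "\<And>\<zeta>. \<zeta> \<in> {\<xi>, \<psi>} \<Longrightarrow> continuous_map S euclidean (\<lambda>k. v (\<Psi> k \<zeta>))"
      "\<And>x. x \<in> carrier G \<Longrightarrow> (LINT k|m. v (\<Psi> k \<xi>) * \<Psi> k \<xi> x) = (LINT k|m. v (\<Psi> k \<psi>) * \<Psi> k \<psi> x)" for v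
    using that by (auto simp: P_def)
  have in_D: "\<zeta> \<in> carrier D" if "\<zeta> \<in> {\<xi>, \<psi>}" for \<zeta> using that xi psi by auto
  have val: "continuous_map S euclidean (\<lambda>k. \<Psi> k \<zeta> x)" if "\<zeta> \<in> {\<xi>, \<psi>}" "x \<in> carrier G" for \<zeta> x
    by (rule continuous_dual_value[OF in_D[OF that(1)] that(2)])
  have int: "integrable m (\<lambda>k. v (\<Psi> k \<zeta>) * \<Psi> k \<zeta> x)" if "P v" "\<zeta> \<in> {\<xi>, \<psi>}" "x \<in> carrier G" for v \<zeta> x
    by (rule integrable_continuous[OF continuous_map_times[OF Pc[OF that(1,2)] val[OF that(2,3)]]])
  have P1: "P (\<lambda>h. 1)"
  proof (rule PI)
    show "(LINT k|m. 1 * \<Psi> k \<xi> x) = (LINT k|m. 1 * \<Psi> k \<psi> x)" if x: "x \<in> carrier G" for x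
      using orbital_character_orbit[OF xi x] orbital_character_orbit[OF psi x] eq
      by (simp add: integral_dual_value[OF xi x] integral_dual_value[OF psi x])
  qed simp
  have Padd: "P (\<lambda>h. u h + v h)" if u: "P u" and v: "P v" for u v
  proof (rule PI)
    show "continuous_map S euclidean (\<lambda>k. u (\<Psi> k \<zeta>) + v (\<Psi> k \<zeta>))" if "\<zeta> \<in> {\<xi>, \<psi>}" for \<zeta>
      by (rule continuous_map_add[OF Pc[OF u that] Pc[OF v that]])
    fix x assume x: "x \<in> carrier G"
    have "(LINT k|m. (u (\<Psi> k \<zeta>) + v (\<Psi> k \<zeta>)) * \<Psi> k \<zeta> x) = (LINT k|m. u (\<Psi> k \<zeta>) * \<Psi> k \<zeta> x) + (LINT k|m. v (\<Psi> k \<zeta>) * \<Psi> k \<zeta> x)"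
      if z: "\<zeta> \<in> {\<xi>, \<psi>}" for \<zeta>
      unfolding distrib_right by (rule Bochner_Integration.integral_add[OF int[OF u z x] int[OF v z x]])
    then show "(LINT k|m. (u (\<Psi> k \<xi>) + v (\<Psi> k \<xi>)) * \<Psi> k \<xi> x) = (LINT k|m. (u (\<Psi> k \<psi>) + v (\<Psi> k \<psi>)) * \<Psi> k \<psi> x)"
      using Pe[OF u x] Pe[OF v x] by simp
  qed
  have Pscale: "P (\<lambda>h. c * u h)" if u: "P u" for c u
  proof (rule PI)
    show "continuous_map S euclidean (\<lambda>k. c * u (\<Psi> k \<zeta>))" if "\<zeta> \<in> {\<xi>, \<psi>}" for \<zeta>
      by (rule continuous_map_times[OF _ Pc[OF u that]]) simp
    show "(LINT k|m. c * u (\<Psi> k \<xi>) * \<Psi> k \<xi> x) = (LINT k|m. c * u (\<Psi> k \<psi>) * \<Psi> k \<psi> x)" if "x \<in> carrier G" for x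
      using Pe[OF u that] by (simp add: mult.assoc)
  qed
  have Pcoord: "P (\<lambda>h. h i * u h)" if i: "i \<in> carrier G" and u: "P u" for i u
  proof (rule PI)
    show "continuous_map S euclidean (\<lambda>k. \<Psi> k \<zeta> i * u (\<Psi> k \<zeta>))" if z: "\<zeta> \<in> {\<xi>, \<psi>}" for \<zeta>
      by (rule continuous_map_times[OF val[OF z i] Pc[OF u z]])
    fix x assume x: "x \<in> carrier G"
    have "(LINT k|m. \<Psi> k \<zeta> i * u (\<Psi> k \<zeta>) * \<Psi> k \<zeta> x) = (LINT k|m. u (\<Psi> k \<zeta>) * \<Psi> k \<zeta> (i \<otimes> x))" if z: "\<zeta> \<in> {\<xi>, \<psi>}" for \<zeta>
      by (rule Bochner_Integration.integral_cong[OF refl])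
        (simp add: dual_carrierD(4)[OF dual_action_closed[OF _ in_D[OF z]] i x] space_m')
    then show "(LINT k|m. \<Psi> k \<xi> i * u (\<Psi> k \<xi>) * \<Psi> k \<xi> x) = (LINT k|m. \<Psi> k \<psi> i * u (\<Psi> k \<psi>) * \<Psi> k \<psi> x)"
      using Pe[OF u m_closed[OF i x]] by simp
  qed
  have Pconj: "P (\<lambda>h. cnj (h i) * u h)" if i: "i \<in> carrier G" and u: "P u" for i u
  proof (rule PI)
    show "continuous_map S euclidean (\<lambda>k. cnj (\<Psi> k \<zeta> i) * u (\<Psi> k \<zeta>))" if z: "\<zeta> \<in> {\<xi>, \<psi>}" for \<zeta>
      by (rule continuous_map_times[OF continuous_map_cnj[OF val[OF z i]] Pc[OF u z]])
    fix x assume x: "x \<in> carrier G"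
    have "(LINT k|m. cnj (\<Psi> k \<zeta> i) * u (\<Psi> k \<zeta>) * \<Psi> k \<zeta> x) = (LINT k|m. u (\<Psi> k \<zeta>) * \<Psi> k \<zeta> (inv i \<otimes> x))" if z: "\<zeta> \<in> {\<xi>, \<psi>}" for \<zeta>
      by (rule Bochner_Integration.integral_cong[OF refl])
        (simp add: dual_carrierD(4)[OF dual_action_closed[OF _ in_D[OF z]] inv_closed[OF i] x]
          dual_inv[OF dual_action_closed[OF _ in_D[OF z]] i] space_m')
    then show "(LINT k|m. cnj (\<Psi> k \<xi> i) * u (\<Psi> k \<xi>) * \<Psi> k \<xi> x) = (LINT k|m. cnj (\<Psi> k \<psi> i) * u (\<Psi> k \<psi>) * \<Psi> k \<psi> x)"
      using Pe[OF u m_closed[OF inv_closed[OF i] x]] by simp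
  qed
  obtain r where r: "r \<in> coordinate_ring (carrier G)" "\<And>x. x \<in> A \<xi> \<union> A \<psi> \<Longrightarrow> 0 \<le> r x \<and> r x \<le> 1"
    "\<And>x. x \<in> A \<xi> \<Longrightarrow> r x < 1 / 3" "\<And>x. x \<in> A \<psi> \<Longrightarrow> r x > 1 - 1 / 3"
  proof (rule coordinate_ring_separation[OF comp[OF xi] comp[OF psi] disj, of "carrier G" "1 / 3"])
    show "\<exists>i\<in>carrier G. f i \<noteq> g i" if h: "f \<in> A \<xi> \<union> A \<psi>" "g \<in> A \<xi> \<union> A \<psi>" "f \<noteq> g" for f g
    proof -
      have "f \<in> carrier D" "g \<in> carrier D" using h(1,2) sub[OF xi] sub[OF psi] by auto
      then show ?thesis using h(3) extensionalityI[OF dual_carrierD(1) dual_carrierD(1), of f g] by blast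
    qed
  qed (simp, simp, rule that)
  have Pr: "P (\<lambda>h. complex_of_real (r h) * 1)"
    by (rule coordinate_ring_multiplier[where P = P, OF r(1) P1]) (fact Padd | fact Pscale | fact Pcoord | fact Pconj)+
  have rc: "continuous_map S euclidean (\<lambda>k. complex_of_real (r (\<Psi> k \<zeta>)))" if "\<zeta> \<in> {\<xi>, \<psi>}" for \<zeta>
    using Pc[OF Pr that] by simp
  have "(LINT k|m. complex_of_real (r (\<Psi> k \<zeta>)) * 1 * \<Psi> k \<zeta> \<one>) = (LINT k|m. complex_of_real (r (\<Psi> k \<zeta>)))" if "\<zeta> \<in> {\<xi>, \<psi>}" for \<zeta>
    by (rule Bochner_Integration.integral_cong[OF refl]) (simp add: dual_one[OF dual_action_closed[OF _ in_D[OF that]]] space_m')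
  then have e: "(LINT k|m. complex_of_real (r (\<Psi> k \<xi>))) = (LINT k|m. complex_of_real (r (\<Psi> k \<psi>)))"
    using Pe[OF Pr one_closed] by simp
  have Ain: "\<Psi> k \<zeta> \<in> A \<zeta>" if "k \<in> carrier K" for k \<zeta> using that by (auto simp: A_def K.topspace_eq_carrier)
  have b1: "norm (LINT k|m. complex_of_real (r (\<Psi> k \<xi>))) \<le> 1 / 3"
  proof (rule norm_average_le[OF _ rc])
    show "norm (complex_of_real (r (\<Psi> k \<xi>))) \<le> 1 / 3" if k: "k \<in> carrier K" for k
      using r(2)[of "\<Psi> k \<xi>"] r(3)[of "\<Psi> k \<xi>"] Ain[OF k, of \<xi>] by auto
  qed simp
  have rc1: "continuous_map S euclidean (\<lambda>k. 1 - complex_of_real (r (\<Psi> k \<psi>)))"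
    by (rule continuous_map_diff[OF _ rc]) simp_all
  have b2: "norm (LINT k|m. 1 - complex_of_real (r (\<Psi> k \<psi>))) \<le> 1 / 3"
  proof (rule norm_average_le[OF _ rc1])
    show "norm (1 - complex_of_real (r (\<Psi> k \<psi>))) \<le> 1 / 3" if k: "k \<in> carrier K" for k
    proof -
      have "norm (1 - complex_of_real (r (\<Psi> k \<psi>))) = \<bar>1 - r (\<Psi> k \<psi>)\<bar>"
        using norm_of_real[of "1 - r (\<Psi> k \<psi>)", where 'a = complex] by simp
      then show ?thesis using r(2)[of "\<Psi> k \<psi>"] r(4)[of "\<Psi> k \<psi>"] Ain[OF k, of \<psi>] by auto
    qed
  qed
  \<comment> \<open>The two integrals of \<open>r\<close> coincide, yet \<open>r\<close> is below
    1/3 on one orbit and above 2/3 on the other; the two bounds add up to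
    \<open>1 \<le> 2 / 3\<close>.\<close>
  have "(LINT k|m. 1 - complex_of_real (r (\<Psi> k \<psi>))) = 1 - (LINT k|m. complex_of_real (r (\<Psi> k \<psi>)))"
    using integrable_continuous[OF rc, of \<psi>] by (simp add: prob_space)
  then have "(1::complex) = (LINT k|m. 1 - complex_of_real (r (\<Psi> k \<psi>))) + (LINT k|m. complex_of_real (r (\<Psi> k \<xi>)))"
    using e by simp
  then have "norm (1::complex) \<le> 1 / 3 + 1 / 3"
    using norm_triangle_mono[OF b2 b1] by simp
  then show False by simp
qed

lemma topspace_OT: "topspace OT = \<O>"
  by (simp add: topspace_eq_carrier orbits_carrier)

lemma character_topology_orbit: "X = compact_convergence_topology OT (hypergroup_characters H)"
  by (simp add: character_topology_def htop_orbit_hypergroup)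

lemma topspace_X: "topspace X = hypergroup_characters H"
  by (simp add: character_topology_orbit)

lemma characters_extensional: "hypergroup_characters H \<subseteq> extensional (topspace OT)"
  unfolding topspace_OT using hypergroup_characterD(1) by blast

lemma Hausdorff_X: "Hausdorff_space X"
  unfolding character_topology_orbit by (rule Hausdorff_compact_convergence[OF characters_extensional])

lemma hypergroup_character_bound:
  assumes tau: "\<tau> \<in> hypergroup_characters H" and A: "A \<in> \<O>"
  shows "norm (\<tau> A) \<le> 1"
proof -
  obtain \<xi> where xi: "\<xi> \<in> carrier D" "\<tau> = orbital_character \<xi>" using tau unfolding hypergroup_characters_orbit by auto
  obtain x where x: "x \<in> carrier G" "A = orbit K \<phi> x" using A by auto
  show ?thesis by (simp add: xi x orbital_character_orbit norm_avg_le)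
qed

lemma hypergroup_character_one:
  assumes tau: "\<tau> \<in> hypergroup_characters H"
  shows "\<tau> (orbit K \<phi> \<one>) = 1"
proof -
  obtain \<xi> where xi: "\<xi> \<in> carrier D" "\<tau> = orbital_character \<xi>" using tau unfolding hypergroup_characters_orbit by auto
  show ?thesis by (simp add: xi orbital_character_orbit avg_one)
qed

lemma character_nbhd:
  assumes "\<tau> \<in> hypergroup_characters H" "compactin OT C" "e > 0"
  obtains U where "openin X U" "\<tau> \<in> U" "U \<subseteq> hypergroup_characters H"
    "\<And>\<psi> A. \<psi> \<in> U \<Longrightarrow> A \<in> C \<Longrightarrow> dist (\<psi> A) (\<tau> A) < e"
proof -
  obtain U where "openin (compact_convergence_topology OT (hypergroup_characters H)) U" "\<tau> \<in> U"
    "U \<subseteq> hypergroup_characters H" "\<And>\<psi> A. \<psi> \<in> U \<Longrightarrow> A \<in> C \<Longrightarrow> dist (\<psi> A) (\<tau> A) < e"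
    by (rule compact_convergence_nbhd[OF assms]) (rule that)
  then show ?thesis by (intro that[of U]) (simp_all add: character_topology_orbit)
qed

text \<open>Evaluation is continuous in the character and the point together, as long as the point
  runs through the compact image of \<open>S\<close>, on which the topology of \<open>X\<close> is
  uniform.\<close>

lemma continuous_map_joint_evaluation:
  assumes C: "continuous_map S OT C"
  shows "continuous_map (prod_topology S X) euclidean (\<lambda>z. snd z (C (fst z)))"
proof (rule continuous_map_normI)
  fix e :: real and z0 assume e: "e > 0" and z0: "z0 \<in> topspace (prod_topology S X)"
  obtain l0 \<tau>0 where z: "z0 = (l0, \<tau>0)" "l0 \<in> topspace S" "\<tau>0 \<in> hypergroup_characters H"
    using z0 by (auto simp: topspace_X)
  have e2: "e / 2 > 0" using e by simp
  have CS: "compactin OT (C ` topspace S)" using image_compactin[OF _ C] compact_S by (simp add: compact_space_def)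
  obtain V where V: "openin X V" "\<tau>0 \<in> V" "V \<subseteq> hypergroup_characters H"
    "\<And>\<tau> A. \<tau> \<in> V \<Longrightarrow> A \<in> C ` topspace S \<Longrightarrow> dist (\<tau> A) (\<tau>0 A) < e / 2"
    by (rule character_nbhd[OF z(3) CS e2]) (rule that)
  have tc: "continuous_map S euclidean (\<lambda>l. \<tau>0 (C l))"
    using continuous_map_compose[OF C hypergroup_characterD(2)[OF z(3)]] by (simp add: o_def)
  obtain U where U: "openin S U" "l0 \<in> U" "\<And>l. l \<in> U \<Longrightarrow> norm (\<tau>0 (C l) - \<tau>0 (C l0)) < e / 2"
    by (rule continuous_map_norm_le[OF tc e2 z(2)]) (rule that)
  have "norm (\<tau> (C l) - \<tau>0 (C l0)) \<le> e" if h: "l \<in> U" "\<tau> \<in> V" for l \<tau>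
  proof -
    have "l \<in> topspace S" using h openin_subset[OF U(1)] by auto
    then have "norm (\<tau> (C l) - \<tau>0 (C l)) < e / 2" using V(4)[OF h(2), of "C l"] by (simp add: dist_norm)
    then show ?thesis
      using U(3)[OF h(1)] norm_triangle_ineq[of "\<tau> (C l) - \<tau>0 (C l)" "\<tau>0 (C l) - \<tau>0 (C l0)"] by simp
  qed
  then show "\<exists>U. openin (prod_topology S X) U \<and> z0 \<in> U \<and> (\<forall>z\<in>U. norm (snd z (C (fst z)) - snd z0 (C (fst z0))) \<le> e)"
    using U(1,2) V(1,2) z by (intro exI[of _ "U \<times> V"]) (auto simp: openin_prod_Times_iff)
qed

text \<open>A product of two values of a hypergroup character is not another value but an average of
  values over a hyperproduct. Exchanging this average with the integral over characters reduces
  higher moments to first moments, and polynomials determine a Radon measure.\<close>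

lemma radon_character_eqI:
  assumes mu: "radon_probability X \<mu>" and nu: "radon_probability X \<nu>"
    and eq: "\<And>A. A \<in> \<O> \<Longrightarrow> (LINT \<tau>|\<mu>. \<tau> A) = (LINT \<tau>|\<nu>. \<tau> A)"
  shows "\<mu> = \<nu>"
proof (rule radon_probability_eqI[OF mu nu Hausdorff_X])
  show "continuous_map X euclidean (\<lambda>f. f)"
    unfolding character_topology_orbit by (rule continuous_map_to_product[OF characters_extensional])
  show "\<exists>A\<in>\<O>. f A \<noteq> g A" if "f \<in> topspace X" "g \<in> topspace X" "f \<noteq> g" for f g
    using that extensionalityI[of f \<O> g] hypergroup_characterD(1) unfolding topspace_X by blast
  show "\<exists>b. \<forall>h\<in>topspace X. norm (h A) \<le> b" if "A \<in> \<O>" for A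
    using hypergroup_character_bound[OF _ that] unfolding topspace_X by blast
  have spaces: "space \<mu> = hypergroup_characters H" "space \<nu> = hypergroup_characters H"
    using radon_probability_space[OF mu] radon_probability_space[OF nu] by (simp_all add: topspace_X)
  have ev: "continuous_map X euclidean (\<lambda>\<tau>. \<tau> A)" if "A \<in> \<O>" for A
    unfolding character_topology_orbit by (rule continuous_map_evaluation) (unfold topspace_OT, rule that)
  \<comment> \<open>As on the orbits, a free evaluation \<open>\<tau> A\<close> is carried along.
    Boundedness of \<open>v\<close> is added because \<open>X\<close> need not be compact and the
    exchange of integrals asks for a uniform bound.\<close>
  define P where "P v \<longleftrightarrow> continuous_map X euclidean v \<and> (\<exists>b\<ge>0. \<forall>\<tau>\<in>hypergroup_characters H. norm (v \<tau>) \<le> b) \<and>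
    (\<forall>A\<in>\<O>. (LINT \<tau>|\<mu>. v \<tau> * \<tau> A) = (LINT \<tau>|\<nu>. v \<tau> * \<tau> A))" for v :: "('a set \<Rightarrow> complex) \<Rightarrow> complex"
  have Pe: "(LINT \<tau>|\<mu>. v \<tau> * \<tau> A) = (LINT \<tau>|\<nu>. v \<tau> * \<tau> A)" if "P v" "A \<in> \<O>" for v A
    using that unfolding P_def by blast
  have int: "integrable \<rho> (\<lambda>\<tau>. v \<tau> * \<tau> A)" if v: "P v" and A: "A \<in> \<O>" and rho: "radon_probability X \<rho>" for v A \<rho>
  proof -
    interpret rho: prob_space \<rho> by (rule radon_probability_prob[OF rho])
    obtain b where b: "b \<ge> 0" "\<And>\<tau>. \<tau> \<in> hypergroup_characters H \<Longrightarrow> norm (v \<tau>) \<le> b" using v by (auto simp: P_def)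
    have "continuous_map X euclidean (\<lambda>\<tau>. v \<tau> * \<tau> A)"
      using v by (intro continuous_map_times ev A) (simp add: P_def)
    then have "(\<lambda>\<tau>. v \<tau> * \<tau> A) \<in> borel_measurable \<rho>"
      by (rule borel_measurable_continuous_map[OF radon_probability_sets[OF rho]])
    moreover have "norm (v \<tau> * \<tau> A) \<le> b * 1" if "\<tau> \<in> hypergroup_characters H" for \<tau>
      unfolding norm_mult using b that hypergroup_character_bound[OF that A] by (intro mult_mono) auto
    ultimately show ?thesis
      by (intro rho.integrable_const_bound[where B = b]) (auto simp: radon_probability_space[OF rho] topspace_X)
  qed
  have Padd: "P (\<lambda>h. u h + v h)" if u: "P u" and v: "P v" for u v
    unfolding P_def
  proof (intro conjI ballI)
    show "continuous_map X euclidean (\<lambda>h. u h + v h)" using u v by (intro continuous_map_add) (auto simp: P_def)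
    obtain a b where "a \<ge> 0" "\<And>\<tau>. \<tau> \<in> hypergroup_characters H \<Longrightarrow> norm (u \<tau>) \<le> a"
      "b \<ge> 0" "\<And>\<tau>. \<tau> \<in> hypergroup_characters H \<Longrightarrow> norm (v \<tau>) \<le> b" using u v by (auto simp: P_def)
    then show "\<exists>b\<ge>0. \<forall>\<tau>\<in>hypergroup_characters H. norm (u \<tau> + v \<tau>) \<le> b"
      by (intro exI[of _ "a + b"]) (auto intro: norm_triangle_mono)
    fix A assume A: "A \<in> \<O>"
    have "(LINT \<tau>|\<rho>. (u \<tau> + v \<tau>) * \<tau> A) = (LINT \<tau>|\<rho>. u \<tau> * \<tau> A) + (LINT \<tau>|\<rho>. v \<tau> * \<tau> A)"
      if "radon_probability X \<rho>" for \<rho>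
      unfolding distrib_right by (rule Bochner_Integration.integral_add[OF int[OF u A that] int[OF v A that]])
    then show "(LINT \<tau>|\<mu>. (u \<tau> + v \<tau>) * \<tau> A) = (LINT \<tau>|\<nu>. (u \<tau> + v \<tau>) * \<tau> A)"
      using mu nu Pe[OF u A] Pe[OF v A] by simp
  qed
  have Pscale: "P (\<lambda>h. c * u h)" if u: "P u" for c u
    unfolding P_def
  proof (intro conjI ballI)
    show "continuous_map X euclidean (\<lambda>h. c * u h)" using u by (intro continuous_map_times) (auto simp: P_def)
    obtain b where "b \<ge> 0" "\<And>\<tau>. \<tau> \<in> hypergroup_characters H \<Longrightarrow> norm (u \<tau>) \<le> b" using u by (auto simp: P_def)
    then show "\<exists>b\<ge>0. \<forall>\<tau>\<in>hypergroup_characters H. norm (c * u \<tau>) \<le> b"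
      by (intro exI[of _ "norm c * b"]) (auto simp: norm_mult intro: mult_left_mono)
    show "(LINT \<tau>|\<mu>. c * u \<tau> * \<tau> A) = (LINT \<tau>|\<nu>. c * u \<tau> * \<tau> A)" if "A \<in> \<O>" for A
      using Pe[OF u that] by (simp add: mult.assoc)
  qed
  have Pcoord: "P (\<lambda>h. h A * u h)" if A: "A \<in> \<O>" and u: "P u" for A u
    unfolding P_def
  proof (intro conjI ballI)
    have uc: "continuous_map X euclidean u" using u by (simp add: P_def)
    show "continuous_map X euclidean (\<lambda>h. h A * u h)" by (rule continuous_map_times[OF ev[OF A] uc])
    obtain b where b: "b \<ge> 0" "\<And>\<tau>. \<tau> \<in> hypergroup_characters H \<Longrightarrow> norm (u \<tau>) \<le> b" using u by (auto simp: P_def)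
    have bd: "norm (\<tau> B * u \<tau>) \<le> b" if "B \<in> \<O>" "\<tau> \<in> hypergroup_characters H" for \<tau> B
    proof -
      have "norm (\<tau> B * u \<tau>) \<le> 1 * b"
        unfolding norm_mult using b that hypergroup_character_bound[OF that(2,1)] by (intro mult_mono) auto
      then show ?thesis by simp
    qed
    then show "\<exists>b\<ge>0. \<forall>\<tau>\<in>hypergroup_characters H. norm (\<tau> A * u \<tau>) \<le> b" using A b(1) by blast
    fix B assume B: "B \<in> \<O>"
    \<comment> \<open>The orbits over which the hyperproduct of \<open>A\<close> and
      \<open>B\<close> is spread, so that \<open>\<tau> A * \<tau> B\<close> is the integral of
      \<open>\<tau> (C l)\<close> over \<open>l\<close>.\<close>
    define C where "C l = orbit K \<phi> (rep A \<otimes> \<phi> l (rep B))" for l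
    have Cc: "continuous_map S OT C"
      unfolding C_def[abs_def] by (rule continuous_map_orbit_product[OF rep_props(1)[OF A] rep_props(1)[OF B]])
    have CO: "C l \<in> \<O>" if "l \<in> topspace S" for l
      using that rep_props(1)[OF A] rep_props(1)[OF B] by (auto simp: C_def K.topspace_eq_carrier)
    have swap: "(LINT \<tau>|\<rho>. \<tau> A * u \<tau> * \<tau> B) = (LINT l|m. LINT \<tau>|\<rho>. \<tau> (C l) * u \<tau>)"
      if rho: "radon_probability X \<rho>" for \<rho>
    proof -
      have "(LINT \<tau>|\<rho>. \<tau> A * u \<tau> * \<tau> B) = (LINT \<tau>|\<rho>. LINT l|m. \<tau> (C l) * u \<tau>)"
      proof (rule Bochner_Integration.integral_cong[OF refl])
        fix \<tau> assume "\<tau> \<in> space \<rho>"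
        then have "\<tau> \<in> hypergroup_characters H" by (simp add: radon_probability_space[OF rho] topspace_X)
        from hypergroup_characterD(6)[OF this A B]
        show "\<tau> A * u \<tau> * \<tau> B = (LINT l|m. \<tau> (C l) * u \<tau>)" by (simp add: C_def)
      qed
      also have "\<dots> = (LINT l|m. LINT \<tau>|\<rho>. \<tau> (C l) * u \<tau>)"
      proof (rule radon_swap[OF rho Hausdorff_X _ b(1)])
        show "continuous_map (prod_topology S X) euclidean (\<lambda>(l, \<tau>). \<tau> (C l) * u \<tau>)"
          using continuous_map_times[OF continuous_map_joint_evaluation[OF Cc]
              continuous_map_compose[OF continuous_map_snd uc, of S]] by (simp add: case_prod_unfold o_def)
        show "norm (\<tau> (C l) * u \<tau>) \<le> b" if "l \<in> topspace S" "\<tau> \<in> topspace X" for l \<tau>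
          using bd[OF CO[OF that(1)]] that(2) by (simp add: topspace_X)
      qed
      finally show ?thesis .
    qed
    have "(LINT \<tau>|\<mu>. \<tau> (C l) * u \<tau>) = (LINT \<tau>|\<nu>. \<tau> (C l) * u \<tau>)" if "l \<in> space m" for l
      using Pe[OF u CO[of l]] that by (simp add: space_m mult.commute)
    then show "(LINT \<tau>|\<mu>. \<tau> A * u \<tau> * \<tau> B) = (LINT \<tau>|\<nu>. \<tau> A * u \<tau> * \<tau> B)"
      unfolding swap[OF mu] swap[OF nu] by (rule Bochner_Integration.integral_cong[OF refl])
  qed
  have Pconj: "P (\<lambda>h. cnj (h A) * u h)" if A: "A \<in> \<O>" and u: "P u" for A u
  proof -
    obtain x where x: "x \<in> carrier G" "A = orbit K \<phi> x" using A by auto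
    \<comment> \<open>Conjugation amounts to evaluation at the orbit of the inverse.\<close>
    define A' where "A' = orbit K \<phi> (inv x)"
    have A': "A' \<in> \<O>" using x by (simp add: A'_def)
    have c: "\<tau> A' = cnj (\<tau> A)" if "\<tau> \<in> hypergroup_characters H" for \<tau>
      using hypergroup_characterD(5)[OF that x(1)] by (simp add: A'_def x)
    have PA: "P (\<lambda>h. h A' * u h)" by (rule Pcoord[OF A' u])
    show ?thesis
      unfolding P_def
    proof (intro conjI ballI)
      have uc: "continuous_map X euclidean u" using u by (simp add: P_def)
      show "continuous_map X euclidean (\<lambda>h. cnj (h A) * u h)"
        by (rule continuous_map_times[OF continuous_map_cnj[OF ev[OF A]] uc])
      show "\<exists>b\<ge>0. \<forall>\<tau>\<in>hypergroup_characters H. norm (cnj (\<tau> A) * u \<tau>) \<le> b"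
        using PA by (simp add: P_def c)
      fix B assume B: "B \<in> \<O>"
      have "(LINT \<tau>|\<mu>. cnj (\<tau> A) * u \<tau> * \<tau> B) = (LINT \<tau>|\<mu>. \<tau> A' * u \<tau> * \<tau> B)"
        by (rule Bochner_Integration.integral_cong[OF refl]) (simp add: c spaces)
      also have "\<dots> = (LINT \<tau>|\<nu>. \<tau> A' * u \<tau> * \<tau> B)" by (rule Pe[OF PA B])
      also have "\<dots> = (LINT \<tau>|\<nu>. cnj (\<tau> A) * u \<tau> * \<tau> B)"
        by (rule Bochner_Integration.integral_cong[OF refl]) (simp add: c spaces)
      finally show "(LINT \<tau>|\<mu>. cnj (\<tau> A) * u \<tau> * \<tau> B) = (LINT \<tau>|\<nu>. cnj (\<tau> A) * u \<tau> * \<tau> B)" .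
    qed
  qed
  have P1: "P (\<lambda>h. 1)"
    unfolding P_def
  proof (intro conjI)
    show "\<exists>b\<ge>0. \<forall>\<tau>\<in>hypergroup_characters H. norm (1::complex) \<le> b" by (rule exI[of _ 1]) simp
  qed (use eq in auto)
  fix r assume r: "r \<in> coordinate_ring \<O>"
  have Pr: "P (\<lambda>h. complex_of_real (r h) * 1)"
    by (rule coordinate_ring_multiplier[where P = P, OF r P1]) (fact Padd | fact Pscale | fact Pcoord | fact Pconj)+
  have v: "complex_of_real (LINT h|\<rho>. r h) = (LINT h|\<rho>. complex_of_real (r h) * 1 * h (orbit K \<phi> \<one>))"
    if rho: "radon_probability X \<rho>" for \<rho>
  proof -
    have "complex_of_real (LINT h|\<rho>. r h) = (LINT h|\<rho>. complex_of_real (r h))" by simp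
    also have "\<dots> = (LINT h|\<rho>. complex_of_real (r h) * 1 * h (orbit K \<phi> \<one>))"
      by (rule Bochner_Integration.integral_cong[OF refl])
        (simp add: hypergroup_character_one radon_probability_space[OF rho] topspace_X)
    finally show ?thesis .
  qed
  have "(LINT h|\<mu>. complex_of_real (r h) * 1 * h (orbit K \<phi> \<one>)) = (LINT h|\<nu>. complex_of_real (r h) * 1 * h (orbit K \<phi> \<one>))"
    by (rule Pe[OF Pr one_orbit])
  then have "complex_of_real (LINT h|\<mu>. r h) = complex_of_real (LINT h|\<nu>. r h)"
    by (simp only: v[OF mu] v[OF nu])
  then show "(LINT h|\<mu>. r h) = (LINT h|\<nu>. r h)" by (simp only: of_real_eq_iff)
qed

end

section \<open>The homeomorphism and the isomorphism\<close>

context topological_group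
begin

text \<open>Ascoli's theorem for characters. Equicontinuity with prescribed neighbourhoods makes the
  set closed, hence compact, for pointwise convergence, since limits stay continuous. On such a set
  pointwise and compact convergence agree.\<close>

lemma compactin_equicontinuous_characters:
  assumes N: "\<And>e. e > 0 \<Longrightarrow> openin T (N e)" "\<And>e. e > (0::real) \<Longrightarrow> \<one> \<in> N e"
  shows "compactin DT {\<xi> \<in> carrier D. \<forall>e>0. \<forall>x\<in>carrier G. \<forall>z\<in>N e. norm (\<xi> (x \<otimes> z) - \<xi> x) \<le> e}"
    (is "compactin DT ?Q")
proof -
  have NG: "z \<in> carrier G" if "e > 0" "z \<in> N e" for z e
    using that openin_subset[OF N(1)[OF that(1)]] by (auto simp: topspace_eq_carrier)
  have equi_cont: "continuous_map T euclidean \<xi>"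
    if eq: "\<And>e x z. e > 0 \<Longrightarrow> x \<in> carrier G \<Longrightarrow> z \<in> N e \<Longrightarrow> norm (\<xi> (x \<otimes> z) - \<xi> x) \<le> e" for \<xi> :: "'a \<Rightarrow> complex"
  proof (rule continuous_map_normI)
    fix e :: real and x0 assume e: "e > 0" and x0: "x0 \<in> topspace T"
    have x0c: "x0 \<in> carrier G" using x0 by (simp add: topspace_eq_carrier)
    define U where "U = {z \<in> carrier G. inv x0 \<otimes> z \<in> N e}"
    have "openin T U" unfolding U_def by (rule openin_translate[OF N(1)[OF e] inv_closed[OF x0c]])
    moreover have "x0 \<in> U" using x0c N(2)[OF e] by (simp add: U_def)
    moreover have "norm (\<xi> x - \<xi> x0) \<le> e" if "x \<in> U" for x
    proof -
      have x: "x \<in> carrier G" "inv x0 \<otimes> x \<in> N e" using that by (auto simp: U_def)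
      have "x0 \<otimes> (inv x0 \<otimes> x) = x" using x0c x by (simp add: m_assoc[symmetric])
      then show ?thesis using eq[OF e x0c x(2)] by simp
    qed
    ultimately show "\<exists>U. openin T U \<and> x0 \<in> U \<and> (\<forall>x\<in>U. norm (\<xi> x - \<xi> x0) \<le> e)" by blast
  qed
  \<comment> \<open>Off the carrier an extensional function has only the value
    \<open>undefined\<close>, so those factors of the product are single points.\<close>
  define B where "B x = (if x \<in> carrier G then cball 0 1 else {undefined :: complex})" for x
  define E where "E = {f :: 'a \<Rightarrow> complex. (\<forall>x. f x \<in> B x)} \<inter>
    (\<Inter>x\<in>carrier G. {f. norm (f x) = 1}) \<inter> (\<Inter>x\<in>carrier G. \<Inter>y\<in>carrier G. {f. f (x \<otimes> y) = f x * f y}) \<inter>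
    (\<Inter>e\<in>{0<..}. \<Inter>x\<in>carrier G. \<Inter>z\<in>N e. {f. norm (f (x \<otimes> z) - f x) \<le> e})"
  have cl1: "closed {f :: 'a \<Rightarrow> complex. norm (f x) = 1}" for x
    by (intro closed_Collect_eq continuous_intros)
  have cl2: "closed {f :: 'a \<Rightarrow> complex. f (x \<otimes> y) = f x * f y}" for x y
    by (intro closed_Collect_eq continuous_intros)
  have cl3: "closed {f :: 'a \<Rightarrow> complex. norm (f (x \<otimes> z) - f x) \<le> e}" for x z e
    by (intro closed_Collect_le continuous_intros)
  have "compact {f :: 'a \<Rightarrow> complex. \<forall>x. f x \<in> B x}"
    by (rule compact_Pi_UNIV) (simp add: B_def)
  then have "compact E"
    unfolding E_def by (intro compact_Int_closed closed_INT ballI cl1 cl2 cl3)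
  moreover have "E = ?Q"
  proof
    show "E \<subseteq> ?Q"
    proof
      fix f assume f: "f \<in> E"
      have eq: "norm (f (x \<otimes> z) - f x) \<le> e" if "e > 0" "x \<in> carrier G" "z \<in> N e" for e x z
        using f that by (auto simp: E_def)
      have "f \<in> extensional (carrier G)"
        using f by (auto simp: E_def B_def extensional_def split: if_splits)
      moreover have "norm (f x) = 1" if "x \<in> carrier G" for x using f that by (auto simp: E_def)
      moreover have "f (x \<otimes> y) = f x * f y" if "x \<in> carrier G" "y \<in> carrier G" for x y using f that by (auto simp: E_def)
      ultimately have "f \<in> carrier D" using equi_cont[OF eq] by (simp add: dual_carrier_iff)
      then show "f \<in> ?Q" using eq by simp
    qed
    show "?Q \<subseteq> E"
    proof
      fix f assume f: "f \<in> ?Q"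
      then have fD: "f \<in> carrier D" by simp
      have "f x \<in> B x" for x
        using dual_carrierD(1)[OF fD] dual_carrierD(3)[OF fD, of x] by (auto simp: B_def extensional_def)
      then show "f \<in> E" using f dual_carrierD(3,4)[OF fD] by (simp add: E_def)
    qed
  qed
  ultimately have cQ: "compact ?Q" by simp
  have "continuous_map (top_of_set ?Q) DT (\<lambda>f. f)"
    unfolding pontryagin_topology_def
  proof (rule continuous_map_into_compact_convergence)
    show "f \<in> carrier D" if "f \<in> topspace (top_of_set ?Q)" for f using that by simp
    fix f0 C and e :: real assume f0: "f0 \<in> topspace (top_of_set ?Q)" and C: "compactin T C" and e: "e > 0"
    \<comment> \<open>Finitely many translates of \<open>N (e / 4)\<close> cover \<open>C\<close>.
      The passage from \<open>x\<close> to a covering point and back, together with the distance at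
      that point, stays below three quarters of \<open>e\<close>.\<close>
    have e4: "e / 4 > 0" using e by simp
    obtain Y where Y: "finite Y" "Y \<subseteq> carrier G" "\<And>x. x \<in> C \<Longrightarrow> \<exists>s\<in>Y. inv s \<otimes> x \<in> N (e / 4)"
      by (rule compactin_translate_cover[OF C N(1)[OF e4] N(2)[OF e4]]) (rule that)
    define U where "U = ?Q \<inter> (\<Inter>s\<in>Y. {f. dist (f s) (f0 s) < e / 4})"
    have "open (\<Inter>s\<in>Y. {f :: 'a \<Rightarrow> complex. dist (f s) (f0 s) < e / 4})"
      using Y(1) by (intro open_INT ballI open_Collect_less continuous_intros)
    then have "openin (top_of_set ?Q) U" unfolding U_def by (rule openin_open_Int)
    moreover have "f0 \<in> U" using f0 e by (simp add: U_def)
    moreover have "dist (f x) (f0 x) < e" if f: "f \<in> U" and x: "x \<in> C" for f x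
    proof -
      obtain s where s: "s \<in> Y" "inv s \<otimes> x \<in> N (e / 4)" using Y(3)[OF x] by blast
      have sG: "s \<in> carrier G" using s Y(2) by auto
      have xG: "x \<in> carrier G" using x compactin_subset_topspace[OF C] by (auto simp: topspace_eq_carrier)
      have "s \<otimes> (inv s \<otimes> x) = x" using sG xG by (simp add: m_assoc[symmetric])
      moreover have "norm (g (s \<otimes> (inv s \<otimes> x)) - g s) \<le> e / 4" if "g \<in> ?Q" for g
        using that e4 sG s(2) by blast
      ultimately have n: "norm (g x - g s) \<le> e / 4" if "g \<in> ?Q" for g using that by simp
      have "norm (f x - f s) \<le> e / 4" "norm (f0 x - f0 s) \<le> e / 4" "norm (f s - f0 s) < e / 4"
        using n[of f] n[of f0] f f0 s(1) by (simp_all add: U_def dist_norm)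
      moreover have "norm (f x - f0 x) \<le> norm (f x - f s) + norm (f s - f0 s) + norm (f0 x - f0 s)"
        using norm_triangle_ineq[of "f x - f s" "f s - f0 s"] norm_triangle_ineq4[of "(f x - f s) + (f s - f0 s)" "f0 x - f0 s"]
        by simp
      ultimately show ?thesis using e by (simp add: dist_norm)
    qed
    ultimately show "\<exists>U. openin (top_of_set ?Q) U \<and> f0 \<in> U \<and> (\<forall>f\<in>U. \<forall>x\<in>C. dist (f x) (f0 x) < e)" by blast
  qed
  moreover have "compactin (top_of_set ?Q) ?Q" using cQ by (simp add: compactin_subtopology)
  ultimately have "compactin DT ((\<lambda>f. f) ` ?Q)" by (rule image_compactin[rotated])
  then show ?thesis by simp
qed

end

context lca_orbit
begin

interpretation dual: group_orbit D DT K S m \<Psi>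
  by (rule group_orbit_dual)

text \<open>Orbit maps are open: the saturation of \<open>V\<close> is a union of preimages of
  \<open>V\<close> under the homeomorphisms \<open>\<phi> k\<close>.\<close>

lemma openin_orbit_image:
  assumes V: "openin T V"
  shows "openin OT (orbit K \<phi> ` V)"
  unfolding openin_orbit_topology
proof
  have VG: "V \<subseteq> carrier G" using openin_subset[OF V] by (simp add: topspace_eq_carrier)
  then show "orbit K \<phi> ` V \<subseteq> orbits K (topspace T) \<phi>" by (auto simp: topspace_eq_carrier orbits_carrier)
  have "{x \<in> topspace T. orbit K \<phi> x \<in> orbit K \<phi> ` V} = (\<Union>k\<in>carrier K. {x \<in> topspace T. \<phi> k x \<in> V})"
  proof (intro equalityI subsetI)
    fix x assume "x \<in> {x \<in> topspace T. orbit K \<phi> x \<in> orbit K \<phi> ` V}"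
    then obtain v where v: "x \<in> topspace T" "v \<in> V" "orbit K \<phi> x = orbit K \<phi> v" by auto
    have "v \<in> orbit K \<phi> x" using orbit_self[of v] VG v(2,3) by auto
    then obtain k where "k \<in> carrier K" "v = \<phi> k x" unfolding orbit_alt by (rule imageE)
    then show "x \<in> (\<Union>k\<in>carrier K. {x \<in> topspace T. \<phi> k x \<in> V})" using v(1,2) by auto
  next
    fix x assume "x \<in> (\<Union>k\<in>carrier K. {x \<in> topspace T. \<phi> k x \<in> V})"
    then obtain k where k: "k \<in> carrier K" "x \<in> topspace T" "\<phi> k x \<in> V" by auto
    then have "orbit K \<phi> x = orbit K \<phi> (\<phi> k x)" by (simp add: topspace_eq_carrier)
    then show "x \<in> {x \<in> topspace T. orbit K \<phi> x \<in> orbit K \<phi> ` V}" using k by auto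
  qed
  moreover have "openin T (\<Union>k\<in>carrier K. {x \<in> topspace T. \<phi> k x \<in> V})"
    by (intro openin_Union) (auto intro: openin_continuous_map_preimage[OF continuous_map_phi_right V])
  ultimately show "openin T {x \<in> topspace T. orbit K \<phi> x \<in> orbit K \<phi> ` V}" by simp
qed

text \<open>Images of open sets with compact neighbourhoods cover \<open>C\<close>; finitely many
  suffice, and the union of the corresponding compact sets lies above \<open>C\<close>.\<close>

lemma compactin_orbit_lift:
  assumes C: "compactin OT C"
  obtains C' where "compactin T C'" "C \<subseteq> orbit K \<phi> ` C'"
proof -
  have "\<exists>U L. openin T U \<and> compactin T L \<and> x \<in> U \<and> U \<subseteq> L" if "x \<in> carrier G" for x
    using locally_compact that unfolding locally_compact_space_def topspace_eq_carrier by blast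
  then obtain U L where UL: "\<And>x. x \<in> carrier G \<Longrightarrow> openin T (U x) \<and> compactin T (L x) \<and> x \<in> U x \<and> U x \<subseteq> L x"
    by metis
  define \<U> where "\<U> = (\<lambda>x. orbit K \<phi> ` U x) ` carrier G"
  have op: "\<forall>V\<in>\<U>. openin OT V" unfolding \<U>_def using UL openin_orbit_image by auto
  have cov: "C \<subseteq> \<Union>\<U>"
  proof
    fix A assume "A \<in> C"
    then have "A \<in> \<O>" using compactin_subset_topspace[OF C] unfolding topspace_OT by auto
    then obtain x where x: "x \<in> carrier G" "A = orbit K \<phi> x" by auto
    then have "A \<in> orbit K \<phi> ` U x" using UL by auto
    then show "A \<in> \<Union>\<U>" unfolding \<U>_def using x(1) by auto
  qed
  obtain \<F> where F: "finite \<F>" "\<F> \<subseteq> \<U>" "C \<subseteq> \<Union>\<F>"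
    using C op cov unfolding compactin_def by metis
  obtain Y where Y: "Y \<subseteq> carrier G" "finite Y" "\<F> = (\<lambda>x. orbit K \<phi> ` U x) ` Y"
    using finite_subset_image[OF F(1) F(2)[unfolded \<U>_def]] by auto
  show thesis
  proof (rule that)
    show "compactin T (\<Union>(L ` Y))" by (rule compactin_Union) (use Y UL in auto)
    show "C \<subseteq> orbit K \<phi> ` \<Union>(L ` Y)"
    proof
      fix A assume "A \<in> C"
      then obtain y where y: "y \<in> Y" "A \<in> orbit K \<phi> ` U y" using F(3) Y(3) by auto
      then have "U y \<subseteq> L y" using UL Y(1) by auto
      then show "A \<in> orbit K \<phi> ` \<Union>(L ` Y)" using y by auto
    qed
  qed
qed

text \<open>A compact set of orbits is covered by the image of a compact set in \<open>G\<close>,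
  and closeness of characters on the saturation of that set bounds the difference of their
  averages.\<close>

lemma continuous_map_orbital_character: "continuous_map DT X orbital_character"
  unfolding character_topology_orbit
proof (rule continuous_map_into_compact_convergence)
  show "orbital_character \<xi> \<in> hypergroup_characters H" if "\<xi> \<in> topspace DT" for \<xi>
    using that orbital_character_in by (simp add: topspace_dual)
  fix \<xi>0 C and e :: real assume x0: "\<xi>0 \<in> topspace DT" and C: "compactin OT C" and e: "e > 0"
  have x0: "\<xi>0 \<in> carrier D" using x0 by (simp add: topspace_dual)
  obtain C' where C': "compactin T C'" "C \<subseteq> orbit K \<phi> ` C'" by (rule compactin_orbit_lift[OF C])
  have C'G: "C' \<subseteq> carrier G" using compactin_subset_topspace[OF C'(1)] by (simp add: topspace_eq_carrier)
  have e2: "e / 2 > 0" using e by simp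
  obtain U where U: "openin DT U" "\<xi>0 \<in> U" "U \<subseteq> carrier D" "\<And>\<psi> x. \<psi> \<in> U \<Longrightarrow> x \<in> sat C' \<Longrightarrow> dist (\<psi> x) (\<xi>0 x) < e / 2"
    by (rule dual_nbhd[OF x0 compactin_sat[OF C'(1)] e2]) (rule that)
  have "dist (orbital_character \<xi> A) (orbital_character \<xi>0 A) < e" if xi: "\<xi> \<in> U" and A: "A \<in> C" for \<xi> A
  proof -
    have xD: "\<xi> \<in> carrier D" using xi U(3) by auto
    obtain x where x: "x \<in> C'" "A = orbit K \<phi> x" using A C'(2) by auto
    have xG: "x \<in> carrier G" using x C'G by auto
    note i = integrable_continuous[OF character_phi_section[OF xD xG]] integrable_continuous[OF character_phi_section[OF x0 xG]]
    have "norm (avg \<xi> x - avg \<xi>0 x) = norm (LINT k|m. \<xi> (\<phi> k x) - \<xi>0 (\<phi> k x))" unfolding avg_def using i by simp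
    also have "\<dots> \<le> e / 2"
    proof (rule norm_average_le)
      show "norm (\<xi> (\<phi> k x) - \<xi>0 (\<phi> k x)) \<le> e / 2" if "k \<in> carrier K" for k
        using U(4)[OF xi sat_phi[OF C'G that x(1)]] by (simp add: dist_norm)
      show "continuous_map S euclidean (\<lambda>k. \<xi> (\<phi> k x) - \<xi>0 (\<phi> k x))"
        by (rule continuous_map_diff[OF character_phi_section[OF xD xG] character_phi_section[OF x0 xG]])
    qed
    finally show ?thesis using e by (simp add: x orbital_character_orbit xD x0 xG dist_norm)
  qed
  then show "\<exists>U. openin DT U \<and> \<xi>0 \<in> U \<and> (\<forall>\<xi>\<in>U. \<forall>A\<in>C. dist (orbital_character \<xi> A) (orbital_character \<xi>0 A) < e)"
    using U by blast
qed

lemma orbital_character_dual_action: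
  assumes "\<xi> \<in> carrier D" "k \<in> carrier K"
  shows "orbital_character (\<Psi> k \<xi>) = orbital_character \<xi>"
proof (rule extensionalityI[where A = \<O>])
  show "orbital_character (\<Psi> k \<xi>) A = orbital_character \<xi> A" if "A \<in> \<O>" for A
    using that assms by (auto simp: orbital_character_orbit dual_action_closed avg_dual_action)
qed (simp_all add: orbital_character_def)

text \<open>Only the character is chosen; its orbit does not depend on the choice because equal
  averages imply equal orbits.\<close>

definition dual_orbit :: "('a set \<Rightarrow> complex) \<Rightarrow> ('a \<Rightarrow> complex) set" where
  "dual_orbit \<tau> = orbit K \<Psi> (SOME \<xi>. \<xi> \<in> carrier D \<and> orbital_character \<xi> = \<tau>)"

lemma dual_orbit_orbital_character:
  assumes "\<xi> \<in> carrier D"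
  shows "dual_orbit (orbital_character \<xi>) = orbit K \<Psi> \<xi>"
proof -
  define \<eta> where "\<eta> = (SOME \<eta>. \<eta> \<in> carrier D \<and> orbital_character \<eta> = orbital_character \<xi>)"
  have "\<eta> \<in> carrier D \<and> orbital_character \<eta> = orbital_character \<xi>"
    unfolding \<eta>_def by (rule someI[of _ \<xi>]) (simp add: assms)
  then show ?thesis
    unfolding dual_orbit_def \<eta>_def[symmetric] using orbital_character_eq_imp_orbit_eq[of \<eta> \<xi>] assms by blast
qed

abbreviation "DO \<equiv> orbit_topology K DT \<Psi>"

lemma topspace_DO: "topspace DO = orbit K \<Psi> ` carrier D"
  by (simp add: topspace_dual dual.orbits_carrier)

lemma orbital_character_dual_rep:
  assumes "\<xi> \<in> carrier D"
  shows "orbital_character (dual.rep (orbit K \<Psi> \<xi>)) = orbital_character \<xi>"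
proof -
  have "dual.rep (orbit K \<Psi> \<xi>) \<in> orbit K \<Psi> \<xi>" using assms by (intro dual.rep_props(3)) simp
  then obtain k where "k \<in> carrier K" "dual.rep (orbit K \<Psi> \<xi>) = \<Psi> k \<xi>" unfolding dual.orbit_alt by auto
  then show ?thesis using orbital_character_dual_action[OF assms] by simp
qed

text \<open>The properness behind the homeomorphism: if the average of \<open>\<xi>\<close> is close
  to that of \<open>\<xi>0\<close> on the support of the kernel \<open>h\<close>, then
  \<open>I\<close> of \<open>h\<close> times this average stays bounded away from 0. The characters
  in question are then equicontinuous with common neighbourhoods, since each is an eigenfunction
  with its own average as eigenvalue.\<close>

lemma characters_near_equicontinuous:
  assumes xi0: "\<xi>0 \<in> carrier D"
  obtains C d Q where "compactin T C" "d > 0" "compactin DT Q"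
    "\<And>\<xi>. \<xi> \<in> carrier D \<Longrightarrow> \<forall>x\<in>C. norm (avg \<xi> x - avg \<xi>0 x) \<le> d \<Longrightarrow> \<xi> \<in> Q"
proof -
  obtain I and h :: "'a \<Rightarrow> complex" and C where I: "invariant_functional G T I" and h: "continuous_map T euclidean h"
    and hK: "\<And>k x. k \<in> carrier K \<Longrightarrow> x \<in> carrier G \<Longrightarrow> h (\<phi> k x) = h x"
    and C: "compactin T C" "\<And>x. x \<in> carrier G - C \<Longrightarrow> h x = 0"
    and nz: "I (\<lambda>x. h x * avg \<xi>0 x) \<noteq> 0"
    by (rule smoothing_kernel[OF continuous_avg[OF xi0] avg_one[OF xi0] avg_phi[OF xi0]]) (assumption, assumption, rule that)
  interpret I: invariant_functional G T I by (rule I)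
  \<comment> \<open>Half of the value at \<open>\<xi>0\<close>, so that a deviation of at most
    \<open>c0\<close> still leaves at least \<open>c0\<close>.\<close>
  define c0 where "c0 = norm (I (\<lambda>x. h x * avg \<xi>0 x)) / 2"
  have c0: "c0 > 0" using nz by (simp add: c0_def)
  have avg_bounded: "bounded_fun (avg \<xi>)" if "\<xi> \<in> carrier D" for \<xi>
    unfolding bounded_fun_def using norm_avg_le[OF that] by blast
  have exN: "\<exists>N. openin T N \<and> \<one> \<in> N \<and> (\<forall>\<xi>\<in>carrier D. c0 \<le> norm (I (\<lambda>w. h w * avg \<xi> w)) \<longrightarrow>
      (\<forall>x\<in>carrier G. \<forall>z\<in>N. norm (\<xi> (x \<otimes> z) - \<xi> x) \<le> e))"
    if e: "e > 0" for e
  proof (rule eigenfunctions_equicontinuous[OF I h _ C(1) _ c0 e])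
    show "h (\<phi> k x) = h x" if "k \<in> carrier K" "x \<in> carrier G" for k x by (rule hK[OF that])
    show "h x = 0" if "x \<in> carrier G - C" for x by (rule C(2)[OF that])
    fix N assume N: "openin T N" "\<one> \<in> N"
      and eq: "\<And>f g x z. bounded_fun f \<Longrightarrow> norm (I (\<lambda>w. h w * f w)) \<ge> c0 \<Longrightarrow> continuous_map T euclidean g \<Longrightarrow>
      (\<And>x. x \<in> carrier G \<Longrightarrow> norm (g x) \<le> 1) \<Longrightarrow>
      (\<And>x w. x \<in> carrier G \<Longrightarrow> w \<in> carrier G \<Longrightarrow> (LINT k|m. g (x \<otimes> \<phi> k w)) = f w * g x) \<Longrightarrow>
      x \<in> carrier G \<Longrightarrow> z \<in> N \<Longrightarrow> norm (g (x \<otimes> z) - g x) \<le> e"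
    have "norm (\<xi> (x \<otimes> z) - \<xi> x) \<le> e"
      if xi: "\<xi> \<in> carrier D" and c: "c0 \<le> norm (I (\<lambda>w. h w * avg \<xi> w))" and xz: "x \<in> carrier G" "z \<in> N" for \<xi> x z
    proof (rule eq[OF avg_bounded[OF xi] c dual_carrierD(2)[OF xi] _ _ xz])
      show "norm (\<xi> x) \<le> 1" if "x \<in> carrier G" for x using dual_carrierD(3)[OF xi that] by simp
      show "(LINT k|m. \<xi> (x \<otimes> \<phi> k w)) = avg \<xi> w * \<xi> x" if "x \<in> carrier G" "w \<in> carrier G" for x w
        by (rule integral_character_mult[OF xi that])
    qed
    then show ?thesis using N by blast
  qed
  define N where "N e = (SOME N. openin T N \<and> \<one> \<in> N \<and> (\<forall>\<xi>\<in>carrier D. c0 \<le> norm (I (\<lambda>w. h w * avg \<xi> w)) \<longrightarrow>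
      (\<forall>x\<in>carrier G. \<forall>z\<in>N. norm (\<xi> (x \<otimes> z) - \<xi> x) \<le> e)))" for e
  note N' = someI_ex[OF exN, folded N_def]
  have N: "openin T (N e)" "\<one> \<in> N e" if "e > 0" for e using N'[OF that] by auto
  have N3: "norm (\<xi> (x \<otimes> z) - \<xi> x) \<le> e"
    if "e > 0" "\<xi> \<in> carrier D" "c0 \<le> norm (I (\<lambda>w. h w * avg \<xi> w))" "x \<in> carrier G" "z \<in> N e" for e \<xi> x z
    using N'[OF that(1)] that(2-5) by blast
  define Q where "Q = {\<xi> \<in> carrier D. \<forall>e>0. \<forall>x\<in>carrier G. \<forall>z\<in>N e. norm (\<xi> (x \<otimes> z) - \<xi> x) \<le> e}"
  have hb: "bounded_fun h" by (rule bounded_fun_compact_support[OF h C])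
  then obtain b where b: "\<And>x. x \<in> carrier G \<Longrightarrow> norm (h x) \<le> b" by (auto simp: bounded_fun_def)
  define R where "R = Re (I (indicator C))"
  have R: "R \<ge> 0" unfolding R_def by (rule I.I_indicator_nonneg[OF C(1)])
  have b0: "b \<ge> 0" using b[OF one_closed] norm_ge_zero order_trans by blast
  \<comment> \<open>A deviation of \<open>d\<close> on \<open>C\<close> changes the functional by at
    most \<open>b * d * R\<close>, which this choice keeps below \<open>c0\<close>; the summand 1
    avoids division by 0.\<close>
  define d where "d = c0 / (b * R + 1)"
  have bR: "b * R + 1 > 0" using b0 R by (intro add_nonneg_pos mult_nonneg_nonneg) auto
  have d: "d > 0" "b * d * R \<le> c0" using c0 bR b0 R by (auto simp: d_def field_simps)
  have cs: "compactly_supported (\<lambda>w. h w * avg \<xi> w)" if "\<xi> \<in> carrier D" for \<xi>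
    by (rule compactly_supported_off[OF C(1) bounded_fun_mult[OF hb avg_bounded[OF that]]]) (simp add: C(2))
  have "\<xi> \<in> Q" if xi: "\<xi> \<in> carrier D" and near: "\<forall>x\<in>C. norm (avg \<xi> x - avg \<xi>0 x) \<le> d" for \<xi>
  proof -
    have csd: "compactly_supported (\<lambda>w. h w * avg \<xi> w - h w * avg \<xi>0 w)"
      using compactly_supported_add[OF cs[OF xi] compactly_supported_scale[OF cs[OF xi0], of "-1"]] by simp
    have "norm (I (\<lambda>w. h w * avg \<xi> w - h w * avg \<xi>0 w)) \<le> b * d * R"
      unfolding R_def
    proof (rule I.I_bound[OF csd C(1)])
      show "norm (h x * avg \<xi> x - h x * avg \<xi>0 x) \<le> b * d" if x: "x \<in> C" for x
      proof -
        have "x \<in> carrier G" using x compactin_subset_topspace[OF C(1)] by (auto simp: topspace_eq_carrier)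
        then show ?thesis
          unfolding right_diff_distrib[symmetric] norm_mult using b bspec[OF near x] b0 by (intro mult_mono) auto
      qed
    qed (simp add: C(2))
    then have "norm (I (\<lambda>w. h w * avg \<xi> w) - I (\<lambda>w. h w * avg \<xi>0 w)) \<le> c0"
      using d(2) by (simp add: I.I_diff[OF cs[OF xi] cs[OF xi0]])
    moreover have "norm (I (\<lambda>w. h w * avg \<xi>0 w)) = 2 * c0" by (simp add: c0_def)
    ultimately have "c0 \<le> norm (I (\<lambda>w. h w * avg \<xi> w))"
      using norm_triangle_ineq2[of "I (\<lambda>w. h w * avg \<xi>0 w)" "I (\<lambda>w. h w * avg \<xi> w)"]
      by (simp add: norm_minus_commute)
    then show ?thesis unfolding Q_def using xi N3[OF _ xi] by simp
  qed
  moreover have "compactin DT Q" unfolding Q_def by (rule compactin_equicontinuous_characters[OF N(1,2)])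
  ultimately show ?thesis using that[OF C(1) d(1)] by blast
qed

text \<open>Hypergroup characters near \<open>\<tau>\<close> are averages of characters from a
  compact set \<open>Q\<close>. The part of \<open>Q\<close> outside the preimage of
  \<open>U\<close> is compact, its averages form a closed set, and \<open>\<tau>\<close> is not
  among them because averages determine dual orbits; deleting this set leaves a neighbourhood mapped
  into \<open>U\<close>.\<close>

lemma continuous_map_dual_orbit: "continuous_map X DO dual_orbit"
  unfolding continuous_map_def
proof (intro conjI allI impI)
  show "dual_orbit \<in> topspace X \<rightarrow> topspace DO"
    unfolding topspace_X topspace_DO hypergroup_characters_orbit by (auto simp: dual_orbit_orbital_character)
  fix U assume U: "openin DO U"
  define U' where "U' = {\<xi> \<in> topspace DT. orbit K \<Psi> \<xi> \<in> U}"
  have U': "openin DT U'" using U unfolding U'_def openin_orbit_topology by simp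
  show "openin X {\<tau> \<in> topspace X. dual_orbit \<tau> \<in> U}"
  proof (subst openin_subopen, intro ballI)
    fix \<tau> assume "\<tau> \<in> {\<tau> \<in> topspace X. dual_orbit \<tau> \<in> U}"
    then have tau: "\<tau> \<in> hypergroup_characters H" "dual_orbit \<tau> \<in> U" by (auto simp: topspace_X)
    then obtain \<xi>0 where xi0: "\<xi>0 \<in> carrier D" "\<tau> = orbital_character \<xi>0" unfolding hypergroup_characters_orbit by auto
    have x0U: "orbit K \<Psi> \<xi>0 \<in> U" using tau(2) xi0 by (simp add: dual_orbit_orbital_character)
    obtain C d Q where C: "compactin T C" and d: "d > 0" and Q: "compactin DT Q"
      and near: "\<And>\<xi>. \<xi> \<in> carrier D \<Longrightarrow> \<forall>x\<in>C. norm (avg \<xi> x - avg \<xi>0 x) \<le> d \<Longrightarrow> \<xi> \<in> Q"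
      by (rule characters_near_equicontinuous[OF xi0(1)]) (rule that)
    have CG: "C \<subseteq> carrier G" using compactin_subset_topspace[OF C] by (simp add: topspace_eq_carrier)
    define L where "L = orbital_character ` ((topspace DT - U') \<inter> Q)"
    have "closedin DT (topspace DT - U')" by (rule closedin_diff[OF closedin_topspace U'])
    then have "compactin DT ((topspace DT - U') \<inter> Q)" using Q by (rule closed_Int_compactin)
    then have "compactin X L" unfolding L_def by (rule image_compactin[OF _ continuous_map_orbital_character])
    then have "closedin X L" by (rule compactin_imp_closedin[OF Hausdorff_X])
    then have opL: "openin X (topspace X - L)" by (rule openin_diff[OF openin_topspace])
    have tauL: "\<tau> \<notin> L"
    proof
      assume "\<tau> \<in> L"
      then obtain \<zeta> where z: "\<zeta> \<in> topspace DT" "\<zeta> \<notin> U'" "\<tau> = orbital_character \<zeta>" by (auto simp: L_def)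
      then have "orbit K \<Psi> \<zeta> = orbit K \<Psi> \<xi>0"
        using dual_orbit_orbital_character[of \<zeta>] dual_orbit_orbital_character[OF xi0(1)] xi0(2) by (simp add: topspace_dual)
      then show False using z x0U by (simp add: U'_def)
    qed
    have orbC: "compactin OT (orbit K \<phi> ` C)" by (rule image_compactin[OF C continuous_map_orbit])
    obtain V where V: "openin X V" "\<tau> \<in> V" "V \<subseteq> hypergroup_characters H"
      "\<And>\<psi> A. \<psi> \<in> V \<Longrightarrow> A \<in> orbit K \<phi> ` C \<Longrightarrow> dist (\<psi> A) (\<tau> A) < d"
      by (rule character_nbhd[OF tau(1) orbC d]) (rule that)
    have "V \<inter> (topspace X - L) \<subseteq> {\<tau> \<in> topspace X. dual_orbit \<tau> \<in> U}"
    proof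
      fix \<psi> assume psi: "\<psi> \<in> V \<inter> (topspace X - L)"
      then have "\<psi> \<in> hypergroup_characters H" using V(3) by auto
      then obtain \<xi> where xi: "\<xi> \<in> carrier D" "\<psi> = orbital_character \<xi>" unfolding hypergroup_characters_orbit by auto
      have "\<xi> \<in> Q"
      proof (rule near[OF xi(1)], rule ballI)
        fix x assume x: "x \<in> C"
        have xG: "x \<in> carrier G" using x CG by auto
        have "dist (\<psi> (orbit K \<phi> x)) (\<tau> (orbit K \<phi> x)) < d" using V(4)[of \<psi> "orbit K \<phi> x"] psi x by auto
        then show "norm (avg \<xi> x - avg \<xi>0 x) \<le> d"
          by (simp add: xi xi0 orbital_character_orbit xG dist_norm)
      qed
      moreover have "\<psi> \<notin> L" using psi by auto
      ultimately have "\<xi> \<in> U'" using xi unfolding L_def by (auto simp: topspace_dual)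
      then show "\<psi> \<in> {\<tau> \<in> topspace X. dual_orbit \<tau> \<in> U}"
        using psi xi by (simp add: U'_def dual_orbit_orbital_character)
    qed
    moreover have "\<tau> \<in> V \<inter> (topspace X - L)" using V(2) tauL tau(1) by (simp add: topspace_X)
    moreover have "openin X (V \<inter> (topspace X - L))" by (rule openin_Int[OF V(1) opL])
    ultimately show "\<exists>W. openin X W \<and> \<tau> \<in> W \<and> W \<subseteq> {\<tau> \<in> topspace X. dual_orbit \<tau> \<in> U}" by blast
  qed
qed

lemma homeomorphic_map_dual_orbit: "homeomorphic_map X DO dual_orbit"
  unfolding homeomorphic_map_maps homeomorphic_maps_def
proof (intro exI conjI ballI)
  show "continuous_map X DO dual_orbit" by (rule continuous_map_dual_orbit)
  show "continuous_map DO X (\<lambda>A. orbital_character (dual.rep A))"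
  proof (rule dual.continuous_map_from_orbit_topology)
    show "continuous_map DT X (\<lambda>\<xi>. orbital_character (dual.rep (orbit K \<Psi> \<xi>)))"
      by (rule continuous_map_eq[OF continuous_map_orbital_character])
        (simp add: orbital_character_dual_rep topspace_dual)
  qed
  show "orbital_character (dual.rep (dual_orbit \<tau>)) = \<tau>" if "\<tau> \<in> topspace X" for \<tau>
    using that unfolding topspace_X hypergroup_characters_orbit
    by (auto simp: dual_orbit_orbital_character orbital_character_dual_rep)
  show "dual_orbit (orbital_character (dual.rep A)) = A" if "A \<in> topspace DO" for A
    using that unfolding topspace_DO by (auto simp: orbital_character_dual_rep dual_orbit_orbital_character)
qed

lemma continuous_map_dual_product:
  assumes "\<xi> \<in> carrier D" "\<eta> \<in> carrier D"
  shows "continuous_map S X (\<lambda>l. orbital_character (\<xi> \<otimes>\<^bsub>D\<^esub> \<Psi> l \<eta>))"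
proof -
  have "continuous_map S DT (\<lambda>l. \<xi> \<otimes>\<^bsub>D\<^esub> \<Psi> l \<eta>)"
    using assms by (intro dual.continuous_map_mult dual.continuous_map_phi_left) (simp_all add: topspace_dual)
  from continuous_map_compose[OF this continuous_map_orbital_character] show ?thesis by (simp add: o_def)
qed

text \<open>The product formula \<open>integral_avg_dual_mult\<close> shows that the image measure
  is a hyperproduct; a Radon measure on the dual is determined by its first moments, so there is no
  other.\<close>

lemma is_dual_hyperproduct_iff:
  assumes xi: "\<xi> \<in> carrier D" and eta: "\<eta> \<in> carrier D"
  shows "is_dual_hyperproduct H (orbital_character \<xi>) (orbital_character \<eta>) \<mu> \<longleftrightarrow>
    \<mu> = distr m (borel_of X) (\<lambda>l. orbital_character (\<xi> \<otimes>\<^bsub>D\<^esub> \<Psi> l \<eta>))" (is "_ \<longleftrightarrow> \<mu> = ?\<nu>")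
proof -
  have radon: "radon_probability X ?\<nu>" by (rule radon_distr[OF radon_m Hausdorff_X continuous_map_dual_product[OF assms]])
  have int: "orbital_character \<xi> A * orbital_character \<eta> A = (LINT \<tau>|?\<nu>. \<tau> A)" if A: "A \<in> \<O>" for A
  proof -
    obtain x where x: "x \<in> carrier G" "A = orbit K \<phi> x" using A by auto
    have ev: "continuous_map X euclidean (\<lambda>\<tau>. \<tau> A)"
      unfolding character_topology_orbit by (rule continuous_map_evaluation) (unfold topspace_OT, rule A)
    have "(LINT \<tau>|?\<nu>. \<tau> A) = (LINT l|m. orbital_character (\<xi> \<otimes>\<^bsub>D\<^esub> \<Psi> l \<eta>) A)"
      by (rule integral_distr[OF measurable_m[OF continuous_map_dual_product[OF assms]]])
        (rule borel_measurable_continuous_map[OF refl ev])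
    also have "\<dots> = (LINT l|m. avg (\<xi> \<otimes>\<^bsub>D\<^esub> \<Psi> l \<eta>) x)"
    proof (rule Bochner_Integration.integral_cong[OF refl])
      fix l assume "l \<in> space m"
      then have "\<xi> \<otimes>\<^bsub>D\<^esub> \<Psi> l \<eta> \<in> carrier D"
        using xi eta by (intro dual.m_closed dual_action_closed) (simp_all add: space_m')
      then show "orbital_character (\<xi> \<otimes>\<^bsub>D\<^esub> \<Psi> l \<eta>) A = avg (\<xi> \<otimes>\<^bsub>D\<^esub> \<Psi> l \<eta>) x"
        by (simp add: x orbital_character_orbit)
    qed
    also have "\<dots> = avg \<xi> x * avg \<eta> x" by (rule integral_avg_dual_mult[OF assms x(1)])
    finally show ?thesis by (simp add: x orbital_character_orbit xi eta)
  qed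
  show ?thesis
  proof
    assume mu: "\<mu> = ?\<nu>"
    show "is_dual_hyperproduct H (orbital_character \<xi>) (orbital_character \<eta>) \<mu>"
      unfolding mu is_dual_hyperproduct_def topspace_orbit_hypergroup
      by (rule conjI[OF radon], rule ballI, rule int)
  next
    assume mu: "is_dual_hyperproduct H (orbital_character \<xi>) (orbital_character \<eta>) \<mu>"
    show "\<mu> = ?\<nu>"
    proof (rule radon_character_eqI[OF _ radon])
      show "radon_probability X \<mu>" using mu by (simp add: is_dual_hyperproduct_def)
      show "(LINT \<tau>|\<mu>. \<tau> A) = (LINT \<tau>|?\<nu>. \<tau> A)" if A: "A \<in> \<O>" for A
      proof -
        have "orbital_character \<xi> A * orbital_character \<eta> A = (LINT \<tau>|\<mu>. \<tau> A)"
          by (rule mu[unfolded is_dual_hyperproduct_def topspace_orbit_hypergroup, THEN conjunct2, THEN bspec, OF A])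
        then show ?thesis using int[OF A] by (rule trans[OF sym])
      qed
    qed
  qed
qed

lemma dual_hyperproducts_exist_orbit: "dual_hyperproducts_exist H"
  unfolding dual_hyperproducts_exist_def hypergroup_characters_orbit by (auto simp: is_dual_hyperproduct_iff)

lemma hprod_dual_hypergroup:
  assumes "\<xi> \<in> carrier D" "\<eta> \<in> carrier D"
  shows "hprod (dual_hypergroup H) (orbital_character \<xi>) (orbital_character \<eta>) =
    distr m (borel_of X) (\<lambda>l. orbital_character (\<xi> \<otimes>\<^bsub>D\<^esub> \<Psi> l \<eta>))"
proof -
  have "hprod (dual_hypergroup H) (orbital_character \<xi>) (orbital_character \<eta>) =
      (THE \<mu>. is_dual_hyperproduct H (orbital_character \<xi>) (orbital_character \<eta>) \<mu>)"
    by (simp add: dual_hypergroup_def)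
  then show ?thesis unfolding is_dual_hyperproduct_iff[OF assms] by simp
qed

lemma hinv_dual_hypergroup:
  assumes xi: "\<xi> \<in> carrier D"
  shows "hinv (dual_hypergroup H) (orbital_character \<xi>) = orbital_character (inv\<^bsub>D\<^esub> \<xi>)"
proof (rule extensionalityI[where A = \<O>])
  show "hinv (dual_hypergroup H) (orbital_character \<xi>) \<in> extensional \<O>"
    unfolding dual_hypergroup_def topspace_orbit_hypergroup by simp
  show "orbital_character (inv\<^bsub>D\<^esub> \<xi>) \<in> extensional \<O>" by (simp add: orbital_character_def)
  fix A assume A: "A \<in> \<O>"
  then obtain x where x: "x \<in> carrier G" "A = orbit K \<phi> x" by auto
  have "avg (inv\<^bsub>D\<^esub> \<xi>) x = (LINT k|m. cnj (\<xi> (\<phi> k x)))"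
    unfolding avg_def by (rule Bochner_Integration.integral_cong[OF refl]) (simp add: dual_inverse[OF xi] x space_m')
  then have "avg (inv\<^bsub>D\<^esub> \<xi>) x = cnj (avg \<xi> x)" by (simp add: avg_def)
  moreover have "hinv (dual_hypergroup H) (orbital_character \<xi>) A = cnj (orbital_character \<xi> A)"
    unfolding dual_hypergroup_def topspace_orbit_hypergroup using A by simp
  ultimately show "hinv (dual_hypergroup H) (orbital_character \<xi>) A = orbital_character (inv\<^bsub>D\<^esub> \<xi>) A"
    using dual.inv_closed[OF xi] by (simp add: x orbital_character_orbit xi)
qed

lemma hone_dual_hypergroup: "hone (dual_hypergroup H) = orbital_character \<one>\<^bsub>D\<^esub>"
proof (rule extensionalityI[where A = \<O>])
  show "hone (dual_hypergroup H) \<in> extensional \<O>"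
    unfolding dual_hypergroup_def topspace_orbit_hypergroup by simp
  show "orbital_character \<one>\<^bsub>D\<^esub> \<in> extensional \<O>" by (simp add: orbital_character_def)
  fix A assume A: "A \<in> \<O>"
  then obtain x where x: "x \<in> carrier G" "A = orbit K \<phi> x" by auto
  have "avg \<one>\<^bsub>D\<^esub> x = (LINT k|m. 1)"
    unfolding avg_def by (rule Bochner_Integration.integral_cong[OF refl]) (simp add: dual_unit x space_m')
  then have "orbital_character \<one>\<^bsub>D\<^esub> A = 1"
    using dual.one_closed by (simp add: x orbital_character_orbit prob_space)
  then show "hone (dual_hypergroup H) A = orbital_character \<one>\<^bsub>D\<^esub> A"
    unfolding dual_hypergroup_def topspace_orbit_hypergroup using A by simp
qed

lemma hypergroup_isomorphism_dual_orbit: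
  "hypergroup_isomorphism (dual_hypergroup H) (orbit_hypergroup K m D DT \<Psi>) dual_orbit"
  unfolding hypergroup_isomorphism_def dual.htop_orbit_hypergroup
proof (intro conjI ballI)
  have htop: "htop (dual_hypergroup H) = X" by (simp add: dual_hypergroup_def)
  show "homeomorphic_map (htop (dual_hypergroup H)) DO dual_orbit"
    unfolding htop by (rule homeomorphic_map_dual_orbit)
  show "dual_orbit (hone (dual_hypergroup H)) = hone (orbit_hypergroup K m D DT \<Psi>)"
    unfolding hone_dual_hypergroup dual.hone_orbit_hypergroup
    by (simp add: dual_orbit_orbital_character dual.orbit_one)
  fix \<tau> assume "\<tau> \<in> topspace (htop (dual_hypergroup H))"
  then have tau: "\<tau> \<in> orbital_character ` carrier D" unfolding htop topspace_X hypergroup_characters_orbit .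
  then show "dual_orbit (hinv (dual_hypergroup H) \<tau>) = hinv (orbit_hypergroup K m D DT \<Psi>) (dual_orbit \<tau>)"
    by (auto simp: hinv_dual_hypergroup dual_orbit_orbital_character dual.hinv_orbit_hypergroup)
  fix \<sigma> assume "\<sigma> \<in> topspace (htop (dual_hypergroup H))"
  then have sigma: "\<sigma> \<in> orbital_character ` carrier D" unfolding htop topspace_X hypergroup_characters_orbit .
  have rep: "dual_orbit \<tau> \<in> orbit K \<Psi> ` carrier D \<and> orbital_character (dual.rep (dual_orbit \<tau>)) = \<tau>"
    if "\<tau> \<in> orbital_character ` carrier D" for \<tau>
    using that by (auto simp: dual_orbit_orbital_character orbital_character_dual_rep)
  \<comment> \<open>Exactly the representatives used by the orbit hyperproduct on the dual side, so
    that both measures are images of \<open>m\<close> under the same map.\<close>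
  define \<xi> where "\<xi> = dual.rep (dual_orbit \<tau>)"
  define \<eta> where "\<eta> = dual.rep (dual_orbit \<sigma>)"
  have xi: "\<xi> \<in> carrier D" "orbital_character \<xi> = \<tau>" and eta: "\<eta> \<in> carrier D" "orbital_character \<eta> = \<sigma>"
    using rep[OF tau] rep[OF sigma] dual.rep_props(1) by (auto simp: \<xi>_def \<eta>_def)
  have "distr (hprod (dual_hypergroup H) \<tau> \<sigma>) (borel_of DO) dual_orbit =
      distr (distr m (borel_of X) (\<lambda>l. orbital_character (\<xi> \<otimes>\<^bsub>D\<^esub> \<Psi> l \<eta>))) (borel_of DO) dual_orbit"
    using hprod_dual_hypergroup[OF xi(1) eta(1)] by (simp add: xi eta)
  also have "\<dots> = distr m (borel_of DO) (dual_orbit \<circ> (\<lambda>l. orbital_character (\<xi> \<otimes>\<^bsub>D\<^esub> \<Psi> l \<eta>)))"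
    by (rule distr_distr[OF measurable_borel_of[OF continuous_map_dual_orbit]
        measurable_m[OF continuous_map_dual_product[OF xi(1) eta(1)]]])
  also have "\<dots> = distr m (borel_of DO) (\<lambda>l. orbit K \<Psi> (\<xi> \<otimes>\<^bsub>D\<^esub> \<Psi> l \<eta>))"
  proof (rule distr_cong[OF refl refl])
    fix l assume "l \<in> space m"
    then have "\<xi> \<otimes>\<^bsub>D\<^esub> \<Psi> l \<eta> \<in> carrier D"
      using xi eta by (intro dual.m_closed dual_action_closed) (simp_all add: space_m')
    then show "(dual_orbit \<circ> (\<lambda>l. orbital_character (\<xi> \<otimes>\<^bsub>D\<^esub> \<Psi> l \<eta>))) l = orbit K \<Psi> (\<xi> \<otimes>\<^bsub>D\<^esub> \<Psi> l \<eta>)"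
      by (simp add: dual_orbit_orbital_character)
  qed
  also have "\<dots> = hprod (orbit_hypergroup K m D DT \<Psi>) (dual_orbit \<tau>) (dual_orbit \<sigma>)"
    using rep[OF tau] rep[OF sigma] by (simp add: dual.hprod_orbit_hypergroup \<xi>_def \<eta>_def)
  finally show "distr (hprod (dual_hypergroup H) \<tau> \<sigma>) (borel_of DO) dual_orbit =
    hprod (orbit_hypergroup K m D DT \<Psi>) (dual_orbit \<tau>) (dual_orbit \<sigma>)" .
qed

end

theorem theorem2p7:
  fixes G :: "'a monoid" and T :: "'a topology"
    and K :: "'k monoid" and S :: "'k topology" and m :: "'k measure"
    and \<phi> :: "'k \<Rightarrow> 'a \<Rightarrow> 'a"
  assumes "lca_group G T"
    and "compact_group K S"
    and "normalized_haar_measure K S m"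
    and "continuous_action_by_automorphisms K S G T \<phi>"
  shows "dual_hyperproducts_exist (orbit_hypergroup K m G T \<phi>) \<and>
         hypergroup_isomorphic
           (dual_hypergroup (orbit_hypergroup K m G T \<phi>))
           (orbit_hypergroup K m (pontryagin_dual G T) (pontryagin_topology G T)
              (dual_action K G T \<phi>))"
proof -
  have "group_orbit G T K S m \<phi>"
    by (intro group_orbit.intro group_orbit_axioms.intro lca_group.axioms(1) assms)
  then interpret lca_orbit G T K S m \<phi>
    using assms(1) by (rule lca_orbit.intro)
  show ?thesis
    unfolding hypergroup_isomorphic_def
    by (intro conjI exI[of _ dual_orbit] dual_hyperproducts_exist_orbit hypergroup_isomorphism_dual_orbit)
qed

end
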